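(* Let $d\ge2$, $T>0$, $\gamma>1$ and $\alpha:=\frac{2}{3\min\{\gamma,2\}}$. Let $(\varrho,\mathbf u)$ be a weak solution of the compressible isentropic Euler system with pressure $\varrho^\gamma$ on $\mathbb T^d\times(0,T)$ with initial data $(\varrho_0,\varrho_0\mathbf u_0)$. Assume $$\varrho>0,\quad\varrho,\varrho^{-1}\in L^\infty(\mathbb T^d\times(0,T)),\qquad\mathbf u\in L^3(\mathbb T^d\times(0,T)),$$ that for some $\delta_0>0$ $$\|\varrho\|_{L^\infty(0,T;\mathcal V^{\alpha,\infty}_{\delta_0}(\mathbb T^d))}+\|\mathbf u\|_{L^3(0,T;\mathcal V^{1/3,3}_{\delta_0}(\mathbb T^d))}<\infty,\qquad\limsup_{\delta\to0}\|\mathbf u\|_{L^3(0,T;\mathcal V^{1/3,3}_\delta(\mathbb T^d))}=0,$$ and, in case $\gamma\ge2$, additionally $\limsup_{\delta\to0}\|\varrho\|_{L^\infty(0,T;\mathcal V^{\alpha,\infty}_\delta(\mathbb T^d))}=0$. Then $$\int_{\mathbb T^d}\Big(\tfrac12(\varrho|\mathbf u|^2)(x,t)+\frac{\varrho(x,t)^\gamma}{\gamma-1}\Big)dx=\int_{\mathbb T^d}\Big(\tfrac12(\varrho_0|\mathbf u_0|^2)(x)+\frac{\varrho_0(x)^\gamma}{\gamma-1}\Big)dx$$ for (almost) every $t\in(0,T)$.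
   Context: Weak solution of the compressible isentropic Euler system on a domain $\Omega$ ($\Omega=\mathbb T^d$ here): measurable $\varrho:\Omega\times(0,T)\to\mathbb R_+$, $\mathbf u:\Omega\times(0,T)\to\mathbb R^d$ (with enough integrability for the integrals below to make sense) such that (i) $\int_0^T\int_\Omega(\varrho\,\partial_t\varphi+\varrho\mathbf u\cdot\nabla\varphi)\,dxdt=0$ for all $\varphi\in C_0^\infty(\Omega\times(0,T))$; (ii) $\int_0^T\int_\Omega(\varrho\mathbf u\cdot\partial_t\psi+\varrho\mathbf u\otimes\mathbf u:\nabla\psi+\varrho^\gamma\,\nabla\cdot\psi)\,dxdt=0$ for all $\psi\in C_0^\infty(\Omega\times(0,T))^d$; (iii) $\lim_{t\to0}\int_\Omega\varrho(x,t)\varphi(x)dx=\int_\Omega\varrho_0\varphi\,dx$ for all $\varphi\in C_0^\infty(\Omega)$; (iv) $\lim_{t\to0}\int_\Omega(\varrho\mathbf u)(x,t)\cdot\psi(x)dx=\int_\Omega\varrho_0\mathbf u_0\cdot\psi\,dx$ for all $\psi\in C_0^\infty(\Omega)^d$. This is the weak form of $\partial_t\varrho+\operatorname{div}(\varrho\mathbf u)=0$, $\partial_t(\varrho\mathbf u)+\operatorname{div}(\varrho\mathbf u\otimes\mathbf u)+\nabla\varrho^\gamma=0$. For $\beta>0$, $\delta>0$, $p\in[1,\infty]$ and $f$ on $\mathbb T^d$: $\|f\|_{\mathcal V^{\beta,p}_\delta(\mathbb T^d)}:=\sup_{|h|<\delta}|h|^{-\beta}\|f(\cdot+h)-f(\cdot)\|_{L^p(\mathbb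 T^d)}$. For time-dependent $f$, $\|f\|_{L^q(0,T;\mathcal V^{\beta,p}_\delta)}:=\big(\int_0^T\|f(t)\|_{\mathcal V^{\beta,p}_\delta}^qdt\big)^{1/q}$ for $q<\infty$ and the essential supremum in $t$ for $q=\infty$. *)

theory Defs
  imports "HOL-Analysis.Analysis"
begin

definition ennpowr :: "ennreal \<Rightarrow> real \<Rightarrow> ennreal" where
  "ennpowr x p = (if x = top then top else ennreal (enn2real x powr p))"

text \<open>C-infinity: all iterated directional (Frechet) derivatives exist.\<close>
definition smooth_fun :: "('a::euclidean_space \<Rightarrow> real) \<Rightarrow> bool" where
  "smooth_fun f \<longleftrightarrow> (\<exists>F. f \<in> F \<and>
     (\<forall>g\<in>F. g differentiable_on UNIV \<and> (\<forall>v. (\<lambda>x. frechet_derivative g (at x) v) \<in> F)))"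

text \<open>The torus T^d is represented by the unit cube with 1-periodic functions.\<close>
definition cube :: "((real^('d::finite))) set" where
  "cube = cbox 0 One"

definition periodic_x :: "((real^('d::finite)) \<Rightarrow> 'b) \<Rightarrow> bool" where
  "periodic_x f \<longleftrightarrow> (\<forall>x i. f (x + axis i 1) = f x)"

definition test_fun :: "real \<Rightarrow> ((real^('d::finite)) \<times> real \<Rightarrow> real) \<Rightarrow> bool" where
  "test_fun T \<phi> \<longleftrightarrow> smooth_fun \<phi> \<and> (\<forall>t. periodic_x (\<lambda>x. \<phi> (x, t))) \<and>
     (\<exists>a b. 0 < a \<and> a < b \<and> b < T \<and> (\<forall>x t. t \<notin> {a..b} \<longrightarrow> \<phi> (x, t) = 0))"

definition vtest_fun :: "real \<Rightarrow> ((real^('d::finite)) \<times> real \<Rightarrow> (real^('d::finite))) \<Rightarrow> bool" where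
  "vtest_fun T \<psi> \<longleftrightarrow> (\<forall>i. test_fun T (\<lambda>z. \<psi> z $ i))"

definition test_fun_x :: "((real^('d::finite)) \<Rightarrow> real) \<Rightarrow> bool" where
  "test_fun_x \<phi> \<longleftrightarrow> smooth_fun \<phi> \<and> periodic_x \<phi>"

definition dt :: "((real^('d::finite)) \<times> real \<Rightarrow> real) \<Rightarrow> (real^('d::finite)) \<times> real \<Rightarrow> real" where
  "dt \<phi> z = frechet_derivative \<phi> (at z) (0, 1)"

definition dx :: "'d \<Rightarrow> ((real^('d::finite)) \<times> real \<Rightarrow> real) \<Rightarrow> (real^('d::finite)) \<times> real \<Rightarrow> real" where
  "dx j \<phi> z = frechet_derivative \<phi> (at z) (axis j 1, 0)"

definition spacetime :: "real \<Rightarrow> ((real^('d::finite)) \<times> real) set" where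
  "spacetime T = cube \<times> {0<..<T}"

definition weak_solution ::
  "real \<Rightarrow> real \<Rightarrow> ((real^('d::finite)) \<Rightarrow> real \<Rightarrow> real) \<Rightarrow> ((real^('d::finite)) \<Rightarrow> real \<Rightarrow> (real^('d::finite)))
   \<Rightarrow> ((real^('d::finite)) \<Rightarrow> real) \<Rightarrow> ((real^('d::finite)) \<Rightarrow> (real^('d::finite))) \<Rightarrow> bool" where
  "weak_solution \<gamma> T \<rho> u \<rho>0 u0 \<longleftrightarrow>
     (\<lambda>(x,t). \<rho> x t) \<in> borel_measurable borel \<and>
     (\<lambda>(x,t). u x t) \<in> borel_measurable borel \<and>
     (\<forall>x t. t \<in> {0<..<T} \<longrightarrow> 0 \<le> \<rho> x t) \<and>
     (\<forall>\<phi>. test_fun T \<phi> \<longrightarrow>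
        (let F = (\<lambda>(x,t). \<rho> x t * dt \<phi> (x,t) + (\<Sum>j\<in>UNIV. \<rho> x t * u x t $ j * dx j \<phi> (x,t)))
         in set_integrable lborel (spacetime T) F \<and> (LINT z:spacetime T|lborel. F z) = 0)) \<and>
     (\<forall>\<psi>. vtest_fun T \<psi> \<longrightarrow>
        (let F = (\<lambda>(x,t). (\<Sum>i\<in>UNIV. \<rho> x t * u x t $ i * dt (\<lambda>z. \<psi> z $ i) (x,t))
                  + (\<Sum>i\<in>UNIV. \<Sum>j\<in>UNIV. \<rho> x t * u x t $ i * u x t $ j * dx j (\<lambda>z. \<psi> z $ i) (x,t))
                  + \<rho> x t powr \<gamma> * (\<Sum>i\<in>UNIV. dx i (\<lambda>z. \<psi> z $ i) (x,t)))
         in set_integrable lborel (spacetime T) F \<and> (LINT z:spacetime T|lborel. F z) = 0)) \<and>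
     (\<forall>\<phi>. test_fun_x \<phi> \<longrightarrow>
        set_integrable lborel cube (\<lambda>x. \<rho>0 x * \<phi> x) \<and>
        ((\<lambda>t. LINT x:cube|lborel. \<rho> x t * \<phi> x) \<longlongrightarrow> (LINT x:cube|lborel. \<rho>0 x * \<phi> x)) (at_right 0)) \<and>
     (\<forall>\<psi>::(real^('d::finite)) \<Rightarrow> (real^('d::finite)). (\<forall>i. test_fun_x (\<lambda>x. \<psi> x $ i)) \<longrightarrow>
        set_integrable lborel cube (\<lambda>x. \<rho>0 x * (u0 x \<bullet> \<psi> x)) \<and>
        ((\<lambda>t. LINT x:cube|lborel. \<rho> x t * (u x t \<bullet> \<psi> x)) \<longlongrightarrow>
           (LINT x:cube|lborel. \<rho>0 x * (u0 x \<bullet> \<psi> x))) (at_right 0))"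

definition Lp_norm_x :: "real \<Rightarrow> ((real^('d::finite)) \<Rightarrow> 'b::real_normed_vector) \<Rightarrow> ennreal" where
  "Lp_norm_x p f = ennpowr (\<integral>\<^sup>+ x. ennreal (norm (f x) powr p) * indicator cube x \<partial>lborel) (1/p)"

definition Linf_norm_x :: "((real^('d::finite)) \<Rightarrow> 'b::real_normed_vector) \<Rightarrow> ennreal" where
  "Linf_norm_x f = Inf {C. AE x in lborel. x \<in> cube \<longrightarrow> ennreal (norm (f x)) \<le> C}"

definition V_norm :: "real \<Rightarrow> real \<Rightarrow> real \<Rightarrow> ((real^('d::finite)) \<Rightarrow> 'b::real_normed_vector) \<Rightarrow> ennreal" where
  "V_norm \<beta> p \<delta> f = (SUP h\<in>{h. 0 < norm h \<and> norm h < \<delta>}.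
       ennreal (norm h powr (-\<beta>)) * Lp_norm_x p (\<lambda>x. f (x + h) - f x))"

definition V_inf_norm :: "real \<Rightarrow> real \<Rightarrow> ((real^('d::finite)) \<Rightarrow> 'b::real_normed_vector) \<Rightarrow> ennreal" where
  "V_inf_norm \<beta> \<delta> f = (SUP h\<in>{h. 0 < norm h \<and> norm h < \<delta>}.
       ennreal (norm h powr (-\<beta>)) * Linf_norm_x (\<lambda>x. f (x + h) - f x))"

definition Lq_time :: "real \<Rightarrow> real \<Rightarrow> (real \<Rightarrow> ennreal) \<Rightarrow> ennreal" where
  "Lq_time q T N = ennpowr (\<integral>\<^sup>+ t. ennpowr (N t) q * indicator {0<..<T} t \<partial>lborel) (1/q)"

definition Linf_time :: "real \<Rightarrow> (real \<Rightarrow> ennreal) \<Rightarrow> ennreal" where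
  "Linf_time T N = Inf {C. AE t in lborel. t \<in> {0<..<T} \<longrightarrow> N t \<le> C}"

end

theory Submission
  imports Defs
begin

text \<open>The equations are mollified in space only, with a periodic kernel $K$ of scale
  $\varepsilon$. By the du Bois-Reymond lemma, $R = K * \varrho$ and $M = K * (\varrho u)$ are, at each
  point $x$ and for almost every $t$, indefinite time integrals starting from the mollified initial
  data, so the energy density $|M|^2 / 2R + R^\gamma / (\gamma - 1)$ obeys the chain rule without any
  mollification in time. Writing the balance with the Favre velocity $M / R$, everything integrates
  to zero over the torus except the gradient of $M / R$ contracted with the commutator of $K *$ and
  the flux $\varrho u \otimes u + \varrho^\gamma$. The gradient costs one increment divided by
  $\varepsilon$ and the commutator is quadratic in increments, so the error is bounded by
  $\varepsilon^{-1}$ times an average over $|h| \lesssim \varepsilon$ of the space-time integral of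
  $|u(x+h) - u(x)|^3 + |\varrho(x+h) - \varrho(x)|^3$, which is $o(\varepsilon)$: for $u$ by the vanishing
  hypothesis, for $\varrho$ because $3\alpha > 1$ when $\gamma < 2$ and by the additional hypothesis when
  $\gamma \ge 2$. Finally the mollified energies converge to the true ones.\<close>

section \<open>Smooth functions\<close>

text \<open>The hypotheses measure increments in x only, so a mollification in time would leave
  errors that nothing controls. With the mollified momentum divided by the mollified density as
  velocity, the continuity equation stays exact and the whole error sits in the momentum equation,
  one part from transport and one from pressure. Since \<rho> stays in a compact part of the open
  half line, s powr \<gamma> is twice differentiable with bounded second derivative there for every
  \<gamma> > 1, so the pressure defect is quadratic in increments just like the transport defect.
  Together with the gradient the error is cubic, and increments of order 1/3 make it of order |h|:
  exactly enough against 1 / \<epsilon>, with nothing to spare. The other obstacle is time 0. The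
  initial density has no pointwise lower bound; its mollification inherits one from positive times
  by continuity. The initial energy is not known to be finite, so the final comparison is made
  between extended nonnegative integrals.\<close>

definition bump :: "nat \<Rightarrow> real \<Rightarrow> real" where
  "bump k s = (if s > 0 then exp (- 1 / s) / s ^ k else 0)"

text \<open>A class closed under directional derivatives, so that membership witnesses \<^const>\<open>smooth_fun\<close>.
  The last rule admits antiderivatives of members, as needed for smooth steps.\<close>

inductive sm :: "('a::euclidean_space \<Rightarrow> real) \<Rightarrow> bool" where
  sm_const: "sm (\<lambda>x. c)"
| sm_linear: "bounded_linear f \<Longrightarrow> sm f"
| sm_add: "sm f \<Longrightarrow> sm g \<Longrightarrow> sm (\<lambda>x. f x + g x)"
| sm_mult: "sm f \<Longrightarrow> sm g \<Longrightarrow> sm (\<lambda>x. f x * g x)"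
| sm_sin: "sm f \<Longrightarrow> sm (\<lambda>x. sin (f x))"
| sm_cos: "sm f \<Longrightarrow> sm (\<lambda>x. cos (f x))"
| sm_bump: "sm f \<Longrightarrow> sm (\<lambda>x. bump k (f x))"
| sm_antideriv: "sm f \<Longrightarrow> sm (\<lambda>x. g (f x)) \<Longrightarrow> (\<forall>s. (G has_real_derivative g s) (at s))
    \<Longrightarrow> sm (\<lambda>x. G (f x))"

lemma bump_nonneg: "0 \<le> bump k s" by (simp add: bump_def)

lemma bump_tendsto_0: "(bump k \<longlongrightarrow> 0) (at_right 0)"
proof -
  have "((\<lambda>x::real. x ^ k / exp x) \<longlongrightarrow> 0) at_top" by (rule tendsto_power_div_exp_0)
  then have "((\<lambda>s::real. inverse s ^ k / exp (inverse s)) \<longlongrightarrow> 0) (at_right 0)"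
    by (rule filterlim_compose[OF _ filterlim_inverse_at_top_right])
  moreover have "\<forall>\<^sub>F s in at_right 0. inverse s ^ k / exp (inverse s) = bump k s"
    unfolding eventually_at_right_field
    by (rule exI[of _ 1]) (auto simp: bump_def exp_minus field_simps power_inverse)
  ultimately show ?thesis by (simp cong: tendsto_cong)
qed

text \<open>Differentiating exp (- 1 / s) / s ^ k only raises the power of 1 / s. Indexing the
  family by \<open>k\<close> makes its span closed under differentiation, which a single flat
  function would not be.\<close>

lemma bump_deriv: "(bump k has_real_derivative bump (k+2) s - k * bump (k+1) s) (at s)"
proof -
  consider "s > 0" | "s < 0" | "s = 0" by linarith
  then show ?thesis
  proof cases
    case 1
    have d: "((\<lambda>s. exp (- 1 / s) / s ^ k) has_real_derivative bump (k+2) s - k * bump (k+1) s) (at s)"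
    proof -
      have "((\<lambda>s. exp (- 1 / s) * inverse (s ^ k)) has_real_derivative
          exp (- 1 / s) * (1 / s\<^sup>2) * inverse (s ^ k)
          + exp (- 1 / s) * (- (inverse (s ^ k) * (k * s ^ (k - 1)) * inverse (s ^ k)))) (at s)"
        using 1 by (auto intro!: derivative_eq_intros simp: power2_eq_square)
      moreover have e: "inverse (s ^ k) * (k * s ^ (k - 1)) * inverse (s ^ k) = k / s ^ (k + 1)"
        using 1 by (cases k) (auto simp: field_simps)
      have "exp (- 1 / s) * (1 / s\<^sup>2) * inverse (s ^ k)
          + exp (- 1 / s) * (- (inverse (s ^ k) * (k * s ^ (k - 1)) * inverse (s ^ k)))
          = bump (k+2) s - k * bump (k+1) s"
        unfolding e using 1 by (simp add: bump_def field_simps power2_eq_square power_add)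
      ultimately show ?thesis by (simp add: field_class.field_divide_inverse)
    qed
    show ?thesis
      by (rule has_field_derivative_transform_within_open[OF d, of "{0<..}"]) (use 1 in \<open>auto simp: bump_def\<close>)
  next
    case 2
    have d: "((\<lambda>s. 0) has_real_derivative bump (k+2) s - k * bump (k+1) s) (at s)"
      using 2 by (simp add: bump_def)
    show ?thesis
      by (rule has_field_derivative_transform_within_open[OF d, of "{..<0}"]) (use 2 in \<open>auto simp: bump_def\<close>)
  next
    case 3
    \<comment> \<open>Because \<open>bump k 0\<close> is 0, the quotient from the right is
      \<open>bump (Suc k) h\<close>, so the limit is an instance of
      \<open>bump_tendsto_0\<close>.\<close>
    have "((\<lambda>h. (bump k (0 + h) - bump k 0) / h) \<longlongrightarrow> 0) (at 0)"
      unfolding filterlim_at_split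
    proof
      show "((\<lambda>h. (bump k (0 + h) - bump k 0) / h) \<longlongrightarrow> 0) (at_left 0)"
        by (rule tendsto_eventually) (auto simp: eventually_at_left_field bump_def intro!: exI[of _ "-1"])
      have "\<forall>\<^sub>F h in at_right 0. bump (Suc k) h = (bump k (0 + h) - bump k 0) / h"
        unfolding eventually_at_right_field
        by (rule exI[of _ 1]) (auto simp: bump_def)
      then show "((\<lambda>h. (bump k (0 + h) - bump k 0) / h) \<longlongrightarrow> 0) (at_right 0)"
        by (rule tendsto_cong[THEN iffD1, OF _ bump_tendsto_0])
    qed
    then show ?thesis unfolding DERIV_def using 3 by (simp add: bump_def)
  qed
qed

lemma bump0_le_1: "bump 0 s \<le> 1"
  by (simp add: bump_def)

text \<open>\<open>bump 2\<close> is the derivative of \<open>bump 0\<close>; this is its Lipschitz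
  constant, from the quadratic Taylor bound for the exponential.\<close>

lemma bump2_le_2: "bump 2 s \<le> 2"
proof (cases "s > 0")
  case True
  have "(1/s)\<^sup>2 / 2 \<le> exp (1/s)"
    using exp_lower_Taylor_quadratic[of "1/s"] True by (smt (verit) divide_pos_pos)
  then show ?thesis using True by (auto simp: bump_def field_simps exp_minus)
qed (simp add: bump_def)

text \<open>The induction runs on an explicit derivative whose directional values lie in
  \<open>sm\<close>. Only at the end does uniqueness identify it with
  \<open>frechet_derivative\<close>, so that no case has to compute with a choice operator.\<close>

lemma sm_deriv:
  assumes "sm f"
  shows "(\<forall>x. f differentiable at x) \<and> (\<forall>v. sm (\<lambda>x. frechet_derivative f (at x) v))"
proof -
  have "\<exists>f'. (\<forall>x. (f has_derivative f' x) (at x)) \<and> (\<forall>v. sm (\<lambda>x. f' x v))" using assms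
  proof induction
    case (sm_const c)
    show ?case by (rule exI[of _ "\<lambda>x v. 0"]) (auto intro: sm.sm_const)
  next
    case (sm_linear f)
    then show ?case by (intro exI[of _ "\<lambda>x v. f v"]) (auto intro: sm.sm_const bounded_linear_imp_has_derivative)
  next
    case (sm_add f g)
    then obtain f' g' where *: "\<forall>x. (f has_derivative f' x) (at x)" "\<forall>v. sm (\<lambda>x. f' x v)"
      "\<forall>x. (g has_derivative g' x) (at x)" "\<forall>v. sm (\<lambda>x. g' x v)" by blast
    show ?case by (rule exI[of _ "\<lambda>x v. f' x v + g' x v"])
        (use * in \<open>auto intro!: sm.sm_add has_derivative_add\<close>)
  next
    case (sm_mult f g)
    then obtain f' g' where *: "\<forall>x. (f has_derivative f' x) (at x)" "\<forall>v. sm (\<lambda>x. f' x v)"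
      "\<forall>x. (g has_derivative g' x) (at x)" "\<forall>v. sm (\<lambda>x. g' x v)" by blast
    show ?case by (rule exI[of _ "\<lambda>x v. f x * g' x v + f' x v * g x"])
        (use * sm_mult in \<open>auto intro!: sm.sm_add sm.sm_mult has_derivative_mult\<close>)
  next
    case (sm_sin f)
    then obtain f' where *: "\<forall>x. (f has_derivative f' x) (at x)" "\<forall>v. sm (\<lambda>x. f' x v)" by blast
    show ?case by (rule exI[of _ "\<lambda>x v. f' x v * cos (f x)"])
        (use * sm_sin in \<open>auto intro!: sm.sm_cos sm.sm_mult has_derivative_sin\<close>)
  next
    case (sm_cos f)
    then obtain f' where *: "\<forall>x. (f has_derivative f' x) (at x)" "\<forall>v. sm (\<lambda>x. f' x v)" by blast
    have "((\<lambda>x. cos (f x)) has_derivative (\<lambda>v. f' x v * (- 1 * sin (f x)))) (at x)" for x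
      using has_derivative_cos[OF *(1)[rule_format]] by simp
    moreover have "sm (\<lambda>x. f' x v * (- 1 * sin (f x)))" for v
      by (intro sm.sm_sin sm.sm_mult sm.sm_const *(2)[rule_format] sm_cos(1))
    ultimately show ?case
      by (intro exI[of _ "\<lambda>x v. f' x v * (- 1 * sin (f x))"] conjI allI)
  next
    case (sm_bump f k)
    then obtain f' where *: "\<forall>x. (f has_derivative f' x) (at x)" "\<forall>v. sm (\<lambda>x. f' x v)" by blast
    have "((\<lambda>x. bump k (f x)) has_derivative (\<lambda>v. f' x v * (bump (k+2) (f x) + (- real k) * bump (k+1) (f x)))) (at x)" for x
      using has_derivative_compose[OF *(1)[rule_format] bump_deriv[unfolded has_field_derivative_def]]
      by (simp add: mult.commute)
    moreover have "sm (\<lambda>x. f' x v * (bump (k+2) (f x) + (- real k) * bump (k+1) (f x)))" for v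
      by (intro sm.sm_mult sm.sm_add sm.sm_const sm.sm_bump *(2)[rule_format] sm_bump(1))
    ultimately show ?case
      by (intro exI[of _ "\<lambda>x v. f' x v * (bump (k+2) (f x) + (- real k) * bump (k+1) (f x))"] conjI allI)
  next
    case (sm_antideriv f g G)
    then obtain f' where *: "\<forall>x. (f has_derivative f' x) (at x)" "\<forall>v. sm (\<lambda>x. f' x v)" by blast
    have "((\<lambda>x. G (f x)) has_derivative (\<lambda>v. f' x v * g (f x))) (at x)" for x
      using has_derivative_compose[OF *(1)[rule_format] sm_antideriv(3)[rule_format, unfolded has_field_derivative_def]]
      by (simp add: mult.commute)
    moreover have "sm (\<lambda>x. f' x v * g (f x))" for v
      by (intro sm.sm_mult *(2)[rule_format] sm_antideriv)
    ultimately show ?case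
      by (intro exI[of _ "\<lambda>x v. f' x v * g (f x)"] conjI allI)
  qed
  then obtain f' where *: "\<And>x. (f has_derivative f' x) (at x)" "\<And>v. sm (\<lambda>x. f' x v)" by blast
  moreover have "frechet_derivative f (at x) = f' x" for x
    using *(1) by (simp add: frechet_derivative_at[symmetric])
  ultimately show ?thesis by (auto simp: differentiable_def)
qed

lemma sm_has_derivative:
  "sm f \<Longrightarrow> (f has_derivative frechet_derivative f (at x)) (at x)"
  using sm_deriv frechet_derivative_works by blast

lemma sm_smooth_fun: "sm f \<Longrightarrow> smooth_fun f"
  unfolding smooth_fun_def
  by (rule exI[of _ "Collect sm"]) (auto simp: sm_deriv differentiable_on_def intro: differentiable_at_withinI)

lemma sm_continuous_on: "sm f \<Longrightarrow> continuous_on S f"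
  by (meson continuous_at_imp_continuous_on differentiable_imp_continuous_within sm_deriv)

lemma sm_borel: "sm f \<Longrightarrow> f \<in> borel_measurable borel"
  by (simp add: sm_continuous_on borel_measurable_continuous_onI)

lemma sm_cmult: "sm f \<Longrightarrow> sm (\<lambda>x. c * f x)"
  by (intro sm_mult sm_const)

lemma sm_prod: "finite S \<Longrightarrow> (\<And>i. i \<in> S \<Longrightarrow> sm (f i)) \<Longrightarrow> sm (\<lambda>x. \<Prod>i\<in>S. f i x)"
  by (induction S rule: finite_induct) (auto intro: sm_const sm_mult)

text \<open>Serves reflected and rescaled kernels and the lifting of functions of x or t alone to
  space-time. A linear function becomes affine, hence the split into a constant and a linear
  part.\<close>

lemma sm_affine:
  assumes "sm f" and L: "bounded_linear L"
  shows "sm (\<lambda>x. f (c + L x))"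
  using assms(1)
proof induction
  case (sm_linear f)
  then interpret f: bounded_linear f .
  have "sm (\<lambda>x. f c + f (L x))"
    by (intro sm_add sm_const sm.sm_linear bounded_linear_compose[OF sm_linear L])
  then show ?case by (simp add: f.add)
next
  case (sm_antideriv f g G)
  show ?case by (rule sm.sm_antideriv[of _ g]) (use sm_antideriv in auto)
qed (auto intro: sm.intros)

section \<open>Integration over the torus\<close>

text \<open>A finite measure on all of space instead of a quotient: fields stay total periodic
  functions, and shifted arguments need no reduction modulo the lattice.\<close>

definition torus :: "(real^'d::finite) measure" where
  "torus = density lborel (indicator cube)"

lemma cube_measurable [measurable, simp]: "cube \<in> sets borel"
  by (simp add: cube_def)

lemma sets_torus [measurable_cong, simp]: "sets torus = sets borel"
  by (simp add: torus_def)

lemma space_torus [simp]: "space torus = UNIV"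
  by (simp add: torus_def)

text \<open>\<open>One\<close> abbreviates the sum over \<open>Basis\<close>; as a simp rule this
  reads off its coordinates.\<close>

lemma sum_Basis_cart [simp]: "(\<Sum>x\<in>(Basis :: (real^'d::finite) set). x $ i) = 1"
proof -
  have "(\<Sum>x\<in>(Basis :: (real^'d) set). 1 *\<^sub>R x) \<bullet> axis i 1 = 1"
    by (rule inner_sum_left_Basis) (simp add: axis_in_Basis_iff)
  then show ?thesis by (simp add: inner_axis)
qed

lemma mem_cube: "x \<in> cube \<longleftrightarrow> (\<forall>i. 0 \<le> x $ i \<and> x $ i \<le> 1)"
  by (simp add: cube_def mem_box_cart)

lemma emeasure_cube: "emeasure lborel (cube :: (real^'d::finite) set) = 1"
  by (simp add: cube_def emeasure_lborel_cbox_eq)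

lemma emeasure_torus: "emeasure (torus :: (real^'d::finite) measure) UNIV = 1"
  by (simp add: torus_def emeasure_density emeasure_cube)

interpretation torus: finite_measure "torus :: (real^'d::finite) measure"
  by standard (simp add: emeasure_torus)

lemma measure_torus: "measure (torus :: (real^'d::finite) measure) UNIV = 1"
  by (simp add: measure_def emeasure_torus)

lemma nn_integral_torus:
  "f \<in> borel_measurable borel \<Longrightarrow> (\<integral>\<^sup>+x. f x \<partial>torus) = (\<integral>\<^sup>+x. f x * indicator cube x \<partial>lborel)"
  by (simp add: torus_def nn_integral_density mult.commute)

lemma torus_alt: "torus = density lborel (\<lambda>x. ennreal (indicator cube x))"
  by (simp add: torus_def ennreal_indicator)

lemma integral_torus:
  fixes f :: "_ \<Rightarrow> _::{banach, second_countable_topology}"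
  shows "f \<in> borel_measurable borel \<Longrightarrow> (\<integral>x. f x \<partial>torus) = (LINT x:cube|lborel. f x)"
  by (simp add: torus_alt integral_density set_lebesgue_integral_def)

lemma integrable_torus:
  fixes f :: "_ \<Rightarrow> _::{banach, second_countable_topology}"
  shows "f \<in> borel_measurable borel \<Longrightarrow> integrable torus f \<longleftrightarrow> set_integrable lborel cube f"
  by (simp add: torus_alt integrable_density set_integrable_def)

lemma AE_torus: "(AE x in torus. P x) \<longleftrightarrow> (AE x in lborel. x \<in> cube \<longrightarrow> P x)"
  unfolding torus_def by (subst AE_density) (auto simp: indicator_def)

definition lat :: "('d::finite \<Rightarrow> int) \<Rightarrow> real^'d" where
  "lat k = (\<chi> i. of_int (k i))"

lemma periodic_axis_int:
  assumes "periodic_x f"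
  shows "f (x + axis i (of_int n)) = f x"
proof -
  have *: "f (x + axis i (real m)) = f x" for m x
  proof (induction m)
    case (Suc m)
    have "x + axis i (real (Suc m)) = (x + axis i (real m)) + axis i 1"
      by (simp add: vec_eq_iff axis_def)
    then show ?case using assms Suc unfolding periodic_x_def by metis
  qed (simp add: axis_def zero_vec_def[symmetric])
  show ?thesis
  proof (cases "n \<ge> 0")
    case True
    then show ?thesis using *[of x "nat n"] by simp
  next
    case False
    have "x = (x + axis i (of_int n)) + axis i (real (nat (- n)))"
      using False by (simp add: vec_eq_iff axis_def)
    then show ?thesis using *[of "x + axis i (of_int n)" "nat (- n)"] by metis
  qed
qed

lemma periodic_lat:
  assumes "periodic_x f"
  shows "f (x + lat k) = f x"
proof -
  have "f (x + (\<Sum>i\<in>S. axis i (of_int (k i)))) = f x" if "finite S" for S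
    using that
  proof (induction S)
    case (insert i S)
    have "f ((x + (\<Sum>i\<in>S. axis i (of_int (k i)))) + axis i (of_int (k i))) = f x"
      using periodic_axis_int[OF assms] insert by metis
    then show ?case using insert by (simp add: ac_simps)
  qed simp
  moreover have "lat k = (\<Sum>i\<in>UNIV. axis i (of_int (k i)))"
    by (simp add: vec_eq_iff lat_def axis_def)
  ultimately show ?thesis by simp
qed

lemma periodic_lat_minus:
  assumes "periodic_x f"
  shows "f (x - lat k) = f x"
  using periodic_lat[OF assms, of "x - lat k" k] by simp

lemma lat_reduce: "\<exists>k. x - lat k \<in> cube"
  by (rule exI[of _ "\<lambda>i. \<lfloor>x $ i\<rfloor>"]) (simp add: mem_cube lat_def, linarith)

text \<open>Half-open, so that every point lies in exactly one lattice translate; the closed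
  \<open>cube\<close> covers common faces several times.\<close>

definition unit_cell :: "(real^'d::finite) set" where
  "unit_cell = {x. \<forall>i. 0 \<le> x $ i \<and> x $ i < 1}"

lemma unit_cell_measurable [measurable, simp]: "unit_cell \<in> sets borel"
  unfolding unit_cell_def by measurable

lemma AE_cube_cell: "AE x::real^'d::finite in lborel. (indicator cube x :: ennreal) = indicator unit_cell x"
proof -
  let ?N = "cbox 0 One - box 0 One :: (real^'d) set"
  have "emeasure lborel ?N = emeasure lborel (cbox 0 One :: (real^'d) set) - emeasure lborel (box 0 One :: (real^'d) set)"
    by (rule emeasure_Diff) (auto simp: box_subset_cbox emeasure_lborel_box_eq emeasure_lborel_cbox_eq)
  then have "?N \<in> null_sets lborel"
    by (simp add: emeasure_lborel_box_eq emeasure_lborel_cbox_eq null_setsI)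
  moreover have "{x::real^'d. \<not> ((indicator cube x :: ennreal) = indicator unit_cell x)} \<subseteq> ?N"
    by (auto simp: cube_def unit_cell_def mem_box_cart indicator_def less_eq_real_def split: if_splits; fastforce)
  ultimately show ?thesis by (intro AE_I') auto
qed

lemma unit_cell_count:
  "(\<integral>\<^sup>+k. indicator unit_cell (z - lat k) \<partial>count_space (UNIV :: ('d::finite \<Rightarrow> int) set)) = 1"
proof -
  have "(indicator unit_cell (z - lat k) :: ennreal) = indicator {\<lambda>i. \<lfloor>z $ i\<rfloor>} k" for k :: "'d \<Rightarrow> int"
  proof -
    have "z - lat k \<in> unit_cell \<longleftrightarrow> k = (\<lambda>i. \<lfloor>z $ i\<rfloor>)"
      by (auto simp: unit_cell_def lat_def fun_eq_iff floor_eq_iff eq_commute[of "k _"] algebra_simps)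
    then show ?thesis by (simp add: indicator_def)
  qed
  then show ?thesis by simp
qed

section \<open>Translation and reflection invariance on the torus\<close>

lemma nn_integral_lborel_shift:
  fixes f :: "'a::euclidean_space \<Rightarrow> ennreal"
  assumes [measurable]: "f \<in> borel_measurable borel"
  shows "(\<integral>\<^sup>+x. f (x + h) \<partial>lborel) = (\<integral>\<^sup>+x. f x \<partial>lborel)"
proof -
  have "(\<integral>\<^sup>+x. f x \<partial>lborel) = (\<integral>\<^sup>+x. f x \<partial>distr lborel borel ((+) h))"
    by (simp add: lborel_distr_plus)
  also have "\<dots> = (\<integral>\<^sup>+x. f (h + x) \<partial>lborel)" by (rule nn_integral_distr) auto
  finally show ?thesis by (simp add: add.commute)
qed

lemma nn_integral_lborel_reflect:
  fixes f :: "'a::euclidean_space \<Rightarrow> ennreal"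
  assumes [measurable]: "f \<in> borel_measurable borel"
  shows "(\<integral>\<^sup>+x. f (h - x) \<partial>lborel) = (\<integral>\<^sup>+x. f x \<partial>lborel)"
proof -
  have "(\<integral>\<^sup>+x. f x \<partial>lborel) = (\<integral>\<^sup>+x. f x \<partial>density (distr lborel borel (\<lambda>x. h + (-1) *\<^sub>R x)) (\<lambda>_. \<bar>-1::real\<bar> ^ DIM('a)))"
    using lborel_affine[of "-1" h] by simp
  also have "\<dots> = (\<integral>\<^sup>+x. f (h - x) \<partial>lborel)"
    by (simp add: density_1 nn_integral_distr)
  finally show ?thesis by simp
qed

text \<open>Unfolding: the factor 1, written as the sum over all lattice translates of the cell,
  cuts the shifted cell into pieces. Moving each piece by its lattice vector reassembles them in the
  unshifted cell, and periodicity leaves f unchanged on the way.\<close>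

lemma nn_integral_torus_shift:
  fixes f :: "real^'d::finite \<Rightarrow> ennreal"
  assumes [measurable]: "f \<in> borel_measurable borel" and per: "periodic_x f"
  shows "(\<integral>\<^sup>+x. f (x + h) \<partial>torus) = (\<integral>\<^sup>+x. f x \<partial>torus)"
proof -
  let ?N = "count_space (UNIV :: ('d \<Rightarrow> int) set)"
  interpret N: sigma_finite_measure ?N
    by (rule sigma_finite_measure_count_space_countable) simp
  interpret NL: pair_sigma_finite ?N "lborel :: (real^'d) measure" ..
  have *: "(\<integral>\<^sup>+x. g x \<partial>torus) = (\<integral>\<^sup>+x. g x * indicator unit_cell x \<partial>lborel)"
    if [measurable]: "g \<in> borel_measurable borel" for g :: "real^'d \<Rightarrow> ennreal"
    unfolding nn_integral_torus[OF that]
    by (rule nn_integral_cong_AE) (use AE_cube_cell in eventually_elim, simp)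
  have "(\<integral>\<^sup>+x. f (x + h) \<partial>torus) = (\<integral>\<^sup>+x. f (x + h) * indicator unit_cell (x + h - h) \<partial>lborel)"
    by (simp add: *)
  also have "\<dots> = (\<integral>\<^sup>+x. f x * indicator unit_cell (x - h) \<partial>lborel)"
    by (rule nn_integral_lborel_shift) measurable
  also have "\<dots> = (\<integral>\<^sup>+x. (\<integral>\<^sup>+k. f x * indicator unit_cell (x - h) * indicator unit_cell (x - lat k) \<partial>?N) \<partial>lborel)"
    by (simp add: nn_integral_cmult unit_cell_count)
  also have "\<dots> = (\<integral>\<^sup>+k. (\<integral>\<^sup>+x. f x * indicator unit_cell (x - h) * indicator unit_cell (x - lat k) \<partial>lborel) \<partial>?N)"
    by (rule NL.Fubini') (rule measurable_pair_measure_countable1, auto)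
  also have "\<dots> = (\<integral>\<^sup>+k. (\<integral>\<^sup>+x. f (x + lat k) * indicator unit_cell (x + lat k - h) * indicator unit_cell (x + lat k - lat k) \<partial>lborel) \<partial>?N)"
    by (intro nn_integral_cong nn_integral_lborel_shift[symmetric]) measurable
  also have "\<dots> = (\<integral>\<^sup>+k. (\<integral>\<^sup>+x. f x * indicator unit_cell x * indicator unit_cell (x - h + lat k) \<partial>lborel) \<partial>?N)"
    by (simp add: periodic_lat[OF per] algebra_simps)
  also have "\<dots> = (\<integral>\<^sup>+x. (\<integral>\<^sup>+k. f x * indicator unit_cell x * indicator unit_cell (x - h + lat k) \<partial>?N) \<partial>lborel)"
    by (rule NL.Fubini'[symmetric]) (rule measurable_pair_measure_countable1, auto)
  also have "\<dots> = (\<integral>\<^sup>+x. f x * indicator unit_cell x * (\<integral>\<^sup>+k. indicator unit_cell (x - h + lat k) \<partial>?N) \<partial>lborel)"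
    by (simp add: nn_integral_cmult)
  also have "\<dots> = (\<integral>\<^sup>+x. f x * indicator unit_cell x \<partial>lborel)"
  proof -
    have "(\<integral>\<^sup>+k. indicator unit_cell (z + lat k) \<partial>?N) = 1" for z
    proof -
      have "(\<integral>\<^sup>+k. indicator unit_cell (z + lat k) \<partial>?N) = (\<integral>\<^sup>+k. indicator unit_cell (z - lat (\<lambda>i. - k i)) \<partial>?N)"
        by (simp add: lat_def) (intro nn_integral_cong arg_cong[of _ _ "indicator unit_cell"], simp add: vec_eq_iff)
      also have "\<dots> = (\<integral>\<^sup>+k. indicator unit_cell (z - lat k) \<partial>?N)"
        by (rule nn_integral_bij_count_space)
          (auto simp: bij_def inj_def surj_def fun_eq_iff intro: exI[of _ "\<lambda>i. - _ i"])
      finally show ?thesis by (simp add: unit_cell_count)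
    qed
    then show ?thesis by simp
  qed
  finally show ?thesis by (simp add: *)
qed

lemma periodic_shift: "periodic_x f \<Longrightarrow> periodic_x (\<lambda>x. f (x + h))"
  unfolding periodic_x_def by (metis add.commute add.left_commute)

text \<open>The map x to \<open>One - x\<close> preserves the cube, so a reflection about any point
  is this one followed by a shift.\<close>

lemma nn_integral_torus_reflect:
  fixes f :: "real^'d::finite \<Rightarrow> ennreal"
  assumes [measurable]: "f \<in> borel_measurable borel" and per: "periodic_x f"
  shows "(\<integral>\<^sup>+x. f (h - x) \<partial>torus) = (\<integral>\<^sup>+x. f x \<partial>torus)"
proof -
  have c: "One - x \<in> cube \<longleftrightarrow> x \<in> cube" for x :: "real^'d"
    by (auto simp: mem_cube)
  have "(\<integral>\<^sup>+x. f (h - x) \<partial>torus) = (\<integral>\<^sup>+x. f (h - x) * indicator cube x \<partial>lborel)"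
    by (simp add: nn_integral_torus)
  also have "\<dots> = (\<integral>\<^sup>+x. f (h - (One - x)) * indicator cube (One - x) \<partial>lborel)"
    by (rule nn_integral_lborel_reflect[symmetric]) measurable
  also have "\<dots> = (\<integral>\<^sup>+x. f (x + (h - One)) * indicator cube x \<partial>lborel)"
    by (simp add: c indicator_def algebra_simps)
  also have "\<dots> = (\<integral>\<^sup>+x. f (x + (h - One)) \<partial>torus)"
    by (simp add: nn_integral_torus)
  finally show ?thesis by (simp add: nn_integral_torus_shift[OF _ per])
qed

lemma integral_torus_shift:
  fixes f :: "real^'d::finite \<Rightarrow> real"
  assumes [measurable]: "f \<in> borel_measurable borel" and per: "periodic_x f"
    and int: "integrable torus f" "integrable torus (\<lambda>x. f (x + h))"
  shows "(\<integral>x. f (x + h) \<partial>torus) = (\<integral>x. f x \<partial>torus)"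
proof -
  have "periodic_x (\<lambda>x. ennreal (f x))" "periodic_x (\<lambda>x. ennreal (- f x))"
    using per by (auto simp: periodic_x_def)
  then show ?thesis
    using nn_integral_torus_shift[of "\<lambda>x. ennreal (f x)" h] nn_integral_torus_shift[of "\<lambda>x. ennreal (- f x)" h]
    by (simp add: real_lebesgue_integral_def int)
qed

text \<open>Turns bounds for single shifts into bounds for kernel averages: after the substitution y
  = x - h and an exchange of integrals, the kernel weighs each shift h separately. As the support
  lies near the whole lattice, shifts count modulo lattice vectors.\<close>

lemma torus_average:
  fixes \<kappa> :: "real^'d::finite \<Rightarrow> ennreal" and F :: "real^'d \<Rightarrow> real^'d \<Rightarrow> ennreal"
  assumes [measurable]: "\<kappa> \<in> borel_measurable borel" "case_prod F \<in> borel_measurable (borel \<Otimes>\<^sub>M borel)"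
    and per: "periodic_x \<kappa>" "\<And>x. periodic_x (F x)"
    and supp: "\<And>z. \<kappa> z \<noteq> 0 \<Longrightarrow> \<exists>k. norm (z - lat k) \<le> R"
    and S: "\<And>h. norm h \<le> R \<Longrightarrow> (\<integral>\<^sup>+x. F x (x - h) \<partial>torus) \<le> S"
    and B: "(\<integral>\<^sup>+z. \<kappa> z \<partial>torus) \<le> B"
  shows "(\<integral>\<^sup>+x. \<integral>\<^sup>+y. \<kappa> (x - y) * F x y \<partial>torus \<partial>torus) \<le> B * S"
proof -
  interpret pair_sigma_finite "torus :: (real^'d) measure" "torus :: (real^'d) measure" ..
  have k: "\<kappa> (x + y + axis i 1) = \<kappa> (x + y)" for x y i
    using per(1) by (simp add: periodic_x_def)
  have inner: "(\<integral>\<^sup>+y. \<kappa> (x - y) * F x y \<partial>torus) = (\<integral>\<^sup>+h. \<kappa> h * F x (x - h) \<partial>torus)" for x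
  proof -
    have "periodic_x (\<lambda>y. \<kappa> (x - y) * F x y)"
      unfolding periodic_x_def
    proof (intro allI)
      fix y i
      have "\<kappa> (x - (y + axis i 1)) = \<kappa> (x - y)"
        using per(1)[unfolded periodic_x_def, rule_format, of "x - (y + axis i 1)" i]
        by (simp add: algebra_simps)
      then show "\<kappa> (x - (y + axis i 1)) * F x (y + axis i 1) = \<kappa> (x - y) * F x y"
        using per(2) by (simp add: periodic_x_def)
    qed
    from nn_integral_torus_reflect[OF _ this, of x]
    show ?thesis by simp
  qed
  have "(\<integral>\<^sup>+x. \<integral>\<^sup>+y. \<kappa> (x - y) * F x y \<partial>torus \<partial>torus) = (\<integral>\<^sup>+x. \<integral>\<^sup>+h. \<kappa> h * F x (x - h) \<partial>torus \<partial>torus)"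
    by (simp add: inner)
  also have "\<dots> = (\<integral>\<^sup>+h. \<integral>\<^sup>+x. \<kappa> h * F x (x - h) \<partial>torus \<partial>torus)"
    by (rule Fubini'[symmetric]) measurable
  also have "\<dots> = (\<integral>\<^sup>+h. \<kappa> h * (\<integral>\<^sup>+x. F x (x - h) \<partial>torus) \<partial>torus)"
    by (simp add: nn_integral_cmult)
  also have "\<dots> \<le> (\<integral>\<^sup>+h. \<kappa> h * S \<partial>torus)"
  proof (rule nn_integral_mono)
    fix h :: "real^'d"
    show "\<kappa> h * (\<integral>\<^sup>+x. F x (x - h) \<partial>torus) \<le> \<kappa> h * S"
    proof (cases "\<kappa> h = 0")
      case False
      \<comment> \<open>Periodicity in the second argument replaces h by the short representative
        \<open>h - lat k\<close>, to which \<open>S\<close> applies.\<close>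
      then obtain k where k: "norm (h - lat k) \<le> R" using supp by blast
      have "F x (x - (h - lat k)) = F x (x - h)" for x
        using periodic_lat[OF per(2), of x "x - h" k] by (simp add: algebra_simps)
      then show ?thesis using S[OF k] by (simp add: mult_left_mono)
    qed simp
  qed
  also have "\<dots> \<le> B * S"
    by (simp add: nn_integral_multc B mult_right_mono)
  finally show ?thesis .
qed

lemma periodic_continuous_bounded:
  fixes f :: "real^'d::finite \<Rightarrow> real"
  assumes "continuous_on UNIV f" and per: "periodic_x f"
  obtains M where "M > 0" "\<And>x. \<bar>f x\<bar> \<le> M"
proof -
  have "compact (f ` cube)"
    by (rule compact_continuous_image[OF continuous_on_subset[OF assms(1)]]) (auto simp: cube_def)
  then obtain M where M: "\<And>x. x \<in> cube \<Longrightarrow> \<bar>f x\<bar> \<le> M"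
    by (metis bounded_iff compact_imp_bounded imageI real_norm_def)
  have "\<bar>f x\<bar> \<le> max M 1" for x
  proof -
    obtain k where "x - lat k \<in> cube" using lat_reduce by blast
    then show ?thesis using M[of "x - lat k"] periodic_lat_minus[OF per] by simp
  qed
  then show ?thesis using that[of "max M 1"] by auto
qed

lemma integrable_torus_bounded:
  fixes f :: "real^'d::finite \<Rightarrow> real"
  assumes "f \<in> borel_measurable borel" "\<And>x. \<bar>f x\<bar> \<le> M"
  shows "integrable torus f"
  by (rule torus.integrable_const_bound[of _ M]) (use assms in auto)

text \<open>No boundary terms have to be matched: difference quotients integrate to 0 by translation
  invariance, and the mean value theorem bounds them uniformly, so dominated convergence reaches the
  derivative.\<close>

lemma integral_torus_directional_derivative:
  fixes G G' :: "real^'d::finite \<Rightarrow> real"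
  assumes perG: "periodic_x G" and per: "periodic_x G'"
    and cont: "continuous_on UNIV G" "continuous_on UNIV G'"
    and der: "\<And>x s. ((\<lambda>s. G (x + s *\<^sub>R e)) has_real_derivative G' (x + s *\<^sub>R e)) (at s)"
  shows "(\<integral>x. G' x \<partial>torus) = 0"
proof -
  have [measurable]: "G \<in> borel_measurable borel" "G' \<in> borel_measurable borel"
    using cont by (auto intro: borel_measurable_continuous_onI)
  obtain M where M: "M > 0" "\<And>x. \<bar>G' x\<bar> \<le> M"
    using periodic_continuous_bounded[OF cont(2) per] by metis
  obtain M0 where M0: "\<And>x. \<bar>G x\<bar> \<le> M0"
    using periodic_continuous_bounded[OF cont(1) perG] by metis
  define q where "q n x = (G (x + (1 / Suc n) *\<^sub>R e) - G x) / (1 / Suc n)" for n :: nat and x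
  have [measurable]: "q n \<in> borel_measurable borel" for n
    unfolding q_def by measurable
  have "(\<lambda>n. \<integral>x. q n x \<partial>torus) \<longlonglongrightarrow> (\<integral>x. G' x \<partial>torus)"
  proof (rule integral_dominated_convergence)
    show "integrable torus (\<lambda>x::real^'d. M)" by simp
    show "AE x in torus. (\<lambda>n. q n x) \<longlonglongrightarrow> G' x"
    proof (rule AE_I2)
      fix x
      have "((\<lambda>h. (G (x + h *\<^sub>R e) - G x) / h) \<longlongrightarrow> G' x) (at 0)"
        using der[of x 0] by (simp add: DERIV_def)
      moreover have "filterlim (\<lambda>n. 1 / real (Suc n)) (at 0) sequentially"
        unfolding filterlim_at using LIMSEQ_inverse_real_of_nat by (auto simp: divide_inverse)
      ultimately show "(\<lambda>n. q n x) \<longlonglongrightarrow> G' x"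
        unfolding q_def by (rule filterlim_compose)
    qed
    fix n
    show "AE x in torus. norm (q n x) \<le> M"
    proof (rule AE_I2)
      fix x
      have "\<exists>z. 0 < z \<and> z < 1 / Suc n \<and> G (x + (1 / Suc n) *\<^sub>R e) - G (x + 0 *\<^sub>R e) = (1 / Suc n - 0) * G' (x + z *\<^sub>R e)"
        by (rule MVT2) (use der in auto)
      then obtain z where "q n x = G' (x + z *\<^sub>R e)"
        by (auto simp: q_def simp del: of_nat_Suc)
      then show "norm (q n x) \<le> M" using M by simp
    qed
  qed auto
  moreover have "(\<integral>x. q n x \<partial>torus) = 0" for n
  proof -
    have i: "integrable torus G" "integrable torus (\<lambda>x. G (x + (1 / Suc n) *\<^sub>R e))"
      using M0 by (auto intro!: integrable_torus_bounded)
    show ?thesis unfolding q_def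
      using integral_torus_shift[OF _ perG i] i by simp
  qed
  ultimately show ?thesis by (simp add: LIMSEQ_const_iff)
qed

section \<open>Periodic mollifiers\<close>

definition pd :: "'d::finite \<Rightarrow> (real^'d \<Rightarrow> real) \<Rightarrow> real^'d \<Rightarrow> real" where
  "pd j f x = frechet_derivative f (at x) (axis j 1)"

lemma sm_pd: "sm f \<Longrightarrow> sm (pd j f)"
  unfolding pd_def using sm_deriv by blast

lemma sm_line_derivative:
  assumes "sm f"
  shows "((\<lambda>s. f (x + s *\<^sub>R e)) has_real_derivative frechet_derivative f (at (x + s *\<^sub>R e)) e) (at s)"
proof -
  have f: "(f has_derivative frechet_derivative f (at (x + s *\<^sub>R e))) (at (x + s *\<^sub>R e))"
    by (rule sm_has_derivative[OF assms])
  have g: "((\<lambda>s. x + s *\<^sub>R e) has_derivative (\<lambda>t. t *\<^sub>R e)) (at s)"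
    by (auto intro!: derivative_eq_intros)
  have "((\<lambda>s. f (x + s *\<^sub>R e)) has_derivative (\<lambda>t. frechet_derivative f (at (x + s *\<^sub>R e)) (t *\<^sub>R e))) (at s)"
    by (rule has_derivative_compose[OF g f])
  moreover have "frechet_derivative f (at (x + s *\<^sub>R e)) (t *\<^sub>R e) = frechet_derivative f (at (x + s *\<^sub>R e)) e * t" for t
    using has_derivative_bounded_linear[OF f] by (simp add: bounded_linear_def linear_cmul mult.commute)
  ultimately show ?thesis by (simp add: has_field_derivative_def)
qed

lemma sm_pd_line:
  "sm f \<Longrightarrow> ((\<lambda>s. f (x + s *\<^sub>R axis j 1)) has_real_derivative pd j f (x + s *\<^sub>R axis j 1)) (at s)"
  unfolding pd_def by (rule sm_line_derivative)

lemma pd_eqI: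
  assumes "sm f" "((\<lambda>s. f (x + s *\<^sub>R axis j 1)) has_real_derivative D) (at 0)"
  shows "pd j f x = D"
  using DERIV_unique[OF assms(2)] sm_pd_line[OF assms(1), of x j 0] by simp

lemma periodic_pd:
  assumes "sm f" "periodic_x f"
  shows "periodic_x (pd j f)"
  unfolding periodic_x_def
proof (intro allI)
  fix x and i :: 'a
  have "(\<lambda>s. f (x + axis i 1 + s *\<^sub>R axis j 1)) = (\<lambda>s. f (x + s *\<^sub>R axis j 1))"
    using periodic_shift[OF assms(2)] unfolding periodic_x_def by (metis (no_types) add.commute add.left_commute)
  then show "pd j f (x + axis i 1) = pd j f x"
    using sm_pd_line[OF assms(1), of x j 0] by (intro pd_eqI assms) simp
qed

text \<open>Jordan's inequality with the weaker constant 1 / pi, which is just what makes sin (pi *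
  t) dominate t for t up to 1/2.\<close>

lemma sin_ge_div_pi:
  assumes "0 \<le> x" "x \<le> pi / 2"
  shows "x / pi \<le> sin x"
proof (cases "x \<le> pi / 6")
  case True
  show ?thesis
  proof (cases "x = 0")
    case False
    obtain z where z: "0 < z" "z < x" "sin x - sin 0 = (x - 0) * cos z"
      using MVT2[of 0 x sin cos] assms False by (metis DERIV_sin order_less_le)
    have "cos (pi / 3) \<le> cos z"
      by (rule cos_monotone_0_pi_le) (use z True in auto)
    then have "1 / 2 \<le> cos z" by (simp only: cos_60)
    moreover have "1 / pi \<le> 1 / 2" using pi_ge_two by (simp add: field_simps)
    ultimately have "1 / pi \<le> cos z" by linarith
    then have "x * (1 / pi) \<le> x * cos z" using assms by (intro mult_left_mono) auto
    then show ?thesis using z by simp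
  qed simp
next
  case False
  have "sin (pi / 6) \<le> sin x"
    by (rule sin_monotone_2pi_le) (use False assms in auto)
  then have "1 / 2 \<le> sin x" by (simp only: sin_30)
  moreover have "x / pi \<le> 1 / 2" using assms by (simp add: field_simps)
  ultimately show ?thesis by linarith
qed

text \<open>1 - cos (2 * pi * s) is twice the square of sin (pi * t), where t is the distance of s
  to the nearest integer, and this sine dominates t. It converts supports described by a cosine into
  distances to the lattice.\<close>

lemma near_integer:
  assumes "1 - cos (2 * pi * s) < \<epsilon>\<^sup>2" "0 < \<epsilon>"
  shows "\<bar>s - of_int (round s)\<bar> \<le> \<epsilon>"
proof -
  define t where "t = \<bar>s - of_int (round s)\<bar>"
  have t: "0 \<le> t" "t \<le> 1 / 2"
    using of_int_round_abs_le[of s] by (auto simp: t_def abs_minus_commute)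
  have "cos (2 * (pi * t)) = cos (2 * pi * (s - of_int (round s)))"
    by (auto simp: t_def abs_if algebra_simps) (metis cos_minus minus_diff_eq)
  also have "\<dots> = cos (2 * pi * s - 2 * pi * of_int (round s))"
    by (simp add: algebra_simps)
  also have "\<dots> = cos (2 * pi * s)"
    unfolding cos_diff by (simp add: cos_int_2pin sin_int_2pin)
  finally have "cos (2 * (pi * t)) = cos (2 * pi * s)" .
  then have "2 * (sin (pi * t))\<^sup>2 < \<epsilon>\<^sup>2"
    using assms by (simp add: cos_double_sin)
  moreover have "t \<le> sin (pi * t)"
    using sin_ge_div_pi[of "pi * t"] t by simp
  then have "t\<^sup>2 \<le> (sin (pi * t))\<^sup>2" using t by (intro power_mono)
  ultimately have "t\<^sup>2 \<le> \<epsilon>\<^sup>2"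
    using zero_le_power2[of t] by linarith
  then show ?thesis using t assms(2) by (simp add: t_def[symmetric] power2_le_iff_abs_le)
qed

text \<open>The majorant $\kappa$ controls both $K$ and $\varepsilon |\nabla K|$; its mass bound $B$ can be chosen
  independently of $\varepsilon$. Points near the lattice play the role of points near $0$.\<close>

locale mollifier =
  fixes \<epsilon> B :: real and K \<kappa> :: "real^'d::finite \<Rightarrow> real"
  assumes eps: "0 < \<epsilon>"
    and sm_K: "sm K" and per_K: "periodic_x K" and K_nonneg: "0 \<le> K z"
    and int_K: "(\<integral>z. K z \<partial>torus) = 1"
    and kap_meas [measurable]: "\<kappa> \<in> borel_measurable borel" and per_kap: "periodic_x \<kappa>"
    and K_le: "K z \<le> \<kappa> z" and pd_K_le: "\<bar>pd j K z\<bar> \<le> \<kappa> z / \<epsilon>"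
    and kap_bdd: "\<exists>M. \<forall>z. \<kappa> z \<le> M"
    and int_kap: "(\<integral>z. \<kappa> z \<partial>torus) \<le> B"
    and kap_supp: "\<kappa> z \<noteq> 0 \<Longrightarrow> \<exists>k. norm (z - lat k) \<le> CARD('d) * \<epsilon>"

text \<open>Composing the bump with a cosine gives a smooth 1-periodic function at once, with no need to
  sum over translates.\<close>

definition periodic_bump :: "real \<Rightarrow> real \<Rightarrow> real" where
  "periodic_bump \<epsilon> s = bump 0 (1 - (1 - cos (2 * pi * s)) / \<epsilon>\<^sup>2)"

lemma periodic_bump_bounds: "0 \<le> periodic_bump \<epsilon> s" "periodic_bump \<epsilon> s \<le> 1"
  by (auto simp: periodic_bump_def bump_nonneg bump0_le_1)

lemma periodic_bump_eq_0: "0 < \<epsilon> \<Longrightarrow> \<epsilon>\<^sup>2 \<le> 1 - cos (2 * pi * s) \<Longrightarrow> periodic_bump \<epsilon> s = 0"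
  by (simp add: periodic_bump_def bump_def field_simps)

lemma periodic_bump_periodic: "periodic_bump \<epsilon> (s + 1) = periodic_bump \<epsilon> s"
  using cos_periodic[of "2 * pi * s"] by (simp add: periodic_bump_def algebra_simps)

text \<open>On this interval the argument of \<open>bump 0\<close> is at least 1/2, and
  \<open>bump 0 (1/2)\<close> is exp (- 2). The interval has length proportional to \<epsilon>,
  which bounds the normalising integral of the kernel from below by the right power of
  \<epsilon>.\<close>

lemma periodic_bump_ge:
  assumes "0 < \<epsilon>" "0 \<le> s" "s \<le> \<epsilon> / (2 * pi)"
  shows "exp (- 2) \<le> periodic_bump \<epsilon> s"
proof -
  have "\<bar>sin (pi * s)\<bar> \<le> \<bar>pi * s\<bar>" by (rule abs_sin_x_le_abs_x)
  also have "\<dots> \<le> \<epsilon> / 2" using assms by (simp add: field_simps)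
  finally have "(sin (pi * s))\<^sup>2 \<le> (\<epsilon> / 2)\<^sup>2" using assms by (simp add: abs_le_square_iff[symmetric])
  then have "(1 - cos (2 * pi * s)) / \<epsilon>\<^sup>2 \<le> 1 / 2"
    using assms(1) cos_double_sin[of "pi * s"] by (simp add: field_simps power2_eq_square)
  then have t: "1 / 2 \<le> 1 - (1 - cos (2 * pi * s)) / \<epsilon>\<^sup>2" (is "_ \<le> ?t") by simp
  moreover have "- 2 \<le> - 1 / y" if "1 / 2 \<le> y" for y :: real using that by (simp add: field_simps)
  ultimately have "- 2 \<le> - 1 / ?t" by blast
  moreover have "?t > 0" using t by linarith
  ultimately show ?thesis by (simp add: periodic_bump_def bump_def)
qed

text \<open>The chain rule alone costs the square of 1 / \<epsilon>. On the support the square of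
  the sine is (1 - cos) * (1 + cos), at most twice the square of \<epsilon>, which gives one factor
  back. The constant is 24 = 2 * (2 * 4) * (3/2), from \<open>bump2_le_2\<close>, pi < 4 and the
  square root of 2 being below 3/2.\<close>

lemma periodic_bump_deriv:
  assumes "0 < \<epsilon>"
  obtains D where "(periodic_bump \<epsilon> has_real_derivative D) (at s)" "\<bar>D\<bar> \<le> 24 / \<epsilon>"
    "\<epsilon>\<^sup>2 \<le> 1 - cos (2 * pi * s) \<Longrightarrow> D = 0"
proof -
  let ?t = "1 - (1 - cos (2 * pi * s)) / \<epsilon>\<^sup>2"
  let ?D = "bump 2 ?t * (- (2 * pi * sin (2 * pi * s)) / \<epsilon>\<^sup>2)"
  have 1: "(bump 0 has_real_derivative bump 2 ?t) (at ?t)" using bump_deriv[of 0 ?t] by (simp add: numeral_2_eq_2)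
  have 2: "((\<lambda>s. 1 - (1 - cos (2 * pi * s)) / \<epsilon>\<^sup>2) has_real_derivative (- (2 * pi * sin (2 * pi * s)) / \<epsilon>\<^sup>2)) (at s)"
    using assms by (auto intro!: derivative_eq_intros simp: field_simps)
  have der: "(periodic_bump \<epsilon> has_real_derivative ?D) (at s)"
    using DERIV_chain2[OF 1 2] by (simp add: periodic_bump_def[abs_def])
  have z: "?D = 0" if "\<epsilon>\<^sup>2 \<le> 1 - cos (2 * pi * s)"
    using that assms by (simp add: bump_def field_simps)
  have "\<bar>?D\<bar> \<le> 24 / \<epsilon>"
  proof (cases "\<epsilon>\<^sup>2 \<le> 1 - cos (2 * pi * s)")
    case True
    then have "\<bar>?D\<bar> = 0" using z by simp
    then show ?thesis using assms by (metis divide_nonneg_pos zero_le_numeral)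
  next
    case False
    have "(sin (2 * pi * s))\<^sup>2 = (1 - cos (2 * pi * s)) * (1 + cos (2 * pi * s))"
      by (simp add: sin_squared_eq power2_eq_square algebra_simps)
    also have "\<dots> \<le> \<epsilon>\<^sup>2 * 2"
      using False by (intro mult_mono) (auto simp: add_increasing, smt (verit) cos_ge_minus_one)
    also have "\<dots> \<le> (3 / 2 * \<epsilon>)\<^sup>2" by (simp add: power2_eq_square)
    finally have "\<bar>sin (2 * pi * s)\<bar> \<le> \<bar>3 / 2 * \<epsilon>\<bar>" by (simp only: abs_le_square_iff)
    then have sn: "\<bar>sin (2 * pi * s)\<bar> \<le> 3 / 2 * \<epsilon>" using assms by simp
    have "\<bar>?D\<bar> = bump 2 ?t * (2 * pi * \<bar>sin (2 * pi * s)\<bar> / \<epsilon>\<^sup>2)"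
      by (simp add: abs_mult bump_nonneg)
    also have "\<dots> \<le> 2 * (2 * 4 * (3 / 2 * \<epsilon>) / \<epsilon>\<^sup>2)"
      using pi_less_4 sn assms by (intro mult_mono divide_right_mono bump2_le_2) auto
    also have "\<dots> = 24 / \<epsilon>" using assms by (simp add: power2_eq_square)
    finally show ?thesis .
  qed
  then show ?thesis using that der z by blast
qed

lemma sm_periodic_bump: "sm (\<lambda>z::real^'d::finite. periodic_bump \<epsilon> (z $ i))"
proof -
  have "sm (\<lambda>z::real^'d. bump 0 ((1 - 1 / \<epsilon>\<^sup>2) + (1 / \<epsilon>\<^sup>2) * cos (2 * pi * z $ i)))"
    by (intro sm_bump sm_add sm_cos sm_mult[of "\<lambda>x. 1 / \<epsilon>\<^sup>2"] sm_const sm_linear bounded_linear_const_mult bounded_linear_vec_nth)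
  then show ?thesis by (simp add: periodic_bump_def diff_divide_distrib diff_diff_eq2 add_diff_eq algebra_simps)
qed

text \<open>The unnormalised kernel is at least a constant on a box of side \<epsilon> / (2 * pi)
  and vanishes outside a set of measure at most (2 * \<epsilon>) ^ d. Per coordinate the ratio is 2
  * \<epsilon> / (exp (- 2) * \<epsilon> / (2 * pi)) = 4 * pi * exp 2, which is \<open>c\<close>; so
  the mass bound does not depend on \<epsilon>.\<close>

lemma mollifier_exists:
  "\<exists>B>0. \<forall>\<epsilon>. 0 < \<epsilon> \<and> \<epsilon> < 1 / 4 \<longrightarrow> (\<exists>K \<kappa> :: real^'d::finite \<Rightarrow> real. mollifier \<epsilon> B K \<kappa>)"
proof -
  define c where "c = 4 * pi * exp 2"
  have "c > 0" by (simp add: c_def)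
  have "\<exists>K \<kappa> :: real^'d \<Rightarrow> real. mollifier \<epsilon> (24 * c ^ CARD('d)) K \<kappa>"
    if "0 < \<epsilon> \<and> \<epsilon> < 1 / 4" for \<epsilon>
  proof -
    have e: "0 < \<epsilon>" "\<epsilon> < 1 / 4" using that by auto
    define g :: "real^'d \<Rightarrow> real" where "g z = (\<Prod>i\<in>UNIV. periodic_bump \<epsilon> (z $ i))" for z
    define Z where "Z = (\<integral>z. g z \<partial>torus)"
    define S where "S = {z::real^'d. \<forall>i. 1 - cos (2 * pi * z $ i) < \<epsilon>\<^sup>2}"
    define K where "K z = 1 / Z * g z" for z
    \<comment> \<open>24 is the constant of \<open>periodic_bump_deriv\<close>; being larger than 1,
      it lets the same function dominate \<open>K\<close> itself.\<close>
    define \<kappa> where "\<kappa> z = 24 / Z * indicator S z" for z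
    have sg: "sm g" unfolding g_def[abs_def] by (intro sm_prod sm_periodic_bump) auto
    have [measurable]: "g \<in> borel_measurable borel" by (rule sm_borel[OF sg])
    have [measurable]: "S \<in> sets borel" unfolding S_def by measurable
    have g01: "0 \<le> g z" "g z \<le> 1" for z
      by (auto simp: g_def periodic_bump_bounds intro!: prod_nonneg prod_le_1)
    have ig: "integrable torus g"
      by (rule integrable_torus_bounded[of _ 1]) (use g01 in auto)
    have perg: "periodic_x g"
      unfolding periodic_x_def
    proof (intro allI)
      fix x :: "real^'d" and i
      have "periodic_bump \<epsilon> ((x + axis i 1) $ j) = periodic_bump \<epsilon> (x $ j)" for j
        using periodic_bump_periodic[of \<epsilon> "x $ j"] by (auto simp: axis_def)
      then show "g (x + axis i 1) = g x" by (simp add: g_def)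
    qed
    define r where "r = \<epsilon> / (2 * pi)"
    have r: "0 < r" "r \<le> 1"
      using e pi_ge_two by (auto simp: r_def field_simps)
    have Z: "(exp (- 2) * r) ^ CARD('d) \<le> Z"
    proof -
      let ?b = "cbox 0 (\<chi> i. r) :: (real^'d) set"
      have sub: "?b \<subseteq> cube" using r by (auto simp: mem_cube mem_box_cart) (smt (verit))
      have "(exp (- 2)) ^ CARD('d) * measure torus ?b = (\<integral>z. exp (- 2) ^ CARD('d) * indicator ?b z \<partial>torus)"
        by simp
      also have "\<dots> \<le> Z" unfolding Z_def
      proof (rule integral_mono)
        fix z :: "real^'d"
        show "exp (- 2) ^ CARD('d) * indicator ?b z \<le> g z"
        proof (cases "z \<in> ?b")
          case True
          have "(\<Prod>i\<in>(UNIV::'d set). exp (- 2)) \<le> g z" unfolding g_def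
            by (rule prod_mono) (use True e in \<open>auto simp: mem_box_cart r_def intro!: periodic_bump_ge\<close>)
          then show ?thesis using True by simp
        qed (simp add: g01)
      qed (auto simp: ig intro!: integrable_torus_bounded[of _ 1])
      also have "measure torus ?b = r ^ CARD('d)"
      proof -
        have "emeasure torus ?b = (\<integral>\<^sup>+x. indicator cube x * indicator ?b x \<partial>lborel)"
          by (simp add: torus_def emeasure_density)
        also have "\<dots> = (\<integral>\<^sup>+x. indicator ?b x \<partial>lborel)"
          using sub by (intro nn_integral_cong) (auto simp: indicator_def)
        finally have "emeasure torus ?b = emeasure lborel ?b" by simp
        then have "measure torus ?b = measure lborel ?b" by (simp add: measure_def)
        also have "\<dots> = (\<Prod>i\<in>(UNIV::'d set). r)"
        proof (subst content_cbox_cart)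
          have "0 \<in> ?b" using r by (simp add: mem_box_cart)
          then show "?b \<noteq> {}" by blast
        qed simp
        finally show ?thesis by simp
      qed
      finally show ?thesis by (simp add: power_mult_distrib)
    qed
    have Z0: "0 < Z" using Z r by (smt (verit) exp_gt_zero mult_pos_pos zero_less_power)
    have mS: "measure torus S \<le> (2 * \<epsilon>) ^ CARD('d)"
    proof -
      \<comment> \<open>\<open>S\<close> meets the unit cube only near its corners. A shift by 1/2
        in every coordinate collects it in one central box, where \<epsilon> < 1/4 forces the
        integer near \<open>x $ i + 1/2\<close> to be 1.\<close>
      let ?b = "cbox (\<chi> i. 1/2 - \<epsilon>) (\<chi> i. 1/2 + \<epsilon>) :: (real^'d) set"
      have "periodic_x (\<lambda>x. indicator S x :: ennreal)"
        unfolding periodic_x_def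
      proof (intro allI)
        fix x :: "real^'d" and i
        have "cos (2 * pi * (x + axis i 1) $ j) = cos (2 * pi * x $ j)" for j
          using cos_periodic[of "2 * pi * x $ j"] by (auto simp: axis_def algebra_simps)
        then show "(indicator S (x + axis i 1) :: ennreal) = indicator S x" by (simp add: S_def indicator_def)
      qed
      then have "emeasure torus S = (\<integral>\<^sup>+x. indicator S (x + (\<chi> i. 1/2)) \<partial>torus)"
        using nn_integral_torus_shift[of "indicator S" "\<chi> i. 1/2"] by simp
      also have "\<dots> = (\<integral>\<^sup>+x. indicator S (x + (\<chi> i. 1/2)) * indicator cube x \<partial>lborel)"
        by (rule nn_integral_torus) measurable
      also have "\<dots> \<le> (\<integral>\<^sup>+x. indicator ?b x \<partial>lborel)"
      proof (rule nn_integral_mono)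
        fix x :: "real^'d"
        have "x \<in> ?b" if "x + (\<chi> i. 1/2) \<in> S" "x \<in> cube"
        proof -
          have "1/2 - \<epsilon> \<le> x $ i \<and> x $ i \<le> 1/2 + \<epsilon>" for i
          proof -
            define n where "n = round (x $ i + 1/2)"
            have n: "\<bar>(x $ i + 1/2) - of_int n\<bar> \<le> \<epsilon>"
              unfolding n_def using that(1) e by (intro near_integer) (auto simp: S_def)
            have "0 \<le> x $ i" "x $ i \<le> 1" using that by (auto simp: mem_cube)
            then have "of_int n > (0::real)" "of_int n < (2::real)" using n e by linarith+
            then have "n = 1" by linarith
            then show ?thesis using n by (auto simp: abs_le_iff)
          qed
          then show ?thesis by (simp add: mem_box_cart)
        qed
        then show "indicator S (x + (\<chi> i. 1/2)) * indicator cube x \<le> (indicator ?b x :: ennreal)"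
          by (auto simp: indicator_def)
      qed
      also have "\<dots> = emeasure lborel ?b" by simp
      finally have "measure torus S \<le> measure lborel ?b"
        by (simp add: measure_def) (intro enn2real_mono, auto simp: emeasure_lborel_cbox_eq)
      also have "\<dots> = (\<Prod>i\<in>(UNIV::'d set). 2 * \<epsilon>)"
      proof (subst content_cbox_cart)
        have "(\<chi> i. 1/2) \<in> ?b" using e by (simp add: mem_box_cart)
        then show "?b \<noteq> {}" by blast
      qed simp
      finally show ?thesis by simp
    qed
    have outside: "\<exists>i. \<epsilon>\<^sup>2 \<le> 1 - cos (2 * pi * z $ i)" if "z \<notin> S" for z
      using that by (auto simp: S_def not_less)
    have g_S: "g z \<le> indicator S z" for z
    proof (cases "z \<in> S")
      case False
      then obtain i where "periodic_bump \<epsilon> (z $ i) = 0" using outside periodic_bump_eq_0 e by metis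
      then have "g z = 0" unfolding g_def by (auto intro!: prod_zero bexI[of _ i])
      then show ?thesis by simp
    qed (simp add: g01)
    have sK: "sm K" unfolding K_def[abs_def] by (rule sm_cmult[OF sg])
    have pdK: "\<bar>pd j K z\<bar> \<le> \<kappa> z / \<epsilon>" for j z
    proof -
      obtain D where D: "(periodic_bump \<epsilon> has_real_derivative D) (at (z $ j))" "\<bar>D\<bar> \<le> 24 / \<epsilon>"
        "\<epsilon>\<^sup>2 \<le> 1 - cos (2 * pi * z $ j) \<Longrightarrow> D = 0"
        using periodic_bump_deriv[OF e(1)] by metis
      define P where "P = (\<Prod>i\<in>UNIV-{j}. periodic_bump \<epsilon> (z $ i))"
      have P: "0 \<le> P" "P \<le> 1" by (auto simp: P_def periodic_bump_bounds intro!: prod_nonneg prod_le_1)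
      have "K (z + s *\<^sub>R axis j 1) = 1 / Z * (periodic_bump \<epsilon> (z $ j + s) * P)" for s
      proof -
        have "g (z + s *\<^sub>R axis j 1) = periodic_bump \<epsilon> ((z + s *\<^sub>R axis j 1) $ j) * (\<Prod>i\<in>UNIV-{j}. periodic_bump \<epsilon> ((z + s *\<^sub>R axis j 1) $ i))"
          unfolding g_def by (rule prod.remove) auto
        also have "\<dots> = periodic_bump \<epsilon> (z $ j + s) * P"
          unfolding P_def by (auto simp: axis_def intro!: prod.cong)
        finally show ?thesis by (simp add: K_def)
      qed
      moreover have "((\<lambda>s. periodic_bump \<epsilon> (z $ j + s)) has_real_derivative D) (at 0)"
      proof -
        have i: "((\<lambda>s. z $ j + s) has_real_derivative 1) (at 0)" by (auto intro!: derivative_eq_intros)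
        show ?thesis using DERIV_chain2[OF _ i, of "periodic_bump \<epsilon>" D] D(1) by simp
      qed
      ultimately have pd: "pd j K z = 1 / Z * (D * P)"
        using Z0 by (intro pd_eqI sK) (auto intro!: derivative_eq_intros)
      show ?thesis
      proof (cases "z \<in> S")
        case True
        have "\<bar>D\<bar> * P \<le> 24 / \<epsilon> * 1" using D(2) P e by (intro mult_mono) auto
        then have "\<bar>D\<bar> * P / Z \<le> 24 / \<epsilon> / Z" using Z0 by (intro divide_right_mono) auto
        then show ?thesis using True Z0 P by (simp add: pd \<kappa>_def abs_mult field_simps)
      next
        case False
        \<comment> \<open>Some factor vanishes here. If it is the differentiated one, its derivative
          vanishes as well; otherwise it kills the product P.\<close>
        then obtain i where i: "\<epsilon>\<^sup>2 \<le> 1 - cos (2 * pi * z $ i)" using outside by blast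
        have "D * P = 0"
        proof (cases "i = j")
          case False
          then have "P = 0" unfolding P_def using i e by (auto intro!: prod_zero bexI[of _ i] periodic_bump_eq_0)
          then show ?thesis by simp
        qed (use D(3) i in auto)
        then have "pd j K z = 0" using pd by simp
        then show ?thesis using Z0 e by (simp add: \<kappa>_def False)
      qed
    qed
    have "(\<integral>z. \<kappa> z \<partial>torus) = 24 / Z * measure torus S"
      by (simp add: \<kappa>_def)
    also have "\<dots> \<le> 24 / (exp (- 2) * r) ^ CARD('d) * (2 * \<epsilon>) ^ CARD('d)"
      using mS Z Z0 r by (intro mult_mono divide_left_mono) auto
    also have "\<dots> = 24 * (2 * \<epsilon> / (exp (- 2) * r)) ^ CARD('d)"
      by (simp add: power_divide)
    also have "2 * \<epsilon> / (exp (- 2) * r) = c"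
      using e by (simp add: r_def c_def exp_minus field_simps)
    finally have Bk: "(\<integral>z. \<kappa> z \<partial>torus) \<le> 24 * c ^ CARD('d)" .
    have "mollifier \<epsilon> (24 * c ^ CARD('d)) K \<kappa>"
    proof
      show "0 < \<epsilon>" by (rule e)
      show "sm K" by (rule sK)
      show "periodic_x K" using perg by (simp add: K_def periodic_x_def)
      show "0 \<le> K z" for z using g01 Z0 by (simp add: K_def)
      show "(\<integral>z. K z \<partial>torus) = 1" using Z0 by (simp add: K_def Z_def[symmetric])
      show "\<kappa> \<in> borel_measurable borel" unfolding \<kappa>_def by measurable
      show "periodic_x \<kappa>"
        unfolding periodic_x_def
      proof (intro allI)
        fix x :: "real^'d" and i
        have "cos (2 * pi * (x + axis i 1) $ j) = cos (2 * pi * x $ j)" for j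
          using cos_periodic[of "2 * pi * x $ j"] by (auto simp: axis_def algebra_simps)
        then show "\<kappa> (x + axis i 1) = \<kappa> x" by (simp add: \<kappa>_def S_def indicator_def)
      qed
      show "K z \<le> \<kappa> z" for z
      proof -
        have "1 / Z * g z \<le> 24 / Z * indicator S z"
          using g_S[of z] Z0 g01 by (intro mult_mono divide_right_mono) auto
        then show ?thesis by (simp add: K_def \<kappa>_def)
      qed
      show "\<exists>M. \<forall>z. \<kappa> z \<le> M"
        using Z0 by (intro exI[of _ "24 / Z"]) (auto simp: \<kappa>_def indicator_def)
      show "\<exists>k. norm (z - lat k) \<le> CARD('d) * \<epsilon>" if "\<kappa> z \<noteq> 0" for z
      proof (rule exI)
        have "z \<in> S" using that by (auto simp: \<kappa>_def indicator_def split: if_splits)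
        then have "\<bar>(z - lat (\<lambda>i. round (z $ i))) $ i\<bar> \<le> \<epsilon>" for i
          using near_integer[OF _ e(1)] by (auto simp: S_def lat_def)
        then have "(\<Sum>i\<in>UNIV. \<bar>(z - lat (\<lambda>i. round (z $ i))) $ i\<bar>) \<le> (\<Sum>i\<in>(UNIV::'d set). \<epsilon>)"
          by (intro sum_mono)
        then show "norm (z - lat (\<lambda>i. round (z $ i))) \<le> CARD('d) * \<epsilon>"
          using norm_le_l1_cart[of "z - lat (\<lambda>i. round (z $ i))"] by simp
      qed
    qed (use pdK Bk in auto)
    then show ?thesis by blast
  qed
  then show ?thesis using \<open>c > 0\<close> by (intro exI[of _ "24 * c ^ CARD('d)"]) simp
qed

section \<open>Translation continuity and the du Bois-Reymond lemma\<close>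

lemma AE_approx_continuous:
  fixes f :: "'a::euclidean_space \<Rightarrow> real"
  assumes "f \<in> borel_measurable borel"
  obtains g where "\<And>n::nat. continuous_on UNIV (g n)" "AE x in lborel. (\<lambda>n. g n x) \<longlonglongrightarrow> f x"
proof -
  have "f measurable_on UNIV"
    using assms by (intro lebesgue_measurable_imp_measurable_on) (auto simp: measurable_completion)
  then obtain N g where N: "negligible N" and g: "\<And>n::nat. continuous_on UNIV (g n)"
    "\<And>x. x \<notin> N \<Longrightarrow> (\<lambda>n. g n x) \<longlonglongrightarrow> f x"
    unfolding measurable_on_def by auto
  have "AE x in lebesgue. (\<lambda>n. g n x) \<longlonglongrightarrow> f x"
    using N g(2) by (intro AE_I'[of N]) (auto simp: negligible_iff_null_sets)
  then have "AE x in lborel. (\<lambda>n. g n x) \<longlonglongrightarrow> f x"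
    by (simp add: AE_completion_iff)
  with g(1) show ?thesis by (rule that)
qed

lemma nn_integral_diff_tendsto_0:
  fixes f :: "'a \<Rightarrow> real"
  assumes [measurable]: "f \<in> borel_measurable M" "\<And>n. g n \<in> borel_measurable M" and w: "integrable M w"
    and lim: "AE x in M. (\<lambda>n. g n x) \<longlonglongrightarrow> f x"
    and bd: "\<And>n. AE x in M. \<bar>g n x\<bar> \<le> w x"
  shows "(\<lambda>n. \<integral>\<^sup>+x. ennreal \<bar>g n x - f x\<bar> \<partial>M) \<longlonglongrightarrow> 0"
proof -
  have [measurable]: "w \<in> borel_measurable M" using w by auto
  have "(\<lambda>n. \<integral>\<^sup>+x. norm (f x - g n x) \<partial>M) \<longlonglongrightarrow> 0"
  proof (rule nn_integral_dominated_convergence_norm)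
    show "(\<integral>\<^sup>+x. ennreal (w x) \<partial>M) < \<infinity>"
      using integrableD(2)[OF w] by (simp add: less_top)
  qed (use lim bd in auto)
  then show ?thesis by (simp add: abs_minus_commute)
qed

text \<open>Continuous approximants converge only almost everywhere. Truncating f in value and in
  support first allows them to be clamped in the same way, and the clamped ones are
  dominated.\<close>

lemma L1_approx_continuous:
  fixes f :: "'a::euclidean_space \<Rightarrow> real"
  assumes f: "integrable lborel f" and e: "e > 0"
  obtains g R where "continuous_on UNIV g" "\<And>x. norm x > R \<Longrightarrow> g x = 0"
    "(\<integral>\<^sup>+x. ennreal \<bar>g x - f x\<bar> \<partial>lborel) < ennreal e"
proof -
  have [measurable]: "f \<in> borel_measurable borel" using f by auto
  define F where "F n x = f x * indicator {x. \<bar>f x\<bar> \<le> real n \<and> norm x \<le> real n} x" for n :: nat and x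
  have [measurable]: "F n \<in> borel_measurable borel" for n unfolding F_def by measurable
  have "(\<lambda>n. \<integral>\<^sup>+x. ennreal \<bar>F n x - f x\<bar> \<partial>lborel) \<longlonglongrightarrow> 0"
  proof (rule nn_integral_diff_tendsto_0[where w="\<lambda>x. \<bar>f x\<bar>"])
    show "AE x in lborel. (\<lambda>n. F n x) \<longlonglongrightarrow> f x"
    proof (rule AE_I2)
      fix x
      obtain m :: nat where m: "\<bar>f x\<bar> \<le> real m" "norm x \<le> real m"
        using real_arch_simple[of "max \<bar>f x\<bar> (norm x)"] by auto
      show "(\<lambda>n. F n x) \<longlonglongrightarrow> f x"
      proof (rule tendsto_eventually)
        show "\<forall>\<^sub>F n in sequentially. F n x = f x"
          unfolding eventually_sequentially
          by (rule exI[of _ m]) (use m in \<open>auto simp: F_def indicator_def\<close>)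
      qed
    qed
  qed (use f in \<open>auto simp: F_def indicator_def\<close>)
  then have "\<forall>\<^sub>F n in sequentially. (\<integral>\<^sup>+x. ennreal \<bar>F n x - f x\<bar> \<partial>lborel) < ennreal (e/2)"
    using e by (intro order_tendstoD) auto
  then obtain n where n: "(\<integral>\<^sup>+x. ennreal \<bar>F n x - f x\<bar> \<partial>lborel) < ennreal (e/2)"
    by (auto simp: eventually_sequentially)
  obtain g where g: "\<And>m::nat. continuous_on UNIV (g m)" "AE x in lborel. (\<lambda>m. g m x) \<longlonglongrightarrow> F n x"
    using AE_approx_continuous[of "F n"] by auto
  \<comment> \<open>The cutoff is 1 wherever \<open>F n\<close> is nonzero, and the clamp fixes all
    values of \<open>F n\<close>, so neither changes the limit.\<close>
  define h where "h m x = max 0 (min 1 (real n + 1 - norm x)) * max (- real n) (min (real n) (g m x))" for m x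
  have ch: "continuous_on UNIV (h m)" for m
    unfolding h_def using g(1) by (intro continuous_intros)
  then have [measurable]: "h m \<in> borel_measurable borel" for m
    by (rule borel_measurable_continuous_onI)
  have h0: "h m x = 0" if "norm x > real n + 1" for m x
    using that by (simp add: h_def)
  have "(\<lambda>m. \<integral>\<^sup>+x. ennreal \<bar>h m x - F n x\<bar> \<partial>lborel) \<longlonglongrightarrow> 0"
  proof (rule nn_integral_diff_tendsto_0[where w="\<lambda>x. real n * indicator (cball 0 (real n + 1)) x"])
    show "integrable lborel (\<lambda>x::'a. real n * indicator (cball 0 (real n + 1)) x :: real)"
      using emeasure_bounded_finite[of "cball (0::'a) (real n + 1)"]
      by (intro integrable_mult_right integrable_real_indicator) auto
    show "AE x in lborel. (\<lambda>m. h m x) \<longlonglongrightarrow> F n x"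
      using g(2)
    proof eventually_elim
      case (elim x)
      have "(\<lambda>m. h m x) \<longlonglongrightarrow> max 0 (min 1 (real n + 1 - norm x)) * max (- real n) (min (real n) (F n x))"
        unfolding h_def by (intro tendsto_intros elim)
      moreover have "max 0 (min 1 (real n + 1 - norm x)) * max (- real n) (min (real n) (F n x)) = F n x"
        by (auto simp: F_def indicator_def)
      ultimately show ?case by simp
    qed
    show "AE x in lborel. \<bar>h m x\<bar> \<le> real n * indicator (cball 0 (real n + 1)) x" for m
    proof (rule AE_I2)
      fix x
      show "\<bar>h m x\<bar> \<le> real n * indicator (cball 0 (real n + 1)) x"
      proof (cases "norm x > real n + 1")
        case False
        have "\<bar>h m x\<bar> \<le> 1 * real n" unfolding h_def abs_mult by (intro mult_mono) auto
        then show ?thesis using False by simp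
      qed (simp add: h0)
    qed
  qed auto
  then have "\<forall>\<^sub>F m in sequentially. (\<integral>\<^sup>+x. ennreal \<bar>h m x - F n x\<bar> \<partial>lborel) < ennreal (e/2)"
    using e by (intro order_tendstoD) auto
  then obtain m where m: "(\<integral>\<^sup>+x. ennreal \<bar>h m x - F n x\<bar> \<partial>lborel) < ennreal (e/2)"
    by (auto simp: eventually_sequentially)
  have "(\<integral>\<^sup>+x. ennreal \<bar>h m x - f x\<bar> \<partial>lborel)
      \<le> (\<integral>\<^sup>+x. ennreal \<bar>h m x - F n x\<bar> + ennreal \<bar>F n x - f x\<bar> \<partial>lborel)"
    by (intro nn_integral_mono) (auto simp flip: ennreal_plus intro!: ennreal_leI)
  also have "\<dots> = (\<integral>\<^sup>+x. ennreal \<bar>h m x - F n x\<bar> \<partial>lborel) + (\<integral>\<^sup>+x. ennreal \<bar>F n x - f x\<bar> \<partial>lborel)"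
    by (rule nn_integral_add) auto
  also have "\<dots> < ennreal (e/2) + ennreal (e/2)" by (rule add_strict_mono[OF m n])
  also have "\<dots> = ennreal e" using e by (simp flip: ennreal_plus)
  finally show ?thesis using that[OF ch h0] by blast
qed

text \<open>Three errors: a compactly supported continuous approximant is uniformly continuous, and
  the shifted approximation error equals the unshifted one by translation invariance.\<close>

lemma L1_translation_continuous:
  fixes f :: "'a::euclidean_space \<Rightarrow> real"
  assumes f: "integrable lborel f" and e: "e > 0"
  shows "\<exists>\<delta>>0. \<forall>h. norm h < \<delta> \<longrightarrow> (\<integral>\<^sup>+x. ennreal \<bar>f (x + h) - f x\<bar> \<partial>lborel) \<le> ennreal e"
proof -
  have [measurable]: "f \<in> borel_measurable borel" using f by auto
  obtain g R where g: "continuous_on UNIV g" "\<And>x. norm x > R \<Longrightarrow> g x = 0"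
    "(\<integral>\<^sup>+x. ennreal \<bar>g x - f x\<bar> \<partial>lborel) < ennreal (e/3)"
    using L1_approx_continuous[OF f, of "e/3"] e by auto
  have [measurable]: "g \<in> borel_measurable borel" using g(1) by (rule borel_measurable_continuous_onI)
  \<comment> \<open>For \<open>norm h < 1\<close> both g x and g (x + h) vanish when x is outside
    \<open>?B\<close>, and x + h stays in \<open>?C\<close> when x is in \<open>?B\<close>. The
    absolute value guards against a negative R.\<close>
  let ?B = "cball 0 (\<bar>R\<bar> + 1) :: 'a set" and ?C = "cball 0 (\<bar>R\<bar> + 2) :: 'a set"
  define V where "V = measure lborel ?B"
  have V: "emeasure lborel ?B = ennreal V" "V \<ge> 0"
    using emeasure_bounded_finite[of ?B] by (auto simp: V_def measure_def)
  have "uniformly_continuous_on ?C g"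
    by (intro compact_uniformly_continuous continuous_on_subset[OF g(1)]) auto
  moreover have "e / (3 * (V + 1)) > 0" using e V by simp
  ultimately obtain d where d: "d > 0"
    "\<And>x y. x \<in> ?C \<Longrightarrow> y \<in> ?C \<Longrightarrow> dist y x < d \<Longrightarrow> dist (g y) (g x) < e / (3 * (V + 1))"
    unfolding uniformly_continuous_on_def by metis
  have "(\<integral>\<^sup>+x. ennreal \<bar>f (x + h) - f x\<bar> \<partial>lborel) \<le> ennreal e" if h: "norm h < min d 1" for h
  proof -
    have pt: "ennreal \<bar>g (x + h) - g x\<bar> \<le> ennreal (e / (3 * (V + 1))) * indicator ?B x" for x
    proof (cases "x \<in> ?B")
      case True
      have "norm (x + h) \<le> norm x + norm h" by (rule norm_triangle_ineq)
      then have "x \<in> ?C" "x + h \<in> ?C" using True h by auto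
      then have "dist (g (x + h)) (g x) < e / (3 * (V + 1))" using h by (intro d) (auto simp: dist_norm)
      then show ?thesis using True by (auto simp: dist_real_def intro!: ennreal_leI)
    next
      case False
      have "norm x \<le> norm (x + h) + norm h" using norm_triangle_ineq4[of "x + h" h] by simp
      then have "norm (x + h) > R" "norm x > R" using False h by auto
      then show ?thesis using g(2) by simp
    qed
    have 1: "(\<integral>\<^sup>+x. ennreal \<bar>g (x + h) - g x\<bar> \<partial>lborel) \<le> ennreal (e/3)"
    proof -
      have "(\<integral>\<^sup>+x. ennreal \<bar>g (x + h) - g x\<bar> \<partial>lborel) \<le> (\<integral>\<^sup>+x. ennreal (e / (3 * (V + 1))) * indicator ?B x \<partial>lborel)"
        by (intro nn_integral_mono pt)
      also have "\<dots> = ennreal (e / (3 * (V + 1)) * V)"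
        using V e by (subst nn_integral_cmult_indicator) (auto simp: ennreal_mult[symmetric])
      also have "\<dots> \<le> ennreal (e / 3)"
        using V e by (intro ennreal_leI) (simp add: field_simps)
      finally show ?thesis .
    qed
    have 2: "(\<integral>\<^sup>+x. ennreal \<bar>g (x + h) - f (x + h)\<bar> \<partial>lborel) \<le> ennreal (e/3)"
      using nn_integral_lborel_shift[of "\<lambda>x. ennreal \<bar>g x - f x\<bar>" h] g(3) by (simp add: less_imp_le)
    have "(\<integral>\<^sup>+x. ennreal \<bar>f (x + h) - f x\<bar> \<partial>lborel)
      \<le> (\<integral>\<^sup>+x. (ennreal \<bar>g (x + h) - f (x + h)\<bar> + ennreal \<bar>g (x + h) - g x\<bar>) + ennreal \<bar>g x - f x\<bar> \<partial>lborel)"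
      by (intro nn_integral_mono) (auto simp flip: ennreal_plus intro!: ennreal_leI)
    also have "\<dots> = ((\<integral>\<^sup>+x. ennreal \<bar>g (x + h) - f (x + h)\<bar> \<partial>lborel) + (\<integral>\<^sup>+x. ennreal \<bar>g (x + h) - g x\<bar> \<partial>lborel))
       + (\<integral>\<^sup>+x. ennreal \<bar>g x - f x\<bar> \<partial>lborel)"
      by (simp add: nn_integral_add)
    also have "\<dots> \<le> (ennreal (e/3) + ennreal (e/3)) + ennreal (e/3)"
      using 1 2 g(3) by (intro add_mono) auto
    also have "\<dots> = ennreal e" using e by (simp flip: ennreal_plus)
    finally show ?thesis .
  qed
  then show ?thesis using d(1) by (intro exI[of _ "min d 1"]) auto
qed

text \<open>A periodic f is not integrable on the whole space, but its restriction to the box with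
  coordinates between -1 and 2 is, as finitely many lattice translates of the cube cover that box.
  For x in the cube and \<open>norm h < 1\<close> the restriction sees both f x and f (x +
  h).\<close>

lemma torus_L1_translation:
  fixes f :: "real^'d::finite \<Rightarrow> real"
  assumes [measurable]: "f \<in> borel_measurable borel" and per: "periodic_x f"
    and f: "integrable torus f" and e: "e > 0"
  shows "\<exists>\<delta>>0. \<forall>h. norm h < \<delta> \<longrightarrow> (\<integral>\<^sup>+x. ennreal \<bar>f (x + h) - f x\<bar> \<partial>torus) \<le> ennreal e"
proof -
  define b where "b = {x::real^'d. \<forall>i. -1 \<le> x $ i \<and> x $ i \<le> 2}"
  have [measurable]: "b \<in> sets borel" unfolding b_def by measurable
  define KK where "KK = {k :: 'd \<Rightarrow> int. \<forall>i. k i \<in> {-1..2}}"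
  have fin: "finite KK"
    using finite_PiE[of "UNIV :: 'd set" "\<lambda>_. {-1..2::int}"] by (simp add: KK_def PiE_def Pi_def)
  define F where "F x = indicator b x * f x" for x
  have [measurable]: "F \<in> borel_measurable borel" unfolding F_def by measurable
  have "(\<integral>\<^sup>+x. ennreal (norm (F x)) \<partial>lborel)
      \<le> (\<integral>\<^sup>+x. (\<Sum>k\<in>KK. ennreal \<bar>f (x - lat k)\<bar> * indicator cube (x - lat k)) \<partial>lborel)"
  proof (rule nn_integral_mono)
    fix x :: "real^'d"
    show "ennreal (norm (F x)) \<le> (\<Sum>k\<in>KK. ennreal \<bar>f (x - lat k)\<bar> * indicator cube (x - lat k))"
    proof (cases "x \<in> b")
      case True
      define k where "k = (\<lambda>i. \<lfloor>x $ i\<rfloor>)"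
      have "k \<in> KK" using True unfolding KK_def k_def b_def
        by (auto simp: le_floor_iff) (smt (verit) floor_le_iff of_int_numeral)
      have "x - lat k \<in> cube" by (simp add: k_def mem_cube lat_def, linarith)
      then have "ennreal (norm (F x)) = ennreal \<bar>f (x - lat k)\<bar> * indicator cube (x - lat k)"
        using True by (simp add: F_def periodic_lat_minus[OF per])
      also have "\<dots> \<le> (\<Sum>k\<in>KK. ennreal \<bar>f (x - lat k)\<bar> * indicator cube (x - lat k))"
        by (rule member_le_sum) (use \<open>k \<in> KK\<close> fin in auto)
      finally show ?thesis .
    qed (simp add: F_def)
  qed
  also have "\<dots> = (\<Sum>k\<in>KK. \<integral>\<^sup>+x. ennreal \<bar>f (x - lat k)\<bar> * indicator cube (x - lat k) \<partial>lborel)"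
    by (rule nn_integral_sum) measurable
  also have "\<dots> = (\<Sum>k\<in>KK. \<integral>\<^sup>+x. ennreal \<bar>f x\<bar> \<partial>torus)"
  proof (rule sum.cong)
    fix k
    show "(\<integral>\<^sup>+x. ennreal \<bar>f (x - lat k)\<bar> * indicator cube (x - lat k) \<partial>lborel) = (\<integral>\<^sup>+x. ennreal \<bar>f x\<bar> \<partial>torus)"
      using nn_integral_lborel_shift[of "\<lambda>x. ennreal \<bar>f x\<bar> * indicator cube x" "- lat k"]
      by (simp add: nn_integral_torus)
  qed simp
  also have "\<dots> < \<infinity>"
    using f[unfolded integrable_iff_bounded] by (simp add: less_top[symmetric] ennreal_mult_eq_top_iff)
  finally have "integrable lborel F" by (intro integrableI_bounded) auto
  from L1_translation_continuous[OF this e] obtain d where d: "d > 0"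
    "\<And>h. norm h < d \<Longrightarrow> (\<integral>\<^sup>+x. ennreal \<bar>F (x + h) - F x\<bar> \<partial>lborel) \<le> ennreal e" by blast
  have "(\<integral>\<^sup>+x. ennreal \<bar>f (x + h) - f x\<bar> \<partial>torus) \<le> ennreal e" if h: "norm h < min d 1" for h
  proof -
    have "(\<integral>\<^sup>+x. ennreal \<bar>f (x + h) - f x\<bar> \<partial>torus) = (\<integral>\<^sup>+x. ennreal \<bar>f (x + h) - f x\<bar> * indicator cube x \<partial>lborel)"
      by (rule nn_integral_torus) measurable
    also have "\<dots> \<le> (\<integral>\<^sup>+x. ennreal \<bar>F (x + h) - F x\<bar> \<partial>lborel)"
    proof (rule nn_integral_mono)
      fix x :: "real^'d"
      have "x \<in> b" "x + h \<in> b" if "x \<in> cube"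
      proof -
        have "\<bar>h $ i\<bar> \<le> 1" for i using component_le_norm_cart[of h i] h by simp
        then have "-1 \<le> x $ i + h $ i \<and> x $ i + h $ i \<le> 2" for i
          using that unfolding mem_cube by (smt (verit))
        then show "x + h \<in> b" by (simp add: b_def)
        show "x \<in> b" using that unfolding mem_cube b_def by (smt (verit) mem_Collect_eq)
      qed
      then show "ennreal \<bar>f (x + h) - f x\<bar> * indicator cube x \<le> ennreal \<bar>F (x + h) - F x\<bar>"
        by (auto simp: indicator_def F_def)
    qed
    also have "\<dots> \<le> ennreal e" using d h by simp
    finally show ?thesis .
  qed
  then show ?thesis using d(1) by (intro exI[of _ "min d 1"]) auto
qed

section \<open>Indefinite integrals and smooth steps in time\<close>

lemma continuous_on_integral_lessThan:
  fixes g :: "real \<Rightarrow> 'b::{banach, second_countable_topology}"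
  assumes g: "integrable lborel g"
  shows "continuous_on UNIV (\<lambda>t. \<integral>s. indicator {..<t} s *\<^sub>R g s \<partial>lborel)"
  unfolding continuous_on_sequentially comp_def
proof (intro ballI allI impI)
  have [measurable]: "g \<in> borel_measurable lborel" using g by auto
  fix t and x :: "nat \<Rightarrow> real" assume x: "(\<forall>n. x n \<in> UNIV) \<and> x \<longlonglongrightarrow> t"
  show "(\<lambda>n. \<integral>s. indicator {..<x n} s *\<^sub>R g s \<partial>lborel) \<longlonglongrightarrow> (\<integral>s. indicator {..<t} s *\<^sub>R g s \<partial>lborel)"
  proof (rule integral_dominated_convergence[where w="\<lambda>s. norm (g s)"])
    show "AE s in lborel. (\<lambda>n. indicator {..<x n} s *\<^sub>R g s) \<longlonglongrightarrow> indicator {..<t} s *\<^sub>R g s"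
      using AE_lborel_singleton[of t]
    proof eventually_elim
      case (elim s)
      have "\<forall>\<^sub>F n in sequentially. (s < x n \<longleftrightarrow> s < t)"
      proof (cases "s < t")
        case True
        then have "\<forall>\<^sub>F n in sequentially. s < x n" using x order_tendstoD(1) by blast
        then show ?thesis using True by (auto elim: eventually_mono)
      next
        case False
        then have "\<forall>\<^sub>F n in sequentially. x n < s" using x elim by (intro order_tendstoD(2)) auto
        then show ?thesis using False by (auto elim: eventually_mono)
      qed
      then have "\<forall>\<^sub>F n in sequentially. indicator {..<x n} s *\<^sub>R g s = indicator {..<t} s *\<^sub>R g s"
        by eventually_elim (simp add: indicator_def)
      then show ?case by (rule tendsto_eventually)
    qed
  qed (use g in \<open>auto simp: indicator_def\<close>)
qed

lemma continuous_on_indefinite_integral: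
  fixes f :: "real \<Rightarrow> 'b::{banach, second_countable_topology}"
  assumes f: "set_integrable lborel {0<..<T} f"
  shows "continuous_on {..T} (\<lambda>t. LINT s:{0<..<t}|lborel. f s)"
proof -
  have "continuous_on {..T} (\<lambda>t. \<integral>s. indicator {..<t} s *\<^sub>R (indicator {0<..<T} s *\<^sub>R f s) \<partial>lborel)"
    using f unfolding set_integrable_def
    by (intro continuous_on_subset[OF continuous_on_integral_lessThan]) auto
  then show ?thesis
    by (rule continuous_on_eq)
      (auto simp: set_lebesgue_integral_def indicator_def intro!: Bochner_Integration.integral_cong)
qed

text \<open>The step is an antiderivative of a product of two bumps, normalised by its increase over
  the unit interval. Only its derivative is placed in \<open>sm\<close> here; the step itself enters
  through \<open>sm_antideriv\<close>.\<close>

lemma smooth_step: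
  obtains \<sigma> k :: "real \<Rightarrow> real" where
    "\<And>s. (\<sigma> has_real_derivative k s) (at s)" "sm k" "\<And>s. s \<le> 0 \<Longrightarrow> \<sigma> s = 0" "\<And>s. s \<ge> 1 \<Longrightarrow> \<sigma> s = 1"
    "\<And>s. k s \<ge> 0" "\<And>s. s \<notin> {0<..<1} \<Longrightarrow> k s = 0"
proof -
  define X where "X s = bump 0 s * bump 0 (1 + (- 1) * s)" for s
  have smX: "sm X" unfolding X_def
    by (intro sm_mult sm_bump sm_add sm_const sm_linear bounded_linear_ident)
  have X0: "X s \<ge> 0" "s \<notin> {0<..<1} \<Longrightarrow> X s = 0" for s by (auto simp: X_def bump_def)
  have Xpos: "X s > 0" if "0 < s" "s < 1" for s using that by (simp add: X_def bump_def)
  have "\<exists>F. \<forall>x. - \<infinity> < ereal x \<longrightarrow> ereal x < \<infinity> \<longrightarrow> (F has_vector_derivative X x) (at x)"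
    by (rule einterval_antiderivative)
      (use sm_continuous_on[OF smX, of UNIV] in \<open>auto simp: continuous_on_eq_continuous_at\<close>)
  then obtain G where G: "\<And>x. (G has_real_derivative X x) (at x)"
    by (auto simp: has_real_derivative_iff_has_vector_derivative)
  \<comment> \<open>The increase over the unit interval equals the value of X at an interior point,
    hence is positive and can serve as a divisor.\<close>
  obtain z where z: "0 < z" "z < 1" "G 1 - G 0 = (1 - 0) * X z"
    using MVT2[of 0 1 G X] G by auto
  define w where "w = G 1 - G 0"
  have w: "w > 0" using z Xpos by (simp add: w_def)
  have G0: "G s = G 0" if "s \<le> 0" for s
  proof (cases "s = 0")
    case False
    then have "\<exists>y. s < y \<and> y < 0 \<and> G 0 - G s = (0 - s) * X y"
      using that by (intro MVT2) (auto intro: G)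
    then obtain y where "s < y" "y < 0" "G 0 - G s = (0 - s) * X y" by blast
    then show ?thesis using X0(2)[of y] by simp
  qed simp
  have G1: "G s = G 1" if "s \<ge> 1" for s
  proof (cases "s = 1")
    case False
    then have "\<exists>y. 1 < y \<and> y < s \<and> G s - G 1 = (s - 1) * X y"
      using that by (intro MVT2) (auto intro: G)
    then obtain y where "1 < y" "y < s" "G s - G 1 = (s - 1) * X y" by blast
    then show ?thesis using X0(2)[of y] by simp
  qed simp
  show ?thesis
  proof (rule that[of "\<lambda>s. (G s - G 0) / w" "\<lambda>s. 1 / w * X s"])
    show "((\<lambda>s. (G s - G 0) / w) has_real_derivative 1 / w * X s) (at s)" for s
      using w by (auto intro!: derivative_eq_intros G)
    show "sm (\<lambda>s. 1 / w * X s)" by (rule sm_cmult[OF smX])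
    show "(G s - G 0) / w = 0" if "s \<le> 0" for s using G0[OF that] by simp
    show "(G s - G 0) / w = 1" if "s \<ge> 1" for s using G1[OF that] w by (simp add: w_def)
  qed (use w X0 in auto)
qed

lemma sm_step_compose:
  assumes "\<And>s. (\<sigma> has_real_derivative k s) (at s)" "sm k"
  shows "sm (\<lambda>t. \<sigma> ((t - s) / r))"
proof -
  have a: "sm (\<lambda>t. (- s / r) + (1 / r) * t)"
    by (intro sm_add sm_const sm_linear bounded_linear_mult_right)
  have "sm (\<lambda>t. k ((- s / r) + (1 / r) * t))"
    by (rule sm_affine[OF assms(2) bounded_linear_mult_right])
  then have "sm (\<lambda>t. \<sigma> ((- s / r) + (1 / r) * t))"
    by (rule sm_antideriv[OF a]) (use assms in auto)
  then show ?thesis by (simp add: diff_divide_distrib)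
qed

text \<open>Since \<open>b\<close> is merely integrable, its indefinite integral need not be
  differentiable at every point. Fubini on the triangle t < s < T replaces the product rule, and
  \<phi> T = 0 removes the boundary term.\<close>

lemma integral_by_parts_indefinite:
  fixes b \<phi> \<phi>' :: "real \<Rightarrow> real"
  assumes b: "set_integrable lborel {0<..<T} b"
    and der: "\<And>s. (\<phi> has_real_derivative \<phi>' s) (at s)" and cont: "continuous_on UNIV \<phi>'"
    and end0: "\<phi> T = 0" and T: "T > 0"
  shows "(LINT t:{0<..<T}|lborel. \<phi> t * b t) = - (LINT t:{0<..<T}|lborel. \<phi>' t * (LINT s:{0<..<t}|lborel. b s))"
proof -
  have [measurable]: "\<phi>' \<in> borel_measurable borel" using cont by (rule borel_measurable_continuous_onI)
  define g where "g s = indicator {0<..<T} s * b s" for s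
  have g: "integrable lborel g" using b by (simp add: g_def[abs_def] set_integrable_def)
  then have [measurable]: "g \<in> borel_measurable borel" by auto
  obtain M where M: "\<And>s. s \<in> {0..T} \<Longrightarrow> \<bar>\<phi>' s\<bar> \<le> M"
    using compact_continuous_image[OF continuous_on_subset[OF cont, of "{0..T}"]]
    by (metis bounded_iff compact_Icc compact_imp_bounded image_eqI real_norm_def subset_UNIV)
  have M0: "M \<ge> 0" using M[of 0] T by simp
  define f where "f t s = g t * (indicator {0<..<T} s * indicator {t<..<T} s * \<phi>' s)" for t s
  have [measurable]: "case_prod f \<in> borel_measurable (borel \<Otimes>\<^sub>M borel)"
  proof -
    have "case_prod f = (\<lambda>(t,s). g t * (indicator {0<..<T} s * (if t < s \<and> s < T then 1 else 0) * \<phi>' s))"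
      by (auto simp: f_def indicator_def fun_eq_iff)
    then show ?thesis by simp
  qed
  have intf: "integrable (lborel \<Otimes>\<^sub>M lborel) (case_prod f)"
  proof (rule Bochner_Integration.integrable_bound)
    have "integrable lborel (\<lambda>s. M * indicator {0<..<T} s :: real)"
      using T by (intro integrable_mult_right integrable_real_indicator) auto
    then show "integrable (lborel \<Otimes>\<^sub>M lborel) (\<lambda>(t, s). g t * (M * indicator {0<..<T} s))"
      using g by (intro lborel_pair.Fubini_integrable) (auto intro!: integrable_mult_right integrable_mult_left simp: abs_mult)
    show "AE z in lborel \<Otimes>\<^sub>M lborel. norm (case_prod f z) \<le> norm (case z of (t, s) \<Rightarrow> g t * (M * indicator {0<..<T} s))"
      using M M0 by (intro AE_I2) (auto simp: f_def abs_mult indicator_def intro!: mult_left_mono)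
  qed simp
  have "(LINT t:{0<..<T}|lborel. \<phi> t * b t) = (\<integral>t. - (\<integral>s. f t s \<partial>lborel) \<partial>lborel)"
    unfolding set_lebesgue_integral_def
  proof (rule Bochner_Integration.integral_cong)
    fix t :: real
    show "indicator {0<..<T} t *\<^sub>R (\<phi> t * b t) = - (\<integral>s. f t s \<partial>lborel)"
    proof (cases "t \<in> {0<..<T}")
      case True
      have "(\<integral>s. f t s \<partial>lborel) = g t * (\<integral>s. indicator {t<..<T} s * \<phi>' s \<partial>lborel)"
        using True unfolding f_def
        by (subst integral_mult_right_zero[symmetric]) (auto simp: indicator_def intro!: Bochner_Integration.integral_cong)
      also have "(\<integral>s. indicator {t<..<T} s * \<phi>' s \<partial>lborel) = (\<integral>s. \<phi>' s * indicator {t..T} s \<partial>lborel)"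
      proof (rule integral_cong_AE)
        show "AE s in lborel. indicator {t<..<T} s * \<phi>' s = \<phi>' s * indicator {t..T} s"
          using AE_lborel_singleton[of t] AE_lborel_singleton[of T] by eventually_elim (auto simp: indicator_def)
      qed auto
      also have "\<dots> = \<phi> T - \<phi> t"
        by (rule integral_FTC_Icc_real)
          (use True der cont in \<open>auto simp: continuous_on_eq_continuous_at\<close>)
      finally show ?thesis using True end0 by (simp add: g_def)
    qed (simp add: f_def g_def)
  qed simp
  also have "\<dots> = - (\<integral>s. (\<integral>t. f t s \<partial>lborel) \<partial>lborel)"
    using lborel_pair.Fubini_integral[OF intf] by simp
  also have "(\<integral>s. (\<integral>t. f t s \<partial>lborel) \<partial>lborel) = (LINT t:{0<..<T}|lborel. \<phi>' t * (LINT s:{0<..<t}|lborel. b s))"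
    unfolding set_lebesgue_integral_def
  proof (rule Bochner_Integration.integral_cong)
    fix s :: real
    have "(\<integral>t. f t s \<partial>lborel) = (\<integral>t. (indicator {0<..<T} s * \<phi>' s) * (indicator {0<..<s} t * b t) \<partial>lborel)"
      by (rule Bochner_Integration.integral_cong) (auto simp: f_def g_def indicator_def)
    then show "(\<integral>t. f t s \<partial>lborel) = indicator {0<..<T} s *\<^sub>R (\<phi>' s * (\<integral>t. indicator {0<..<s} t *\<^sub>R b t \<partial>lborel))"
      by (simp add: integral_mult_right_zero)
  qed simp
  finally show ?thesis .
qed

text \<open>Tested against the difference of two translates of a smooth step of width $r$, the weak equation
  says that the averages of $a - \int b$ over $(s, s + r)$ do not depend on $s$. Letting $s \to 0$
  identifies their common value, and letting $r \to 0$ recovers the function.\<close>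

lemma du_bois_reymond:
  fixes a b :: "real \<Rightarrow> real"
  assumes T: "T > 0"
    and a: "set_integrable lborel {0<..<T} a" and b: "set_integrable lborel {0<..<T} b"
    and weak: "\<And>\<phi> \<phi>'. sm \<phi> \<Longrightarrow> (\<And>s. (\<phi> has_real_derivative \<phi>' s) (at s)) \<Longrightarrow>
      (\<exists>c d. 0 < c \<and> c < d \<and> d < T \<and> (\<forall>t. t \<notin> {c..d} \<longrightarrow> \<phi> t = 0)) \<Longrightarrow>
      (LINT t:{0<..<T}|lborel. \<phi>' t * a t) + (LINT t:{0<..<T}|lborel. \<phi> t * b t) = 0"
    and lim: "(a \<longlongrightarrow> a0) (at_right 0)"
  shows "AE t in lborel. t \<in> {0<..<T} \<longrightarrow> a t = a0 + (LINT s:{0<..<t}|lborel. b s)"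
proof -
  obtain \<sigma> k :: "real \<Rightarrow> real" where \<sigma>: "\<And>s. (\<sigma> has_real_derivative k s) (at s)" "sm k"
    "\<And>s. s \<le> 0 \<Longrightarrow> \<sigma> s = 0" "\<And>s. s \<ge> 1 \<Longrightarrow> \<sigma> s = 1"
    "\<And>s. k s \<ge> 0" "\<And>s. s \<notin> {0<..<1} \<Longrightarrow> k s = 0"
    using smooth_step by metis
  define \<beta> where "\<beta> t = (LINT s:{0<..<t}|lborel. b s)" for t
  have \<beta>c: "continuous_on {..T} \<beta>" unfolding \<beta>_def by (rule continuous_on_indefinite_integral[OF b])
  define D where "D t = indicator {0<..<T} t * (a t - \<beta> t)" for t
  have i\<beta>: "set_integrable lborel {0<..<T} \<beta>"
  proof (rule set_integrable_subset[of _ "{0..T}"])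
    show "set_integrable lborel {0..T} \<beta>"
      by (rule borel_integrable_atLeastAtMost') (rule continuous_on_subset[OF \<beta>c], auto)
  qed auto
  have D: "integrable lborel D"
    using set_integral_diff(1)[OF a i\<beta>] by (simp add: D_def[abs_def] set_integrable_def)
  then have [measurable]: "D \<in> borel_measurable borel" by auto
  have ck: "continuous_on UNIV k" by (rule sm_continuous_on[OF \<sigma>(2)])
  then have [measurable]: "k \<in> borel_measurable borel" by (rule borel_measurable_continuous_onI)
  have kb: "\<exists>M. \<forall>s. k s \<le> M"
  proof -
    have "compact (k ` {0..1})" using continuous_on_subset[OF ck] by (intro compact_continuous_image) auto
    then obtain M where "\<And>s. s \<in> {0..1} \<Longrightarrow> \<bar>k s\<bar> \<le> M"
      by (metis bounded_iff compact_imp_bounded imageI real_norm_def)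
    note M = this
    have "k s \<le> max M 0" for s
    proof (cases "s \<in> {0<..<1}")
      case True
      then have "\<bar>k s\<bar> \<le> M" by (intro M) auto
      then show ?thesis by linarith
    qed (simp add: \<sigma>(6))
    then show ?thesis by blast
  qed
  \<comment> \<open>The derivative of the step moved to s and stretched to width r: a probability
    density on the interval from s to s + r.\<close>
  define ker where "ker r s t = k ((t - s) / r) / r" for r s t
  have [measurable]: "ker r s \<in> borel_measurable borel" for r s unfolding ker_def by measurable
  have [measurable]: "(\<lambda>(s, t). ker r s t) \<in> borel_measurable (borel \<Otimes>\<^sub>M borel)" for r
    unfolding ker_def by measurable
  have ker0: "ker r s t \<ge> 0" if "r > 0" for r s t using that \<sigma>(5) by (simp add: ker_def)
  have ker_out: "ker r s t = 0" if "r > 0" "t \<notin> {s<..<s+r}" for r s t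
    using that \<sigma>(6)[of "(t - s) / r"] by (auto simp: ker_def field_simps)
  have ker1: "(\<integral>\<^sup>+t. ennreal (ker r s t) \<partial>lborel) = 1" if r: "r > 0" for r s
  proof -
    have "(\<integral>\<^sup>+t. ennreal (ker r s t) \<partial>lborel) = (\<integral>\<^sup>+t. ennreal (ker r s t) * indicator {s..s+r} t \<partial>lborel)"
      by (rule nn_integral_cong) (use ker_out[OF r] in \<open>auto simp: indicator_def\<close>)
    also have "\<dots> = ennreal (\<sigma> (((s + r) - s) / r) - \<sigma> ((s - s) / r))"
    proof (rule nn_integral_FTC_Icc)
      fix t
      have "((\<lambda>t. \<sigma> ((t - s) / r)) has_real_derivative k ((t - s) / r) * (1 / r)) (at t)"
        by (rule DERIV_chain2[OF \<sigma>(1)]) (use r in \<open>auto intro!: derivative_eq_intros\<close>)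
      then show "((\<lambda>t. \<sigma> ((t - s) / r)) has_real_derivative ker r s t) (at t)"
        by (simp add: ker_def)
    qed (use r ker0 in auto)
    finally show ?thesis using r \<sigma>(3,4) by simp
  qed
  have iker: "integrable lborel (ker r s)" "(\<integral>t. ker r s t \<partial>lborel) = 1" if r: "r > 0" for r s
    using integral_eq_nn_integral[of "ker r s" lborel] ker1[OF r, of s] ker0[OF r, of s]
    by (auto intro!: integrableI_nonneg)
  have ikerD: "integrable lborel (\<lambda>t. ker r s t * D t)" if r: "r > 0" for r s
  proof -
    obtain M where M: "\<And>s. k s \<le> M" using kb by blast
    show ?thesis
    proof (rule Bochner_Integration.integrable_bound)
      show "integrable lborel (\<lambda>t. M / r * D t)" using D by simp
      show "AE t in lborel. norm (ker r s t * D t) \<le> norm (M / r * D t)"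
      proof (rule AE_I2)
        fix t
        have "\<bar>ker r s t\<bar> \<le> \<bar>M / r\<bar>"
          using ker0[OF r, of s t] M[of "(t - s) / r"] \<sigma>(5)[of "(t - s) / r"] r by (auto simp: ker_def intro!: divide_right_mono)
        then show "norm (ker r s t * D t) \<le> norm (M / r * D t)"
          unfolding real_norm_def abs_mult[of _ "D t"] by (rule mult_right_mono) simp
      qed
    qed measurable
  qed
  define m where "m r s = (\<integral>t. ker r s t * D t \<partial>lborel)" for r s
  \<comment> \<open>The difference of the two steps vanishes before s1, and also after s2 + r
    because both steps have reached 1 there; it is therefore an admissible test function.\<close>
  have meq: "m r s1 = m r s2" if h: "0 < s1" "s1 < s2" "s2 + r < T" "r > 0" for r s1 s2
  proof -
    define \<phi> where "\<phi> t = \<sigma> ((t - s1) / r) + (- 1) * \<sigma> ((t - s2) / r)" for t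
    define \<phi>' where "\<phi>' t = ker r s1 t - ker r s2 t" for t
    have smp: "sm \<phi>" unfolding \<phi>_def
      by (intro sm_add sm_cmult sm_step_compose[of \<sigma> k] \<sigma>(1,2))
    have der: "(\<phi> has_real_derivative \<phi>' t) (at t)" for t
    proof -
      have "((\<lambda>t. \<sigma> ((t - s) / r)) has_real_derivative ker r s t) (at t)" for s
      proof -
        have "((\<lambda>t. \<sigma> ((t - s) / r)) has_real_derivative k ((t - s) / r) * (1 / r)) (at t)"
          by (rule DERIV_chain2[OF \<sigma>(1)]) (use h in \<open>auto intro!: derivative_eq_intros\<close>)
        then show ?thesis by (simp add: ker_def)
      qed
      then show ?thesis unfolding \<phi>_def[abs_def] \<phi>'_def by (auto intro!: derivative_eq_intros)
    qed
    have supp: "\<forall>t. t \<notin> {s1..s2+r} \<longrightarrow> \<phi> t = 0"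
    proof (intro allI impI)
      fix t assume "t \<notin> {s1..s2+r}"
      then consider "t < s1" | "t > s2 + r" by fastforce
      then show "\<phi> t = 0"
      proof cases
        case 1
        then show ?thesis using h \<sigma>(3)[of "(t - s1) / r"] \<sigma>(3)[of "(t - s2) / r"]
          by (simp add: \<phi>_def divide_nonpos_pos)
      next
        case 2
        then show ?thesis using h \<sigma>(4)[of "(t - s1) / r"] \<sigma>(4)[of "(t - s2) / r"]
          by (simp add: \<phi>_def field_simps)
      qed
    qed
    have ex: "\<exists>c d. 0 < c \<and> c < d \<and> d < T \<and> (\<forall>t. t \<notin> {c..d} \<longrightarrow> \<phi> t = 0)"
      by (rule exI[of _ s1], rule exI[of _ "s2 + r"]) (use h supp in \<open>auto simp del: atLeastAtMost_iff\<close>)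
    have w0: "(LINT t:{0<..<T}|lborel. \<phi>' t * a t) + (LINT t:{0<..<T}|lborel. \<phi> t * b t) = 0"
      by (rule weak[OF smp der ex])
    have cont: "continuous_on UNIV \<phi>'" unfolding \<phi>'_def ker_def
      using h by (intro continuous_intros continuous_on_compose2[OF ck]) auto
    have ibp: "(LINT t:{0<..<T}|lborel. \<phi> t * b t) = - (LINT t:{0<..<T}|lborel. \<phi>' t * \<beta> t)"
      unfolding \<beta>_def by (rule integral_by_parts_indefinite[OF b der cont]) (use supp h T in auto)
    have bdd: "\<exists>M. \<forall>t\<in>{0<..<T}. \<bar>\<phi>' t\<bar> \<le> M"
    proof -
      have "compact (\<phi>' ` {0..T})" using continuous_on_subset[OF cont] by (intro compact_continuous_image) auto
      then obtain M where "\<And>s. s \<in> {0..T} \<Longrightarrow> \<bar>\<phi>' s\<bar> \<le> M"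
        by (metis bounded_iff compact_imp_bounded imageI real_norm_def)
      then show ?thesis by (intro exI[of _ M]) auto
    qed
    have [measurable]: "\<phi>' \<in> borel_measurable borel" using cont by (rule borel_measurable_continuous_onI)
    have prod_int: "set_integrable lborel {0<..<T} (\<lambda>t. \<phi>' t * f t)" if f: "set_integrable lborel {0<..<T} f" for f
    proof -
      obtain M where M: "\<And>t. t \<in> {0<..<T} \<Longrightarrow> \<bar>\<phi>' t\<bar> \<le> M" using bdd by blast
      have fm: "(\<lambda>t. indicator {0<..<T} t * f t) \<in> borel_measurable lborel"
        using f by (auto simp: set_integrable_def)
      show ?thesis unfolding set_integrable_def
      proof (rule Bochner_Integration.integrable_bound)
        show "integrable lborel (\<lambda>t. M * (indicator {0<..<T} t *\<^sub>R f t))"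
          using f unfolding set_integrable_def by (rule integrable_mult_right)
        have "(\<lambda>t. indicator {0<..<T} t *\<^sub>R (\<phi>' t * f t)) = (\<lambda>t. \<phi>' t * (indicator {0<..<T} t * f t))"
          by (auto simp: fun_eq_iff)
        then show "(\<lambda>t. indicator {0<..<T} t *\<^sub>R (\<phi>' t * f t)) \<in> borel_measurable lborel"
          using fm by simp
        show "AE t in lborel. norm (indicator {0<..<T} t *\<^sub>R (\<phi>' t * f t)) \<le> norm (M * (indicator {0<..<T} t *\<^sub>R f t))"
          using M by (intro AE_I2) (force simp: indicator_def abs_mult intro!: mult_right_mono)
      qed
    qed
    have "(\<integral>t. \<phi>' t * D t \<partial>lborel) = (LINT t:{0<..<T}|lborel. \<phi>' t * a t - \<phi>' t * \<beta> t)"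
      unfolding set_lebesgue_integral_def
      by (rule Bochner_Integration.integral_cong) (auto simp: D_def algebra_simps)
    also have "\<dots> = (LINT t:{0<..<T}|lborel. \<phi>' t * a t) - (LINT t:{0<..<T}|lborel. \<phi>' t * \<beta> t)"
      by (rule set_integral_diff(2)) (rule prod_int a i\<beta>)+
    finally have "(\<integral>t. \<phi>' t * D t \<partial>lborel) = 0" using w0 ibp by simp
    then show ?thesis
      using Bochner_Integration.integral_diff[OF ikerD[of r s1] ikerD[of r s2]] h
      by (simp add: \<phi>'_def m_def left_diff_distrib)
  qed
  have m_close: "\<bar>m r s - x\<bar> \<le> \<eta>" if "r > 0" "\<And>t. t \<in> {s<..<s+r} \<Longrightarrow> \<bar>D t - x\<bar> \<le> \<eta>" for r s x \<eta>
  proof -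
    have "m r s - x = (\<integral>t. ker r s t * D t - ker r s t * x \<partial>lborel)"
      using iker[OF that(1), of s] ikerD[OF that(1), of s] by (simp add: m_def)
    also have "\<bar>\<dots>\<bar> \<le> (\<integral>t. ker r s t * \<eta> \<partial>lborel)"
    proof (rule integral_abs_bound_integral)
      fix t
      show "\<bar>ker r s t * D t - ker r s t * x\<bar> \<le> ker r s t * \<eta>"
      proof (cases "t \<in> {s<..<s+r}")
        case True
        have "\<bar>ker r s t * D t - ker r s t * x\<bar> = ker r s t * \<bar>D t - x\<bar>"
          using ker0[OF that(1), of s t] by (simp add: abs_mult flip: right_diff_distrib)
        then show ?thesis using that(2)[OF True] ker0[OF that(1), of s t] by (simp add: mult_left_mono)
      qed (simp add: ker_out[OF that(1)])
    qed (use iker[OF that(1), of s] ikerD[OF that(1), of s] in auto)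
    also have "\<dots> = \<eta>" using iker[OF that(1), of s] by simp
    finally show ?thesis .
  qed
  have "(\<beta> \<longlongrightarrow> \<beta> 0) (at 0 within {..T})"
    using \<beta>c T by (auto simp: continuous_on_def)
  then have "(\<beta> \<longlongrightarrow> \<beta> 0) (at 0 within {0..T})"
    by (rule tendsto_within_subset) auto
  then have "(\<beta> \<longlongrightarrow> \<beta> 0) (at_right 0)"
    using T by (simp add: at_within_Icc_at_right)
  moreover have "\<beta> 0 = 0" by (simp add: \<beta>_def set_lebesgue_integral_def)
  ultimately have lim': "((\<lambda>t. a t - \<beta> t) \<longlongrightarrow> a0) (at_right 0)"
    using tendsto_diff[OF lim, of \<beta> 0] by simp
  \<comment> \<open>Three comparisons: \<open>m r s0\<close> is close to a0 since s0 + r is close to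
    0, \<open>m r s\<close> is equal to \<open>m r s0\<close>, and D s is close to
    \<open>m r s\<close> in L1 by translation continuity. As \<eta> is arbitrary, D = a0
    follows.\<close>
  have key: "(\<integral>\<^sup>+s. ennreal \<bar>D s - a0\<bar> * indicator {p<..<q} s \<partial>lborel) \<le> ennreal (\<eta> * (1 + T))"
    if pq: "0 < p" "p < q" "q < T" and \<eta>: "\<eta> > 0" for p q \<eta>
  proof -
    have "\<forall>\<^sub>F t in at_right 0. dist (a t - \<beta> t) a0 < \<eta>" using lim' \<eta> by (rule tendstoD)
    then obtain d1 where d1: "d1 > 0" "\<And>t. 0 < t \<Longrightarrow> t < d1 \<Longrightarrow> \<bar>a t - \<beta> t - a0\<bar> < \<eta>"
      unfolding eventually_at_right_field dist_real_def by blast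
    obtain d2 where d2: "d2 > 0"
      "\<And>h. norm h < d2 \<Longrightarrow> (\<integral>\<^sup>+x. ennreal \<bar>D (x + h) - D x\<bar> \<partial>lborel) \<le> ennreal \<eta>"
      using L1_translation_continuous[OF D \<eta>] by blast
    have "0 < min (min (d1 / 2) d2) (T - q)" "0 < min p (d1 / 2)" using d1(1) d2(1) pq by auto
    then obtain r s0 where "0 < r" "r < min (min (d1 / 2) d2) (T - q)" and "0 < s0" "s0 < min p (d1 / 2)"
      by (meson dense)
    then have r: "r > 0" "r < d1 / 2" "r < d2" "q + r < T" and s0: "0 < s0" "s0 < p" "s0 < d1 / 2"
      by auto
    have m0: "\<bar>m r s0 - a0\<bar> \<le> \<eta>"
    proof (rule m_close[OF r(1)])
      fix t assume t: "t \<in> {s0<..<s0 + r}"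
      then have "t < T" "0 < t" "t < d1" using r s0 pq by auto
      then show "\<bar>D t - a0\<bar> \<le> \<eta>" using d1(2)[of t] by (simp add: D_def)
    qed
    have "(\<integral>\<^sup>+s. ennreal \<bar>D s - a0\<bar> * indicator {p<..<q} s \<partial>lborel)
       \<le> (\<integral>\<^sup>+s. ennreal \<eta> * indicator {0<..<T} s + (\<integral>\<^sup>+t. ennreal (ker r s t) * ennreal \<bar>D t - D s\<bar> \<partial>lborel) \<partial>lborel)"
    proof (rule nn_integral_mono)
      fix s :: real
      show "ennreal \<bar>D s - a0\<bar> * indicator {p<..<q} s
        \<le> ennreal \<eta> * indicator {0<..<T} s + (\<integral>\<^sup>+t. ennreal (ker r s t) * ennreal \<bar>D t - D s\<bar> \<partial>lborel)"
      proof (cases "s \<in> {p<..<q}")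
        case True
        then have ms: "m r s0 = m r s" using s0 r by (intro meq) auto
        have "m r s - D s = (\<integral>t. ker r s t * D t - ker r s t * D s \<partial>lborel)"
          using iker[OF r(1), of s] ikerD[OF r(1), of s] by (simp add: m_def)
        then have "ennreal \<bar>m r s - D s\<bar> \<le> (\<integral>\<^sup>+t. norm (ker r s t * D t - ker r s t * D s) \<partial>lborel)"
          using integral_norm_bound_ennreal[of lborel "\<lambda>t. ker r s t * D t - ker r s t * D s"]
            iker[OF r(1), of s] ikerD[OF r(1), of s] by simp
        also have "\<dots> = (\<integral>\<^sup>+t. ennreal (ker r s t) * ennreal \<bar>D t - D s\<bar> \<partial>lborel)"
          using ker0[OF r(1), of s]
          by (intro nn_integral_cong) (simp add: abs_mult ennreal_mult flip: right_diff_distrib)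
        finally have "ennreal \<bar>m r s - D s\<bar> \<le> \<dots>" .
        moreover have "ennreal \<bar>D s - a0\<bar> \<le> ennreal \<eta> + ennreal \<bar>m r s - D s\<bar>"
          using m0 \<eta> unfolding ms by (simp flip: ennreal_plus)
        ultimately have "ennreal \<bar>D s - a0\<bar> \<le> ennreal \<eta> + (\<integral>\<^sup>+t. ennreal (ker r s t) * ennreal \<bar>D t - D s\<bar> \<partial>lborel)"
          by (meson add_left_mono order_trans)
        then show ?thesis using True pq by simp
      qed simp
    qed
    also have "\<dots> = (\<integral>\<^sup>+s. ennreal \<eta> * indicator {0<..<T} s \<partial>lborel)
       + (\<integral>\<^sup>+s. (\<integral>\<^sup>+t. ennreal (ker r s t) * ennreal \<bar>D t - D s\<bar> \<partial>lborel) \<partial>lborel)"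
      by (rule nn_integral_add) measurable
    also have "(\<integral>\<^sup>+s. ennreal \<eta> * indicator {0<..<T} s \<partial>lborel) = ennreal (\<eta> * T)"
      using T \<eta> by (subst nn_integral_cmult_indicator) (auto simp: ennreal_mult[symmetric])
    also have "(\<integral>\<^sup>+s. (\<integral>\<^sup>+t. ennreal (ker r s t) * ennreal \<bar>D t - D s\<bar> \<partial>lborel) \<partial>lborel)
      = (\<integral>\<^sup>+s. (\<integral>\<^sup>+h. ennreal (ker r 0 h) * ennreal \<bar>D (s + h) - D s\<bar> \<partial>lborel) \<partial>lborel)"
    proof (rule nn_integral_cong)
      fix s :: real
      show "(\<integral>\<^sup>+t. ennreal (ker r s t) * ennreal \<bar>D t - D s\<bar> \<partial>lborel)
        = (\<integral>\<^sup>+h. ennreal (ker r 0 h) * ennreal \<bar>D (s + h) - D s\<bar> \<partial>lborel)"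
        using nn_integral_lborel_shift[of "\<lambda>t. ennreal (ker r s t) * ennreal \<bar>D t - D s\<bar>" s]
        by (simp add: ker_def add.commute)
    qed
    also have "\<dots> = (\<integral>\<^sup>+h. (\<integral>\<^sup>+s. ennreal (ker r 0 h) * ennreal \<bar>D (s + h) - D s\<bar> \<partial>lborel) \<partial>lborel)"
      by (rule lborel_pair.Fubini'[symmetric]) measurable
    also have "\<dots> = (\<integral>\<^sup>+h. ennreal (ker r 0 h) * (\<integral>\<^sup>+s. ennreal \<bar>D (s + h) - D s\<bar> \<partial>lborel) \<partial>lborel)"
      by (simp add: nn_integral_cmult)
    also have "\<dots> \<le> (\<integral>\<^sup>+h. ennreal (ker r 0 h) * ennreal \<eta> \<partial>lborel)"
    proof (rule nn_integral_mono)
      fix h :: real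
      show "ennreal (ker r 0 h) * (\<integral>\<^sup>+s. ennreal \<bar>D (s + h) - D s\<bar> \<partial>lborel) \<le> ennreal (ker r 0 h) * ennreal \<eta>"
      proof (cases "h \<in> {0<..<0+r}")
        case True
        then show ?thesis using r by (intro mult_left_mono d2) auto
      qed (simp add: ker_out[OF r(1)])
    qed
    also have "\<dots> = ennreal \<eta>" using ker1[OF r(1)] by (simp add: nn_integral_multc)
    finally show ?thesis using T \<eta> by (simp add: algebra_simps flip: ennreal_plus)
  qed
  have zero: "AE s in lborel. s \<in> {p<..<q} \<longrightarrow> D s = a0" if pq: "0 < p" "p < q" "q < T" for p q
  proof -
    have "(\<integral>\<^sup>+s. ennreal \<bar>D s - a0\<bar> * indicator {p<..<q} s \<partial>lborel) \<le> 0"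
    proof (rule ennreal_le_epsilon)
      fix e :: real assume "e > 0"
      then show "(\<integral>\<^sup>+s. ennreal \<bar>D s - a0\<bar> * indicator {p<..<q} s \<partial>lborel) \<le> 0 + ennreal e"
        using key[OF pq, of "e / (1 + T)"] T by simp
    qed
    then have "(\<integral>\<^sup>+s. ennreal \<bar>D s - a0\<bar> * indicator {p<..<q} s \<partial>lborel) = 0" by simp
    then have "AE s in lborel. ennreal \<bar>D s - a0\<bar> * indicator {p<..<q} s = 0"
      by (subst (asm) nn_integral_0_iff_AE) auto
    then show ?thesis by eventually_elim (auto simp: indicator_def split: if_splits)
  qed
  \<comment> \<open>The intervals exhaust (0, T). The offset 3 keeps all of them nonempty, as T / 3
    < T - T / 3.\<close>
  have "AE s in lborel. \<forall>n::nat. s \<in> {T / (real n + 3)<..<T - T / (real n + 3)} \<longrightarrow> D s = a0"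
  proof (subst AE_all_countable, intro allI zero)
    fix n :: nat
    have "T / (real n + 3) \<le> T / 3" by (rule divide_left_mono) (use T in auto)
    moreover have "0 < T / (real n + 3)" using T by simp
    ultimately show "0 < T / (real n + 3)" "T / (real n + 3) < T - T / (real n + 3)" "T - T / (real n + 3) < T"
      using T by linarith+
  qed
  then show ?thesis
  proof eventually_elim
    case (elim s)
    show ?case
    proof
      assume s: "s \<in> {0<..<T}"
      obtain n :: nat where n: "real n > T / min s (T - s)" using reals_Archimedean2 by blast
      have m: "min s (T - s) > 0" using s by auto
      then have "T < real n * min s (T - s)" using n by (simp only: pos_divide_less_eq)
      also have "\<dots> \<le> (real n + 3) * min s (T - s)" using m by (intro mult_right_mono) auto
      finally have "T < min s (T - s) * (real n + 3)" by (simp only: mult.commute)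
      moreover have "0 < real n + 3" by simp
      ultimately have "T / (real n + 3) < min s (T - s)" by (simp only: pos_divide_less_eq)
      then have "D s = a0" using elim s by (auto dest: spec[of _ n])
      then show "a s = a0 + (LINT t:{0<..<s}|lborel. b t)" using s by (simp add: D_def \<beta>_def)
    qed
  qed
qed

section \<open>Chain rule and convolution on the torus\<close>

text \<open>U is merely absolutely continuous. On each cell of a fine partition the gradient is
  frozen at the left end; by uniform continuity the two resulting errors are \<eta> times the
  integral of \<open>norm (g x)\<close> over the cell, and they sum to a multiple of \<eta>.
  Convexity of H keeps the segments between values of U inside the domain of
  \<open>e\<close>.\<close>

lemma chain_rule_indefinite_integral:
  fixes g :: "real \<Rightarrow> 'v::euclidean_space" and e :: "'v \<Rightarrow> real" and grad :: "'v \<Rightarrow> 'v"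
  assumes g: "integrable lborel g"
    and U: "\<And>t. U t = U0 + (\<integral>x. indicator {..<t} x *\<^sub>R g x \<partial>lborel)"
    and H: "compact H" "convex H" "\<And>t. U t \<in> H"
    and der: "\<And>v. v \<in> H \<Longrightarrow> (e has_derivative (\<lambda>z. grad v \<bullet> z)) (at v within H)"
    and cont: "continuous_on H grad"
    and st: "s0 \<le> t0"
  shows "integrable lborel (\<lambda>x. grad (U x) \<bullet> g x)"
    and "e (U t0) - e (U s0) = (\<integral>x. indicator {s0..<t0} x * (grad (U x) \<bullet> g x) \<partial>lborel)"
proof -
  have [measurable]: "g \<in> borel_measurable borel" using g by auto
  have cU: "continuous_on UNIV U"
  proof -
    have "continuous_on UNIV (\<lambda>t. \<integral>x. indicator {..<t} x *\<^sub>R g x \<partial>lborel)"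
      by (rule continuous_on_integral_lessThan[OF g])
    then show ?thesis unfolding U[abs_def] by (intro continuous_intros)
  qed
  have cgU: "continuous_on UNIV (\<lambda>x. grad (U x))"
    by (rule continuous_on_compose2[OF cont cU]) (use H in auto)
  then have [measurable]: "(\<lambda>x. grad (U x)) \<in> borel_measurable borel"
    by (rule borel_measurable_continuous_onI)
  obtain M where M: "\<And>x. norm (grad (U x)) \<le> M"
    using compact_imp_bounded[OF compact_continuous_image[OF cont H(1)]] H(3)
    unfolding bounded_iff by blast
  show int: "integrable lborel (\<lambda>x. grad (U x) \<bullet> g x)"
  proof (rule Bochner_Integration.integrable_bound)
    show "integrable lborel (\<lambda>x. M * norm (g x))" using g by auto
    show "AE x in lborel. norm (grad (U x) \<bullet> g x) \<le> norm (M * norm (g x))"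
    proof (rule AE_I2)
      fix x
      have "norm (grad (U x) \<bullet> g x) \<le> norm (grad (U x)) * norm (g x)" by (simp add: Cauchy_Schwarz_ineq2)
      also have "\<dots> \<le> M * norm (g x)" using M by (intro mult_right_mono) auto
      finally show "norm (grad (U x) \<bullet> g x) \<le> norm (M * norm (g x))" by simp
    qed
  qed measurable
  have iU: "integrable lborel (\<lambda>x. indicator A x *\<^sub>R g x)" "integrable lborel (\<lambda>x. indicator A x * norm (g x))"
    "integrable lborel (\<lambda>x. indicator A x * (grad (U x) \<bullet> g x))" if "A \<in> sets borel" for A
    using integrable_mult_indicator[of A lborel g] integrable_mult_indicator[of A lborel "\<lambda>x. norm (g x)"]
      integrable_mult_indicator[of A lborel "\<lambda>x. grad (U x) \<bullet> g x"] that g int by auto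
  define B where "B s t = (\<integral>x. indicator {s..<t} x * norm (g x) \<partial>lborel)" for s t
  have B_add: "B s t + B t r = B s r" if "s \<le> t" "t \<le> r" for s t r
  proof -
    have "B s t + B t r = (\<integral>x. indicator {s..<t} x * norm (g x) + indicator {t..<r} x * norm (g x) \<partial>lborel)"
      unfolding B_def by (rule Bochner_Integration.integral_add[symmetric]) (auto intro: iU)
    also have "\<dots> = B s r" unfolding B_def
      by (rule Bochner_Integration.integral_cong) (use that in \<open>auto simp: indicator_def\<close>)
    finally show ?thesis .
  qed
  have Udiff: "U t - U s = (\<integral>x. indicator {s..<t} x *\<^sub>R g x \<partial>lborel)" if "s \<le> t" for s t
  proof -
    have "U t - U s = (\<integral>x. indicator {..<t} x *\<^sub>R g x - indicator {..<s} x *\<^sub>R g x \<partial>lborel)"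
      unfolding U by (subst Bochner_Integration.integral_diff) (auto intro: iU)
    also have "\<dots> = (\<integral>x. indicator {s..<t} x *\<^sub>R g x \<partial>lborel)"
      by (rule Bochner_Integration.integral_cong) (use that in \<open>auto simp: indicator_def\<close>)
    finally show ?thesis .
  qed
  have Ubound: "norm (U t - U s) \<le> B s t" if "s \<le> t" for s t
  proof -
    have "norm (U t - U s) \<le> (\<integral>x. norm (indicator {s..<t} x *\<^sub>R g x) \<partial>lborel)"
      unfolding Udiff[OF that] by (rule integral_norm_bound)
    then show ?thesis by (simp add: B_def)
  qed
  define J where "J s t = (\<integral>x. indicator {s..<t} x * (grad (U x) \<bullet> g x) \<partial>lborel)" for s t
  have J_add: "J s t + J t r = J s r" if "s \<le> t" "t \<le> r" for s t r
  proof -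
    have "J s t + J t r = (\<integral>x. indicator {s..<t} x * (grad (U x) \<bullet> g x) + indicator {t..<r} x * (grad (U x) \<bullet> g x) \<partial>lborel)"
      unfolding J_def by (rule Bochner_Integration.integral_add[symmetric]) (auto intro: iU)
    also have "\<dots> = J s r" unfolding J_def
      by (rule Bochner_Integration.integral_cong) (use that in \<open>auto simp: indicator_def\<close>)
    finally show ?thesis .
  qed
  have small: "\<bar>e (U t0) - e (U s0) - J s0 t0\<bar> \<le> 2 * \<eta> * B s0 t0" if \<eta>: "\<eta> > 0" for \<eta>
  proof -
    have "uniformly_continuous_on H grad" by (rule compact_uniformly_continuous[OF cont H(1)])
    then obtain d' where d': "d' > 0" "\<And>v w. v \<in> H \<Longrightarrow> w \<in> H \<Longrightarrow> dist w v < d' \<Longrightarrow> dist (grad w) (grad v) < \<eta>"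
      unfolding uniformly_continuous_on_def using \<eta> by metis
    have "uniformly_continuous_on {s0..t0} U"
      by (intro compact_uniformly_continuous continuous_on_subset[OF cU]) auto
    then obtain d where d: "d > 0"
      "\<And>s t. s \<in> {s0..t0} \<Longrightarrow> t \<in> {s0..t0} \<Longrightarrow> dist t s < d \<Longrightarrow> dist (U t) (U s) < d'"
      unfolding uniformly_continuous_on_def using d'(1) by metis
    have step: "\<bar>e (U t) - e (U s) - J s t\<bar> \<le> 2 * \<eta> * B s t"
      if h: "s0 \<le> s" "s \<le> t" "t \<le> t0" "t - s < d" for s t
    proof -
      have seg: "closed_segment (U s) (U t) \<subseteq> H" using H by (simp add: closed_segment_subset)
      have Ut: "dist (U t) (U s) < d'" by (rule d(2)) (use h in \<open>auto simp: dist_real_def\<close>)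
      \<comment> \<open>Subtracting the linear part at U s leaves a function whose derivative along
        the segment is at most \<eta>.\<close>
      have "norm ((e (U t) - grad (U s) \<bullet> U t) - (e (U s) - grad (U s) \<bullet> U s)) \<le> \<eta> * norm (U t - U s)"
      proof (rule differentiable_bound[of "closed_segment (U s) (U t)" "\<lambda>v. e v - grad (U s) \<bullet> v" "\<lambda>v z. (grad v - grad (U s)) \<bullet> z"])
        fix v assume v: "v \<in> closed_segment (U s) (U t)"
        have "(e has_derivative (\<lambda>z. grad v \<bullet> z)) (at v within closed_segment (U s) (U t))"
          using has_derivative_subset[OF der seg] seg v by blast
        then show "((\<lambda>v. e v - grad (U s) \<bullet> v) has_derivative (\<lambda>z. (grad v - grad (U s)) \<bullet> z)) (at v within closed_segment (U s) (U t))"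
          unfolding inner_diff_left
          by (intro has_derivative_diff bounded_linear_imp_has_derivative bounded_linear_inner_right)
        have "dist v (U s) \<le> dist (U t) (U s)"
          using v by (metis dist_commute dist_in_closed_segment(1))
        then have "dist (grad v) (grad (U s)) < \<eta>" using v seg Ut H(3) by (intro d') auto
        moreover have "norm ((grad v - grad (U s)) \<bullet> z) \<le> norm (grad v - grad (U s)) * norm z" for z
          by (simp add: Cauchy_Schwarz_ineq2)
        ultimately show "onorm (\<lambda>z. (grad v - grad (U s)) \<bullet> z) \<le> \<eta>"
          by (intro onorm_le) (smt (verit) dist_norm mult_right_mono norm_ge_zero)
      qed auto
      also have "\<dots> \<le> \<eta> * B s t" using Ubound[OF h(2)] \<eta> by simp
      finally have 1: "\<bar>e (U t) - e (U s) - grad (U s) \<bullet> (U t - U s)\<bar> \<le> \<eta> * B s t"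
        by (simp add: inner_diff_right algebra_simps)
      have "grad (U s) \<bullet> (U t - U s) = (\<integral>x. indicator {s..<t} x * (grad (U s) \<bullet> g x) \<partial>lborel)"
        unfolding Udiff[OF h(2)] using iU(1)[of "{s..<t}"]
        by (subst integral_inner_right[symmetric]) auto
      moreover have "integrable lborel (\<lambda>x. indicator {s..<t} x * (grad (U s) \<bullet> g x))"
        using integrable_inner_right[of "grad (U s)" lborel "\<lambda>x. indicator {s..<t} x *\<^sub>R g x"] iU(1)[of "{s..<t}"] by auto
      ultimately have "grad (U s) \<bullet> (U t - U s) - J s t
         = (\<integral>x. indicator {s..<t} x * (grad (U s) \<bullet> g x) - indicator {s..<t} x * (grad (U x) \<bullet> g x) \<partial>lborel)"
        unfolding J_def using iU(3)[of "{s..<t}"] by simp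
      also have "\<bar>\<dots>\<bar> \<le> (\<integral>x. \<eta> * (indicator {s..<t} x * norm (g x)) \<partial>lborel)"
      proof (rule integral_abs_bound_integral)
        fix x
        show "\<bar>indicator {s..<t} x * (grad (U s) \<bullet> g x) - indicator {s..<t} x * (grad (U x) \<bullet> g x)\<bar>
          \<le> \<eta> * (indicator {s..<t} x * norm (g x))"
        proof (cases "x \<in> {s..<t}")
          case True
          have "dist (U s) (U x) < d'" by (rule d(2)) (use True h in \<open>auto simp: dist_real_def\<close>)
          then have "dist (grad (U s)) (grad (U x)) < \<eta>" using H(3) by (intro d') auto
          then have "norm (grad (U s) - grad (U x)) * norm (g x) \<le> \<eta> * norm (g x)"
            by (intro mult_right_mono) (auto simp: dist_norm)
          then show ?thesis using True Cauchy_Schwarz_ineq2[of "grad (U s) - grad (U x)" "g x"]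
            by (simp add: inner_diff_left)
        qed simp
      next
        show "integrable lborel (\<lambda>x. indicator {s..<t} x * (grad (U s) \<bullet> g x) - indicator {s..<t} x * (grad (U x) \<bullet> g x))"
          using integrable_inner_right[of "grad (U s)" lborel "\<lambda>x. indicator {s..<t} x *\<^sub>R g x"] iU[of "{s..<t}"] by auto
      qed (use iU in auto)
      also have "\<dots> = \<eta> * B s t" by (simp add: B_def)
      finally show ?thesis using 1 by linarith
    qed
    obtain n :: nat where n: "(t0 - s0) / d < real n" using reals_Archimedean2 by blast
    have n0: "n > 0" using n st d(1) by (metis divide_nonneg_pos diff_ge_0_iff_ge gr0I not_less of_nat_0)
    define p where "p k = s0 + real k * ((t0 - s0) / n)" for k :: nat
    have p: "s0 \<le> p k" "p k \<le> p (Suc k)" "p (Suc k) - p k < d" for k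
    proof -
      have w: "0 \<le> (t0 - s0) / n" "(t0 - s0) / n < d"
        using st n n0 d(1) by (auto simp: pos_divide_less_eq mult.commute)
      have "p (Suc k) = p k + (t0 - s0) / n" by (simp add: p_def distrib_right add_divide_distrib)
      then show "p k \<le> p (Suc k)" "p (Suc k) - p k < d" using w by linarith+
      have "0 \<le> real k * ((t0 - s0) / n)" using w(1) by (intro mult_nonneg_nonneg) auto
      then show "s0 \<le> p k" by (simp only: p_def)
    qed
    have p_le: "p k \<le> t0" if "k \<le> n" for k
    proof -
      have "real k * (t0 - s0) \<le> n * (t0 - s0)" using that st by (intro mult_right_mono) auto
      then show ?thesis using n0 by (simp add: p_def field_simps)
    qed
    have "\<bar>e (U (p k)) - e (U s0) - J s0 (p k)\<bar> \<le> 2 * \<eta> * B s0 (p k)" if "k \<le> n" for k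
      using that
    proof (induction k)
      case 0
      then show ?case by (simp add: p_def J_def B_def)
    next
      case (Suc k)
      have "\<bar>e (U (p (Suc k))) - e (U (p k)) - J (p k) (p (Suc k))\<bar> \<le> 2 * \<eta> * B (p k) (p (Suc k))"
        by (rule step) (use p p_le Suc.prems in auto)
      moreover have "J s0 (p k) + J (p k) (p (Suc k)) = J s0 (p (Suc k))" by (intro J_add p)
      moreover have "2 * \<eta> * B s0 (p k) + 2 * \<eta> * B (p k) (p (Suc k)) = 2 * \<eta> * B s0 (p (Suc k))"
        using B_add[OF p(1) p(2)[of k]] by (simp flip: distrib_left)
      moreover have "\<bar>e (U (p k)) - e (U s0) - J s0 (p k)\<bar> \<le> 2 * \<eta> * B s0 (p k)"
        using Suc by simp
      ultimately show ?case by linarith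
    qed
    from this[of n] show ?thesis using n0 by (simp add: p_def)
  qed
  have "\<bar>e (U t0) - e (U s0) - J s0 t0\<bar> \<le> 0"
  proof (rule field_le_epsilon)
    fix r :: real assume r: "r > 0"
    have B0: "B s0 t0 \<ge> 0" unfolding B_def by (rule Bochner_Integration.integral_nonneg) auto
    have "\<bar>e (U t0) - e (U s0) - J s0 t0\<bar> \<le> 2 * (r / (2 * (B s0 t0 + 1))) * B s0 t0"
      by (rule small) (use r B0 in auto)
    also have "\<dots> \<le> r" using r B0 by (simp add: field_simps)
    finally show "\<bar>e (U t0) - e (U s0) - J s0 t0\<bar> \<le> 0 + r" by simp
  qed
  then show "e (U t0) - e (U s0) = (\<integral>x. indicator {s0..<t0} x * (grad (U x) \<bullet> g x) \<partial>lborel)"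
    by (simp add: J_def)
qed

section \<open>Convolution with periodic kernels\<close>

definition cv :: "(real^'d::finite \<Rightarrow> real) \<Rightarrow> (real^'d \<Rightarrow> real) \<Rightarrow> real^'d \<Rightarrow> real" where
  "cv k f x = (\<integral>y. k (x - y) * f y \<partial>torus)"

locale periodic_kernel =
  fixes k :: "real^'d::finite \<Rightarrow> real"
  assumes cont_k: "continuous_on UNIV k" and per_k: "periodic_x k"
begin

lemma meas_k [measurable]: "k \<in> borel_measurable borel"
  by (rule borel_measurable_continuous_onI[OF cont_k])

lemma cv_integrable:
  assumes f: "integrable torus f"
  shows "integrable torus (\<lambda>y. k (x - y) * f y)"
proof -
  obtain M where M: "\<And>x. \<bar>k x\<bar> \<le> M" using periodic_continuous_bounded[OF cont_k per_k] by metis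
  have [measurable]: "f \<in> borel_measurable borel" using f by auto
  show ?thesis
  proof (rule Bochner_Integration.integrable_bound)
    show "integrable torus (\<lambda>y. M * f y)" using f by simp
    show "AE y in torus. norm (k (x - y) * f y) \<le> norm (M * f y)"
    proof (rule AE_I2)
      fix y
      have "\<bar>k (x - y)\<bar> \<le> \<bar>M\<bar>" using M[of "x - y"] by linarith
      then show "norm (k (x - y) * f y) \<le> norm (M * f y)" by (simp add: abs_mult mult_right_mono)
    qed
  qed simp
qed

lemma cv_bound:
  assumes f: "integrable torus f" and M: "\<And>x. \<bar>k x\<bar> \<le> M"
  shows "\<bar>cv k f x\<bar> \<le> M * (\<integral>y. \<bar>f y\<bar> \<partial>torus)"
proof -
  have "\<bar>cv k f x\<bar> \<le> (\<integral>y. M * \<bar>f y\<bar> \<partial>torus)"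
    unfolding cv_def
    by (rule integral_abs_bound_integral)
      (use f M in \<open>auto simp: cv_integrable abs_mult intro!: mult_right_mono\<close>)
  then show ?thesis by simp
qed

lemma cv_continuous:
  assumes f: "integrable torus f"
  shows "continuous_on UNIV (cv k f)"
proof -
  obtain M where M: "\<And>x. \<bar>k x\<bar> \<le> M" using periodic_continuous_bounded[OF cont_k per_k] by metis
  have [measurable]: "f \<in> borel_measurable borel" using f by auto
  show ?thesis
    unfolding continuous_on_sequentially comp_def cv_def
  proof (intro ballI allI impI)
    fix x and xs :: "nat \<Rightarrow> real^'d" assume xs: "(\<forall>n. xs n \<in> UNIV) \<and> xs \<longlonglongrightarrow> x"
    show "(\<lambda>n. \<integral>y. k (xs n - y) * f y \<partial>torus) \<longlonglongrightarrow> (\<integral>y. k (x - y) * f y \<partial>torus)"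
    proof (rule integral_dominated_convergence[where w="\<lambda>y. M * \<bar>f y\<bar>"])
      show "AE y in torus. (\<lambda>n. k (xs n - y) * f y) \<longlonglongrightarrow> k (x - y) * f y"
        using xs cont_k by (intro AE_I2 tendsto_mult tendsto_const
            isCont_tendsto_compose[of _ k] tendsto_diff) (auto simp: continuous_on_eq_continuous_at)
    qed (use f M in \<open>auto simp: abs_mult intro!: mult_right_mono\<close>)
  qed
qed

lemma cv_periodic: "periodic_x (cv k f)"
proof -
  have "k (x + axis i 1 - y) = k (x - y)" for x y i
    using per_k[unfolded periodic_x_def, rule_format, of "x - y" i] by (simp add: algebra_simps)
  then show ?thesis by (simp add: periodic_x_def cv_def)
qed

lemma cv_add:
  "integrable torus f \<Longrightarrow> integrable torus g \<Longrightarrow> cv k (\<lambda>y. f y + g y) x = cv k f x + cv k g x"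
  by (simp add: cv_def distrib_left cv_integrable)

lemma cv_diff:
  "integrable torus f \<Longrightarrow> integrable torus g \<Longrightarrow> cv k (\<lambda>y. f y - g y) x = cv k f x - cv k g x"
  by (simp add: cv_def right_diff_distrib cv_integrable)

lemma cv_mult: "cv k (\<lambda>y. c * f y) x = c * cv k f x"
  by (simp add: cv_def mult.left_commute)

end

lemma periodic_kernel_sm: "sm k \<Longrightarrow> periodic_x k \<Longrightarrow> periodic_kernel k"
  by (simp add: periodic_kernel_def sm_continuous_on)

text \<open>The second derivative of a smooth periodic kernel is bounded, so the Taylor remainder is
  quadratic in h uniformly in the base point. It can then be integrated against an f that is only
  integrable.\<close>

lemma cv_line_derivative:
  fixes k :: "real^'d::finite \<Rightarrow> real"
  assumes k: "sm k" "periodic_x k" and f: "integrable torus f"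
  shows "((\<lambda>s. cv k f (x + s *\<^sub>R axis j 1)) has_real_derivative cv (pd j k) f (x + s *\<^sub>R axis j 1)) (at s)"
proof -
  let ?e = "axis j 1 :: real^'d"
  interpret k0: periodic_kernel k by (rule periodic_kernel_sm[OF k])
  interpret k1: periodic_kernel "pd j k" by (rule periodic_kernel_sm[OF sm_pd[OF k(1)] periodic_pd[OF k]])
  have sm2: "sm (pd j (pd j k))" "periodic_x (pd j (pd j k))"
    using k by (simp_all add: sm_pd periodic_pd)
  obtain L where L: "\<And>x. \<bar>pd j (pd j k) x\<bar> \<le> L"
    using periodic_continuous_bounded[OF sm_continuous_on[OF sm2(1)] sm2(2)] by metis
  have taylor: "\<bar>k (z + h *\<^sub>R ?e) - k z - h * pd j k z\<bar> \<le> L * h\<^sup>2" for z h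
  proof -
    have b1: "\<bar>pd j k (z + t *\<^sub>R ?e) - pd j k z\<bar> \<le> L * \<bar>t\<bar>" for t
    proof -
      have "norm (pd j k (z + t *\<^sub>R ?e) - pd j k (z + 0 *\<^sub>R ?e)) \<le> L * norm (t - 0)"
        by (rule field_differentiable_bound[of UNIV "\<lambda>t. pd j k (z + t *\<^sub>R ?e)" "\<lambda>t. pd j (pd j k) (z + t *\<^sub>R ?e)"])
          (use sm_pd_line[OF sm_pd[OF k(1)]] L in auto)
      then show ?thesis by simp
    qed
    have "norm ((k (z + h *\<^sub>R ?e) - h * pd j k z) - (k (z + 0 *\<^sub>R ?e) - 0 * pd j k z)) \<le> (L * \<bar>h\<bar>) * norm (h - 0)"
    proof (rule field_differentiable_bound[of "closed_segment 0 h" "\<lambda>t. k (z + t *\<^sub>R ?e) - t * pd j k z"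
          "\<lambda>t. pd j k (z + t *\<^sub>R ?e) - pd j k z"])
      fix t assume t: "t \<in> closed_segment 0 h"
      show "((\<lambda>t. k (z + t *\<^sub>R ?e) - t * pd j k z) has_real_derivative pd j k (z + t *\<^sub>R ?e) - pd j k z) (at t within closed_segment 0 h)"
        by (auto intro!: derivative_eq_intros has_field_derivative_at_within[OF sm_pd_line[OF k(1)]])
      have "\<bar>t\<bar> \<le> \<bar>h\<bar>" using t by (auto simp: closed_segment_eq_real_ivl split: if_splits)
      moreover have "L \<ge> 0" using L[of z] by linarith
      ultimately have "L * \<bar>t\<bar> \<le> L * \<bar>h\<bar>" by (rule mult_left_mono)
      then show "norm (pd j k (z + t *\<^sub>R ?e) - pd j k z) \<le> L * \<bar>h\<bar>"
        using b1[of t] by simp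
    qed auto
    moreover have "(L * \<bar>h\<bar>) * norm (h - 0) = L * h\<^sup>2"
      by (simp add: power2_eq_square mult.assoc)
    moreover have "(k (z + h *\<^sub>R ?e) - h * pd j k z) - (k (z + 0 *\<^sub>R ?e) - 0 * pd j k z)
      = k (z + h *\<^sub>R ?e) - k z - h * pd j k z" by simp
    ultimately show ?thesis by (simp only: real_norm_def)
  qed
  define N where "N = (\<integral>y. \<bar>f y\<bar> \<partial>torus)"
  have cvt: "\<bar>cv k f (w + h *\<^sub>R ?e) - cv k f w - h * cv (pd j k) f w\<bar> \<le> L * h\<^sup>2 * N" for w h
  proof -
    have "cv k f (w + h *\<^sub>R ?e) - cv k f w - h * cv (pd j k) f w
      = (\<integral>y. k (w + h *\<^sub>R ?e - y) * f y - k (w - y) * f y - h * (pd j k (w - y) * f y) \<partial>torus)"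
      unfolding cv_def using f by (simp add: k0.cv_integrable k1.cv_integrable)
    also have "\<bar>\<dots>\<bar> \<le> (\<integral>y. L * h\<^sup>2 * \<bar>f y\<bar> \<partial>torus)"
    proof (rule integral_abs_bound_integral)
      fix y
      have "k (w + h *\<^sub>R ?e - y) * f y - k (w - y) * f y - h * (pd j k (w - y) * f y)
        = (k ((w - y) + h *\<^sub>R ?e) - k (w - y) - h * pd j k (w - y)) * f y"
        by (simp add: algebra_simps)
      then show "\<bar>k (w + h *\<^sub>R ?e - y) * f y - k (w - y) * f y - h * (pd j k (w - y) * f y)\<bar> \<le> L * h\<^sup>2 * \<bar>f y\<bar>"
        using taylor[of "w - y" h] by (simp add: abs_mult mult_right_mono)
    qed (use f in \<open>auto simp: k0.cv_integrable k1.cv_integrable\<close>)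
    also have "\<dots> = L * h\<^sup>2 * N" by (simp add: N_def)
    finally show ?thesis .
  qed
  let ?w = "x + s *\<^sub>R ?e"
  have "((\<lambda>h. (cv k f (x + (s + h) *\<^sub>R ?e) - cv k f ?w) / h - cv (pd j k) f ?w) \<longlongrightarrow> 0) (at 0)"
  proof (rule Lim_null_comparison)
    show "\<forall>\<^sub>F h in at 0. norm ((cv k f (x + (s + h) *\<^sub>R ?e) - cv k f ?w) / h - cv (pd j k) f ?w) \<le> L * N * \<bar>h\<bar>"
      unfolding eventually_at_filter
    proof (intro always_eventually allI impI)
      fix h :: real assume h: "h \<noteq> 0"
      have "(cv k f (x + (s + h) *\<^sub>R ?e) - cv k f ?w) / h - cv (pd j k) f ?w
        = (cv k f (?w + h *\<^sub>R ?e) - cv k f ?w - h * cv (pd j k) f ?w) / h"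
        using h by (simp add: field_simps scaleR_add_left)
      also have "norm \<dots> \<le> L * h\<^sup>2 * N / \<bar>h\<bar>"
        using cvt[of ?w h] by (simp add: divide_right_mono)
      also have "\<dots> = L * N * \<bar>h\<bar>" using h by (simp add: power2_eq_square abs_if)
      finally show "norm ((cv k f (x + (s + h) *\<^sub>R ?e) - cv k f ?w) / h - cv (pd j k) f ?w) \<le> L * N * \<bar>h\<bar>" .
    qed
    show "((\<lambda>h. L * N * \<bar>h\<bar>) \<longlongrightarrow> 0) (at 0)"
      by (auto intro!: tendsto_eq_intros)
  qed
  then show ?thesis unfolding DERIV_def by (simp add: LIM_zero_iff)
qed

section \<open>The commutator at a fixed time\<close>

text \<open>On a finite measure this yields every lower moment from the third one.\<close>

lemma cube_dominates: "0 \<le> (t::real) \<Longrightarrow> t \<le> 1 + t ^ 3" "0 \<le> t \<Longrightarrow> t\<^sup>2 \<le> 1 + t ^ 3"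
proof -
  assume t: "0 \<le> t"
  show "t \<le> 1 + t ^ 3"
  proof (cases "t \<le> 1")
    case False
    then have "t ^ 1 \<le> t ^ 3" by (intro power_increasing) auto
    then show ?thesis by simp
  qed (use zero_le_power[OF t, of 3] in linarith)
  show "t\<^sup>2 \<le> 1 + t ^ 3"
  proof (cases "t \<le> 1")
    case True
    then have "t\<^sup>2 \<le> 1" using t by (simp add: power_le_one)
    moreover have "0 \<le> t ^ 3" using t by simp
    ultimately show ?thesis by linarith
  next
    case False
    then have "t ^ 2 \<le> t ^ 3" by (intro power_increasing) auto
    then show ?thesis by simp
  qed
qed

lemma mult_square_le_cubes: "0 \<le> (a::real) \<Longrightarrow> 0 \<le> b \<Longrightarrow> a * b\<^sup>2 \<le> a ^ 3 + b ^ 3"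
proof (cases "a \<le> b")
  case True
  assume "0 \<le> a" "0 \<le> b"
  then have "a * b\<^sup>2 \<le> b * b\<^sup>2" "0 \<le> a ^ 3" using True by (auto intro: mult_right_mono)
  then show ?thesis by (simp add: power3_eq_cube power2_eq_square mult.assoc)
next
  case False
  assume *: "0 \<le> a" "0 \<le> b"
  then have "b\<^sup>2 \<le> a\<^sup>2" using False by (intro power_mono) auto
  then have "a * b\<^sup>2 \<le> a * a\<^sup>2" "0 \<le> b ^ 3" using * by (auto intro: mult_left_mono)
  then show ?thesis by (simp add: power3_eq_cube power2_eq_square mult.assoc)
qed

lemma cube_sum_le: "0 \<le> (a::real) \<Longrightarrow> 0 \<le> b \<Longrightarrow> (a + b) ^ 3 \<le> 4 * (a ^ 3 + b ^ 3)"
proof -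
  assume "0 \<le> a" "0 \<le> b"
  then have "0 \<le> 3 * (a + b) * (a - b)\<^sup>2" by simp
  also have "\<dots> = 4 * (a ^ 3 + b ^ 3) - (a + b) ^ 3"
    by (simp add: power2_eq_square power3_eq_cube algebra_simps)
  finally show ?thesis by simp
qed

lemma weighted_integrable:
  fixes k w :: "'a \<Rightarrow> real"
  assumes [measurable]: "w \<in> borel_measurable M" and k: "integrable M k" "\<And>y. 0 \<le> k y"
    and w: "\<And>y. 0 \<le> w y" and kw: "integrable M (\<lambda>y. k y * w y ^ 3)"
  shows "integrable M (\<lambda>y. k y * w y)" "integrable M (\<lambda>y. k y * (w y)\<^sup>2)"
proof -
  have [measurable]: "k \<in> borel_measurable M" using k by auto
  have i: "integrable M (\<lambda>y. k y + k y * w y ^ 3)" using k kw by auto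
  have "norm (k y * w y) \<le> norm (k y + k y * w y ^ 3)" "norm (k y * (w y)\<^sup>2) \<le> norm (k y + k y * w y ^ 3)" for y
    using mult_left_mono[OF cube_dominates(1)[OF w[of y]] k(2)[of y]] mult_left_mono[OF cube_dominates(2)[OF w[of y]] k(2)[of y]]
      k(2)[of y] w[of y] by (auto simp: distrib_left abs_mult)
  then show "integrable M (\<lambda>y. k y * w y)" "integrable M (\<lambda>y. k y * (w y)\<^sup>2)"
    by (auto intro!: Bochner_Integration.integrable_bound[OF i])
qed

text \<open>Takes the place of Hoelder's inequality. Under the double integral w y times the square
  of v z is at most the sum of their cubes, and each of the two terms leaves one total mass of k, at
  most B. It later turns gradient times defect into third moments.\<close>

lemma weighted_product:
  fixes k w v :: "'a \<Rightarrow> real"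
  assumes [measurable]: "w \<in> borel_measurable M" "v \<in> borel_measurable M"
    and k: "integrable M k" "\<And>y. 0 \<le> k y" and B: "(\<integral>y. k y \<partial>M) \<le> B"
    and w: "\<And>y. 0 \<le> w y" and v: "\<And>y. 0 \<le> v y"
    and kw: "integrable M (\<lambda>y. k y * w y ^ 3)" and kv: "integrable M (\<lambda>y. k y * v y ^ 3)"
  shows "(\<integral>y. k y * w y \<partial>M) * (\<integral>y. k y * (v y)\<^sup>2 \<partial>M)
    \<le> B * ((\<integral>y. k y * w y ^ 3 \<partial>M) + (\<integral>y. k y * v y ^ 3 \<partial>M))"
proof -
  note iw = weighted_integrable[OF assms(1) k w kw] and iv = weighted_integrable[OF assms(2) k v kv]
  let ?V2 = "\<integral>y. k y * (v y)\<^sup>2 \<partial>M" and ?V3 = "\<integral>y. k y * v y ^ 3 \<partial>M" and ?W3 = "\<integral>y. k y * w y ^ 3 \<partial>M"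
  have V3: "0 \<le> ?V3" using k v by (intro Bochner_Integration.integral_nonneg) auto
  have pt: "w y * ?V2 \<le> B * w y ^ 3 + ?V3" for y
  proof -
    have "w y * ?V2 = (\<integral>z. k z * (w y * (v z)\<^sup>2) \<partial>M)"
      by (subst integral_mult_right_zero[symmetric]) (simp add: mult.left_commute)
    also have "\<dots> \<le> (\<integral>z. k z * w y ^ 3 + k z * v z ^ 3 \<partial>M)"
    proof (rule integral_mono)
      show "integrable M (\<lambda>z. k z * (w y * (v z)\<^sup>2))"
        using integrable_mult_right[OF iv(2), of "w y"] by (simp add: mult.left_commute)
      fix z
      show "k z * (w y * (v z)\<^sup>2) \<le> k z * w y ^ 3 + k z * v z ^ 3"
        using mult_left_mono[OF mult_square_le_cubes[OF w[of y] v[of z]] k(2)[of z]] by (simp add: distrib_left)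
    qed (use k kv in auto)
    also have "\<dots> = (\<integral>z. k z \<partial>M) * w y ^ 3 + ?V3" using k kv by simp
    also have "\<dots> \<le> B * w y ^ 3 + ?V3" using B w by (simp add: mult_right_mono)
    finally show ?thesis .
  qed
  have "(\<integral>y. k y * w y \<partial>M) * ?V2 = (\<integral>y. k y * (w y * ?V2) \<partial>M)"
    by (subst integral_mult_left_zero[symmetric]) (simp add: mult.assoc)
  also have "\<dots> \<le> (\<integral>y. B * (k y * w y ^ 3) + k y * ?V3 \<partial>M)"
  proof (rule integral_mono)
    show "integrable M (\<lambda>y. k y * (w y * ?V2))"
      using integrable_mult_left[OF iw(1), of ?V2] by (simp add: mult.assoc)
    fix y
    show "k y * (w y * ?V2) \<le> B * (k y * w y ^ 3) + k y * ?V3"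
      using mult_left_mono[OF pt[of y] k(2)[of y]] by (simp add: distrib_left mult.left_commute)
  qed (use k kw in auto)
  also have "\<dots> = B * ?W3 + (\<integral>y. k y \<partial>M) * ?V3" using k kw by simp
  also have "\<dots> \<le> B * (?W3 + ?V3)" using B V3 by (simp add: distrib_left mult_right_mono)
  finally show ?thesis .
qed

text \<open>The integral of k * (s - w)^2 is a nonnegative quadratic polynomial in s, evaluated at
  its minimum. If k has mass zero the polynomial is linear, which forces the first moment to
  vanish.\<close>

lemma weighted_Cauchy:
  fixes k w :: "'a \<Rightarrow> real"
  assumes k: "integrable M k" "\<And>y. 0 \<le> k y" and B: "(\<integral>y. k y \<partial>M) \<le> B"
    and kw: "integrable M (\<lambda>y. k y * w y)" "integrable M (\<lambda>y. k y * (w y)\<^sup>2)"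
  shows "(\<integral>y. k y * w y \<partial>M)\<^sup>2 \<le> B * (\<integral>y. k y * (w y)\<^sup>2 \<partial>M)"
proof -
  let ?A = "\<integral>y. k y * w y \<partial>M" and ?W = "\<integral>y. k y * (w y)\<^sup>2 \<partial>M" and ?k = "\<integral>y. k y \<partial>M"
  have k0: "0 \<le> ?k" and W0: "0 \<le> ?W" using k by (auto intro!: Bochner_Integration.integral_nonneg)
  have q: "0 \<le> s\<^sup>2 * ?k - 2 * s * ?A + ?W" for s
  proof -
    have "0 \<le> (\<integral>y. k y * (s - w y)\<^sup>2 \<partial>M)" using k by (intro Bochner_Integration.integral_nonneg) auto
    also have "\<dots> = (\<integral>y. s\<^sup>2 * k y - 2 * s * (k y * w y) + k y * (w y)\<^sup>2 \<partial>M)"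
      by (rule Bochner_Integration.integral_cong) (auto simp: power2_eq_square algebra_simps)
    also have "\<dots> = s\<^sup>2 * ?k - 2 * s * ?A + ?W" using k kw by simp
    finally show ?thesis .
  qed
  have "?A\<^sup>2 \<le> ?k * ?W"
  proof (cases "?k = 0")
    case True
    have "?A = 0"
    proof (rule ccontr)
      assume "?A \<noteq> 0"
      then show False using q[of "(?W + 1) / (2 * ?A)"] True by simp
    qed
    then show ?thesis using True by simp
  next
    case False
    then show ?thesis using q[of "?A / ?k"] k0 by (simp add: power2_eq_square field_simps)
  qed
  also have "\<dots> \<le> B * ?W" using B W0 by (rule mult_right_mono)
  finally show ?thesis .
qed

lemma integral_torus_reflect:
  fixes f :: "real^'d::finite \<Rightarrow> real"
  assumes [measurable]: "f \<in> borel_measurable borel" and per: "periodic_x f" and M: "\<And>x. \<bar>f x\<bar> \<le> M"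
  shows "(\<integral>x. f (h - x) \<partial>torus) = (\<integral>x. f x \<partial>torus)"
proof -
  have "integrable torus f" "integrable torus (\<lambda>x. f (h - x))"
    using M by (auto intro!: integrable_torus_bounded[of _ M])
  moreover have "periodic_x (\<lambda>x. ennreal (f x))" "periodic_x (\<lambda>x. ennreal (- f x))"
    using per by (auto simp: periodic_x_def)
  ultimately show ?thesis
    using nn_integral_torus_reflect[of "\<lambda>x. ennreal (f x)" h] nn_integral_torus_reflect[of "\<lambda>x. ennreal (- f x)" h]
    by (simp add: real_lebesgue_integral_def)
qed

text \<open>\<open>rho_t\<close>, \<open>mom_t\<close> and \<open>energy_t\<close> are the time derivatives of the mollified density, momentum and
  energy that the Euler equations dictate; \<open>favre\<close> is the velocity $M / R$ and
  \<open>favre_grad K \<rho> u j i\<close> is $\partial_j$ of its $i$-th component.\<close>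

definition stress :: "(real^'d::finite \<Rightarrow> real) \<Rightarrow> real \<Rightarrow> (real^'d \<Rightarrow> real) \<Rightarrow> (real^'d \<Rightarrow> real^'d) \<Rightarrow> 'd \<Rightarrow> 'd \<Rightarrow> real^'d \<Rightarrow> real" where
  "stress k \<gamma> \<rho> u i j x = cv k (\<lambda>y. \<rho> y * u y $ i * u y $ j) x + (if i = j then cv k (\<lambda>y. \<rho> y powr \<gamma>) x else 0)"

definition rho_t :: "(real^'d::finite \<Rightarrow> real) \<Rightarrow> (real^'d \<Rightarrow> real) \<Rightarrow> (real^'d \<Rightarrow> real^'d) \<Rightarrow> real^'d \<Rightarrow> real" where
  "rho_t K \<rho> u x = - (\<Sum>j\<in>UNIV. cv (pd j K) (\<lambda>y. \<rho> y * u y $ j) x)"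

definition mom_t :: "(real^'d::finite \<Rightarrow> real) \<Rightarrow> real \<Rightarrow> (real^'d \<Rightarrow> real) \<Rightarrow> (real^'d \<Rightarrow> real^'d) \<Rightarrow> 'd \<Rightarrow> real^'d \<Rightarrow> real" where
  "mom_t K \<gamma> \<rho> u i x = - (\<Sum>j\<in>UNIV. stress (pd j K) \<gamma> \<rho> u i j x)"

definition favre :: "(real^'d::finite \<Rightarrow> real) \<Rightarrow> (real^'d \<Rightarrow> real) \<Rightarrow> (real^'d \<Rightarrow> real^'d) \<Rightarrow> 'd \<Rightarrow> real^'d \<Rightarrow> real" where
  "favre K \<rho> u i x = cv K (\<lambda>y. \<rho> y * u y $ i) x / cv K \<rho> x"

definition energy_t :: "(real^'d::finite \<Rightarrow> real) \<Rightarrow> real \<Rightarrow> (real^'d \<Rightarrow> real) \<Rightarrow> (real^'d \<Rightarrow> real^'d) \<Rightarrow> real^'d \<Rightarrow> real" where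
  "energy_t K \<gamma> \<rho> u x = (\<Sum>i\<in>UNIV. favre K \<rho> u i x * mom_t K \<gamma> \<rho> u i x)
    + (\<gamma> / (\<gamma> - 1) * cv K \<rho> x powr (\<gamma> - 1) - 1/2 * (\<Sum>i\<in>UNIV. (favre K \<rho> u i x)\<^sup>2)) * rho_t K \<rho> u x"

definition favre_grad :: "(real^'d::finite \<Rightarrow> real) \<Rightarrow> (real^'d \<Rightarrow> real) \<Rightarrow> (real^'d \<Rightarrow> real^'d) \<Rightarrow> 'd \<Rightarrow> 'd \<Rightarrow> real^'d \<Rightarrow> real" where
  "favre_grad K \<rho> u j i x = (cv (pd j K) (\<lambda>y. \<rho> y * u y $ i) x - favre K \<rho> u i x * cv (pd j K) \<rho> x) / cv K \<rho> x"

text \<open>The mollified momentum is R times the Favre velocity, so the subtracted product is the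
  flux R v_i v_j of the mollified state. The bracket compares the mollified flux with the flux of
  the mollified fields.\<close>

definition commutator :: "(real^'d::finite \<Rightarrow> real) \<Rightarrow> real \<Rightarrow> (real^'d \<Rightarrow> real) \<Rightarrow> (real^'d \<Rightarrow> real^'d) \<Rightarrow> real^'d \<Rightarrow> real" where
  "commutator K \<gamma> \<rho> u x = (\<Sum>j\<in>UNIV. \<Sum>i\<in>UNIV. favre_grad K \<rho> u j i x *
     (stress K \<gamma> \<rho> u i j x - favre K \<rho> u i x * cv K (\<lambda>y. \<rho> y * u y $ j) x - (if i = j then cv K \<rho> x powr \<gamma> else 0)))"

text \<open>The differentiated expression is the $j$-th component of an energy flux, which integrates to zero
  over the torus; this turns \<open>energy_t\<close> into \<open>commutator\<close>.\<close>

lemma energy_flux_derivative: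
  fixes r r' \<gamma> s :: real and R :: "real \<Rightarrow> real" and m S :: "'i::finite \<Rightarrow> real \<Rightarrow> real" and m' S' :: "'i \<Rightarrow> real"
  assumes R: "(R has_real_derivative r') (at s)" and m: "\<And>i. (m i has_real_derivative m' i) (at s)"
    and S: "\<And>i. (S i has_real_derivative S' i) (at s)" and pos: "R s > 0" and gam: "\<gamma> > 1"
  defines "v \<equiv> \<lambda>i. m i s / R s" and "dv \<equiv> \<lambda>i. (m' i - m i s / R s * r') / R s"
  shows "((\<lambda>s. (\<Sum>i\<in>UNIV. m i s / R s * S i s) - 1/2 * (\<Sum>i\<in>UNIV. (m i s / R s)\<^sup>2) * m j s
     + \<gamma> / (\<gamma> - 1) * R s powr (\<gamma> - 1) * m j s - R s powr \<gamma> * (m j s / R s)) has_real_derivative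
     (\<Sum>i\<in>UNIV. dv i * (S i s - v i * m j s - (if i = j then R s powr \<gamma> else 0))) + (\<Sum>i\<in>UNIV. v i * S' i)
     + (\<gamma> / (\<gamma> - 1) * R s powr (\<gamma> - 1) - 1/2 * (\<Sum>i\<in>UNIV. (v i)\<^sup>2)) * m' j) (at s)"
proof -
  have dvi: "((\<lambda>s. m i s / R s) has_real_derivative dv i) (at s)" for i
    using DERIV_divide[OF m R] pos by (simp add: dv_def field_simps)
  have p1: "((\<lambda>s. R s powr (\<gamma> - 1)) has_real_derivative (\<gamma> - 1) * R s powr (\<gamma> - 2) * r') (at s)"
    using DERIV_fun_powr[OF R pos, of "\<gamma> - 1"] by simp
  have p2: "((\<lambda>s. R s powr \<gamma>) has_real_derivative \<gamma> * R s powr (\<gamma> - 1) * r') (at s)"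
    using DERIV_fun_powr[OF R pos, of \<gamma>] by simp
  have rr: "R s powr (\<gamma> - 2) * m j s = R s powr (\<gamma> - 1) * v j"
  proof -
    have "R s powr (\<gamma> - 1) = R s powr (\<gamma> - 2) * R s"
      using pos powr_add[of "R s" "\<gamma> - 2" 1] by simp
    then show ?thesis using pos by (simp add: v_def)
  qed
  have "((\<lambda>s. (\<Sum>i\<in>UNIV. m i s / R s * S i s) - 1/2 * (\<Sum>i\<in>UNIV. (m i s / R s)\<^sup>2) * m j s
     + \<gamma> / (\<gamma> - 1) * R s powr (\<gamma> - 1) * m j s - R s powr \<gamma> * (m j s / R s)) has_real_derivative
     (\<Sum>i\<in>UNIV. dv i * S i s + S' i * v i) - (1/2 * (\<Sum>i\<in>UNIV. 2 * (dv i * v i)) * m j s + m' j * (1/2 * (\<Sum>i\<in>UNIV. (v i)\<^sup>2)))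
     + ((\<gamma> / (\<gamma> - 1) * ((\<gamma> - 1) * R s powr (\<gamma> - 2) * r')) * m j s + m' j * (\<gamma> / (\<gamma> - 1) * R s powr (\<gamma> - 1)))
     - (\<gamma> * R s powr (\<gamma> - 1) * r' * v j + dv j * R s powr \<gamma>)) (at s)"
    unfolding v_def
    by (intro DERIV_add DERIV_diff DERIV_mult DERIV_cmult DERIV_sum dvi m S p1 p2)
      (use DERIV_power[OF dvi, where n=2] in \<open>auto simp: mult_ac\<close>)
  moreover have "(\<Sum>i\<in>UNIV. dv i * S i s + S' i * v i) - (1/2 * (\<Sum>i\<in>UNIV. 2 * (dv i * v i)) * m j s + m' j * (1/2 * (\<Sum>i\<in>UNIV. (v i)\<^sup>2)))
     + ((\<gamma> / (\<gamma> - 1) * ((\<gamma> - 1) * R s powr (\<gamma> - 2) * r')) * m j s + m' j * (\<gamma> / (\<gamma> - 1) * R s powr (\<gamma> - 1)))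
     - (\<gamma> * R s powr (\<gamma> - 1) * r' * v j + dv j * R s powr \<gamma>)
    = (\<Sum>i\<in>UNIV. dv i * (S i s - v i * m j s - (if i = j then R s powr \<gamma> else 0))) + (\<Sum>i\<in>UNIV. v i * S' i)
     + (\<gamma> / (\<gamma> - 1) * R s powr (\<gamma> - 1) - 1/2 * (\<Sum>i\<in>UNIV. (v i)\<^sup>2)) * m' j"
  proof -
    \<comment> \<open>By \<open>rr\<close> the derivative of R powr (\<gamma> - 1) cancels against
      that of R powr \<gamma>. Apart from the potential term in \<open>m' j\<close>, the pressure
      leaves only - dv j * R powr \<gamma>, the diagonal term of the commutator.\<close>
    have a: "(\<gamma> / (\<gamma> - 1) * ((\<gamma> - 1) * R s powr (\<gamma> - 2) * r')) * m j s = \<gamma> * R s powr (\<gamma> - 1) * r' * v j"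
      using gam rr by (simp add: mult_ac)
    have b: "(\<Sum>i\<in>UNIV. dv i * (S i s - v i * m j s - (if i = j then R s powr \<gamma> else 0)))
      = (\<Sum>i\<in>UNIV. dv i * S i s) - (\<Sum>i\<in>UNIV. dv i * v i) * m j s - dv j * R s powr \<gamma>"
    proof -
      have "(\<Sum>i\<in>UNIV. dv i * (S i s - v i * m j s - (if i = j then R s powr \<gamma> else 0)))
        = (\<Sum>i\<in>UNIV. dv i * S i s - (dv i * v i) * m j s - (if i = j then dv i * R s powr \<gamma> else 0))"
        by (intro sum.cong) (auto simp: algebra_simps)
      also have "\<dots> = (\<Sum>i\<in>UNIV. dv i * S i s) - (\<Sum>i\<in>UNIV. dv i * v i) * m j s - dv j * R s powr \<gamma>"
        by (simp add: sum_subtractf sum_distrib_right)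
      finally show ?thesis .
    qed
    have c: "(\<Sum>i\<in>UNIV. 2 * (dv i * v i)) = 2 * (\<Sum>i\<in>UNIV. dv i * v i)" by (simp add: sum_distrib_left)
    have d: "(\<Sum>i\<in>UNIV. dv i * S i s + S' i * v i) = (\<Sum>i\<in>UNIV. dv i * S i s) + (\<Sum>i\<in>UNIV. v i * S' i)"
      by (simp add: sum.distrib mult.commute)
    show ?thesis unfolding a b c d by (simp add: algebra_simps)
  qed
  ultimately show ?thesis by simp
qed

text \<open>Assembled from the quantities V, S, P and D in the proof of
  \<open>time_derivative_bounds\<close>. It may blow up as \<epsilon> tends to 0, through
  \<open>Mk\<close>: it only ensures integrability for one kernel at a time.\<close>

definition energy_t_const :: "real \<Rightarrow> real \<Rightarrow> real \<Rightarrow> real \<Rightarrow> real \<Rightarrow> real" where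
  "energy_t_const d Mk c C \<gamma> = 3 * d * (Mk * C / c) * (d * Mk * (C + C powr \<gamma>))
    + (\<gamma> / (\<gamma> - 1) * C powr (\<gamma> - 1)) * (d * Mk * C) + 2 * (d * (Mk * C / c)\<^sup>2 * (d * Mk * C))"

section \<open>Estimates for one kernel at one time\<close>

context mollifier
begin

lemma kap_nonneg: "0 \<le> \<kappa> z" using K_le[of z] K_nonneg[of z] by linarith

lemma B_nonneg: "0 \<le> B"
  using int_kap kap_nonneg by (meson Bochner_Integration.integral_nonneg order_trans)

lemma kernel_K: "periodic_kernel K" by (rule periodic_kernel_sm[OF sm_K per_K])
lemma kernel_pd_K: "periodic_kernel (pd j K)" by (rule periodic_kernel_sm[OF sm_pd[OF sm_K] periodic_pd[OF sm_K per_K]])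

lemmas cvK_integrable = periodic_kernel.cv_integrable[OF kernel_K]
  and cvd_integrable = periodic_kernel.cv_integrable[OF kernel_pd_K]

lemma cv_cont: "integrable torus f \<Longrightarrow> continuous_on A (cv K f)" "integrable torus f \<Longrightarrow> continuous_on A (cv (pd j K) f)"
  by (auto intro: continuous_on_subset periodic_kernel.cv_continuous kernel_K kernel_pd_K)

lemma cv_per: "cv K f (x + axis i 1) = cv K f x" "cv (pd j K) f (x + axis i 1) = cv (pd j K) f x"
  using periodic_kernel.cv_periodic[OF kernel_K, of f] periodic_kernel.cv_periodic[OF kernel_pd_K, of j f] by (auto simp: periodic_x_def)

lemma kap_bound: obtains M where "M > 0" "\<And>z. \<bar>\<kappa> z\<bar> \<le> M"
proof -
  obtain M where "\<And>z. \<kappa> z \<le> M" using kap_bdd by blast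
  then have "\<bar>\<kappa> z\<bar> \<le> max M 1" for z using kap_nonneg[of z] by (simp add: le_max_iff_disj)
  then show ?thesis using that[of "max M 1"] by auto
qed

lemma int_K_shift: "(\<integral>y. K (x - y) \<partial>torus) = 1"
proof -
  obtain M where "\<And>z. \<bar>\<kappa> z\<bar> \<le> M" using kap_bound by metis
  then have "\<bar>K z\<bar> \<le> M" for z using K_le[of z] K_nonneg[of z] by (smt (verit))
  then show ?thesis using integral_torus_reflect[OF sm_borel[OF sm_K] per_K, of M x] int_K by simp
qed

lemma int_kap_shift: "(\<integral>y. \<kappa> (x - y) \<partial>torus) \<le> B" "integrable torus (\<lambda>y. \<kappa> (x - y))"
proof -
  obtain M where M: "\<And>z. \<bar>\<kappa> z\<bar> \<le> M" using kap_bound by metis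
  show "(\<integral>y. \<kappa> (x - y) \<partial>torus) \<le> B"
    using integral_torus_reflect[OF kap_meas per_kap M, of x] int_kap by simp
  show "integrable torus (\<lambda>y. \<kappa> (x - y))"
    by (rule integrable_torus_bounded[of _ M]) (use M in auto)
qed

lemma int_kap_mult:
  assumes f: "integrable torus f"
  shows "integrable torus (\<lambda>y. \<kappa> (x - y) * f y)"
proof -
  obtain M where M: "\<And>z. \<bar>\<kappa> z\<bar> \<le> M" "M > 0" using kap_bound by metis
  have [measurable]: "f \<in> borel_measurable borel" using f by auto
  show ?thesis
  proof (rule Bochner_Integration.integrable_bound)
    show "integrable torus (\<lambda>y. M * f y)" using f by simp
    show "AE y in torus. norm (\<kappa> (x - y) * f y) \<le> norm (M * f y)"
      using M by (intro AE_I2) (auto simp: abs_mult intro!: mult_right_mono)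
  qed simp
qed

lemma cvK_const: "cv K (\<lambda>y. a) x = a"
  using int_K_shift by (simp add: cv_def)

lemma cvK_mono:
  assumes "integrable torus f" "integrable torus g" "\<And>y. f y \<le> g y"
  shows "cv K f x \<le> cv K g x"
  unfolding cv_def using assms K_nonneg by (intro integral_mono cvK_integrable) (auto intro: mult_left_mono)

text \<open>One integral against the majorant controls both the convolution and, at the price of 1 /
  \<epsilon>, its gradient. All later error terms are thus moments under the same weight.\<close>

lemma cv_dominated:
  assumes f: "integrable torus f" and g: "integrable torus g" and fg: "\<And>y. \<bar>f y\<bar> \<le> g y"
  shows "\<bar>cv K f x\<bar> \<le> (\<integral>y. \<kappa> (x - y) * g y \<partial>torus)"
    and "\<bar>cv (pd j K) f x\<bar> \<le> (\<integral>y. \<kappa> (x - y) * g y \<partial>torus) / \<epsilon>"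
proof -
  have g0: "0 \<le> g y" for y using fg[of y] by linarith
  show "\<bar>cv K f x\<bar> \<le> (\<integral>y. \<kappa> (x - y) * g y \<partial>torus)"
    unfolding cv_def
  proof (rule integral_abs_bound_integral[OF cvK_integrable[OF f] int_kap_mult[OF g]])
    show "\<bar>K (x - y) * f y\<bar> \<le> \<kappa> (x - y) * g y" for y
      unfolding abs_mult using K_le[of "x - y"] K_nonneg[of "x - y"] fg kap_nonneg by (intro mult_mono) auto
  qed
  have "\<bar>cv (pd j K) f x\<bar> \<le> (\<integral>y. \<kappa> (x - y) * g y / \<epsilon> \<partial>torus)"
    unfolding cv_def
  proof (rule integral_abs_bound_integral[OF cvd_integrable[OF f]])
    show "integrable torus (\<lambda>y. \<kappa> (x - y) * g y / \<epsilon>)" using int_kap_mult[OF g] by simp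
    show "\<bar>pd j K (x - y) * f y\<bar> \<le> \<kappa> (x - y) * g y / \<epsilon>" for y
    proof -
      have "\<bar>pd j K (x - y)\<bar> * \<bar>f y\<bar> \<le> (\<kappa> (x - y) / \<epsilon>) * g y"
        using pd_K_le fg kap_nonneg eps by (intro mult_mono) auto
      then show ?thesis by (simp add: abs_mult)
    qed
  qed
  then show "\<bar>cv (pd j K) f x\<bar> \<le> (\<integral>y. \<kappa> (x - y) * g y \<partial>torus) / \<epsilon>" by simp
qed

end

text \<open>The fields at one time, with bounds at every point. The Taylor constant
  \<open>M2\<close> is a parameter so that one choice serves all times and all kernels.\<close>

locale slice = mollifier \<epsilon> B K \<kappa> for \<epsilon> B and K \<kappa> :: "real^'d::finite \<Rightarrow> real" +
  fixes \<rho> :: "real^'d \<Rightarrow> real" and u :: "real^'d \<Rightarrow> real^'d" and c C \<gamma> M2 :: real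
  assumes c: "0 < c" and rho_ge: "c \<le> \<rho> y" and rho_le: "\<rho> y \<le> C" and gam: "\<gamma> > 1"
    and rho_meas [measurable]: "\<rho> \<in> borel_measurable borel" and u_meas [measurable]: "u \<in> borel_measurable borel"
    and u3: "integrable torus (\<lambda>y. norm (u y) ^ 3)"
    and M2: "0 \<le> M2"
    and taylor: "\<lbrakk>c \<le> s; s \<le> C; c \<le> a; a \<le> C\<rbrakk> \<Longrightarrow> \<bar>s powr \<gamma> - a powr \<gamma> - \<gamma> * a powr (\<gamma> - 1) * (s - a)\<bar> \<le> M2 * (s - a)\<^sup>2"
begin

lemma u_comp_meas [measurable]: "(\<lambda>x. u x $ i) \<in> borel_measurable borel"
  by (rule measurable_compose[OF u_meas]) (intro borel_measurable_continuous_onI continuous_intros)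

lemma C: "0 < C" "c \<le> C" using rho_ge[of 0] rho_le[of 0] c by auto

lemma u_pow: "norm (u y) \<le> 1 + norm (u y) ^ 3" "(norm (u y))\<^sup>2 \<le> 1 + norm (u y) ^ 3"
  by (auto intro: cube_dominates)

lemma integrable_u_bound:
  assumes "f \<in> borel_measurable borel" "\<And>y. \<bar>f y\<bar> \<le> A * (1 + norm (u y) ^ 3)"
  shows "integrable torus (f :: _ \<Rightarrow> real)"
proof (rule Bochner_Integration.integrable_bound)
  show "integrable torus (\<lambda>y. A * (1 + norm (u y) ^ 3))" using u3 by auto
  show "AE y in torus. norm (f y) \<le> norm (A * (1 + norm (u y) ^ 3))"
    using assms(2) by (intro AE_I2) (metis abs_ge_self order_trans real_norm_def)
qed (use assms in auto)

lemma int_rho: "integrable torus \<rho>"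
  by (rule integrable_torus_bounded[of _ C]) (use rho_ge rho_le c in \<open>auto simp: abs_le_iff intro: order_trans\<close>,
      smt (verit) rho_ge rho_le)

lemma int_p: "integrable torus (\<lambda>y. \<rho> y powr \<gamma>)"
proof (rule integrable_torus_bounded[of _ "C powr \<gamma>"])
  show "\<bar>\<rho> y powr \<gamma>\<bar> \<le> C powr \<gamma>" for y
    using rho_ge[of y] rho_le[of y] c gam by (auto intro!: powr_mono2)
qed measurable

lemma int_mom: "integrable torus (\<lambda>y. \<rho> y * u y $ i)"
proof (rule integrable_u_bound)
  show "\<bar>\<rho> y * u y $ i\<bar> \<le> C * (1 + norm (u y) ^ 3)" for y
  proof -
    have "\<bar>\<rho> y * u y $ i\<bar> \<le> C * norm (u y)"
      unfolding abs_mult using rho_ge[of y] rho_le[of y] c component_le_norm_cart[of "u y" i] by (intro mult_mono) auto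
    also have "\<dots> \<le> C * (1 + norm (u y) ^ 3)" using u_pow(1) C by (intro mult_left_mono) auto
    finally show ?thesis .
  qed
qed measurable

lemma abs_rho_uu: "\<bar>\<rho> y * u y $ i * u y $ j\<bar> \<le> C * (norm (u y))\<^sup>2"
  unfolding abs_mult power2_eq_square mult.assoc
  using rho_ge[of y] rho_le[of y] c component_le_norm_cart[of "u y" i] component_le_norm_cart[of "u y" j]
  by (intro mult_mono) auto

lemma int_uu: "integrable torus (\<lambda>y. \<rho> y * u y $ i * u y $ j)"
proof (rule integrable_u_bound)
  show "\<bar>\<rho> y * u y $ i * u y $ j\<bar> \<le> C * (1 + norm (u y) ^ 3)" for y
    using abs_rho_uu[of y i j] mult_left_mono[OF u_pow(2)[of y], of C] C by linarith
qed measurable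

lemmas ints = int_rho int_p int_mom int_uu

lemma r_bounds: "c \<le> cv K \<rho> x" "cv K \<rho> x \<le> C"
proof -
  have "cv K (\<lambda>y. c) x \<le> cv K \<rho> x" "cv K \<rho> x \<le> cv K (\<lambda>y. C) x"
    by (auto intro!: cvK_mono int_rho rho_ge rho_le)
  then show "c \<le> cv K \<rho> x" "cv K \<rho> x \<le> C" by (simp_all add: cvK_const)
qed

lemma r_pos: "0 < cv K \<rho> x" using r_bounds(1)[of x] c by linarith

lemma line_stress: "((\<lambda>s. stress K \<gamma> \<rho> u i j' (x + s *\<^sub>R axis j 1)) has_real_derivative
   stress (pd j K) \<gamma> \<rho> u i j' (x + s *\<^sub>R axis j 1)) (at s)"
  unfolding stress_def
  using cv_line_derivative[OF sm_K per_K int_uu[of i j'], of x j s] cv_line_derivative[OF sm_K per_K int_p, of x j s]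
  by (cases "i = j'") (auto intro!: DERIV_add)

lemma integral_energy_t:
  "(\<integral>x. energy_t K \<gamma> \<rho> u x \<partial>torus) = (\<integral>x. commutator K \<gamma> \<rho> u x \<partial>torus)"
proof -
  define m where "m i = cv K (\<lambda>y. \<rho> y * u y $ i)" for i
  define G where "G j x = (\<Sum>i\<in>UNIV. m i x / cv K \<rho> x * stress K \<gamma> \<rho> u i j x)
     - 1/2 * (\<Sum>i\<in>UNIV. (m i x / cv K \<rho> x)\<^sup>2) * m j x
     + \<gamma> / (\<gamma> - 1) * cv K \<rho> x powr (\<gamma> - 1) * m j x - cv K \<rho> x powr \<gamma> * (m j x / cv K \<rho> x)" for j x
  define G1 where "G1 j x = (\<Sum>i\<in>UNIV. favre_grad K \<rho> u j i x * (stress K \<gamma> \<rho> u i j x - favre K \<rho> u i x * m j x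
        - (if i = j then cv K \<rho> x powr \<gamma> else 0)))" for j x
  define G' where "G' j x = G1 j x
     + (\<Sum>i\<in>UNIV. favre K \<rho> u i x * stress (pd j K) \<gamma> \<rho> u i j x)
     + (\<gamma> / (\<gamma> - 1) * cv K \<rho> x powr (\<gamma> - 1) - 1/2 * (\<Sum>i\<in>UNIV. (favre K \<rho> u i x)\<^sup>2)) * cv (pd j K) (\<lambda>y. \<rho> y * u y $ j) x" for j x
  have r0: "cv K \<rho> x \<noteq> 0" for x using r_pos[of x] by simp
  have cs: "continuous_on UNIV (stress K \<gamma> \<rho> u i j)" "continuous_on UNIV (stress (pd j' K) \<gamma> \<rho> u i j)" for i j j'
    unfolding stress_def by (cases "i = j"; simp; intro continuous_intros cv_cont ints)+
  have cfav: "continuous_on UNIV (favre K \<rho> u i)" for i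
    unfolding favre_def by (intro continuous_intros cv_cont ints) (use r0 in auto)
  have cfg: "continuous_on UNIV (favre_grad K \<rho> u j i)" for j i
    unfolding favre_grad_def by (intro continuous_intros cv_cont ints cfav) (use r0 in auto)
  have cm: "continuous_on UNIV (m j)" for j unfolding m_def by (intro cv_cont ints)
  have cG1: "continuous_on UNIV (G1 j)" for j
    unfolding G1_def
  proof (intro continuous_intros cs cfav cfg cm)
    fix i show "continuous_on UNIV (\<lambda>x. if i = j then cv K \<rho> x powr \<gamma> else 0)"
      by (cases "i = j"; simp) (intro continuous_intros cv_cont ints; use r0 in auto)
  qed
  have cG': "continuous_on UNIV (G' j)" for j
    unfolding G'_def by (intro continuous_intros cs cfav cG1 cv_cont ints) (use r0 in auto)
  have cG: "continuous_on UNIV (G j)" for j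
    unfolding G_def by (intro continuous_intros cs cm cv_cont ints) (use r0 in auto)
  have perG: "periodic_x (G j)" "periodic_x (G1 j)" "periodic_x (G' j)" for j
    by (auto simp: periodic_x_def G_def G1_def G'_def m_def stress_def favre_def favre_grad_def cv_per cong: if_cong)
  have zero: "(\<integral>x. G' j x \<partial>torus) = 0" for j
  proof (rule integral_torus_directional_derivative[OF perG(1) perG(3) cG cG', where e="axis j 1"])
    fix x s
    show "((\<lambda>s. G j (x + s *\<^sub>R axis j 1)) has_real_derivative G' j (x + s *\<^sub>R axis j 1)) (at s)"
    proof -
      let ?x = "\<lambda>s. x + s *\<^sub>R axis j 1"
      show ?thesis
        unfolding G_def G'_def G1_def favre_grad_def favre_def m_def
        using energy_flux_derivative[where R="\<lambda>s. cv K \<rho> (?x s)" and s=s and \<gamma>=\<gamma> and j=j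
            and m="\<lambda>i s. cv K (\<lambda>y. \<rho> y * u y $ i) (?x s)" and S="\<lambda>i s. stress K \<gamma> \<rho> u i j (?x s)",
            OF cv_line_derivative[OF sm_K per_K int_rho] cv_line_derivative[OF sm_K per_K int_mom] line_stress r_pos gam] .
    qed
  qed
  have bdd: "integrable torus f" if f: "continuous_on UNIV f" "periodic_x f" for f :: "real^'d \<Rightarrow> real"
  proof -
    obtain M where "\<And>x. \<bar>f x\<bar> \<le> M" using periodic_continuous_bounded[OF f] by metis
    then show ?thesis using f(1) by (intro integrable_torus_bounded[of _ M] borel_measurable_continuous_onI)
  qed
  have comm: "commutator K \<gamma> \<rho> u x = (\<Sum>j\<in>UNIV. G1 j x)" for x
    by (simp add: commutator_def G1_def m_def)
  \<comment> \<open>Apart from \<open>G1\<close>, the flux derivatives sum to minus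
    \<open>energy_t\<close>: their terms are the favre velocities against \<open>mom_t\<close> and
    the potential against \<open>rho_t\<close>.\<close>
  have "energy_t K \<gamma> \<rho> u x = (\<Sum>j\<in>UNIV. G1 j x) - (\<Sum>j\<in>UNIV. G' j x)" for x
  proof -
    have "(\<Sum>i\<in>UNIV. favre K \<rho> u i x * mom_t K \<gamma> \<rho> u i x)
       = - (\<Sum>j\<in>UNIV. \<Sum>i\<in>UNIV. favre K \<rho> u i x * stress (pd j K) \<gamma> \<rho> u i j x)"
      unfolding mom_t_def by (subst sum.swap) (simp add: sum_negf sum_distrib_left)
    then show ?thesis
      unfolding energy_t_def rho_t_def G'_def
      by (simp add: sum.distrib sum_distrib_left)
  qed
  then have "(\<integral>x. energy_t K \<gamma> \<rho> u x \<partial>torus) = (\<integral>x. (\<Sum>j\<in>UNIV. G1 j x) - (\<Sum>j\<in>UNIV. G' j x) \<partial>torus)"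
    by simp
  also have "\<dots> = (\<integral>x. (\<Sum>j\<in>UNIV. G1 j x) \<partial>torus) - (\<Sum>j\<in>UNIV. \<integral>x. G' j x \<partial>torus)"
    using bdd[OF cG1 perG(2)] bdd[OF cG' perG(3)] by (subst Bochner_Integration.integral_diff) auto
  finally show ?thesis by (simp add: zero comm)
qed

definition w3 :: "real^'d \<Rightarrow> real" where "w3 x = (\<integral>y. \<kappa> (x - y) * norm (u y - u x) ^ 3 \<partial>torus)"
definition q3 :: "real^'d \<Rightarrow> real" where "q3 x = (\<integral>y. \<kappa> (x - y) * \<bar>\<rho> y - \<rho> x\<bar> ^ 3 \<partial>torus)"

lemma int_w3: "integrable torus (\<lambda>y. norm (u y - u x) ^ 3)"
proof (rule integrable_u_bound)
  show "\<bar>norm (u y - u x) ^ 3\<bar> \<le> 4 * (1 + norm (u x) ^ 3) * (1 + norm (u y) ^ 3)" for y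
  proof -
    have "norm (u y - u x) ^ 3 \<le> (norm (u y) + norm (u x)) ^ 3"
      by (intro power_mono norm_triangle_ineq4) auto
    also have "\<dots> \<le> 4 * (norm (u y) ^ 3 + norm (u x) ^ 3)" by (rule cube_sum_le) auto
    also have "\<dots> \<le> 4 * (1 + norm (u x) ^ 3) * (1 + norm (u y) ^ 3)" by (simp add: algebra_simps)
    finally show ?thesis by simp
  qed
qed measurable

lemma int_q: "integrable torus (\<lambda>y. \<bar>\<rho> y - \<rho> x\<bar> ^ n)"
proof (rule integrable_torus_bounded[of _ "C ^ n"])
  show "\<bar>\<bar>\<rho> y - \<rho> x\<bar> ^ n\<bar> \<le> C ^ n" for y
    unfolding power_abs using rho_ge[of x] rho_ge[of y] rho_le[of x] rho_le[of y] c
    by (intro power_mono) auto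
qed measurable

text \<open>Both factors ignore constants in the velocity: subtracting u x inside the convolutions
  changes neither the gradient of the Favre velocity nor the stress defect. So the gradient is at
  most a multiple of W1 / \<epsilon> and the defect a combination of W2 and Q2, moments of the
  increments at x under \<kappa>. The products W1 * W2 and W1 * Q2 then fall to
  \<open>weighted_product\<close>.\<close>

lemma commutator_bound:
  "\<bar>commutator K \<gamma> \<rho> u x\<bar> \<le> (real CARD('d))\<^sup>2 * ((C + C / c * (C * B)) / c) * (B * (2 * (C + C * (C / c)\<^sup>2 * B) + M2)) / \<epsilon> * (w3 x + q3 x)"
proof -
  let ?k = "\<lambda>y. \<kappa> (x - y)"
  define w where "w y = norm (u y - u x)" for y
  define q where "q y = \<bar>\<rho> y - \<rho> x\<bar>" for y
  have [measurable]: "w \<in> borel_measurable borel" "q \<in> borel_measurable borel" unfolding w_def q_def by measurable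
  have mt: "w \<in> borel_measurable torus" "q \<in> borel_measurable torus" by auto
  have w0: "0 \<le> w y" "0 \<le> q y" for y by (auto simp: w_def q_def)
  have iw3: "integrable torus (\<lambda>y. w y ^ 3)" unfolding w_def by (rule int_w3)
  have iw: "integrable torus w" "integrable torus (\<lambda>y. (w y)\<^sup>2)"
    using weighted_integrable[of w torus "\<lambda>_. 1"] iw3 w0 by auto
  have iq: "integrable torus (\<lambda>y. q y ^ n)" for n unfolding q_def by (rule int_q)
  define W1 W2 W3 Q2 Q3 where "W1 = (\<integral>y. ?k y * w y \<partial>torus)" and "W2 = (\<integral>y. ?k y * (w y)\<^sup>2 \<partial>torus)"
    and "W3 = (\<integral>y. ?k y * w y ^ 3 \<partial>torus)" and "Q2 = (\<integral>y. ?k y * (q y)\<^sup>2 \<partial>torus)" and "Q3 = (\<integral>y. ?k y * q y ^ 3 \<partial>torus)"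
  note W_defs = W1_def W2_def W3_def Q2_def Q3_def
  have nn: "0 \<le> W1" "0 \<le> W2" "0 \<le> W3" "0 \<le> Q2" "0 \<le> Q3"
    unfolding W_defs using kap_nonneg w0 by (auto intro!: Bochner_Integration.integral_nonneg)
  have WW: "W1 * W2 \<le> B * (W3 + W3)" unfolding W_defs
    by (rule weighted_product[OF mt(1) mt(1)]) (use int_kap_shift kap_nonneg w0 int_kap_mult iw3 in auto)
  have WQ: "W1 * Q2 \<le> B * (W3 + Q3)" unfolding W_defs
    by (rule weighted_product[OF mt]) (use int_kap_shift kap_nonneg w0 int_kap_mult iw3 iq in auto)
  have W1sq: "W1\<^sup>2 \<le> B * W2" unfolding W_defs
    by (rule weighted_Cauchy) (use int_kap_shift kap_nonneg int_kap_mult iw in auto)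
  define r where "r = cv K \<rho> x"
  have r: "c \<le> r" "r \<le> C" "0 < r" using r_bounds[of x] r_pos[of x] by (auto simp: r_def)
  define v where "v i = favre K \<rho> u i x" for i
  have ui: "\<bar>u y $ i - u x $ i\<bar> \<le> w y" for y i
    using component_le_norm_cart[of "u y - u x" i] by (simp add: w_def)
  have i1: "integrable torus (\<lambda>y. \<rho> y * (u y $ i - a))" for i a
    using int_mom[of i] int_rho by (simp add: right_diff_distrib)
  have d1: "\<bar>\<rho> y * (u y $ i - u x $ i)\<bar> \<le> C * w y" for y i
    unfolding abs_mult using rho_ge[of y] rho_le[of y] c ui by (intro mult_mono) (auto simp: w_def)
  have iCw: "integrable torus (\<lambda>y. C * w y)" using iw by simp
  have kCw: "(\<integral>y. ?k y * (C * w y) \<partial>torus) = C * W1"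
    unfolding W1_def by (subst integral_mult_right_zero[symmetric]) (simp add: mult.left_commute)
  have lin: "cv K (\<lambda>y. \<rho> y * (u y $ i - a)) x = cv K (\<lambda>y. \<rho> y * u y $ i) x - a * r"
    "cv (pd j K) (\<lambda>y. \<rho> y * (u y $ i - a)) x = cv (pd j K) (\<lambda>y. \<rho> y * u y $ i) x - a * cv (pd j K) \<rho> x" for i a j
  proof -
    have e: "(\<lambda>y. \<rho> y * (u y $ i - a)) = (\<lambda>y. \<rho> y * u y $ i - a * \<rho> y)" by (auto simp: algebra_simps)
    show "cv K (\<lambda>y. \<rho> y * (u y $ i - a)) x = cv K (\<lambda>y. \<rho> y * u y $ i) x - a * r"
      unfolding e r_def using periodic_kernel.cv_diff[OF kernel_K int_mom, of "\<lambda>y. a * \<rho> y"] int_rho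
      by (simp add: periodic_kernel.cv_mult[OF kernel_K])
    show "cv (pd j K) (\<lambda>y. \<rho> y * (u y $ i - a)) x = cv (pd j K) (\<lambda>y. \<rho> y * u y $ i) x - a * cv (pd j K) \<rho> x"
      unfolding e using periodic_kernel.cv_diff[OF kernel_pd_K int_mom, of "\<lambda>y. a * \<rho> y"] int_rho
      by (simp add: periodic_kernel.cv_mult[OF kernel_pd_K])
  qed
  have vr: "cv K (\<lambda>y. \<rho> y * u y $ i) x = v i * r" for i using r by (simp add: v_def favre_def r_def)
  have vdev: "\<bar>v i - u x $ i\<bar> \<le> C / c * W1" for i
  proof -
    have "r * \<bar>v i - u x $ i\<bar> = \<bar>cv K (\<lambda>y. \<rho> y * (u y $ i - u x $ i)) x\<bar>"
      unfolding lin(1) vr using r by (simp add: abs_mult flip: left_diff_distrib)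
    also have "\<dots> \<le> C * W1" using cv_dominated(1)[OF i1 iCw d1, where x=x] by (simp add: kCw)
    finally have "c * \<bar>v i - u x $ i\<bar> \<le> C * W1" using mult_right_mono[OF r(1), of "\<bar>v i - u x $ i\<bar>"] by simp
    then show ?thesis using c by (simp add: field_simps)
  qed
  have rj: "\<bar>cv (pd j K) \<rho> x\<bar> \<le> C * B / \<epsilon>" for j
  proof -
    have "\<bar>cv (pd j K) \<rho> x\<bar> \<le> (\<integral>y. ?k y * C \<partial>torus) / \<epsilon>"
      by (rule cv_dominated(2)[OF int_rho]) (use rho_ge rho_le c in \<open>auto simp: abs_le_iff\<close>, smt (verit) rho_ge rho_le)
    also have "\<dots> \<le> B * C / \<epsilon>"
      using int_kap_shift C eps by (simp add: divide_right_mono mult_right_mono)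
    finally show ?thesis by (simp add: mult.commute)
  qed
  define L1 where "L1 = (C + C / c * (C * B)) / c"
  have L1: "0 \<le> L1" using C c B_nonneg by (simp add: L1_def)
  have dv: "\<bar>favre_grad K \<rho> u j i x\<bar> \<le> L1 / \<epsilon> * W1" for i j
  proof -
    \<comment> \<open>Subtracting the constant u x $ i from u and from v i shifts both terms by the
      same multiple of the gradient of the mollified density, so only increments remain.\<close>
    have "\<bar>cv (pd j K) (\<lambda>y. \<rho> y * u y $ i) x - v i * cv (pd j K) \<rho> x\<bar>
      = \<bar>cv (pd j K) (\<lambda>y. \<rho> y * (u y $ i - u x $ i)) x - (v i - u x $ i) * cv (pd j K) \<rho> x\<bar>"
      unfolding lin(2) by (simp add: algebra_simps)
    also have "\<dots> \<le> \<bar>cv (pd j K) (\<lambda>y. \<rho> y * (u y $ i - u x $ i)) x\<bar> + \<bar>v i - u x $ i\<bar> * \<bar>cv (pd j K) \<rho> x\<bar>"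
      by (rule order_trans[OF abs_triangle_ineq4]) (simp add: abs_mult)
    also have "\<dots> \<le> C * W1 / \<epsilon> + C / c * W1 * (C * B / \<epsilon>)"
      using cv_dominated(2)[OF i1 iCw d1, where j=j and x=x] vdev rj C c nn by (intro add_mono mult_mono) (auto simp: kCw)
    also have "\<dots> = c * (L1 / \<epsilon> * W1)" using c eps by (simp add: L1_def field_simps)
    finally have *: "\<bar>cv (pd j K) (\<lambda>y. \<rho> y * u y $ i) x - v i * cv (pd j K) \<rho> x\<bar> \<le> c * (L1 / \<epsilon> * W1)" .
    also have "\<dots> \<le> r * (L1 / \<epsilon> * W1)" using r L1 eps nn by (intro mult_right_mono) auto
    finally show ?thesis using r
      by (simp add: favre_grad_def r_def[symmetric] v_def[symmetric] pos_divide_le_eq mult.commute)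
  qed
  define L2 where "L2 = C + C * (C / c)\<^sup>2 * B"
  \<comment> \<open>A covariance identity: the defect is the convolution of \<rho> * (u - a) * (u -
    b), components i and j, minus r * (v i - a) * (v j - b). The second product is quadratic in W1
    and so bounded by W2 through \<open>W1sq\<close>.\<close>
  have R: "\<bar>cv K (\<lambda>y. \<rho> y * u y $ i * u y $ j) x - v i * cv K (\<lambda>y. \<rho> y * u y $ j) x\<bar> \<le> L2 * W2" for i j
  proof -
    define a b where "a = u x $ i" and "b = u x $ j"
    have "(\<lambda>y. \<rho> y * (u y $ i - a) * (u y $ j - b))
      = (\<lambda>y. ((\<rho> y * u y $ i * u y $ j - a * (\<rho> y * u y $ j)) - b * (\<rho> y * u y $ i)) + (a * b) * \<rho> y)"
      by (auto simp: algebra_simps)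
    then have e: "cv K (\<lambda>y. \<rho> y * (u y $ i - a) * (u y $ j - b)) x
      = cv K (\<lambda>y. \<rho> y * u y $ i * u y $ j) x - a * (v j * r) - b * (v i * r) + (a * b) * r"
      using ints by (simp add: periodic_kernel.cv_add[OF kernel_K] periodic_kernel.cv_diff[OF kernel_K] periodic_kernel.cv_mult[OF kernel_K] vr r_def)
    have ii: "integrable torus (\<lambda>y. \<rho> y * (u y $ i - a) * (u y $ j - b))"
      using ints by (simp add: algebra_simps)
    have "\<bar>\<rho> y * (u y $ i - a) * (u y $ j - b)\<bar> \<le> C * (w y)\<^sup>2" for y
      unfolding abs_mult power2_eq_square mult.assoc a_def b_def using rho_ge[of y] rho_le[of y] c ui w0
      by (intro mult_mono) auto
    then have "\<bar>cv K (\<lambda>y. \<rho> y * (u y $ i - a) * (u y $ j - b)) x\<bar> \<le> (\<integral>y. ?k y * (C * (w y)\<^sup>2) \<partial>torus)"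
      by (intro cv_dominated(1)[OF ii]) (use iw in auto)
    also have "\<dots> = C * W2"
      unfolding W2_def by (subst integral_mult_right_zero[symmetric]) (simp add: mult.left_commute)
    finally have 1: "\<bar>cv K (\<lambda>y. \<rho> y * (u y $ i - a) * (u y $ j - b)) x\<bar> \<le> C * W2" .
    have "\<bar>r * ((v i - a) * (v j - b))\<bar> \<le> C * ((C / c * W1) * (C / c * W1))"
      unfolding abs_mult using vdev[of i] vdev[of j] r C c nn by (intro mult_mono) (auto simp: a_def b_def)
    also have "\<dots> = C * (C / c)\<^sup>2 * W1\<^sup>2" by (simp add: power2_eq_square)
    also have "\<dots> \<le> C * (C / c)\<^sup>2 * (B * W2)" using W1sq C by (intro mult_left_mono) auto
    finally have 2: "\<bar>r * ((v i - a) * (v j - b))\<bar> \<le> C * (C / c)\<^sup>2 * (B * W2)" .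
    have "cv K (\<lambda>y. \<rho> y * u y $ i * u y $ j) x - v i * (v j * r)
      = cv K (\<lambda>y. \<rho> y * (u y $ i - a) * (u y $ j - b)) x - r * ((v i - a) * (v j - b))"
      unfolding e by (simp add: algebra_simps)
    then show ?thesis using 1 2 unfolding vr by (simp add: L2_def algebra_simps)
  qed
  \<comment> \<open>The tangent is taken at the mean r, where the linear term convolves to 0 and
    only the quadratic remainder survives. The variance about the mean is in turn at most the second
    moment about \<rho> x, which is what Q2 measures.\<close>
  have P: "\<bar>cv K (\<lambda>y. \<rho> y powr \<gamma>) x - r powr \<gamma>\<bar> \<le> M2 * Q2"
  proof -
    define a where "a = \<rho> x"
    define D where "D = \<gamma> * r powr (\<gamma> - 1)"
    have i2: "integrable torus (\<lambda>y. (\<rho> y - s)\<^sup>2)" if "c \<le> s" "s \<le> C" for s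
    proof (rule integrable_torus_bounded[of _ "C\<^sup>2"])
      show "\<bar>(\<rho> y - s)\<^sup>2\<bar> \<le> C\<^sup>2" for y
        using that rho_ge[of y] rho_le[of y] c by (auto simp: abs_le_square_iff[symmetric])
    qed measurable
    have e1: "cv K (\<lambda>y. \<rho> y powr \<gamma>) x - r powr \<gamma> = cv K (\<lambda>y. (\<rho> y powr \<gamma> - D * \<rho> y) - (r powr \<gamma> - D * r)) x"
      using ints by (simp add: periodic_kernel.cv_diff[OF kernel_K] periodic_kernel.cv_mult[OF kernel_K] cvK_const r_def)
    have e2: "(\<lambda>y. (\<rho> y - r)\<^sup>2) = (\<lambda>y. ((\<rho> y - a)\<^sup>2 - (2 * (r - a)) * \<rho> y) + (2 * (r - a) * a + (r - a)\<^sup>2))"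
      by (auto simp: power2_eq_square algebra_simps)
    have ra: "c \<le> a" "a \<le> C" using rho_ge rho_le by (auto simp: a_def)
    have "\<bar>cv K (\<lambda>y. \<rho> y powr \<gamma>) x - r powr \<gamma>\<bar> \<le> cv K (\<lambda>y. M2 * (\<rho> y - r)\<^sup>2) x"
      unfolding e1 unfolding cv_def
    proof (rule integral_abs_bound_integral)
      show "integrable torus (\<lambda>y. K (x - y) * (\<rho> y powr \<gamma> - D * \<rho> y - (r powr \<gamma> - D * r)))"
        using ints by (intro cvK_integrable) auto
      show "integrable torus (\<lambda>y. K (x - y) * (M2 * (\<rho> y - r)\<^sup>2))"
        using i2[of r] r by (intro cvK_integrable) auto
      fix y
      have "\<bar>\<rho> y powr \<gamma> - D * \<rho> y - (r powr \<gamma> - D * r)\<bar> \<le> M2 * (\<rho> y - r)\<^sup>2"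
        using taylor[OF rho_ge rho_le r(1,2), of y] by (simp add: D_def algebra_simps)
      then show "\<bar>K (x - y) * (\<rho> y powr \<gamma> - D * \<rho> y - (r powr \<gamma> - D * r))\<bar> \<le> K (x - y) * (M2 * (\<rho> y - r)\<^sup>2)"
        using K_nonneg by (simp add: abs_mult mult_left_mono)
    qed
    also have "\<dots> = M2 * cv K (\<lambda>y. (\<rho> y - r)\<^sup>2) x" by (rule periodic_kernel.cv_mult[OF kernel_K])
    also have "cv K (\<lambda>y. (\<rho> y - r)\<^sup>2) x = cv K (\<lambda>y. (\<rho> y - a)\<^sup>2) x - (2 * (r - a)) * r + (2 * (r - a) * a + (r - a)\<^sup>2)"
      unfolding e2 using ints i2[OF ra]
      by (simp add: periodic_kernel.cv_add[OF kernel_K] periodic_kernel.cv_diff[OF kernel_K] periodic_kernel.cv_mult[OF kernel_K] cvK_const r_def)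
    also have "\<dots> = cv K (\<lambda>y. (\<rho> y - a)\<^sup>2) x - (r - a)\<^sup>2" by (simp add: power2_eq_square algebra_simps)
    finally have 1: "\<bar>cv K (\<lambda>y. \<rho> y powr \<gamma>) x - r powr \<gamma>\<bar> \<le> M2 * (cv K (\<lambda>y. (\<rho> y - a)\<^sup>2) x - (r - a)\<^sup>2)" .
    have "cv K (\<lambda>y. (\<rho> y - a)\<^sup>2) x \<le> Q2"
      using cv_dominated(1)[OF i2[OF ra] i2[OF ra], where x=x] unfolding Q2_def q_def a_def by simp
    then have 2: "cv K (\<lambda>y. (\<rho> y - a)\<^sup>2) x - (r - a)\<^sup>2 \<le> Q2" by (simp add: add_increasing2 diff_le_eq)
    show ?thesis using 1 mult_left_mono[OF 2 M2] by linarith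
  qed
  have T: "\<bar>favre_grad K \<rho> u j i x * (stress K \<gamma> \<rho> u i j x - favre K \<rho> u i x * cv K (\<lambda>y. \<rho> y * u y $ j) x
      - (if i = j then cv K \<rho> x powr \<gamma> else 0))\<bar> \<le> L1 / \<epsilon> * (B * (2 * L2 + M2)) * (W3 + Q3)" for i j
  proof -
    have L20: "0 \<le> L2" using C B_nonneg by (simp add: L2_def)
    \<comment> \<open>For i \<noteq> j no pressure term occurs, and adding M2 * Q2 must not spoil
      the bound.\<close>
    have M2Q: "0 \<le> M2 * Q2" using P by linarith
    have "\<bar>stress K \<gamma> \<rho> u i j x - v i * cv K (\<lambda>y. \<rho> y * u y $ j) x - (if i = j then r powr \<gamma> else 0)\<bar> \<le> L2 * W2 + M2 * Q2"
      using R[of i j] P M2Q by (auto simp: stress_def)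
    then have "\<bar>favre_grad K \<rho> u j i x * (stress K \<gamma> \<rho> u i j x - v i * cv K (\<lambda>y. \<rho> y * u y $ j) x - (if i = j then r powr \<gamma> else 0))\<bar>
      \<le> (L1 / \<epsilon> * W1) * (L2 * W2 + M2 * Q2)"
      unfolding abs_mult using dv[of j i] L1 eps nn by (intro mult_mono) auto
    also have "\<dots> = L1 / \<epsilon> * (L2 * (W1 * W2) + M2 * (W1 * Q2))" by (simp add: algebra_simps)
    also have "\<dots> \<le> L1 / \<epsilon> * (B * (2 * L2 + M2) * (W3 + Q3))"
    proof (rule mult_left_mono)
      have 1: "L2 * (W1 * W2) \<le> L2 * (B * (W3 + W3))" using WW L20 by (rule mult_left_mono)
      have 2: "L2 * (B * (W3 + W3)) \<le> B * (2 * L2) * (W3 + Q3)"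
        using nn L20 B_nonneg by (simp add: algebra_simps)
      have 3: "M2 * (W1 * Q2) \<le> M2 * (B * (W3 + Q3))" using WQ M2 by (rule mult_left_mono)
      show "L2 * (W1 * W2) + M2 * (W1 * Q2) \<le> B * (2 * L2 + M2) * (W3 + Q3)"
        using 1 2 3 by (simp add: algebra_simps)
    qed (use L1 eps in auto)
    finally show ?thesis unfolding r_def v_def by (simp only: mult.assoc)
  qed
  have "\<bar>commutator K \<gamma> \<rho> u x\<bar> \<le> (\<Sum>j\<in>(UNIV::'d set). \<Sum>i\<in>(UNIV::'d set). L1 / \<epsilon> * (B * (2 * L2 + M2)) * (W3 + Q3))"
    unfolding commutator_def by (intro order_trans[OF sum_abs] sum_mono order_trans[OF sum_abs] T)
  also have "\<dots> = (real CARD('d))\<^sup>2 * L1 * (B * (2 * L2 + M2)) / \<epsilon> * (W3 + Q3)"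
    by (simp add: power2_eq_square)
  finally show ?thesis
    by (simp add: L1_def L2_def W3_def Q3_def w3_def q3_def w_def q_def)
qed

text \<open>Crude bounds in terms of the kernel, good enough for integrability in time. The worst
  terms are velocity times stress and squared velocity times the divergence of the momentum. Both
  are products of spatial moments of total degree three and reduce to the third moment, so u in L^3
  of space-time just suffices.\<close>

lemma time_derivative_bounds:
  assumes Mk: "\<And>z. \<bar>K z\<bar> \<le> Mk" "\<And>j z. \<bar>pd j K z\<bar> \<le> Mk"
  shows rho_t_bound: "\<bar>rho_t K \<rho> u x\<bar> \<le> real CARD('d) * Mk * C * (1 + (\<integral>y. norm (u y) ^ 3 \<partial>torus))"
    and mom_t_bound: "\<bar>mom_t K \<gamma> \<rho> u i x\<bar> \<le> real CARD('d) * Mk * (C + C powr \<gamma>) * (2 * (1 + (\<integral>y. norm (u y) ^ 3 \<partial>torus)))"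
    and energy_t_bound: "\<bar>energy_t K \<gamma> \<rho> u x\<bar> \<le> energy_t_const (real CARD('d)) Mk c C \<gamma> * (1 + (\<integral>y. norm (u y) ^ 3 \<partial>torus))"
proof -
  define d V S P D where "d = real CARD('d)" and "V = Mk * C / c" and "S = d * Mk * (C + C powr \<gamma>)"
    and "P = \<gamma> / (\<gamma> - 1) * C powr (\<gamma> - 1)" and "D = d * Mk * C"
  have Mk0: "0 \<le> Mk" using Mk(1)[of 0] by linarith
  have nn: "0 \<le> d" "0 \<le> V" "0 \<le> S" "0 \<le> P" "0 \<le> D"
    using Mk0 C c gam by (auto simp: d_def V_def S_def P_def D_def)
  define X1 X2 X3 where "X1 = (\<integral>y. norm (u y) \<partial>torus)" and "X2 = (\<integral>y. (norm (u y))\<^sup>2 \<partial>torus)" and "X3 = (\<integral>y. norm (u y) ^ 3 \<partial>torus)"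
  have iu: "integrable torus (\<lambda>y. norm (u y))" "integrable torus (\<lambda>y. (norm (u y))\<^sup>2)"
    using weighted_integrable[of "\<lambda>y. norm (u y)" torus "\<lambda>_. 1"] u3 by auto
  have X: "0 \<le> X1" "0 \<le> X2" "0 \<le> X3" unfolding X1_def X2_def X3_def
    by (auto intro!: Bochner_Integration.integral_nonneg)
  have X1: "X1 \<le> 1 + X3"
  proof -
    have "X1 \<le> (\<integral>y. 1 + norm (u y) ^ 3 \<partial>torus)" unfolding X1_def
      by (rule integral_mono) (use iu u3 u_pow in auto)
    then show ?thesis using u3 by (simp add: X3_def measure_torus)
  qed
  have X12: "X1 * X2 \<le> 2 * X3"
    using weighted_product[of "\<lambda>y. norm (u y)" torus "\<lambda>y. norm (u y)" "\<lambda>_. 1" 1] u3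
    by (simp add: X1_def X2_def X3_def measure_torus)
  have X11: "X1\<^sup>2 \<le> X2"
    using weighted_Cauchy[of torus "\<lambda>_. 1" 1 "\<lambda>y. norm (u y)"] iu
    by (simp add: X1_def X2_def measure_torus)
  have rho1: "(\<integral>y. \<bar>\<rho> y * u y $ i\<bar> \<partial>torus) \<le> C * X1" for i
  proof -
    have "(\<integral>y. \<bar>\<rho> y * u y $ i\<bar> \<partial>torus) \<le> (\<integral>y. C * norm (u y) \<partial>torus)"
    proof (rule integral_mono)
      show "\<bar>\<rho> y * u y $ i\<bar> \<le> C * norm (u y)" for y
        unfolding abs_mult using rho_ge[of y] rho_le[of y] c component_le_norm_cart[of "u y" i] by (intro mult_mono) auto
    qed (use int_mom iu in auto)
    then show ?thesis by (simp add: X1_def)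
  qed
  have m: "\<bar>cv K (\<lambda>y. \<rho> y * u y $ i) x\<bar> \<le> Mk * (C * X1)" "\<bar>cv (pd j K) (\<lambda>y. \<rho> y * u y $ i) x\<bar> \<le> Mk * (C * X1)" for i j
    using mult_left_mono[OF rho1[of i] Mk0]
    by (auto intro: order_trans[OF periodic_kernel.cv_bound[OF kernel_K int_mom Mk(1)]] order_trans[OF periodic_kernel.cv_bound[OF kernel_pd_K int_mom Mk(2)]])
  have v: "\<bar>favre K \<rho> u i x\<bar> \<le> V * X1" for i
  proof -
    have "\<bar>favre K \<rho> u i x\<bar> \<le> Mk * (C * X1) / c"
      unfolding favre_def abs_divide using m(1)[of i] r_bounds[of x] r_pos[of x] c by (intro frac_le) auto
    then show ?thesis by (simp add: V_def mult.assoc)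
  qed
  have st: "\<bar>stress (pd j K) \<gamma> \<rho> u i j x\<bar> \<le> Mk * (C * X2 + C powr \<gamma>)" for i j
  proof -
    have "(\<integral>y. \<bar>\<rho> y * u y $ i * u y $ j\<bar> \<partial>torus) \<le> (\<integral>y. C * (norm (u y))\<^sup>2 \<partial>torus)"
      by (rule integral_mono) (use int_uu iu abs_rho_uu in auto)
    then have 1: "\<bar>cv (pd j K) (\<lambda>y. \<rho> y * u y $ i * u y $ j) x\<bar> \<le> Mk * (C * X2)"
      using Mk0 by (auto simp: X2_def intro!: order_trans[OF periodic_kernel.cv_bound[OF kernel_pd_K int_uu Mk(2)]] mult_left_mono)
    have "(\<integral>y. \<bar>\<rho> y powr \<gamma>\<bar> \<partial>torus) \<le> (\<integral>y. C powr \<gamma> \<partial>(torus :: (real^'d) measure))"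
    proof (rule integral_mono)
      show "\<bar>\<rho> y powr \<gamma>\<bar> \<le> C powr \<gamma>" for y
        using rho_ge[of y] rho_le[of y] c gam by (auto intro!: powr_mono2)
    qed (use int_p in auto)
    then have 2: "\<bar>cv (pd j K) (\<lambda>y. \<rho> y powr \<gamma>) x\<bar> \<le> Mk * (C powr \<gamma>)"
      using Mk0 by (auto simp: measure_torus intro!: order_trans[OF periodic_kernel.cv_bound[OF kernel_pd_K int_p Mk(2)]] mult_left_mono)
    show ?thesis using 1 2 Mk0 by (auto simp: stress_def distrib_left)
  qed
  have mt: "\<bar>mom_t K \<gamma> \<rho> u i x\<bar> \<le> S * (1 + X2)" for i
  proof -
    have "\<bar>mom_t K \<gamma> \<rho> u i x\<bar> \<le> (\<Sum>j\<in>(UNIV::'d set). Mk * (C * X2 + C powr \<gamma>))"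
      unfolding mom_t_def abs_minus_cancel by (intro order_trans[OF sum_abs] sum_mono st)
    also have "\<dots> = d * Mk * (C * X2 + C powr \<gamma>)" by (simp add: d_def)
    also have "\<dots> \<le> d * Mk * ((C + C powr \<gamma>) * (1 + X2))"
      using Mk0 C X nn by (intro mult_left_mono) (auto simp: algebra_simps)
    finally show ?thesis by (simp add: S_def mult.assoc)
  qed
  have rt: "\<bar>rho_t K \<rho> u x\<bar> \<le> D * X1"
  proof -
    have "\<bar>rho_t K \<rho> u x\<bar> \<le> (\<Sum>j\<in>(UNIV::'d set). Mk * (C * X1))"
      unfolding rho_t_def abs_minus_cancel by (intro order_trans[OF sum_abs] sum_mono m(2))
    then show ?thesis by (simp add: d_def D_def mult.assoc)
  qed
  have X2: "X2 \<le> 1 + X3"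
  proof -
    have "X2 \<le> (\<integral>y. 1 + norm (u y) ^ 3 \<partial>torus)" unfolding X2_def
      by (rule integral_mono) (use iu u3 u_pow in auto)
    then show ?thesis using u3 by (simp add: X3_def measure_torus)
  qed
  have "D * X1 \<le> D * (1 + X3)" using X1 nn by (intro mult_left_mono)
  then show "\<bar>rho_t K \<rho> u x\<bar> \<le> real CARD('d) * Mk * C * (1 + (\<integral>y. norm (u y) ^ 3 \<partial>torus))"
    using rt unfolding D_def d_def X3_def by linarith
  have "1 + X2 \<le> 2 * (1 + X3)" using X2 X by simp
  then have "S * (1 + X2) \<le> S * (2 * (1 + X3))" using nn by (intro mult_left_mono)
  then show "\<bar>mom_t K \<gamma> \<rho> u i x\<bar> \<le> real CARD('d) * Mk * (C + C powr \<gamma>) * (2 * (1 + (\<integral>y. norm (u y) ^ 3 \<partial>torus)))"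
    using mt[of i] unfolding S_def d_def X3_def by linarith
  have 1: "\<bar>\<Sum>i\<in>UNIV. favre K \<rho> u i x * mom_t K \<gamma> \<rho> u i x\<bar> \<le> d * ((V * X1) * (S * (1 + X2)))"
  proof -
    have "\<bar>\<Sum>i\<in>UNIV. favre K \<rho> u i x * mom_t K \<gamma> \<rho> u i x\<bar> \<le> (\<Sum>i\<in>(UNIV::'d set). (V * X1) * (S * (1 + X2)))"
    proof (intro order_trans[OF sum_abs] sum_mono)
      fix i
      show "\<bar>favre K \<rho> u i x * mom_t K \<gamma> \<rho> u i x\<bar> \<le> (V * X1) * (S * (1 + X2))"
        unfolding abs_mult using v mt nn X by (intro mult_mono) auto
    qed
    then show ?thesis by (simp add: d_def)
  qed
  have 2: "0 \<le> (\<Sum>i\<in>UNIV. (favre K \<rho> u i x)\<^sup>2)" "(\<Sum>i\<in>UNIV. (favre K \<rho> u i x)\<^sup>2) \<le> d * (V * X1)\<^sup>2"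
  proof -
    have "(\<Sum>i\<in>UNIV. (favre K \<rho> u i x)\<^sup>2) \<le> (\<Sum>i\<in>(UNIV::'d set). (V * X1)\<^sup>2)"
      using v nn X by (intro sum_mono) (auto simp: abs_le_square_iff[symmetric] abs_mult)
    then show "(\<Sum>i\<in>UNIV. (favre K \<rho> u i x)\<^sup>2) \<le> d * (V * X1)\<^sup>2" by (simp add: d_def)
  qed (simp add: sum_nonneg)
  have 3: "0 \<le> \<gamma> / (\<gamma> - 1) * cv K \<rho> x powr (\<gamma> - 1)" "\<gamma> / (\<gamma> - 1) * cv K \<rho> x powr (\<gamma> - 1) \<le> P"
  proof -
    have g: "0 \<le> \<gamma> / (\<gamma> - 1)" using gam by simp
    have "cv K \<rho> x powr (\<gamma> - 1) \<le> C powr (\<gamma> - 1)"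
      using r_bounds[of x] r_pos[of x] gam by (intro powr_mono2) auto
    then show "\<gamma> / (\<gamma> - 1) * cv K \<rho> x powr (\<gamma> - 1) \<le> P" unfolding P_def using g by (rule mult_left_mono)
    show "0 \<le> \<gamma> / (\<gamma> - 1) * cv K \<rho> x powr (\<gamma> - 1)" by (rule mult_nonneg_nonneg[OF g powr_ge_zero])
  qed
  have 4: "\<bar>(\<gamma> / (\<gamma> - 1) * cv K \<rho> x powr (\<gamma> - 1) - 1/2 * (\<Sum>i\<in>UNIV. (favre K \<rho> u i x)\<^sup>2)) * rho_t K \<rho> u x\<bar>
    \<le> (P + d * (V * X1)\<^sup>2) * (D * X1)"
    unfolding abs_mult[of _ "rho_t K \<rho> u x"] using 2 3 rt nn X by (intro mult_mono) auto
  have "\<bar>energy_t K \<gamma> \<rho> u x\<bar> \<le> d * ((V * X1) * (S * (1 + X2))) + (P + d * (V * X1)\<^sup>2) * (D * X1)"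
    unfolding energy_t_def using 1 4 by linarith
  also have "\<dots> = d * V * S * (X1 + X1 * X2) + P * D * X1 + d * V\<^sup>2 * D * (X1 * X1\<^sup>2)"
    by (simp add: algebra_simps power2_eq_square)
  also have "\<dots> \<le> d * V * S * (3 * (1 + X3)) + P * D * (1 + X3) + (d * V\<^sup>2 * D) * (2 * (1 + X3))"
  proof (intro add_mono mult_left_mono)
    have "X1 + X1 * X2 \<le> (1 + X3) + 2 * X3" by (intro add_mono X1 X12)
    also have "\<dots> \<le> 3 * (1 + X3)" by simp
    finally show "X1 + X1 * X2 \<le> 3 * (1 + X3)" .
    have "X1 * X1\<^sup>2 \<le> X1 * X2" using X11 X by (intro mult_left_mono) auto
    also have "\<dots> \<le> 2 * (1 + X3)" using X12 by simp
    finally show "X1 * X1\<^sup>2 \<le> 2 * (1 + X3)" .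
  qed (use nn X1 in auto)
  also have "\<dots> = (3 * d * V * S + P * D + 2 * (d * V\<^sup>2 * D)) * (1 + X3)" by (simp add: algebra_simps)
  finally show "\<bar>energy_t K \<gamma> \<rho> u x\<bar> \<le> energy_t_const (real CARD('d)) Mk c C \<gamma> * (1 + (\<integral>y. norm (u y) ^ 3 \<partial>torus))"
    unfolding energy_t_const_def V_def S_def P_def D_def d_def X3_def .
qed

end

section \<open>Convergence of the mollified energy\<close>

text \<open>Expressed in density and momentum, because mollification acts linearly on these and the
  energy is jointly convex in them.\<close>

definition energy :: "real \<Rightarrow> real \<Rightarrow> 'v::real_inner \<Rightarrow> real" where
  "energy \<gamma> r m = (m \<bullet> m) / (2 * r) + r powr \<gamma> / (\<gamma> - 1)"

definition cv_mom :: "(real^'d::finite \<Rightarrow> real) \<Rightarrow> (real^'d \<Rightarrow> real) \<Rightarrow> (real^'d \<Rightarrow> real^'d) \<Rightarrow> real^'d \<Rightarrow> real^'d" where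
  "cv_mom k \<rho> u x = (\<chi> i. cv k (\<lambda>y. \<rho> y * u y $ i) x)"

lemma powr_tangent:
  fixes s a \<gamma> :: real
  assumes s: "0 \<le> s" and a: "0 < a" and gam: "1 < \<gamma>"
  shows "a powr \<gamma> + \<gamma> * a powr (\<gamma> - 1) * (s - a) \<le> s powr \<gamma>"
proof (cases "s = 0")
  case True
  have "a powr \<gamma> = a powr (\<gamma> - 1) * a" using a powr_add[of a "\<gamma> - 1" 1] by simp
  then show ?thesis using True gam a by (simp add: algebra_simps)
next
  case False
  have "s powr \<gamma> - a powr \<gamma> \<ge> (\<gamma> * a powr (\<gamma> - 1)) * (s - a)"
  proof (rule convex_on_imp_above_tangent)
    show "convex_on {0<..} (\<lambda>x. x powr \<gamma>)" using gam by (intro powr_convex) simp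
    show "((\<lambda>x. x powr \<gamma>) has_real_derivative \<gamma> * a powr (\<gamma> - 1)) (at a within {0<..})"
      by (rule has_field_derivative_at_within[OF has_real_derivative_powr[OF a]])
    show "a \<in> interior {0<..}" using a by (simp add: interior_open)
  qed (use False s in \<open>auto simp: connected_iff_interval\<close>)
  then show ?thesis by simp
qed

lemma ennreal_integral_le_nn_integral:
  fixes f :: "'a \<Rightarrow> real"
  assumes "integrable M f"
  shows "ennreal (\<integral>x. f x \<partial>M) \<le> (\<integral>\<^sup>+x. ennreal (f x) \<partial>M)"
proof -
  have i: "integrable M (\<lambda>x. max 0 (f x))" using assms by auto
  have "(\<integral>x. f x \<partial>M) \<le> (\<integral>x. max 0 (f x) \<partial>M)"
    by (rule integral_mono) (use assms i in auto)
  then have "ennreal (\<integral>x. f x \<partial>M) \<le> ennreal (\<integral>x. max 0 (f x) \<partial>M)" by (rule ennreal_leI)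
  also have "\<dots> = (\<integral>\<^sup>+x. ennreal (max 0 (f x)) \<partial>M)"
    by (rule nn_integral_eq_integral[symmetric]) (use i in auto)
  also have "\<dots> = (\<integral>\<^sup>+x. ennreal (f x) \<partial>M)"
    by (intro nn_integral_cong) (simp add: max_def ennreal_neg)
  finally show ?thesis .
qed

context mollifier begin

lemma K_meas [measurable]: "K \<in> borel_measurable borel"
  by (rule sm_borel[OF sm_K])

lemma nn_int_K: "(\<integral>\<^sup>+x. ennreal (K (x - y)) \<partial>torus) = 1"
proof -
  have "periodic_x (\<lambda>x. ennreal (K x))" using per_K by (simp add: periodic_x_def)
  then have "(\<integral>\<^sup>+x. ennreal (K (x + (- y))) \<partial>torus) = (\<integral>\<^sup>+x. ennreal (K x) \<partial>torus)"
    by (intro nn_integral_torus_shift) simp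
  also have "\<dots> = ennreal (\<integral>x. K x \<partial>torus)"
  proof (rule nn_integral_eq_integral)
    show "integrable torus K"
      using int_K not_integrable_integral_eq[of torus K] by force
  qed (use K_nonneg in auto)
  finally show ?thesis by (simp add: int_K)
qed

lemma nn_int_kap: "(\<integral>\<^sup>+z. ennreal (\<kappa> z) \<partial>torus) \<le> ennreal B"
proof -
  obtain M where "\<And>z. \<bar>\<kappa> z\<bar> \<le> M" using kap_bound by metis
  then have "integrable torus \<kappa>" by (intro integrable_torus_bounded[of _ M]) auto
  then have "(\<integral>\<^sup>+z. ennreal (\<kappa> z) \<partial>torus) = ennreal (\<integral>z. \<kappa> z \<partial>torus)"
    by (rule nn_integral_eq_integral) (use kap_nonneg in auto)
  then show ?thesis using int_kap by (simp add: ennreal_leI)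
qed

text \<open>Jensen's inequality. An affine minorant of the energy that touches at the mollified
  state is reproduced exactly by convolution with a kernel of mass 1. Only the minorant has to be
  integrable, so the right-hand side may be infinite.\<close>

lemma energy_cv_le:
  fixes \<rho> :: "real^'d \<Rightarrow> real" and u :: "real^'d \<Rightarrow> real^'d"
  assumes [measurable]: "\<rho> \<in> borel_measurable borel" "u \<in> borel_measurable borel"
    and nn: "\<And>y. 0 \<le> \<rho> y" and i: "integrable torus \<rho>" "\<And>i. integrable torus (\<lambda>y. \<rho> y * u y $ i)"
    and pos: "0 < cv K \<rho> x" and gam: "1 < \<gamma>"
  shows "ennreal (energy \<gamma> (cv K \<rho> x) (cv_mom K \<rho> u x))
    \<le> (\<integral>\<^sup>+y. ennreal (K (x - y)) * ennreal (1/2 * \<rho> y * (norm (u y))\<^sup>2 + \<rho> y powr \<gamma> / (\<gamma> - 1)) \<partial>torus)"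
proof -
  define R where "R = cv K \<rho> x"
  define m where "m = cv_mom K \<rho> u x"
  define v where "v = m /\<^sub>R R"
  have R: "R > 0" using pos by (simp add: R_def)
  define P where "P = R powr \<gamma> / (\<gamma> - 1)"
  define P' where "P' = \<gamma> * R powr (\<gamma> - 1) / (\<gamma> - 1)"
  define A where "A = P' - 1/2 * (v \<bullet> v)"
  \<comment> \<open>The tangent plane of the energy at (R, m), evaluated at the state (\<rho> y,
    \<rho> y * u y): its slope is v in the momentum and A in the density.\<close>
  define g where "g y = (\<Sum>i\<in>UNIV. v $ i * (\<rho> y * u y $ i)) + A * \<rho> y + (P - P' * R)" for y
  have ig: "integrable torus g" unfolding g_def[abs_def] using i by auto
  have gle: "g y \<le> 1/2 * \<rho> y * (norm (u y))\<^sup>2 + \<rho> y powr \<gamma> / (\<gamma> - 1)" for y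
  proof -
    have "0 \<le> 1/2 * \<rho> y * ((u y - v) \<bullet> (u y - v))" using nn by simp
    also have "\<dots> = 1/2 * \<rho> y * (norm (u y))\<^sup>2 - \<rho> y * (v \<bullet> u y) + 1/2 * (v \<bullet> v) * \<rho> y"
      by (simp add: inner_diff inner_commute power2_norm_eq_inner algebra_simps)
    also have "\<rho> y * (v \<bullet> u y) = (\<Sum>i\<in>UNIV. v $ i * (\<rho> y * u y $ i))"
      by (simp add: inner_vec_def sum_distrib_left algebra_simps)
    finally have 1: "(\<Sum>i\<in>UNIV. v $ i * (\<rho> y * u y $ i)) - 1/2 * (v \<bullet> v) * \<rho> y \<le> 1/2 * \<rho> y * (norm (u y))\<^sup>2" by simp
    have "(R powr \<gamma> + \<gamma> * R powr (\<gamma> - 1) * (\<rho> y - R)) / (\<gamma> - 1) \<le> \<rho> y powr \<gamma> / (\<gamma> - 1)"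
      using powr_tangent[OF nn R gam] gam by (intro divide_right_mono) auto
    moreover have "(R powr \<gamma> + \<gamma> * R powr (\<gamma> - 1) * (\<rho> y - R)) / (\<gamma> - 1) = P + P' * (\<rho> y - R)"
      by (simp add: P_def P'_def add_divide_distrib)
    ultimately show ?thesis using 1 by (simp add: g_def A_def algebra_simps)
  qed
  have "(\<integral>y. K (x - y) * g y \<partial>torus) = (\<Sum>i\<in>UNIV. v $ i * m $ i) + A * R + (P - P' * R)"
  proof -
    have "(\<integral>y. K (x - y) * g y \<partial>torus) = (\<integral>y. (\<Sum>i\<in>UNIV. v $ i * (K (x - y) * (\<rho> y * u y $ i)))
        + A * (K (x - y) * \<rho> y) + (P - P' * R) * K (x - y) \<partial>torus)"
      by (rule Bochner_Integration.integral_cong) (auto simp: g_def algebra_simps sum_distrib_left)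
    also have "\<dots> = (\<Sum>i\<in>UNIV. v $ i * m $ i) + A * R + (P - P' * R) * 1"
    proof -
      have "integrable torus (\<lambda>y. K (x - y))" using cvK_integrable[of "\<lambda>_. 1"] by simp
      then show ?thesis using i int_K_shift[of x]
        by (simp add: cvK_integrable R_def m_def cv_def cv_mom_def)
    qed
    finally show ?thesis by simp
  qed
  also have "(\<Sum>i\<in>UNIV. v $ i * m $ i) = v \<bullet> m" by (simp add: inner_vec_def)
  also have "v \<bullet> m + A * R + (P - P' * R) = energy \<gamma> R m"
    using R by (simp add: v_def A_def energy_def P_def field_simps)
  finally have e: "energy \<gamma> R m = (\<integral>y. K (x - y) * g y \<partial>torus)" by simp
  have "ennreal (energy \<gamma> R m) \<le> (\<integral>\<^sup>+y. ennreal (K (x - y) * g y) \<partial>torus)"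
    unfolding e by (rule ennreal_integral_le_nn_integral) (rule cvK_integrable[OF ig])
  also have "\<dots> \<le> (\<integral>\<^sup>+y. ennreal (K (x - y)) * ennreal (1/2 * \<rho> y * (norm (u y))\<^sup>2 + \<rho> y powr \<gamma> / (\<gamma> - 1)) \<partial>torus)"
  proof (rule nn_integral_mono)
    fix y
    have "ennreal (K (x - y) * g y) \<le> ennreal (K (x - y) * (1/2 * \<rho> y * (norm (u y))\<^sup>2 + \<rho> y powr \<gamma> / (\<gamma> - 1)))"
      using gle[of y] K_nonneg by (intro ennreal_leI mult_left_mono)
    also have "\<dots> = ennreal (K (x - y)) * ennreal (1/2 * \<rho> y * (norm (u y))\<^sup>2 + \<rho> y powr \<gamma> / (\<gamma> - 1))"
      using K_nonneg by (rule ennreal_mult')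
    finally show "ennreal (K (x - y) * g y) \<le> \<dots>" .
  qed
  finally show ?thesis by (simp add: R_def m_def)
qed

lemma nn_integral_energy_cv_le:
  fixes \<rho> :: "real^'d \<Rightarrow> real" and u :: "real^'d \<Rightarrow> real^'d"
  assumes [measurable]: "\<rho> \<in> borel_measurable borel" "u \<in> borel_measurable borel"
    and nn: "\<And>y. 0 \<le> \<rho> y" and i: "integrable torus \<rho>" "\<And>i. integrable torus (\<lambda>y. \<rho> y * u y $ i)"
    and pos: "\<And>x. 0 < cv K \<rho> x" and gam: "1 < \<gamma>"
  shows "(\<integral>\<^sup>+x. ennreal (energy \<gamma> (cv K \<rho> x) (cv_mom K \<rho> u x)) \<partial>torus)
    \<le> (\<integral>\<^sup>+y. ennreal (1/2 * \<rho> y * (norm (u y))\<^sup>2 + \<rho> y powr \<gamma> / (\<gamma> - 1)) \<partial>torus)"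
proof -
  interpret pair_sigma_finite "torus :: (real^'d) measure" "torus :: (real^'d) measure" ..
  define e where "e y = ennreal (1/2 * \<rho> y * (norm (u y))\<^sup>2 + \<rho> y powr \<gamma> / (\<gamma> - 1))" for y
  have [measurable]: "e \<in> borel_measurable borel" unfolding e_def by measurable
  have "(\<integral>\<^sup>+x. ennreal (energy \<gamma> (cv K \<rho> x) (cv_mom K \<rho> u x)) \<partial>torus)
    \<le> (\<integral>\<^sup>+x. (\<integral>\<^sup>+y. ennreal (K (x - y)) * e y \<partial>torus) \<partial>torus)"
    unfolding e_def by (intro nn_integral_mono energy_cv_le assms)
  also have "\<dots> = (\<integral>\<^sup>+y. (\<integral>\<^sup>+x. ennreal (K (x - y)) * e y \<partial>torus) \<partial>torus)"
    by (rule Fubini'[symmetric]) measurable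
  also have "\<dots> = (\<integral>\<^sup>+y. e y \<partial>torus)" by (simp add: nn_integral_multc nn_int_K)
  finally show ?thesis by (simp add: e_def)
qed

text \<open>As K has mass 1, the error is a K-average of f y - f x; passing to \<kappa>, whose
  support is known, costs only the factor B.\<close>

lemma cv_L1_dist:
  assumes [measurable]: "f \<in> borel_measurable borel" and per: "periodic_x f" and f: "integrable torus f"
    and \<eta>: "\<And>h. norm h \<le> CARD('d) * \<epsilon> \<Longrightarrow> (\<integral>\<^sup>+x. ennreal \<bar>f (x + h) - f x\<bar> \<partial>torus) \<le> ennreal \<eta>"
  shows "(\<integral>\<^sup>+x. ennreal \<bar>cv K f x - f x\<bar> \<partial>torus) \<le> ennreal B * ennreal \<eta>"
proof -
  have "(\<integral>\<^sup>+x. ennreal \<bar>cv K f x - f x\<bar> \<partial>torus)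
      \<le> (\<integral>\<^sup>+x. \<integral>\<^sup>+y. ennreal (\<kappa> (x - y)) * ennreal \<bar>f y - f x\<bar> \<partial>torus \<partial>torus)"
  proof (rule nn_integral_mono)
    fix x
    have i: "integrable torus (\<lambda>y. K (x - y))" using cvK_integrable[of "\<lambda>_. 1"] by simp
    have "cv K f x - f x = (\<integral>y. K (x - y) * f y - K (x - y) * f x \<partial>torus)"
      using cvK_integrable[OF f, of x] int_K_shift[of x] i by (simp add: cv_def)
    also have "ennreal \<bar>\<dots>\<bar> \<le> (\<integral>\<^sup>+y. ennreal (norm (K (x - y) * f y - K (x - y) * f x)) \<partial>torus)"
      using integral_norm_bound_ennreal[of torus "\<lambda>y. K (x - y) * f y - K (x - y) * f x"] cvK_integrable[OF f, of x] i by simp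
    also have "\<dots> \<le> (\<integral>\<^sup>+y. ennreal (\<kappa> (x - y)) * ennreal \<bar>f y - f x\<bar> \<partial>torus)"
    proof (rule nn_integral_mono)
      fix y
      have "norm (K (x - y) * f y - K (x - y) * f x) = K (x - y) * \<bar>f y - f x\<bar>"
        using K_nonneg by (simp add: abs_mult flip: right_diff_distrib)
      also have "\<dots> \<le> \<kappa> (x - y) * \<bar>f y - f x\<bar>" using K_le by (intro mult_right_mono) auto
      finally show "ennreal (norm (K (x - y) * f y - K (x - y) * f x)) \<le> ennreal (\<kappa> (x - y)) * ennreal \<bar>f y - f x\<bar>"
        using kap_nonneg by (simp add: ennreal_mult[symmetric] ennreal_leI)
    qed
    finally show "ennreal \<bar>cv K f x - f x\<bar> \<le> (\<integral>\<^sup>+y. ennreal (\<kappa> (x - y)) * ennreal \<bar>f y - f x\<bar> \<partial>torus)" .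
  qed
  also have "\<dots> \<le> ennreal B * ennreal \<eta>"
  proof (rule torus_average[where R="CARD('d) * \<epsilon>"])
    show "periodic_x (\<lambda>z. ennreal (\<kappa> z))" using per_kap by (simp add: periodic_x_def)
    show "periodic_x (\<lambda>y. ennreal \<bar>f y - f x\<bar>)" for x using per by (simp add: periodic_x_def)
    show "\<exists>k. norm (z - lat k) \<le> CARD('d) * \<epsilon>" if "ennreal (\<kappa> z) \<noteq> 0" for z
      using kap_supp[of z] that by force
    show "(\<integral>\<^sup>+x. ennreal \<bar>f (x - h) - f x\<bar> \<partial>torus) \<le> ennreal \<eta>" if "norm h \<le> CARD('d) * \<epsilon>" for h
      using \<eta>[of "- h"] that by simp
    show "(\<integral>\<^sup>+z. ennreal (\<kappa> z) \<partial>torus) \<le> ennreal B" by (rule nn_int_kap)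
  qed measurable
  finally show ?thesis .
qed

end

text \<open>Upper bound by Jensen's inequality, lower bound by Fatou's lemma. No integrability of the energy
  is assumed, since at the initial time none is available.\<close>

lemma energy_convergence:
  fixes \<rho> :: "real^'d::finite \<Rightarrow> real" and u :: "real^'d \<Rightarrow> real^'d"
  assumes moll: "\<And>n. mollifier (\<epsilon> n) B (K n) (\<kappa> n)" and eps: "\<epsilon> \<longlonglongrightarrow> 0"
    and meas [measurable]: "\<rho> \<in> borel_measurable borel" "u \<in> borel_measurable borel"
    and per: "periodic_x \<rho>" "periodic_x u"
    and nn: "\<And>y. 0 \<le> \<rho> y" and i: "integrable torus \<rho>" "\<And>i. integrable torus (\<lambda>y. \<rho> y * u y $ i)"
    and c: "0 < c" "\<And>n x. c \<le> cv (K n) \<rho> x" and gam: "1 < \<gamma>"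
  shows "\<exists>s. strict_mono s \<and>
    (\<lambda>n. \<integral>\<^sup>+x. ennreal (energy \<gamma> (cv (K (s n)) \<rho> x) (cv_mom (K (s n)) \<rho> u x)) \<partial>torus)
    \<longlonglongrightarrow> (\<integral>\<^sup>+y. ennreal (1/2 * \<rho> y * (norm (u y))\<^sup>2 + \<rho> y powr \<gamma> / (\<gamma> - 1)) \<partial>torus)"
proof -
  have um [measurable]: "(\<lambda>x. u x $ i) \<in> borel_measurable borel" for i
    by (rule measurable_compose[OF meas(2)]) (intro borel_measurable_continuous_onI continuous_intros)
  have cvm: "cv (K n) f \<in> borel_measurable borel" if "integrable torus f" for n f
    using mollifier.cv_cont(1)[OF moll that, of UNIV] by (rule borel_measurable_continuous_onI)
  have L1: "(\<lambda>n. \<integral>x. \<bar>cv (K n) f x - f x\<bar> \<partial>torus) \<longlonglongrightarrow> 0" and L1i: "\<And>n. integrable torus (\<lambda>x. \<bar>cv (K n) f x - f x\<bar>)"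
    if fm [measurable]: "f \<in> borel_measurable borel" and perf: "periodic_x f" and f: "integrable torus f" for f
  proof -
    have [measurable]: "cv (K n) f \<in> borel_measurable borel" for n by (rule cvm[OF f])
    show ci: "integrable torus (\<lambda>x. \<bar>cv (K n) f x - f x\<bar>)" for n
    proof -
      have "periodic_x (cv (K n) f)" using mollifier.cv_per(1)[OF moll] by (simp add: periodic_x_def)
      then obtain M where "\<And>x. \<bar>cv (K n) f x\<bar> \<le> M"
        using periodic_continuous_bounded[OF mollifier.cv_cont(1)[OF moll f]] by metis
      then have "integrable torus (cv (K n) f)" by (intro integrable_torus_bounded[of _ M]) auto
      then show ?thesis using f by auto
    qed
    have B: "B \<ge> 0" using mollifier.B_nonneg[OF moll] by blast
    show "(\<lambda>n. \<integral>x. \<bar>cv (K n) f x - f x\<bar> \<partial>torus) \<longlonglongrightarrow> 0"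
    proof (rule LIMSEQ_I)
      fix r :: real assume r: "r > 0"
      define \<eta> where "\<eta> = r / (2 * (B + 1))"
      have \<eta>: "\<eta> > 0" using r B by (simp add: \<eta>_def)
      obtain \<delta> where \<delta>: "\<delta> > 0" "\<And>h. norm h < \<delta> \<Longrightarrow> (\<integral>\<^sup>+x. ennreal \<bar>f (x + h) - f x\<bar> \<partial>torus) \<le> ennreal \<eta>"
        using torus_L1_translation[OF fm perf f \<eta>] by blast
      have "(\<lambda>n. CARD('d) * \<epsilon> n) \<longlonglongrightarrow> 0" by (rule tendsto_mult_right_zero[OF eps])
      then have "\<forall>\<^sub>F n in sequentially. CARD('d) * \<epsilon> n < \<delta>" using \<delta>(1) by (intro order_tendstoD) auto
      then obtain N where N: "\<And>n. n \<ge> N \<Longrightarrow> CARD('d) * \<epsilon> n < \<delta>" by (auto simp: eventually_sequentially)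
      have "norm ((\<integral>x. \<bar>cv (K n) f x - f x\<bar> \<partial>torus) - 0) < r" if n: "n \<ge> N" for n
      proof -
        have "ennreal (\<integral>x. \<bar>cv (K n) f x - f x\<bar> \<partial>torus) = (\<integral>\<^sup>+x. ennreal \<bar>cv (K n) f x - f x\<bar> \<partial>torus)"
          by (rule nn_integral_eq_integral[symmetric]) (use ci in auto)
        also have "\<dots> \<le> ennreal B * ennreal \<eta>"
        proof (rule mollifier.cv_L1_dist[OF moll fm perf f])
          fix h :: "real^'d" assume "norm h \<le> CARD('d) * \<epsilon> n"
          then show "(\<integral>\<^sup>+x. ennreal \<bar>f (x + h) - f x\<bar> \<partial>torus) \<le> ennreal \<eta>" using N[OF n] by (intro \<delta>) simp
        qed
        also have "\<dots> = ennreal (B * \<eta>)" using B \<eta> by (simp add: ennreal_mult)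
        finally have "(\<integral>x. \<bar>cv (K n) f x - f x\<bar> \<partial>torus) \<le> B * \<eta>" using B \<eta> by (simp add: ennreal_le_iff)
        also have "\<dots> < r" using r B by (simp add: \<eta>_def field_simps add_nonneg_pos)
        finally show ?thesis by simp
      qed
      then show "\<exists>no. \<forall>n\<ge>no. norm ((\<integral>x. \<bar>cv (K n) f x - f x\<bar> \<partial>torus) - 0) < r" by blast
    qed
  qed
  have perm: "periodic_x (\<lambda>y. \<rho> y * u y $ i)" for i using per by (simp add: periodic_x_def)
  \<comment> \<open>Density and all momentum components share one error function, so that a single
    subsequence converges almost everywhere for all of them.\<close>
  define D where "D n x = \<bar>cv (K n) \<rho> x - \<rho> x\<bar> + (\<Sum>i\<in>UNIV. \<bar>cv (K n) (\<lambda>y. \<rho> y * u y $ i) x - \<rho> x * u x $ i\<bar>)" for n x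
  have "\<exists>s. strict_mono s \<and> (AE x in torus. (\<lambda>n. D (s n) x) \<longlonglongrightarrow> 0)"
  proof (rule tendsto_L1_AE_subseq)
    show "integrable torus (D n)" for n
      unfolding D_def using L1i[OF _ per(1) i(1)] L1i[OF _ perm i(2)] by auto
    have "(\<lambda>n. (\<integral>x. \<bar>cv (K n) \<rho> x - \<rho> x\<bar> \<partial>torus) + (\<Sum>i\<in>UNIV. \<integral>x. \<bar>cv (K n) (\<lambda>y. \<rho> y * u y $ i) x - \<rho> x * u x $ i\<bar> \<partial>torus)) \<longlonglongrightarrow> 0 + (\<Sum>i\<in>(UNIV::'d set). 0)"
      by (intro tendsto_add tendsto_sum L1[OF _ per(1) i(1)] L1[OF _ perm i(2)]) measurable
    moreover have "(\<integral>x. norm (D n x) \<partial>torus) = (\<integral>x. \<bar>cv (K n) \<rho> x - \<rho> x\<bar> \<partial>torus) + (\<Sum>i\<in>UNIV. \<integral>x. \<bar>cv (K n) (\<lambda>y. \<rho> y * u y $ i) x - \<rho> x * u x $ i\<bar> \<partial>torus)" for n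
    proof -
      have "norm (D n x) = D n x" for x by (auto simp: D_def intro!: add_nonneg_nonneg sum_nonneg)
      then show ?thesis unfolding D_def using L1i[OF _ per(1) i(1)] L1i[OF _ perm i(2)] by simp
    qed
    ultimately show "(\<lambda>n. \<integral>x. norm (D n x) \<partial>torus) \<longlonglongrightarrow> 0" by simp
  qed
  then obtain s where s: "strict_mono s" "AE x in torus. (\<lambda>n. D (s n) x) \<longlonglongrightarrow> 0" by blast
  define e where "e y = ennreal (1/2 * \<rho> y * (norm (u y))\<^sup>2 + \<rho> y powr \<gamma> / (\<gamma> - 1))" for y
  define en where "en n x = ennreal (energy \<gamma> (cv (K (s n)) \<rho> x) (cv_mom (K (s n)) \<rho> u x))" for n x
  have en_lim: "AE x in torus. (\<lambda>n. en n x) \<longlonglongrightarrow> e x"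
    using s(2)
  proof eventually_elim
    case (elim x)
    have 1: "(\<lambda>n. cv (K (s n)) \<rho> x - \<rho> x) \<longlonglongrightarrow> 0"
    proof (rule Lim_null_comparison[OF _ elim])
      show "\<forall>\<^sub>F n in sequentially. norm (cv (K (s n)) \<rho> x - \<rho> x) \<le> D (s n) x"
        by (intro always_eventually allI) (auto simp: D_def intro!: sum_nonneg)
    qed
    then have r: "(\<lambda>n. cv (K (s n)) \<rho> x) \<longlonglongrightarrow> \<rho> x" by (simp add: LIM_zero_iff)
    have m: "(\<lambda>n. cv_mom (K (s n)) \<rho> u x) \<longlonglongrightarrow> \<rho> x *\<^sub>R u x"
    proof (rule vec_tendstoI)
      fix i
      have "(\<lambda>n. cv (K (s n)) (\<lambda>y. \<rho> y * u y $ i) x - \<rho> x * u x $ i) \<longlonglongrightarrow> 0"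
      proof (rule Lim_null_comparison[OF _ elim])
        show "\<forall>\<^sub>F n in sequentially. norm (cv (K (s n)) (\<lambda>y. \<rho> y * u y $ i) x - \<rho> x * u x $ i) \<le> D (s n) x"
        proof (intro always_eventually allI)
          fix n
          have "\<bar>cv (K (s n)) (\<lambda>y. \<rho> y * u y $ i) x - \<rho> x * u x $ i\<bar>
            \<le> (\<Sum>i\<in>UNIV. \<bar>cv (K (s n)) (\<lambda>y. \<rho> y * u y $ i) x - \<rho> x * u x $ i\<bar>)"
            by (rule member_le_sum) auto
          then show "norm (cv (K (s n)) (\<lambda>y. \<rho> y * u y $ i) x - \<rho> x * u x $ i) \<le> D (s n) x" by (simp add: D_def)
        qed
      qed
      then show "(\<lambda>n. cv_mom (K (s n)) \<rho> u x $ i) \<longlonglongrightarrow> (\<rho> x *\<^sub>R u x) $ i" by (simp add: LIM_zero_iff cv_mom_def)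
    qed
    \<comment> \<open>For the initial density this bound is available only through its
      mollifications.\<close>
    have rc: "c \<le> \<rho> x" using LIMSEQ_le_const[OF r] c(2) by blast
    then have "(\<lambda>n. energy \<gamma> (cv (K (s n)) \<rho> x) (cv_mom (K (s n)) \<rho> u x)) \<longlonglongrightarrow> energy \<gamma> (\<rho> x) (\<rho> x *\<^sub>R u x)"
      unfolding energy_def using c(1) gam by (intro tendsto_intros r m) auto
    moreover have "energy \<gamma> (\<rho> x) (\<rho> x *\<^sub>R u x) = 1/2 * \<rho> x * (norm (u x))\<^sup>2 + \<rho> x powr \<gamma> / (\<gamma> - 1)"
      using rc c(1) by (simp add: energy_def power2_norm_eq_inner)
    ultimately show ?case unfolding en_def e_def by (intro tendsto_ennrealI) simp
  qed
  have [measurable]: "en n \<in> borel_measurable borel" for n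
  proof -
    have [measurable]: "cv (K (s n)) \<rho> \<in> borel_measurable borel" by (rule cvm[OF i(1)])
    have "continuous_on UNIV (cv_mom (K (s n)) \<rho> u)"
      unfolding cv_mom_def by (intro continuous_on_vec_lambda mollifier.cv_cont(1)[OF moll i(2)])
    then have [measurable]: "cv_mom (K (s n)) \<rho> u \<in> borel_measurable borel" by (rule borel_measurable_continuous_onI)
    show ?thesis unfolding en_def energy_def by measurable
  qed
  have "(\<integral>\<^sup>+x. e x \<partial>torus) = (\<integral>\<^sup>+x. liminf (\<lambda>n. en n x) \<partial>torus)"
    by (rule nn_integral_cong_AE) (use en_lim in \<open>eventually_elim, simp add: lim_imp_Liminf\<close>)
  also have "\<dots> \<le> liminf (\<lambda>n. \<integral>\<^sup>+x. en n x \<partial>torus)" by (rule nn_integral_liminf) simp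
  finally have low: "(\<integral>\<^sup>+x. e x \<partial>torus) \<le> liminf (\<lambda>n. \<integral>\<^sup>+x. en n x \<partial>torus)" .
  have up: "(\<integral>\<^sup>+x. en n x \<partial>torus) \<le> (\<integral>\<^sup>+x. e x \<partial>torus)" for n
    unfolding en_def e_def
  proof (rule mollifier.nn_integral_energy_cv_le[OF moll meas nn i _ gam])
    show "0 < cv (K (s n)) \<rho> x" for x using c(2)[of "s n" x] c(1) by linarith
  qed
  have "limsup (\<lambda>n. \<integral>\<^sup>+x. en n x \<partial>torus) \<le> (\<integral>\<^sup>+x. e x \<partial>torus)"
    by (rule Limsup_bounded) (use up in auto)
  then have "(\<lambda>n. \<integral>\<^sup>+x. en n x \<partial>torus) \<longlonglongrightarrow> (\<integral>\<^sup>+x. e x \<partial>torus)"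
    using low Liminf_le_Limsup[of sequentially "\<lambda>n. \<integral>\<^sup>+x. en n x \<partial>torus"]
    by (subst tendsto_iff_Liminf_eq_Limsup) auto
  then show ?thesis using s(1) unfolding en_def e_def by blast
qed

section \<open>The energy balance\<close>

definition time :: "real \<Rightarrow> real measure" where
  "time T = density lborel (indicator {0<..<T})"

lemma sets_time [measurable_cong, simp]: "sets (time T) = sets borel"
  by (simp add: time_def)

lemma space_time [simp]: "space (time T) = UNIV"
  by (simp add: time_def)

interpretation time: finite_measure "time T" for T
  by standard (cases "0 \<le> T"; simp add: time_def emeasure_density)

lemma AE_time: "(AE t in time T. P t) \<longleftrightarrow> (AE t in lborel. t \<in> {0<..<T} \<longrightarrow> P t)"
  unfolding time_def by (subst AE_density) (auto simp: indicator_def)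

lemma time_alt: "time T = density lborel (\<lambda>x. ennreal (indicator {0<..<T} x))"
  by (simp add: time_def ennreal_indicator)

lemma integral_time:
  fixes f :: "_ \<Rightarrow> _::{banach, second_countable_topology}"
  shows "f \<in> borel_measurable borel \<Longrightarrow> (\<integral>t. f t \<partial>time T) = (LINT t:{0<..<T}|lborel. f t)"
  by (simp add: time_alt integral_density set_lebesgue_integral_def)

lemma integrable_time:
  fixes f :: "_ \<Rightarrow> _::{banach, second_countable_topology}"
  shows "f \<in> borel_measurable borel \<Longrightarrow> integrable (time T) f \<longleftrightarrow> set_integrable lborel {0<..<T} f"
  by (simp add: time_alt integrable_density set_integrable_def)

lemma nn_integral_time:
  "f \<in> borel_measurable borel \<Longrightarrow> (\<integral>\<^sup>+t. f t \<partial>time T) = (\<integral>\<^sup>+t. f t * indicator {0<..<T} t \<partial>lborel)"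
  by (simp add: time_def nn_integral_density mult.commute)

text \<open>For \<gamma> < 2 the second derivative is singular at 0, and c > 0 keeps it bounded.
  \<open>max M 0\<close> provides a nonnegative constant even if the interval from c to C is
  empty.\<close>

lemma powr_taylor:
  fixes c C \<gamma> :: real
  assumes c: "0 < c"
  obtains M where "0 \<le> M" "\<And>s a. \<lbrakk>c \<le> s; s \<le> C; c \<le> a; a \<le> C\<rbrakk> \<Longrightarrow>
    \<bar>s powr \<gamma> - a powr \<gamma> - \<gamma> * a powr (\<gamma> - 1) * (s - a)\<bar> \<le> M * (s - a)\<^sup>2"
proof -
  have "compact ((\<lambda>x. \<gamma> * ((\<gamma> - 1) * x powr (\<gamma> - 2))) ` {c..C})"
    using c by (intro compact_continuous_image continuous_intros) auto
  then obtain M where M: "\<And>x. c \<le> x \<Longrightarrow> x \<le> C \<Longrightarrow> \<bar>\<gamma> * ((\<gamma> - 1) * x powr (\<gamma> - 2))\<bar> \<le> M"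
  proof -
    assume "compact ((\<lambda>x. \<gamma> * ((\<gamma> - 1) * x powr (\<gamma> - 2))) ` {c..C})"
    then have "bounded ((\<lambda>x. \<gamma> * ((\<gamma> - 1) * x powr (\<gamma> - 2))) ` {c..C})" by (rule compact_imp_bounded)
    then obtain M where "\<forall>y\<in>(\<lambda>x. \<gamma> * ((\<gamma> - 1) * x powr (\<gamma> - 2))) ` {c..C}. norm y \<le> M"
      unfolding bounded_iff by blast
    then show ?thesis by (intro that[of M]) auto
  qed
  have "\<bar>s powr \<gamma> - a powr \<gamma> - \<gamma> * a powr (\<gamma> - 1) * (s - a)\<bar> \<le> max M 0 * (s - a)\<^sup>2"
    if h: "c \<le> s" "s \<le> C" "c \<le> a" "a \<le> C" for s a
  proof -
    have seg: "c \<le> z \<and> z \<le> C \<and> \<bar>z - a\<bar> \<le> \<bar>s - a\<bar>" if "z \<in> closed_segment a s" for z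
      using that h by (auto simp: closed_segment_eq_real_ivl split: if_splits)
    have b: "\<bar>\<gamma> * z powr (\<gamma> - 1) - \<gamma> * a powr (\<gamma> - 1)\<bar> \<le> max M 0 * \<bar>s - a\<bar>" if z: "z \<in> closed_segment a s" for z
    proof -
      have "norm (\<gamma> * z powr (\<gamma> - 1) - \<gamma> * a powr (\<gamma> - 1)) \<le> max M 0 * norm (z - a)"
      proof (rule field_differentiable_bound[of "{c..C}" "\<lambda>x. \<gamma> * x powr (\<gamma> - 1)" "\<lambda>x. \<gamma> * ((\<gamma> - 1) * x powr (\<gamma> - 2))"])
        fix x assume x: "x \<in> {c..C}"
        have "((\<lambda>x. x powr (\<gamma> - 1)) has_real_derivative (\<gamma> - 1) * x powr (\<gamma> - 2)) (at x)"
          using has_real_derivative_powr[of x "\<gamma> - 1"] x c by simp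
        then show "((\<lambda>x. \<gamma> * x powr (\<gamma> - 1)) has_real_derivative \<gamma> * ((\<gamma> - 1) * x powr (\<gamma> - 2))) (at x within {c..C})"
          by (rule has_field_derivative_at_within[OF DERIV_cmult])
        show "norm (\<gamma> * ((\<gamma> - 1) * x powr (\<gamma> - 2))) \<le> max M 0"
          using M[of x] x by (simp add: le_max_iff_disj)
      next
        show "z \<in> {c..C}" "a \<in> {c..C}" using h seg[OF z] by simp_all
      qed simp
      also have "\<dots> \<le> max M 0 * \<bar>s - a\<bar>" using seg[OF z] by (intro mult_left_mono) auto
      finally show ?thesis by simp
    qed
    have "norm ((s powr \<gamma> - \<gamma> * a powr (\<gamma> - 1) * s) - (a powr \<gamma> - \<gamma> * a powr (\<gamma> - 1) * a)) \<le> (max M 0 * \<bar>s - a\<bar>) * norm (s - a)"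
    proof (rule field_differentiable_bound[of "closed_segment a s" "\<lambda>x. x powr \<gamma> - \<gamma> * a powr (\<gamma> - 1) * x" "\<lambda>x. \<gamma> * x powr (\<gamma> - 1) - \<gamma> * a powr (\<gamma> - 1)"])
      fix x assume x: "x \<in> closed_segment a s"
      have "((\<lambda>x. x powr \<gamma>) has_real_derivative \<gamma> * x powr (\<gamma> - 1)) (at x)"
        using has_real_derivative_powr[of x "\<gamma>"] seg[OF x] c by simp
      then show "((\<lambda>x. x powr \<gamma> - \<gamma> * a powr (\<gamma> - 1) * x) has_real_derivative \<gamma> * x powr (\<gamma> - 1) - \<gamma> * a powr (\<gamma> - 1)) (at x within closed_segment a s)"
        by (intro has_field_derivative_at_within[OF DERIV_diff] DERIV_cmult_Id)
      show "norm (\<gamma> * x powr (\<gamma> - 1) - \<gamma> * a powr (\<gamma> - 1)) \<le> max M 0 * \<bar>s - a\<bar>" using b[OF x] by simp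
    qed auto
    moreover have "(max M 0 * \<bar>s - a\<bar>) * norm (s - a) = max M 0 * (s - a)\<^sup>2"
      by (simp add: power2_eq_square mult.assoc)
    moreover have "(s powr \<gamma> - \<gamma> * a powr (\<gamma> - 1) * s) - (a powr \<gamma> - \<gamma> * a powr (\<gamma> - 1) * a)
      = s powr \<gamma> - a powr \<gamma> - \<gamma> * a powr (\<gamma> - 1) * (s - a)" by (simp add: algebra_simps)
    ultimately show ?thesis by (simp only: real_norm_def)
  qed
  then show ?thesis using that[of "max M 0"] by auto
qed

lemma energy_has_derivative:
  fixes v :: "real \<times> 'v::euclidean_space"
  assumes r: "0 < fst v" and gam: "1 < \<gamma>"
  shows "((\<lambda>v. energy \<gamma> (fst v) (snd v)) has_derivative
    (\<lambda>z. (\<gamma> / (\<gamma> - 1) * fst v powr (\<gamma> - 1) - 1/2 * (snd v \<bullet> snd v) / (fst v)\<^sup>2, (1 / fst v) *\<^sub>R snd v) \<bullet> z)) (at v within H)"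
proof -
  have 0: "((\<lambda>x. x powr \<gamma>) has_derivative (*) (\<gamma> * fst v powr (\<gamma> - 1))) (at (fst v))"
    using has_real_derivative_powr[OF r, of \<gamma>] by (simp add: has_field_derivative_def)
  have 1: "((\<lambda>v::real \<times> 'v. fst v powr \<gamma>) has_derivative (\<lambda>z. fst z * (\<gamma> * fst v powr (\<gamma> - 1)))) (at v within H)"
    using has_derivative_compose[OF has_derivative_fst[OF has_derivative_ident] 0] by (simp add: mult.commute)
  have 2: "((\<lambda>v::real \<times> 'v. snd v \<bullet> snd v) has_derivative (\<lambda>z. snd v \<bullet> snd z + snd z \<bullet> snd v)) (at v within H)"
    by (intro has_derivative_inner has_derivative_snd has_derivative_ident)
  have 3: "((\<lambda>v::real \<times> 'v. (snd v \<bullet> snd v) / (2 * fst v)) has_derivative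
    (\<lambda>z. - (snd v \<bullet> snd v) * (inverse (2 * fst v) * (2 * fst z) * inverse (2 * fst v)) + (snd v \<bullet> snd z + snd z \<bullet> snd v) / (2 * fst v))) (at v within H)"
    using r by (intro has_derivative_divide 2 has_derivative_mult_right has_derivative_fst has_derivative_ident) auto
  have 4: "((\<lambda>v::real \<times> 'v. fst v powr \<gamma> / (\<gamma> - 1)) has_derivative (\<lambda>z. fst z * (\<gamma> * fst v powr (\<gamma> - 1)) / (\<gamma> - 1))) (at v within H)"
    using bounded_linear.has_derivative[OF bounded_linear_divide 1] by simp
  show ?thesis
    unfolding energy_def
    by (rule has_derivative_eq_rhs[OF has_derivative_add[OF 3 4]])
      (use r gam in \<open>auto simp: fun_eq_iff inner_prod_def inner_commute field_simps power2_eq_square\<close>)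
qed

text \<open>Testing with y \<mapsto> K (x - y) turns weak equations into statements about
  convolutions at x. The sign produced by the reflection is the one in front of the sums in
  \<open>rho_t\<close> and \<open>mom_t\<close>.\<close>

lemma pd_reflect:
  assumes "sm K"
  shows "sm (\<lambda>y. K (x - y))" "pd j (\<lambda>y. K (x - y)) y = - pd j K (x - y)"
proof -
  have "sm (\<lambda>y. K (x + - y))"
    by (rule sm_affine[OF assms]) (rule bounded_linear_minus[OF bounded_linear_ident])
  then show s: "sm (\<lambda>y. K (x - y))" by simp
  show "pd j (\<lambda>y. K (x - y)) y = - pd j K (x - y)"
  proof (rule pd_eqI[OF s])
    have 1: "((\<lambda>t. K ((x - y) + t *\<^sub>R axis j 1)) has_real_derivative pd j K (x - y)) (at (- 0))"
      using sm_pd_line[OF assms, of "x - y" j 0] by simp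
    have "((\<lambda>t. K ((x - y) + (- t) *\<^sub>R axis j 1)) has_real_derivative pd j K (x - y) * - 1) (at 0)"
      by (rule DERIV_chain2[where f="\<lambda>t. K ((x - y) + t *\<^sub>R axis j 1)" and g="\<lambda>t. - t", OF 1])
        (auto intro!: derivative_eq_intros)
    then show "((\<lambda>t. K (x - (y + t *\<^sub>R axis j 1))) has_real_derivative - pd j K (x - y)) (at 0)"
      by (simp add: algebra_simps)
  qed
qed

lemma periodic_reflect: "periodic_x f \<Longrightarrow> periodic_x (\<lambda>y. f (x - y))"
proof -
  assume f: "periodic_x f"
  have "f (x - (y + axis i 1)) = f (x - y)" for y i
    using f[unfolded periodic_x_def, rule_format, of "x - (y + axis i 1)" i] by (simp add: algebra_simps)
  then show ?thesis by (simp add: periodic_x_def)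
qed

text \<open>For continuous f the bad set inside (0, T) is open and null, hence empty; the end points
  follow by closure. At t = 0 this transports the lower density bound to the mollified initial
  data.\<close>

lemma AE_ge_imp_ge:
  fixes f :: "real \<Rightarrow> real"
  assumes cont: "continuous_on UNIV f" and ae: "AE t in time T. c \<le> f t" and T: "0 < T" and t: "0 \<le> t" "t \<le> T"
  shows "c \<le> f t"
proof -
  let ?S = "{t \<in> {0<..<T}. f t < c}"
  have "open ?S"
  proof -
    have "?S = {0<..<T} \<inter> {t. f t < c}" by auto
    then show ?thesis using open_Collect_less[OF cont continuous_on_const[of _ c]] by (simp add: open_Int)
  qed
  have "AE t in lebesgue. t \<notin> ?S"
    using ae unfolding AE_time by (intro AE_completion) (auto elim!: eventually_mono)
  then have "?S \<in> null_sets lebesgue"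
    using \<open>open ?S\<close> by (simp add: AE_iff_null_sets)
  then have "negligible ?S" by (simp add: negligible_iff_null_sets)
  then have "?S = {}" using \<open>open ?S\<close> open_not_negligible by blast
  then have "c \<le> f s" if "s \<in> {0<..<T}" for s using that by force
  then show ?thesis
    using continuous_ge_on_closure[of "{0<..<T}" f t c] continuous_on_subset[OF cont] T t by auto
qed

text \<open>Interface between the weak formulation and the energy argument: bounds at every point,
  equations already integrated in time for each fixed smooth periodic kernel, and one joint
  smallness condition on cubic increments. It assumes neither a positive lower bound for \<rho>0 nor
  a finite initial energy.\<close>

locale euler =
  fixes \<rho> :: "real^'d::finite \<Rightarrow> real \<Rightarrow> real" and u :: "real^'d \<Rightarrow> real \<Rightarrow> real^'d"
    and \<rho>0 :: "real^'d \<Rightarrow> real" and u0 :: "real^'d \<Rightarrow> real^'d" and T \<gamma> c C :: real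
  assumes T: "0 < T" and gam: "1 < \<gamma>" and c: "0 < c"
    and rho_meas [measurable]: "case_prod \<rho> \<in> borel_measurable (borel \<Otimes>\<^sub>M borel)"
    and u_meas [measurable]: "case_prod u \<in> borel_measurable (borel \<Otimes>\<^sub>M borel)"
    and rho_per: "periodic_x (\<lambda>x. \<rho> x t)" and u_per: "periodic_x (\<lambda>x. u x t)"
    and rho_ge: "c \<le> \<rho> x t" and rho_le: "\<rho> x t \<le> C"
    and u3: "integrable torus (\<lambda>x. norm (u x t) ^ 3)"
    and u3T: "integrable (time T) (\<lambda>t. \<integral>x. norm (u x t) ^ 3 \<partial>torus)"
    and rho0_meas [measurable]: "\<rho>0 \<in> borel_measurable borel" and u0_meas [measurable]: "u0 \<in> borel_measurable borel"
    and rho0_per: "periodic_x \<rho>0" and u0_per: "periodic_x u0" and rho0_nonneg: "0 \<le> \<rho>0 x"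
    and int0: "integrable torus \<rho>0" "integrable torus (\<lambda>x. \<rho>0 x * u0 x $ i)"
    and mass: "sm k \<Longrightarrow> periodic_x k \<Longrightarrow> AE t in time T. (\<integral>y. \<rho> y t * k y \<partial>torus)
      = (\<integral>y. \<rho>0 y * k y \<partial>torus) + (LINT s:{0<..<t}|lborel. (\<Sum>j\<in>UNIV. \<integral>y. \<rho> y s * u y s $ j * pd j k y \<partial>torus))"
    and momentum: "sm k \<Longrightarrow> periodic_x k \<Longrightarrow> AE t in time T. (\<integral>y. \<rho> y t * u y t $ i * k y \<partial>torus)
      = (\<integral>y. \<rho>0 y * u0 y $ i * k y \<partial>torus) + (LINT s:{0<..<t}|lborel.
          (\<Sum>j\<in>UNIV. \<integral>y. \<rho> y s * u y s $ i * u y s $ j * pd j k y \<partial>torus) + (\<integral>y. \<rho> y s powr \<gamma> * pd i k y \<partial>torus))"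
    and increments: "0 < \<eta> \<Longrightarrow> \<exists>\<delta>>0. \<forall>h. norm h < \<delta> \<longrightarrow>
      (\<integral>\<^sup>+x. \<integral>\<^sup>+t. ennreal (norm (u (x + h) t - u x t) ^ 3 + \<bar>\<rho> (x + h) t - \<rho> x t\<bar> ^ 3) \<partial>time T \<partial>torus) \<le> ennreal (\<eta> * norm h)"
begin

lemma u_comp_meas [measurable]: "(\<lambda>(x, t). u x t $ i) \<in> borel_measurable (borel \<Otimes>\<^sub>M borel)"
proof -
  have "(\<lambda>z. (case_prod u z) $ i) \<in> borel_measurable (borel \<Otimes>\<^sub>M borel)"
    by (rule measurable_compose[OF u_meas]) (intro borel_measurable_continuous_onI continuous_intros)
  then show ?thesis by (simp add: case_prod_beta)
qed

definition cube_norm :: "real \<Rightarrow> real" where "cube_norm t = (\<integral>x. norm (u x t) ^ 3 \<partial>torus)"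

abbreviation "rh t \<equiv> \<lambda>x. \<rho> x t"
abbreviation "vel t \<equiv> \<lambda>x. u x t"

lemma slice_exists: "\<exists>M2\<ge>0. \<forall>\<epsilon> B K \<kappa> t. mollifier \<epsilon> B K \<kappa> \<longrightarrow> slice \<epsilon> B K \<kappa> (rh t) (vel t) c C \<gamma> M2"
proof -
  obtain M2 where "0 \<le> M2" "\<And>s a. \<lbrakk>c \<le> s; s \<le> C; c \<le> a; a \<le> C\<rbrakk> \<Longrightarrow>
    \<bar>s powr \<gamma> - a powr \<gamma> - \<gamma> * a powr (\<gamma> - 1) * (s - a)\<bar> \<le> M2 * (s - a)\<^sup>2"
    using powr_taylor[OF c] by metis
  then show ?thesis
    using c gam rho_ge rho_le u3 by (intro exI[of _ M2]) (auto simp: slice_def slice_axioms_def)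
qed

end

lemma set_integral_time:
  fixes f :: "real \<Rightarrow> real"
  assumes [measurable]: "f \<in> borel_measurable borel" and "t \<le> T"
  shows "(LINT s:{0<..<t}|lborel. f s) = (\<integral>s. indicator {..<t} s * f s \<partial>time T)"
proof -
  have "(\<integral>s. indicator {..<t} s * f s \<partial>time T) = (LINT s:{0<..<T}|lborel. indicator {..<t} s * f s)"
    by (rule integral_time) measurable
  also have "\<dots> = (LINT s:{0<..<t}|lborel. f s)"
    unfolding set_lebesgue_integral_def using assms(2)
    by (intro Bochner_Integration.integral_cong) (auto simp: indicator_def)
  finally show ?thesis by simp
qed

context mollifier begin

lemma kernel_bound: obtains Mk where "\<And>z. \<bar>K z\<bar> \<le> Mk" "\<And>j z. \<bar>pd j K z\<bar> \<le> Mk"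
proof -
  obtain M where M: "M > 0" "\<And>z. \<bar>\<kappa> z\<bar> \<le> M" using kap_bound by metis
  show ?thesis
  proof (rule that[of "max M (M / \<epsilon>)"])
    show "\<bar>K z\<bar> \<le> max M (M / \<epsilon>)" for z
      using K_le[of z] K_nonneg[of z] M(2)[of z] by (auto simp: le_max_iff_disj)
    have "\<kappa> z / \<epsilon> \<le> M / \<epsilon>" for z using M(2)[of z] eps by (intro divide_right_mono) auto
    then show "\<bar>pd j K z\<bar> \<le> max M (M / \<epsilon>)" for j z
      using pd_K_le[of j z] by (meson le_max_iff_disj order_trans)
  qed
qed

end

context euler begin

lemma cube_norm_meas [measurable]: "cube_norm \<in> borel_measurable borel"
  unfolding cube_norm_def by measurable

lemma integrable_time_bound:
  fixes f :: "real \<Rightarrow> real"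
  assumes "f \<in> borel_measurable borel" "\<And>t. \<bar>f t\<bar> \<le> A * (1 + cube_norm t)"
  shows "integrable (time T) f"
proof (rule Bochner_Integration.integrable_bound)
  show "integrable (time T) (\<lambda>t. A * (1 + cube_norm t))"
    using u3T by (auto simp: cube_norm_def)
  show "AE t in time T. norm (f t) \<le> norm (A * (1 + cube_norm t))"
    using assms(2) by (intro AE_I2) (metis abs_ge_self order_trans real_norm_def)
qed (use assms in auto)

context
  fixes \<epsilon> B :: real and K \<kappa> :: "real^'d \<Rightarrow> real"
  assumes moll: "mollifier \<epsilon> B K \<kappa>"
begin

interpretation mollifier \<epsilon> B K \<kappa> by (rule moll)

lemma pd_meas [measurable]: "pd j K \<in> borel_measurable borel"
  by (rule sm_borel[OF sm_pd[OF sm_K]])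

lemma cv_meas:
  assumes [measurable]: "(\<lambda>(y, t). g y t) \<in> borel_measurable (borel \<Otimes>\<^sub>M borel)" "k \<in> borel_measurable borel"
  shows "(\<lambda>z. cv k (\<lambda>y. g y (snd z)) (fst z)) \<in> borel_measurable (borel \<Otimes>\<^sub>M borel)"
  unfolding cv_def by measurable

lemma cv_measurable [measurable]:
  "(\<lambda>z. cv K (rh (snd z)) (fst z)) \<in> borel_measurable (borel \<Otimes>\<^sub>M borel)"
  "(\<lambda>z. cv (pd j K) (rh (snd z)) (fst z)) \<in> borel_measurable (borel \<Otimes>\<^sub>M borel)"
  "(\<lambda>z. cv K (\<lambda>y. \<rho> y (snd z) * u y (snd z) $ i) (fst z)) \<in> borel_measurable (borel \<Otimes>\<^sub>M borel)"
  "(\<lambda>z. cv (pd j K) (\<lambda>y. \<rho> y (snd z) * u y (snd z) $ i) (fst z)) \<in> borel_measurable (borel \<Otimes>\<^sub>M borel)"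
  "(\<lambda>z. cv K (\<lambda>y. \<rho> y (snd z) * u y (snd z) $ i * u y (snd z) $ i') (fst z)) \<in> borel_measurable (borel \<Otimes>\<^sub>M borel)"
  "(\<lambda>z. cv (pd j K) (\<lambda>y. \<rho> y (snd z) * u y (snd z) $ i * u y (snd z) $ i') (fst z)) \<in> borel_measurable (borel \<Otimes>\<^sub>M borel)"
  "(\<lambda>z. cv K (\<lambda>y. \<rho> y (snd z) powr \<gamma>) (fst z)) \<in> borel_measurable (borel \<Otimes>\<^sub>M borel)"
  "(\<lambda>z. cv (pd j K) (\<lambda>y. \<rho> y (snd z) powr \<gamma>) (fst z)) \<in> borel_measurable (borel \<Otimes>\<^sub>M borel)"
  by (rule cv_meas; measurable)+

lemma stress_measurable [measurable]:
  "(\<lambda>z. stress K \<gamma> (rh (snd z)) (vel (snd z)) i j (fst z)) \<in> borel_measurable (borel \<Otimes>\<^sub>M borel)"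
  "(\<lambda>z. stress (pd j' K) \<gamma> (rh (snd z)) (vel (snd z)) i j (fst z)) \<in> borel_measurable (borel \<Otimes>\<^sub>M borel)"
  unfolding stress_def by (cases "i = j"; simp; measurable)+

lemma rho_t_measurable [measurable]:
  "(\<lambda>z. rho_t K (rh (snd z)) (vel (snd z)) (fst z)) \<in> borel_measurable (borel \<Otimes>\<^sub>M borel)"
  unfolding rho_t_def by measurable

lemma mom_t_measurable [measurable]:
  "(\<lambda>z. mom_t K \<gamma> (rh (snd z)) (vel (snd z)) i (fst z)) \<in> borel_measurable (borel \<Otimes>\<^sub>M borel)"
  unfolding mom_t_def by measurable

lemma favre_measurable [measurable]:
  "(\<lambda>z. favre K (rh (snd z)) (vel (snd z)) i (fst z)) \<in> borel_measurable (borel \<Otimes>\<^sub>M borel)"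
  unfolding favre_def by measurable

lemma energy_t_measurable [measurable]:
  "(\<lambda>z. energy_t K \<gamma> (rh (snd z)) (vel (snd z)) (fst z)) \<in> borel_measurable (borel \<Otimes>\<^sub>M borel)"
  unfolding energy_t_def by measurable

lemma slice_meas_t:
  assumes "(\<lambda>z. f (snd z) (fst z)) \<in> borel_measurable (borel \<Otimes>\<^sub>M borel)"
  shows "(\<lambda>t. f t x) \<in> borel_measurable borel"
  using measurable_compose[OF measurable_Pair1'[of x borel borel] assms] by simp

text \<open>The kernel centred at x is one test function, so the exceptional null set of times
  depends on x. The integrated equations provide a continuous path of density-momentum pairs; the
  chain rule applies to it, and it carries the bound \<open>c\<close> back to time 0.\<close>

lemma pointwise_balance:
  shows "c \<le> cv K \<rho>0 x"
    and "AE t in time T. energy \<gamma> (cv K (rh t) x) (cv_mom K (rh t) (vel t) x) = energy \<gamma> (cv K \<rho>0 x) (cv_mom K \<rho>0 u0 x)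
      + (\<integral>s. (if s < t then 1 else 0) * energy_t K \<gamma> (rh s) (vel s) x \<partial>time T)"
proof -
  obtain M2 where sl: "\<And>t. slice \<epsilon> B K \<kappa> (rh t) (vel t) c C \<gamma> M2" using slice_exists moll by blast
  obtain Mk where Mk: "\<And>z. \<bar>K z\<bar> \<le> Mk" "\<And>j z. \<bar>pd j K z\<bar> \<le> Mk" using kernel_bound by metis
  define rt where "rt s = rho_t K (rh s) (vel s) x" for s
  define mt where "mt i s = mom_t K \<gamma> (rh s) (vel s) i x" for i s
  have [measurable]: "rt \<in> borel_measurable borel" unfolding rt_def by (rule slice_meas_t) measurable
  have [measurable]: "mt i \<in> borel_measurable borel" for i unfolding mt_def by (rule slice_meas_t) measurable
  have irt: "integrable (time T) rt"
    unfolding rt_def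
    by (rule integrable_time_bound[OF _ slice.rho_t_bound[OF sl Mk, folded cube_norm_def]]) (fold rt_def, measurable)
  have imt: "integrable (time T) (mt i)" for i
  proof (rule integrable_time_bound)
    show "\<bar>mt i t\<bar> \<le> (real CARD('d) * Mk * (C + C powr \<gamma>) * 2) * (1 + cube_norm t)" for t
      using slice.mom_t_bound[OF sl Mk, of t i x] by (simp add: mt_def cube_norm_def algebra_simps)
  qed measurable
  define e0 :: "real \<times> (real^'d)" where "e0 = (1, 0)"
  define ei :: "'d \<Rightarrow> real \<times> (real^'d)" where "ei i = (0, axis i 1)" for i
  define G where "G s = rt s *\<^sub>R e0 + (\<Sum>i\<in>UNIV. mt i s *\<^sub>R ei i)" for s
  have [measurable]: "G \<in> borel_measurable borel" unfolding G_def by measurable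
  have iG: "integrable (time T) G" unfolding G_def[abs_def]
    by (intro Bochner_Integration.integrable_add Bochner_Integration.integrable_sum integrable_scaleR_left irt imt)
  define g where "g s = indicator {0<..<T} s *\<^sub>R G s" for s
  have ig: "integrable lborel g"
    using iG by (simp add: integrable_time set_integrable_def g_def[abs_def])
  define U0 where "U0 = (cv K \<rho>0 x, cv_mom K \<rho>0 u0 x)"
  \<comment> \<open>The continuous representative of the mollified state \<open>V\<close>; they are
    known to agree for almost every t only.\<close>
  define U where "U t = U0 + (\<integral>s. indicator {..<t} s *\<^sub>R g s \<partial>lborel)" for t
  define V where "V t = (cv K (rh t) x, cv_mom K (rh t) (vel t) x)" for t
  have cU: "continuous_on UNIV U"
    unfolding U_def by (intro continuous_intros continuous_on_integral_lessThan ig)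
  have ind_int: "integrable (time T) (\<lambda>s. indicator {..<t} s * f s)" if "integrable (time T) f" for f :: "real \<Rightarrow> real" and t
    using integrable_mult_indicator[of "{..<t}" "time T" f] that by simp
  have Ueq: "U t = (cv K \<rho>0 x + (\<integral>s. indicator {..<t} s * rt s \<partial>time T),
      \<chi> i. cv_mom K \<rho>0 u0 x $ i + (\<integral>s. indicator {..<t} s * mt i s \<partial>time T))" for t
  proof -
    have "(\<integral>s. indicator {..<t} s *\<^sub>R g s \<partial>lborel) = (\<integral>s. indicator {..<t} s *\<^sub>R G s \<partial>time T)"
      by (simp add: integral_time set_lebesgue_integral_def g_def mult.commute)
    also have "\<dots> = (\<integral>s. (indicator {..<t} s * rt s) *\<^sub>R e0 + (\<Sum>i\<in>UNIV. (indicator {..<t} s * mt i s) *\<^sub>R ei i) \<partial>time T)"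
      by (intro Bochner_Integration.integral_cong) (auto simp: G_def scaleR_add_right scaleR_sum_right)
    also have "\<dots> = (\<integral>s. indicator {..<t} s * rt s \<partial>time T) *\<^sub>R e0
       + (\<Sum>i\<in>UNIV. (\<integral>s. indicator {..<t} s * mt i s \<partial>time T) *\<^sub>R ei i)"
      using ind_int[OF irt] ind_int[OF imt] by simp
    finally show ?thesis
      by (auto simp: U_def U0_def e0_def ei_def prod_eq_iff fst_sum snd_sum vec_eq_iff axis_def if_distrib sum.delta cong: if_cong)
  qed
  have AEU: "AE t in time T. U t = V t"
  proof -
    have kx: "sm (\<lambda>y. K (x - y))" "periodic_x (\<lambda>y. K (x - y))"
      by (rule pd_reflect(1)[OF sm_K], rule periodic_reflect[OF per_K])
    have pdx: "pd j (\<lambda>y. K (x - y)) y = - pd j K (x - y)" for j y by (rule pd_reflect(2)[OF sm_K])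
    have 1: "AE t in time T. cv K (rh t) x = cv K \<rho>0 x + (LINT s:{0<..<t}|lborel. rt s)"
      using mass[OF kx] by (simp add: pdx cv_def rt_def rho_t_def mult.commute sum_negf)
    have "AE t in time T. \<forall>i. cv K (\<lambda>y. \<rho> y t * u y t $ i) x = cv K (\<lambda>y. \<rho>0 y * u0 y $ i) x + (LINT s:{0<..<t}|lborel. mt i s)"
    proof (subst AE_all_countable, intro allI)
      fix i
      have e: "(\<Sum>j\<in>UNIV. \<integral>y. \<rho> y s * u y s $ i * u y s $ j * pd j (\<lambda>y. K (x - y)) y \<partial>torus)
          + (\<integral>y. \<rho> y s powr \<gamma> * pd i (\<lambda>y. K (x - y)) y \<partial>torus) = mt i s" for s
        by (simp add: pdx mt_def mom_t_def stress_def cv_def mult.commute sum_negf sum.distrib)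
      show "AE t in time T. cv K (\<lambda>y. \<rho> y t * u y t $ i) x = cv K (\<lambda>y. \<rho>0 y * u0 y $ i) x + (LINT s:{0<..<t}|lborel. mt i s)"
        using momentum[OF kx, of i] unfolding e by (simp add: cv_def mult.commute)
    qed
    moreover have "AE t in time T. t \<in> {0<..<T}" by (simp add: AE_time)
    ultimately show ?thesis using 1
    proof eventually_elim
      case (elim t)
      then have t: "t \<le> T" by simp
      show ?case using elim set_integral_time[of rt t T] set_integral_time[of "mt _" t T] t
        by (simp add: Ueq V_def cv_mom_def vec_eq_iff)
    qed
  qed
  have Uc: "c \<le> fst (U t)" if "0 \<le> t" "t \<le> T" for t
  proof (rule AE_ge_imp_ge[OF _ _ T that])
    show "continuous_on UNIV (\<lambda>t. fst (U t))" by (intro continuous_intros cU)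
    show "AE t in time T. c \<le> fst (U t)" using AEU
    proof eventually_elim
      case (elim t)
      then show ?case using slice.r_bounds(1)[OF sl[of t], of x] by (simp add: V_def)
    qed
  qed
  have U00: "U 0 = U0"
  proof -
    have "(\<integral>s. indicator {..<0} s *\<^sub>R g s \<partial>lborel) = (\<integral>s. 0 \<partial>(lborel :: real measure))"
      by (rule Bochner_Integration.integral_cong) (auto simp: g_def indicator_def)
    then show ?thesis by (simp add: U_def)
  qed
  show "c \<le> cv K \<rho>0 x" using Uc[of 0] T by (simp add: U00 U0_def)
  \<comment> \<open>The chain rule asks for a compact convex set of states. In the hull of the path
    the density is still at least \<open>c\<close>, since that condition defines a half space, so
    the energy is differentiable on it.\<close>
  define H where "H = convex hull (U ` {0..T})"
  \<comment> \<open>\<open>g\<close> vanishes outside (0, T), so U is constant before 0 and after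
    T.\<close>
  have Uclamp: "U t = U (max 0 (min t T))" for t
    unfolding U_def by (intro arg_cong[of _ _ "(+) U0"] Bochner_Integration.integral_cong) (auto simp: g_def indicator_def)
  have UH: "U t \<in> H" for t
    unfolding H_def using T by (subst Uclamp) (intro hull_inc imageI, auto)
  have cH: "compact H" "convex H"
    unfolding H_def by (auto intro!: compact_convex_hull compact_continuous_image continuous_on_subset[OF cU])
  have Hc: "c \<le> fst v" if "v \<in> H" for v
  proof -
    have "convex (fst -` {c..} :: (real \<times> (real^'d)) set)"
      by (rule convex_linear_vimage) (auto simp: linear_fst)
    then have "H \<subseteq> fst -` {c..}" unfolding H_def using Uc by (intro hull_minimal) auto
    then show ?thesis using that by auto
  qed
  define e where "e v = energy \<gamma> (fst v) (snd v)" for v :: "real \<times> (real^'d)"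
  define grad where "grad v = (\<gamma> / (\<gamma> - 1) * fst v powr (\<gamma> - 1) - 1/2 * (snd v \<bullet> snd v) / (fst v)\<^sup>2, (1 / fst v) *\<^sub>R snd v)" for v :: "real \<times> (real^'d)"
  have der: "(e has_derivative (\<lambda>z. grad v \<bullet> z)) (at v within H)" if "v \<in> H" for v
    unfolding e_def grad_def using Hc[OF that] c gam by (intro energy_has_derivative) auto
  have cg: "continuous_on H grad"
    unfolding grad_def using Hc c by (intro continuous_intros) force+
  have gradV: "grad (V s) \<bullet> G s = energy_t K \<gamma> (rh s) (vel s) x" for s
  proof -
    have "grad (V s) \<bullet> G s = fst (grad (V s)) * rt s + (\<Sum>i\<in>UNIV. mt i s * snd (grad (V s)) $ i)"
      by (simp add: G_def e0_def ei_def inner_add_right inner_sum_right inner_prod_def inner_axis fst_sum snd_sum)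
    then show ?thesis
      by (simp add: grad_def V_def energy_t_def rt_def mt_def cv_mom_def favre_def inner_vec_def
          power2_eq_square sum_divide_distrib sum_distrib_left algebra_simps)
  qed
  have ev: "AE t in time T. t \<in> {0<..<T}" by (simp add: AE_time)
  show "AE t in time T. energy \<gamma> (cv K (rh t) x) (cv_mom K (rh t) (vel t) x) = energy \<gamma> (cv K \<rho>0 x) (cv_mom K \<rho>0 u0 x)
      + (\<integral>s. (if s < t then 1 else 0) * energy_t K \<gamma> (rh s) (vel s) x \<partial>time T)"
    using AEU ev
  proof eventually_elim
    case (elim t)
    note ch = chain_rule_indefinite_integral[OF ig U_def cH UH der cg, of 0 t]
    have [measurable]: "(\<lambda>s. energy_t K \<gamma> (rh s) (vel s) x) \<in> borel_measurable borel"
      by (rule slice_meas_t) measurable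
    have [measurable]: "(\<lambda>s. grad (U s) \<bullet> g s) \<in> borel_measurable borel" using ch(1) elim by auto
    have "e (U t) - e (U 0) = (\<integral>s. indicator {0..<t} s * (grad (U s) \<bullet> g s) \<partial>lborel)"
      using ch(2) elim by simp
    also have "\<dots> = (\<integral>s. indicator {0<..<T} s * ((if s < t then 1 else 0) * energy_t K \<gamma> (rh s) (vel s) x) \<partial>lborel)"
    proof (rule integral_cong_AE)
      show "AE s in lborel. indicator {0..<t} s * (grad (U s) \<bullet> g s)
        = indicator {0<..<T} s * ((if s < t then 1 else 0) * energy_t K \<gamma> (rh s) (vel s) x)"
        using AEU unfolding AE_time
      proof eventually_elim
        case (elim s)
        then show ?case by (auto simp: g_def indicator_def gradV)
      qed
    qed measurable
    also have "\<dots> = (\<integral>s. (if s < t then 1 else 0) * energy_t K \<gamma> (rh s) (vel s) x \<partial>time T)"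
      by (simp add: integral_time set_lebesgue_integral_def)
    finally show ?case using elim by (simp add: e_def U00 U0_def V_def)
  qed
qed

end

end

section \<open>Integration over the torus and the commutator error\<close>

lemma norm_integral_le_nn_integral:
  fixes f :: "'a \<Rightarrow> 'b::{banach, second_countable_topology}"
  shows "ennreal (norm (\<integral>x. f x \<partial>M)) \<le> (\<integral>\<^sup>+x. ennreal (norm (f x)) \<partial>M)"
  by (cases "integrable M f") (simp_all add: integral_norm_bound_ennreal not_integrable_integral_eq)

lemma (in mollifier) energy_cv_integrable:
  assumes i: "integrable torus \<rho>" "\<And>i. integrable torus (\<lambda>y. \<rho> y * u y $ i)" and pos: "\<And>x. 0 < cv K \<rho> x"
  shows "integrable torus (\<lambda>x. energy \<gamma> (cv K \<rho> x) (cv_mom K \<rho> u x))"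
proof -
  have r0: "cv K \<rho> x \<noteq> 0" for x using pos[of x] by simp
  have m: "continuous_on UNIV (cv_mom K \<rho> u)"
    unfolding cv_mom_def by (intro continuous_on_vec_lambda cv_cont(1) i)
  have e: "continuous_on UNIV (\<lambda>x. energy \<gamma> (cv K \<rho> x) (cv_mom K \<rho> u x))"
  proof (cases "\<gamma> = 1")
    case True
    show ?thesis unfolding energy_def True
      by simp (intro continuous_intros cv_cont(1) i m; use r0 in simp)
  next
    case False
    then show ?thesis unfolding energy_def by (intro continuous_intros cv_cont(1) i m) (use r0 in auto)
  qed
  have "periodic_x (\<lambda>x. energy \<gamma> (cv K \<rho> x) (cv_mom K \<rho> u x))"
    by (simp add: periodic_x_def cv_mom_def cv_per)
  then obtain M where "\<And>x. \<bar>energy \<gamma> (cv K \<rho> x) (cv_mom K \<rho> u x)\<bar> \<le> M"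
    using periodic_continuous_bounded[OF e] by metis
  then show ?thesis
    using e by (intro integrable_torus_bounded[of _ M] borel_measurable_continuous_onI)
qed

lemma energy_nonneg: "0 < r \<Longrightarrow> 1 < \<gamma> \<Longrightarrow> 0 \<le> energy \<gamma> r m"
  by (simp add: energy_def)

definition comm_const :: "real \<Rightarrow> real \<Rightarrow> real \<Rightarrow> real \<Rightarrow> real \<Rightarrow> real" where
  "comm_const d c C B M = d\<^sup>2 * ((C + C / c * (C * B)) / c) * (B * (2 * (C + C * (C / c)\<^sup>2 * B) + M))"

context slice begin

lemma comm_const_nonneg: "0 \<le> comm_const (real CARD('d)) c C B M2"
  using C c B_nonneg M2 by (simp add: comm_const_def)

lemma commutator_nn_bound:
  "ennreal \<bar>commutator K \<gamma> \<rho> u x\<bar> \<le> ennreal (comm_const (real CARD('d)) c C B M2 / \<epsilon>) *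
    (\<integral>\<^sup>+y. ennreal (\<kappa> (x - y)) * ennreal (norm (u y - u x) ^ 3 + \<bar>\<rho> y - \<rho> x\<bar> ^ 3) \<partial>torus)"
proof -
  have i: "integrable torus (\<lambda>y. \<kappa> (x - y) * norm (u y - u x) ^ 3)" "integrable torus (\<lambda>y. \<kappa> (x - y) * \<bar>\<rho> y - \<rho> x\<bar> ^ 3)"
    by (intro int_kap_mult int_w3 int_q)+
  have "w3 x + q3 x = (\<integral>y. \<kappa> (x - y) * norm (u y - u x) ^ 3 + \<kappa> (x - y) * \<bar>\<rho> y - \<rho> x\<bar> ^ 3 \<partial>torus)"
    using i by (simp add: w3_def q3_def)
  then have e: "w3 x + q3 x = (\<integral>y. \<kappa> (x - y) * (norm (u y - u x) ^ 3 + \<bar>\<rho> y - \<rho> x\<bar> ^ 3) \<partial>torus)"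
    by (simp add: distrib_left)
  have "ennreal (w3 x + q3 x) = (\<integral>\<^sup>+y. ennreal (\<kappa> (x - y) * (norm (u y - u x) ^ 3 + \<bar>\<rho> y - \<rho> x\<bar> ^ 3)) \<partial>torus)"
    unfolding e using i kap_nonneg
    by (intro nn_integral_eq_integral[symmetric]) (auto simp: distrib_left)
  also have "\<dots> = (\<integral>\<^sup>+y. ennreal (\<kappa> (x - y)) * ennreal (norm (u y - u x) ^ 3 + \<bar>\<rho> y - \<rho> x\<bar> ^ 3) \<partial>torus)"
    using kap_nonneg by (intro nn_integral_cong) (simp add: ennreal_mult)
  finally have f: "ennreal (w3 x + q3 x) = \<dots>" .
  have "ennreal \<bar>commutator K \<gamma> \<rho> u x\<bar> \<le> ennreal (comm_const (real CARD('d)) c C B M2 / \<epsilon> * (w3 x + q3 x))"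
    unfolding comm_const_def by (intro ennreal_leI commutator_bound)
  also have "\<dots> = ennreal (comm_const (real CARD('d)) c C B M2 / \<epsilon>) * ennreal (w3 x + q3 x)"
    using comm_const_nonneg eps by (intro ennreal_mult') auto
  finally show ?thesis by (simp add: f)
qed

end

context euler begin

context
  fixes \<epsilon> B :: real and K \<kappa> :: "real^'d \<Rightarrow> real"
  assumes moll: "mollifier \<epsilon> B K \<kappa>"
begin

interpretation mollifier \<epsilon> B K \<kappa> by (rule moll)
interpretation TT: pair_sigma_finite "torus :: (real^'d) measure" "time T" ..
interpretation QQ: pair_sigma_finite "torus :: (real^'d) measure" "torus :: (real^'d) measure" ..

text \<open>The pointwise balance holds for each x off a null set of times depending on x. Fubini
  exchanges the quantifiers, giving a null set of times off which it holds for almost every x. A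
  second exchange puts the spatial integral inside the time integral, where
  \<open>integral_energy_t\<close> replaces \<open>energy_t\<close> by the commutator.\<close>

lemma integrated_balance:
  "AE t in time T. ennreal \<bar>(\<integral>x. energy \<gamma> (cv K (rh t) x) (cv_mom K (rh t) (vel t) x) \<partial>torus)
       - (\<integral>x. energy \<gamma> (cv K \<rho>0 x) (cv_mom K \<rho>0 u0 x) \<partial>torus)\<bar>
     \<le> (\<integral>\<^sup>+s. \<integral>\<^sup>+x. ennreal \<bar>commutator K \<gamma> (rh s) (vel s) x\<bar> \<partial>torus \<partial>time T)"
proof -
  obtain M2 where sl: "\<And>t. slice \<epsilon> B K \<kappa> (rh t) (vel t) c C \<gamma> M2" using slice_exists moll by blast
  obtain Mk where Mk: "\<And>z. \<bar>K z\<bar> \<le> Mk" "\<And>j z. \<bar>pd j K z\<bar> \<le> Mk" using kernel_bound by metis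
  define Et where "Et x s = energy_t K \<gamma> (rh s) (vel s) x" for x s
  have [measurable]: "case_prod Et \<in> borel_measurable (borel \<Otimes>\<^sub>M borel)"
  proof -
    have "case_prod Et = (\<lambda>z. energy_t K \<gamma> (rh (snd z)) (vel (snd z)) (fst z))"
      by (auto simp: fun_eq_iff Et_def)
    then show ?thesis using energy_t_measurable[OF moll] by simp
  qed
  define en where "en x t = energy \<gamma> (cv K (rh t) x) (cv_mom K (rh t) (vel t) x)" for x t
  define en0 where "en0 x = energy \<gamma> (cv K \<rho>0 x) (cv_mom K \<rho>0 u0 x)" for x
  note cvm [measurable] = cv_measurable[OF moll]
  have [measurable]: "case_prod en \<in> borel_measurable (borel \<Otimes>\<^sub>M borel)"
    unfolding en_def energy_def case_prod_beta inner_vec_def cv_mom_def by simp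
  have ien: "integrable torus (\<lambda>x. en x t)" for t
    unfolding en_def using slice.int_rho[OF sl[of t]] slice.int_mom[OF sl[of t]] slice.r_pos[OF sl[of t]]
    by (intro energy_cv_integrable) auto
  have ien0: "integrable torus en0"
    unfolding en0_def using int0 pointwise_balance(1)[OF moll] c by (intro energy_cv_integrable) (auto intro: less_le_trans)
  have [measurable]: "en0 \<in> borel_measurable borel" using ien0 by auto
  define A where "A = energy_t_const (real CARD('d)) Mk c C \<gamma>"
  have Ab: "\<bar>Et x s\<bar> \<le> A * (1 + cube_norm s)" for x s
    unfolding Et_def A_def cube_norm_def by (rule slice.energy_t_bound[OF sl Mk])
  define J where "J x t = (\<integral>s. (if s < t then 1 else 0) * Et x s \<partial>time T)" for x t
  have [measurable]: "case_prod J \<in> borel_measurable (borel \<Otimes>\<^sub>M borel)"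
    unfolding J_def by measurable
  have iprod: "integrable (torus \<Otimes>\<^sub>M time T) (\<lambda>(x, s). (if s < t then 1 else 0) * Et x s)" for t
  proof (rule Bochner_Integration.integrable_bound)
    have "integrable (time T) (\<lambda>s. A * (1 + cube_norm s))" using u3T by (auto simp: cube_norm_def)
    then show "integrable (torus \<Otimes>\<^sub>M time T) (\<lambda>(x::real^'d, s). A * (1 + cube_norm s))"
      by (intro TT.Fubini_integrable) auto
    show "AE z in torus \<Otimes>\<^sub>M time T. norm (case z of (x, s) \<Rightarrow> (if s < t then 1 else 0) * Et x s) \<le> norm (case z of (x, s) \<Rightarrow> A * (1 + cube_norm s))"
    proof (intro AE_I2)
      fix z :: "(real^'d) \<times> real"
      obtain x s where z: "z = (x, s)" by (cases z)
      have "\<bar>Et x s\<bar> \<le> \<bar>A * (1 + cube_norm s)\<bar>" using Ab[of x s] by linarith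
      then show "norm (case z of (x, s) \<Rightarrow> (if s < t then 1 else 0) * Et x s) \<le> norm (case z of (x, s) \<Rightarrow> A * (1 + cube_norm s))"
        by (simp add: z)
    qed
  qed measurable
  have "AE x in torus. AE t in time T. en x t = en0 x + J x t"
    using pointwise_balance(2)[OF moll] unfolding en_def en0_def J_def Et_def by (rule AE_I2)
  then have "AE t in time T. AE x in torus. en x t = en0 x + J x t"
    by (subst (asm) TT.AE_commute) measurable
  then show ?thesis
  proof eventually_elim
    case (elim t)
    have "(\<integral>x. en x t \<partial>torus) - (\<integral>x. en0 x \<partial>torus) = (\<integral>x. en x t - en0 x \<partial>torus)"
      using ien ien0 by simp
    also have "\<dots> = (\<integral>x. J x t \<partial>torus)"
      by (rule integral_cong_AE) (use elim in \<open>auto elim!: eventually_mono\<close>)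
    also have "\<dots> = (\<integral>s. (\<integral>x. (if s < t then 1 else 0) * Et x s \<partial>torus) \<partial>time T)"
      unfolding J_def using TT.Fubini_integral[OF iprod] by simp
    also have "\<dots> = (\<integral>s. (if s < t then 1 else 0) * (\<integral>x. commutator K \<gamma> (rh s) (vel s) x \<partial>torus) \<partial>time T)"
      unfolding Et_def by (simp add: slice.integral_energy_t[OF sl])
    finally have e: "(\<integral>x. en x t \<partial>torus) - (\<integral>x. en0 x \<partial>torus) = \<dots>" .
    have "ennreal \<bar>(\<integral>x. en x t \<partial>torus) - (\<integral>x. en0 x \<partial>torus)\<bar>
      \<le> (\<integral>\<^sup>+s. ennreal (norm ((if s < t then 1 else 0) * (\<integral>x. commutator K \<gamma> (rh s) (vel s) x \<partial>torus))) \<partial>time T)"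
      unfolding e real_norm_def[symmetric] by (rule norm_integral_le_nn_integral)
    also have "\<dots> \<le> (\<integral>\<^sup>+s. \<integral>\<^sup>+x. ennreal \<bar>commutator K \<gamma> (rh s) (vel s) x\<bar> \<partial>torus \<partial>time T)"
    proof (rule nn_integral_mono)
      fix s
      show "ennreal (norm ((if s < t then 1 else 0) * (\<integral>x. commutator K \<gamma> (rh s) (vel s) x \<partial>torus)))
        \<le> (\<integral>\<^sup>+x. ennreal \<bar>commutator K \<gamma> (rh s) (vel s) x\<bar> \<partial>torus)"
        using norm_integral_le_nn_integral[of torus "commutator K \<gamma> (rh s) (vel s)"] by auto
    qed
    finally show ?case by (simp add: en_def en0_def[abs_def])
  qed
qed

text \<open>The factor 1 / \<epsilon> from \<open>commutator_nn_bound\<close> meets increments of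
  size \<eta> * norm h with \<open>norm h\<close> at most a multiple of \<epsilon>; the scales
  cancel and \<eta> is left. The time integral is moved innermost because increments are small only
  after integration in time.\<close>

lemma commutator_estimate:
  assumes sl: "\<And>t. slice \<epsilon> B K \<kappa> (rh t) (vel t) c C \<gamma> M2" and \<eta>: "0 \<le> \<eta>"
    and incr: "\<And>h. norm h \<le> CARD('d) * \<epsilon> \<Longrightarrow>
      (\<integral>\<^sup>+x. \<integral>\<^sup>+t. ennreal (norm (u (x + h) t - u x t) ^ 3 + \<bar>\<rho> (x + h) t - \<rho> x t\<bar> ^ 3) \<partial>time T \<partial>torus) \<le> ennreal (\<eta> * norm h)"
  shows "(\<integral>\<^sup>+s. \<integral>\<^sup>+x. ennreal \<bar>commutator K \<gamma> (rh s) (vel s) x\<bar> \<partial>torus \<partial>time T)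
    \<le> ennreal (comm_const (real CARD('d)) c C B M2 * B * real CARD('d) * \<eta>)"
proof -
  define L where "L = comm_const (real CARD('d)) c C B M2"
  have L: "0 \<le> L" unfolding L_def by (rule slice.comm_const_nonneg[OF sl])
  define f where "f x y s = ennreal (norm (u y s - u x s) ^ 3 + \<bar>\<rho> y s - \<rho> x s\<bar> ^ 3)" for x y s
  have "(\<integral>\<^sup>+s. \<integral>\<^sup>+x. ennreal \<bar>commutator K \<gamma> (rh s) (vel s) x\<bar> \<partial>torus \<partial>time T)
    \<le> (\<integral>\<^sup>+s. \<integral>\<^sup>+x. ennreal (L / \<epsilon>) * (\<integral>\<^sup>+y. ennreal (\<kappa> (x - y)) * f x y s \<partial>torus) \<partial>torus \<partial>time T)"
    unfolding L_def f_def by (intro nn_integral_mono slice.commutator_nn_bound[OF sl])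
  also have "\<dots> = ennreal (L / \<epsilon>) * (\<integral>\<^sup>+s. \<integral>\<^sup>+x. \<integral>\<^sup>+y. ennreal (\<kappa> (x - y)) * f x y s \<partial>torus \<partial>torus \<partial>time T)"
    by (subst nn_integral_cmult[symmetric], (unfold f_def, measurable)[1])
      (intro nn_integral_cong nn_integral_cmult, unfold f_def, measurable)
  also have "(\<integral>\<^sup>+s. \<integral>\<^sup>+x. \<integral>\<^sup>+y. ennreal (\<kappa> (x - y)) * f x y s \<partial>torus \<partial>torus \<partial>time T)
    = (\<integral>\<^sup>+x. \<integral>\<^sup>+s. \<integral>\<^sup>+y. ennreal (\<kappa> (x - y)) * f x y s \<partial>torus \<partial>time T \<partial>torus)"
    by (rule TT.Fubini') (unfold f_def, measurable)
  also have "\<dots> = (\<integral>\<^sup>+x. \<integral>\<^sup>+y. \<integral>\<^sup>+s. ennreal (\<kappa> (x - y)) * f x y s \<partial>time T \<partial>torus \<partial>torus)"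
    by (intro nn_integral_cong TT.Fubini') (unfold f_def, measurable)
  also have "\<dots> = (\<integral>\<^sup>+x. \<integral>\<^sup>+y. ennreal (\<kappa> (x - y)) * (\<integral>\<^sup>+s. f x y s \<partial>time T) \<partial>torus \<partial>torus)"
    by (intro nn_integral_cong nn_integral_cmult) (unfold f_def, measurable)
  also have "\<dots> \<le> ennreal B * ennreal (\<eta> * (CARD('d) * \<epsilon>))"
  proof (rule torus_average[where R="CARD('d) * \<epsilon>"])
    show "periodic_x (\<lambda>z. ennreal (\<kappa> z))" using per_kap by (simp add: periodic_x_def)
    show "periodic_x (\<lambda>y. \<integral>\<^sup>+s. f x y s \<partial>time T)" for x
      using rho_per u_per by (simp add: periodic_x_def f_def)
    show "\<exists>k. norm (z - lat k) \<le> CARD('d) * \<epsilon>" if "ennreal (\<kappa> z) \<noteq> 0" for z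
      using kap_supp[of z] that by force
    show "(\<integral>\<^sup>+x. \<integral>\<^sup>+s. f x (x - h) s \<partial>time T \<partial>torus) \<le> ennreal (\<eta> * (CARD('d) * \<epsilon>))" if h: "norm h \<le> CARD('d) * \<epsilon>" for h
    proof -
      have "(\<integral>\<^sup>+x. \<integral>\<^sup>+s. f x (x - h) s \<partial>time T \<partial>torus) \<le> ennreal (\<eta> * norm (- h))"
        using incr[of "- h"] h by (simp add: f_def)
      also have "\<dots> \<le> ennreal (\<eta> * (CARD('d) * \<epsilon>))"
        using h \<eta> by (intro ennreal_leI mult_left_mono) auto
      finally show ?thesis .
    qed
    show "(\<integral>\<^sup>+z. ennreal (\<kappa> z) \<partial>torus) \<le> ennreal B" by (rule nn_int_kap)
  qed (unfold f_def, measurable)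
  finally have "(\<integral>\<^sup>+s. \<integral>\<^sup>+x. ennreal \<bar>commutator K \<gamma> (rh s) (vel s) x\<bar> \<partial>torus \<partial>time T)
    \<le> ennreal (L / \<epsilon>) * (ennreal B * ennreal (\<eta> * (CARD('d) * \<epsilon>)))" by (simp add: mult_left_mono)
  also have "\<dots> = ennreal (L / \<epsilon> * (B * (\<eta> * (CARD('d) * \<epsilon>))))"
  proof -
    have w: "0 \<le> \<eta> * (CARD('d) * \<epsilon>)" using \<eta> eps by simp
    have "0 \<le> L / \<epsilon>" "0 \<le> B * (\<eta> * (CARD('d) * \<epsilon>))" using L eps B_nonneg w by auto
    then show ?thesis using B_nonneg w by (simp only: ennreal_mult)
  qed
  also have "L / \<epsilon> * (B * (\<eta> * (CARD('d) * \<epsilon>))) = L * B * real CARD('d) * \<eta>"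
    using eps by simp
  finally show ?thesis by (simp add: L_def)
qed

end

theorem energy_conservation:
  "AE t in time T. (\<integral>\<^sup>+x. ennreal (1/2 * \<rho> x t * (norm (u x t))\<^sup>2 + \<rho> x t powr \<gamma> / (\<gamma> - 1)) \<partial>torus)
    = (\<integral>\<^sup>+x. ennreal (1/2 * \<rho>0 x * (norm (u0 x))\<^sup>2 + \<rho>0 x powr \<gamma> / (\<gamma> - 1)) \<partial>torus)"
proof -
  obtain B where B: "B > 0" "\<And>\<epsilon>. 0 < \<epsilon> \<Longrightarrow> \<epsilon> < 1 / 4 \<Longrightarrow> \<exists>K \<kappa> :: real^'d \<Rightarrow> real. mollifier \<epsilon> B K \<kappa>"
    using mollifier_exists by blast
  \<comment> \<open>The offset keeps every scale at or below 1/5, inside the range of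
    \<open>mollifier_exists\<close>.\<close>
  define \<epsilon> where "\<epsilon> n = inverse (real (Suc (n + 4)))" for n :: nat
  have "\<forall>n. \<exists>K \<kappa> :: real^'d \<Rightarrow> real. mollifier (\<epsilon> n) B K \<kappa>"
    by (intro allI B(2)) (auto simp: \<epsilon>_def field_simps)
  then obtain K \<kappa> :: "nat \<Rightarrow> real^'d \<Rightarrow> real" where moll: "\<And>n. mollifier (\<epsilon> n) B (K n) (\<kappa> n)" by metis
  have eps: "\<epsilon> \<longlonglongrightarrow> 0"
    unfolding \<epsilon>_def by (rule LIMSEQ_ignore_initial_segment[OF LIMSEQ_inverse_real_of_nat])
  obtain M2 where M2: "0 \<le> M2" and sl: "\<And>n t. slice (\<epsilon> n) B (K n) (\<kappa> n) (rh t) (vel t) c C \<gamma> M2"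
    using slice_exists moll by meson
  define X where "X n = (\<integral>\<^sup>+s. \<integral>\<^sup>+x. ennreal \<bar>commutator (K n) \<gamma> (rh s) (vel s) x\<bar> \<partial>torus \<partial>time T)" for n
  define L where "L = comm_const (real CARD('d)) c C B M2 * B * real CARD('d)"
  have L: "0 \<le> L" using slice.comm_const_nonneg[OF sl] B(1) by (simp add: L_def)
  have X: "\<forall>\<^sub>F n in sequentially. X n \<le> ennreal e" if e: "e > 0" for e
  proof -
    define \<eta> where "\<eta> = e / (L + 1)"
    have \<eta>: "\<eta> > 0" using e L by (simp add: \<eta>_def)
    obtain \<delta> where \<delta>: "\<delta> > 0" "\<And>h. norm h < \<delta> \<Longrightarrow>
      (\<integral>\<^sup>+x. \<integral>\<^sup>+t. ennreal (norm (u (x + h) t - u x t) ^ 3 + \<bar>\<rho> (x + h) t - \<rho> x t\<bar> ^ 3) \<partial>time T \<partial>torus) \<le> ennreal (\<eta> * norm h)"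
      using increments[OF \<eta>] by blast
    have "(\<lambda>n. CARD('d) * \<epsilon> n) \<longlonglongrightarrow> 0" by (rule tendsto_mult_right_zero[OF eps])
    then have "\<forall>\<^sub>F n in sequentially. CARD('d) * \<epsilon> n < \<delta>" using \<delta>(1) by (intro order_tendstoD) auto
    then show ?thesis
    proof eventually_elim
      case (elim n)
      have "X n \<le> ennreal (L * \<eta>)"
        unfolding X_def L_def using \<eta> elim by (intro commutator_estimate[OF moll sl] \<delta>) auto
      also have "\<dots> \<le> ennreal e" using e L by (intro ennreal_leI) (simp add: \<eta>_def field_simps)
      finally show ?case .
    qed
  qed
  define a where "a n t = (\<integral>x. energy \<gamma> (cv (K n) (rh t) x) (cv_mom (K n) (rh t) (vel t) x) \<partial>torus)" for n t
  define b where "b n = (\<integral>x. energy \<gamma> (cv (K n) \<rho>0 x) (cv_mom (K n) \<rho>0 u0 x) \<partial>torus)" for n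
  have r0: "c \<le> cv (K n) \<rho>0 x" for n x by (rule pointwise_balance(1)[OF moll])
  have a_nn: "ennreal (a n t) = (\<integral>\<^sup>+x. ennreal (energy \<gamma> (cv (K n) (rh t) x) (cv_mom (K n) (rh t) (vel t) x)) \<partial>torus)" for n t
    unfolding a_def
  proof (rule nn_integral_eq_integral[symmetric])
    show "integrable torus (\<lambda>x. energy \<gamma> (cv (K n) (rh t) x) (cv_mom (K n) (rh t) (vel t) x))"
      using slice.int_rho[OF sl] slice.int_mom[OF sl] slice.r_pos[OF sl]
      by (intro mollifier.energy_cv_integrable[OF moll]) auto
  qed (use slice.r_pos[OF sl] gam in \<open>auto intro!: energy_nonneg\<close>)
  have b_nn: "ennreal (b n) = (\<integral>\<^sup>+x. ennreal (energy \<gamma> (cv (K n) \<rho>0 x) (cv_mom (K n) \<rho>0 u0 x)) \<partial>torus)" for n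
    unfolding b_def
  proof (rule nn_integral_eq_integral[symmetric])
    have p: "0 < cv (K n) \<rho>0 x" for x using r0[of n x] c by linarith
    show "integrable torus (\<lambda>x. energy \<gamma> (cv (K n) \<rho>0 x) (cv_mom (K n) \<rho>0 u0 x))"
      by (intro mollifier.energy_cv_integrable[OF moll] int0 p)
    show "AE x in torus. 0 \<le> energy \<gamma> (cv (K n) \<rho>0 x) (cv_mom (K n) \<rho>0 u0 x)"
      by (intro AE_I2 energy_nonneg p gam)
  qed
  have nonneg: "0 \<le> a n t" "0 \<le> b n" for n t
  proof -
    have p: "0 < cv (K n) \<rho>0 x" for x using r0[of n x] c by linarith
    show "0 \<le> a n t" unfolding a_def
      by (intro Bochner_Integration.integral_nonneg energy_nonneg slice.r_pos[OF sl] gam)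
    show "0 \<le> b n" unfolding b_def
      by (intro Bochner_Integration.integral_nonneg energy_nonneg p gam)
  qed
  define Et where "Et t = (\<integral>\<^sup>+x. ennreal (1/2 * \<rho> x t * (norm (u x t))\<^sup>2 + \<rho> x t powr \<gamma> / (\<gamma> - 1)) \<partial>torus)" for t
  define E0 where "E0 = (\<integral>\<^sup>+x. ennreal (1/2 * \<rho>0 x * (norm (u0 x))\<^sup>2 + \<rho>0 x powr \<gamma> / (\<gamma> - 1)) \<partial>torus)"
  have "AE t in time T. \<forall>n. ennreal \<bar>a n t - b n\<bar> \<le> X n"
    unfolding AE_all_countable a_def b_def X_def using integrated_balance[OF moll] by blast
  then have "AE t in time T. Et t = E0"
  proof eventually_elim
    case (elim t)
    \<comment> \<open>This subsequence depends on t, and another one is extracted from it for the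
      initial data. That is harmless: outside one null set of times the error bound X n holds for
      all n.\<close>
    have "\<exists>s. strict_mono s \<and> (\<lambda>n. ennreal (a (s n) t)) \<longlonglongrightarrow> Et t"
      unfolding a_nn Et_def
    proof (rule energy_convergence[OF moll eps _ _ rho_per u_per])
      show "0 \<le> \<rho> y t" for y using rho_ge[of y t] c by linarith
      show "c \<le> cv (K n) (rh t) x" for n x by (rule slice.r_bounds(1)[OF sl])
    qed (use slice.int_rho[OF sl] slice.int_mom[OF sl] c gam in auto)
    then obtain s1 where s1: "strict_mono s1" "(\<lambda>n. ennreal (a (s1 n) t)) \<longlonglongrightarrow> Et t" by blast
    have "\<exists>s. strict_mono s \<and> (\<lambda>n. ennreal (b (s1 (s n)))) \<longlonglongrightarrow> E0"
      unfolding b_nn E0_def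
      by (rule energy_convergence[where K="\<lambda>n. K (s1 n)", OF moll _ rho0_meas u0_meas rho0_per u0_per rho0_nonneg int0 c r0 gam])
        (use LIMSEQ_subseq_LIMSEQ[OF eps s1(1)] in \<open>simp add: comp_def\<close>)
    then obtain s2 where s2: "strict_mono s2" "(\<lambda>n. ennreal (b (s1 (s2 n)))) \<longlonglongrightarrow> E0" by blast
    define s where "s n = s1 (s2 n)" for n
    have sm: "strict_mono s" using s1(1) s2(1) by (auto simp: s_def strict_mono_def)
    have la: "(\<lambda>n. ennreal (a (s n) t)) \<longlonglongrightarrow> Et t"
      using LIMSEQ_subseq_LIMSEQ[OF s1(2) s2(1)] by (simp add: comp_def s_def)
    have lb: "(\<lambda>n. ennreal (b (s n))) \<longlonglongrightarrow> E0" using s2(2) by (simp add: s_def)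
    have ev: "\<forall>\<^sub>F n in sequentially. \<bar>a (s n) t - b (s n)\<bar> \<le> e" if e: "e > 0" for e
    proof -
      have "\<forall>\<^sub>F n in sequentially. X (s n) \<le> ennreal e"
        using X[OF e] filterlim_subseq[OF sm] by (auto simp: filterlim_iff)
      then show ?thesis
      proof eventually_elim
        case (elim n)
        have "ennreal \<bar>a (s n) t - b (s n)\<bar> \<le> ennreal e"
          using \<open>\<forall>n. ennreal \<bar>a n t - b n\<bar> \<le> X n\<close> elim by (meson order_trans)
        then show ?case using e by simp
      qed
    qed
    \<comment> \<open>Comparison with a slack e instead of a subtraction, because \<open>E0\<close>
      is not known to be finite.\<close>
    have le1: "Et t \<le> E0 + ennreal e" if e: "e > 0" for e
    proof (rule tendsto_le[OF _ tendsto_add[OF lb tendsto_const] la])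
      show "\<forall>\<^sub>F n in sequentially. ennreal (a (s n) t) \<le> ennreal (b (s n)) + ennreal e"
        using ev[OF e]
      proof eventually_elim
        case (elim n)
        then have "a (s n) t \<le> b (s n) + e" by linarith
        then show ?case using nonneg e by (simp flip: ennreal_plus add: ennreal_leI)
      qed
    qed simp
    have le2: "E0 \<le> Et t + ennreal e" if e: "e > 0" for e
    proof (rule tendsto_le[OF _ tendsto_add[OF la tendsto_const] lb])
      show "\<forall>\<^sub>F n in sequentially. ennreal (b (s n)) \<le> ennreal (a (s n) t) + ennreal e"
        using ev[OF e]
      proof eventually_elim
        case (elim n)
        then have "b (s n) \<le> a (s n) t + e" by linarith
        then show ?case using nonneg e by (simp flip: ennreal_plus add: ennreal_leI)
      qed
    qed simp
    have "Et t \<le> E0" by (rule ennreal_le_epsilon) (rule le1)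
    moreover have "E0 \<le> Et t" by (rule ennreal_le_epsilon) (rule le2)
    ultimately show ?case by (rule antisym)
  qed
  then show ?thesis unfolding Et_def E0_def .
qed

end

section \<open>From weak solutions to integrated equations\<close>

lemma nn_integral_spacetime:
  fixes f :: "(real^'d::finite) \<times> real \<Rightarrow> ennreal"
  assumes [measurable]: "f \<in> borel_measurable borel"
  shows "(\<integral>\<^sup>+z. f z * indicator (spacetime T) z \<partial>lborel) = (\<integral>\<^sup>+t. \<integral>\<^sup>+x. f (x, t) \<partial>torus \<partial>time T)"
proof -
  have [measurable]: "f \<in> borel_measurable (borel \<Otimes>\<^sub>M borel)" using assms by (simp add: borel_prod)
  have [measurable]: "spacetime T \<in> sets (borel \<Otimes>\<^sub>M borel :: ((real^'d) \<times> real) measure)"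
    unfolding spacetime_def by (intro pair_measureI) auto
  have "(\<integral>\<^sup>+z. f z * indicator (spacetime T) z \<partial>lborel)
    = (\<integral>\<^sup>+z. f z * indicator (spacetime T) z \<partial>(lborel \<Otimes>\<^sub>M lborel :: ((real^'d) \<times> real) measure))"
    by (simp add: lborel_prod)
  also have "\<dots> = (\<integral>\<^sup>+t. \<integral>\<^sup>+x. f (x, t) * indicator (spacetime T) (x, t) \<partial>lborel \<partial>lborel)"
    by (rule lborel_pair.nn_integral_snd[symmetric]) measurable
  also have "\<dots> = (\<integral>\<^sup>+t. (\<integral>\<^sup>+x. f (x, t) * indicator cube x \<partial>lborel) * indicator {0<..<T} t \<partial>lborel)"
    by (intro nn_integral_cong) (auto simp: spacetime_def indicator_def)
  also have "\<dots> = (\<integral>\<^sup>+t. \<integral>\<^sup>+x. f (x, t) \<partial>torus \<partial>time T)"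
    by (subst nn_integral_time) (auto simp: nn_integral_torus)
  finally show ?thesis .
qed

lemma integral_spacetime:
  fixes f :: "(real^'d::finite) \<times> real \<Rightarrow> real"
  assumes fm: "f \<in> borel_measurable borel" and i: "set_integrable lborel (spacetime T) f"
  shows "(LINT z:spacetime T|lborel. f z) = (\<integral>t. \<integral>x. f (x, t) \<partial>torus \<partial>time T)"
proof -
  have [measurable]: "f \<in> borel_measurable (borel \<Otimes>\<^sub>M borel)" using fm by (simp add: borel_prod)
  have "(LINT z:spacetime T|lborel. f z) = (\<integral>z. indicator (spacetime T) z *\<^sub>R f z \<partial>(lborel \<Otimes>\<^sub>M lborel :: ((real^'d) \<times> real) measure))"
    by (simp add: lborel_prod set_lebesgue_integral_def)
  also have "\<dots> = (\<integral>t. \<integral>x. indicator (spacetime T) (x, t) *\<^sub>R f (x, t) \<partial>lborel \<partial>lborel)"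
    using lborel_pair.integral_snd[of "\<lambda>x t. indicator (spacetime T) (x, t) *\<^sub>R f (x, t)"] i
    by (simp add: set_integrable_def lborel_prod case_prod_unfold)
  also have "\<dots> = (\<integral>t. indicator {0<..<T} t *\<^sub>R (\<integral>x. indicator cube x *\<^sub>R f (x, t) \<partial>lborel) \<partial>lborel)"
    by (intro Bochner_Integration.integral_cong) (auto simp: spacetime_def indicator_def)
  also have "\<dots> = (\<integral>t. \<integral>x. f (x, t) \<partial>torus \<partial>time T)"
    by (subst integral_time) (auto simp: integral_torus set_lebesgue_integral_def)
  finally show ?thesis .
qed

lemma AE_spacetime:
  fixes P :: "real^'d::finite \<Rightarrow> real \<Rightarrow> bool"
  assumes [measurable]: "Measurable.pred (borel \<Otimes>\<^sub>M borel) (\<lambda>z. P (fst z) (snd z))"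
  shows "(AE z in lborel. z \<in> spacetime T \<longrightarrow> P (fst z) (snd z)) \<longleftrightarrow> (AE t in time T. AE x in torus. P x t)"
proof -
  have 1: "(AE t in time T. AE x in torus. P x t) \<longleftrightarrow> (AE t in lborel. AE x in lborel. x \<in> cube \<and> t \<in> {0<..<T} \<longrightarrow> P x t)"
    unfolding AE_time AE_torus by (intro AE_cong) auto
  have 2: "\<dots> \<longleftrightarrow> (AE x in lborel. AE t in lborel. x \<in> cube \<and> t \<in> {0<..<T} \<longrightarrow> P x t)"
    by (rule lborel_pair.AE_commute[symmetric]) measurable
  have 3: "\<dots> \<longleftrightarrow> (AE z in lborel \<Otimes>\<^sub>M lborel. fst z \<in> cube \<and> snd z \<in> {0<..<T} \<longrightarrow> P (fst z) (snd z))"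
    by (rule lborel_pair.AE_pair_iff) measurable
  have 4: "(fst z \<in> cube \<and> snd z \<in> {0<..<T} \<longrightarrow> P (fst z) (snd z)) \<longleftrightarrow> (z \<in> spacetime T \<longrightarrow> P (fst z) (snd z))" for z
    by (cases z) (auto simp: spacetime_def)
  show ?thesis unfolding 1 2 3 4 unfolding lborel_prod ..
qed

text \<open>Carries weak equations over to fields that have been changed on a null set.\<close>

lemma spacetime_cong:
  fixes F G :: "(real^'d::finite) \<times> real \<Rightarrow> real"
  assumes m: "F \<in> borel_measurable (borel \<Otimes>\<^sub>M borel)" "G \<in> borel_measurable (borel \<Otimes>\<^sub>M borel)"
    and eq: "AE t in time T. AE x in torus. F (x, t) = G (x, t)"
  shows "set_integrable lborel (spacetime T) F \<longleftrightarrow> set_integrable lborel (spacetime T) G"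
    and "(LINT z:spacetime T|lborel. F z) = (LINT z:spacetime T|lborel. G z)"
proof -
  note m [measurable]
  have s: "spacetime T \<in> sets (lborel :: ((real^'d) \<times> real) measure)"
    unfolding spacetime_def lborel_prod[symmetric] by (intro pair_measureI) auto
  have ae: "AE z in lborel. z \<in> spacetime T \<longrightarrow> F z = G z"
  proof -
    have "AE z in lborel. z \<in> spacetime T \<longrightarrow> F (fst z, snd z) = G (fst z, snd z)"
      by (subst AE_spacetime) (use eq in simp_all)
    then show ?thesis by simp
  qed
  have mb: "F \<in> borel_measurable lborel" "G \<in> borel_measurable lborel"
    using m by (simp_all add: borel_prod)
  show "set_integrable lborel (spacetime T) F \<longleftrightarrow> set_integrable lborel (spacetime T) G"
    by (rule set_integrable_cong_AE[OF mb ae s])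
  show "(LINT z:spacetime T|lborel. F z) = (LINT z:spacetime T|lborel. G z)"
    by (rule set_lebesgue_integral_cong_AE[OF s mb ae])
qed

section \<open>Product test functions and equations integrated in time\<close>

lemma test_fun_product:
  fixes k :: "real^'d::finite \<Rightarrow> real" and f :: "real \<Rightarrow> real"
  assumes f: "sm f" "\<And>s. (f has_real_derivative f' s) (at s)"
    and supp: "\<exists>a b. 0 < a \<and> a < b \<and> b < T \<and> (\<forall>t. t \<notin> {a..b} \<longrightarrow> f t = 0)"
    and k: "sm k" "periodic_x k"
  shows "test_fun T (\<lambda>z. f (snd z) * k (fst z))"
    and "dt (\<lambda>z. f (snd z) * k (fst z)) (x, t) = f' t * k x"
    and "dx j (\<lambda>z. f (snd z) * k (fst z)) (x, t) = f t * pd j k x"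
proof -
  have s: "sm (\<lambda>z::(real^'d) \<times> real. f (snd z) * k (fst z))"
    using sm_affine[OF f(1) bounded_linear_snd, of 0] sm_affine[OF k(1) bounded_linear_fst, of 0]
    by (intro sm_mult) simp_all
  show "test_fun T (\<lambda>z. f (snd z) * k (fst z))"
    using supp k(2) sm_smooth_fun[OF s] unfolding test_fun_def periodic_x_def by fastforce
  have "((\<lambda>s. f (t + s) * k x) has_real_derivative f' t * k x) (at 0)"
  proof -
    have 1: "((\<lambda>s. t + s) has_real_derivative 1) (at 0)" by (auto intro!: derivative_eq_intros)
    have 2: "(f has_real_derivative f' t) (at (t + 0))" using f(2)[of t] by simp
    show ?thesis using DERIV_cmult_right[OF DERIV_chain2[OF 2 1], of "k x"] by simp
  qed
  then show "dt (\<lambda>z. f (snd z) * k (fst z)) (x, t) = f' t * k x"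
    unfolding dt_def using sm_line_derivative[OF s, of "(x, t)" "(0, 1)" 0] by (intro DERIV_unique) auto
  have "((\<lambda>s. f t * k (x + s *\<^sub>R axis j 1)) has_real_derivative f t * pd j k x) (at 0)"
    using DERIV_cmult[OF sm_pd_line[OF k(1), of x j 0], of "f t"] by simp
  then show "dx j (\<lambda>z. f (snd z) * k (fst z)) (x, t) = f t * pd j k x"
    unfolding dx_def using sm_line_derivative[OF s, of "(x, t)" "(axis j 1, 0)" 0] by (intro DERIV_unique) auto
qed

lemma sm_derivative:
  fixes f f' :: "real \<Rightarrow> real"
  assumes f: "sm f" "\<And>s. (f has_real_derivative f' s) (at s)"
  shows "sm f'"
proof -
  have "f' s = frechet_derivative f (at s) 1" for s
    using DERIV_unique[OF f(2)[of s]] sm_line_derivative[OF f(1), of s 1 0] DERIV_shift[of f _ 0 s]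
    by (simp add: add.commute)
  then show ?thesis using sm_deriv[OF f(1)] by presburger
qed

text \<open>Covers mass and momentum together: f is the conserved density, g j the j-th flux
  component, N a majorant with finite space-time integral. The pairing \<open>a\<close> is kept
  apart from f because the limit at time 0 is known for the original fields, while f will come from
  fields changed on a null set of times, and such a change can destroy a limit.\<close>

lemma integrated_form:
  fixes N f :: "real^'d::finite \<Rightarrow> real \<Rightarrow> real" and g :: "'d \<Rightarrow> real^'d \<Rightarrow> real \<Rightarrow> real"
  assumes T: "0 < T"
    and fm [measurable]: "case_prod f \<in> borel_measurable (borel \<Otimes>\<^sub>M borel)"
    and gm [measurable]: "\<And>j. case_prod (g j) \<in> borel_measurable (borel \<Otimes>\<^sub>M borel)"
    and N0: "\<And>x t. 0 \<le> N x t" and N: "\<And>t. integrable torus (\<lambda>x. N x t)" and NT: "integrable (time T) (\<lambda>t. \<integral>x. N x t \<partial>torus)"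
    and fb: "\<And>x t. \<bar>f x t\<bar> \<le> M * (1 + N x t)" and gb: "\<And>j x t. \<bar>g j x t\<bar> \<le> M * (1 + N x t)" and M: "0 \<le> M"
    and k: "sm k" "periodic_x k"
    and weak: "\<And>\<phi> \<phi>'. sm \<phi> \<Longrightarrow> (\<And>s. (\<phi> has_real_derivative \<phi>' s) (at s)) \<Longrightarrow>
      (\<exists>a b. 0 < a \<and> a < b \<and> b < T \<and> (\<forall>t. t \<notin> {a..b} \<longrightarrow> \<phi> t = 0)) \<Longrightarrow>
      set_integrable lborel (spacetime T) (\<lambda>(x, t). f x t * (\<phi>' t * k x) + (\<Sum>j\<in>UNIV. g j x t * (\<phi> t * pd j k x))) \<and>
      (LINT z:spacetime T|lborel. (case z of (x, t) \<Rightarrow> f x t * (\<phi>' t * k x) + (\<Sum>j\<in>UNIV. g j x t * (\<phi> t * pd j k x)))) = 0"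
    and lim: "(a \<longlongrightarrow> a0) (at_right 0)" and a: "a \<in> borel_measurable borel"
      "AE t in time T. a t = (\<integral>x. f x t * k x \<partial>torus)"
  shows "AE t in time T. (\<integral>x. f x t * k x \<partial>torus) = a0 + (LINT s:{0<..<t}|lborel. (\<Sum>j\<in>UNIV. \<integral>x. g j x s * pd j k x \<partial>torus))"
proof -
  define b where "b t = (\<Sum>j\<in>UNIV. \<integral>x. g j x t * pd j k x \<partial>torus)" for t
  define a' where "a' t = (\<integral>x. f x t * k x \<partial>torus)" for t
  have [measurable]: "k \<in> borel_measurable borel" "pd j k \<in> borel_measurable borel" for j
    using k by (auto intro: sm_borel sm_pd)
  have [measurable]: "a' \<in> borel_measurable borel" "b \<in> borel_measurable borel"
    unfolding a'_def b_def by measurable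
  have [measurable]: "(\<lambda>x. f x t) \<in> borel_measurable borel" "(\<lambda>x. g j x t) \<in> borel_measurable borel" for t j
    by measurable
  have Nm: "(\<lambda>x. N x t) \<in> borel_measurable borel" for t using N[of t] by auto
  have dom: "integrable torus (\<lambda>x. h x * q x)" "\<bar>\<integral>x. h x * q x \<partial>torus\<bar> \<le> M * Mq * (1 + (\<integral>x. N x t \<partial>torus))"
    if hm: "h \<in> borel_measurable borel" "q \<in> borel_measurable borel"
      and hb: "\<And>x. \<bar>h x\<bar> \<le> M * (1 + N x t)" and qb: "\<And>x. \<bar>q x\<bar> \<le> Mq" for h q :: "real^'d \<Rightarrow> real" and Mq t
  proof -
    have b: "\<bar>h x * q x\<bar> \<le> M * Mq * (1 + N x t)" for x
    proof -
      have "\<bar>h x\<bar> * \<bar>q x\<bar> \<le> (M * (1 + N x t)) * Mq"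
        using hb qb N0[of x t] M by (intro mult_mono) auto
      then show ?thesis by (simp add: abs_mult mult_ac)
    qed
    have i: "integrable torus (\<lambda>x. M * Mq * (1 + N x t))" using N by auto
    show i2: "integrable torus (\<lambda>x. h x * q x)"
      by (rule Bochner_Integration.integrable_bound[OF i]) (use hm b in \<open>auto intro!: AE_I2 order_trans[OF b]\<close>)
    have "\<bar>\<integral>x. h x * q x \<partial>torus\<bar> \<le> (\<integral>x. M * Mq * (1 + N x t) \<partial>torus)"
      by (rule integral_abs_bound_integral[OF i2 i b])
    then show "\<bar>\<integral>x. h x * q x \<partial>torus\<bar> \<le> M * Mq * (1 + (\<integral>x. N x t \<partial>torus))"
      using N by (simp add: measure_torus)
  qed
  obtain Mk where Mk: "\<And>x. \<bar>k x\<bar> \<le> Mk" using periodic_continuous_bounded[OF sm_continuous_on[OF k(1)] k(2)] by metis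
  have "\<exists>Mj. \<forall>x. \<bar>pd j k x\<bar> \<le> Mj" for j
    using periodic_continuous_bounded[OF sm_continuous_on[OF sm_pd[OF k(1)]] periodic_pd[OF k]] by metis
  then obtain Mp where Mp: "\<And>j x. \<bar>pd j k x\<bar> \<le> Mp j" by metis
  have fk: "integrable torus (\<lambda>x. f x t * k x)" "\<bar>a' t\<bar> \<le> M * Mk * (1 + (\<integral>x. N x t \<partial>torus))" for t
    unfolding a'_def by (rule dom; use fb Mk in auto)+
  have gk1: "integrable torus (\<lambda>x. g j x t * pd j k x)" for j t
    by (rule dom(1)) (use gb Mp in auto)
  have gk2: "\<bar>\<integral>x. g j x t * pd j k x \<partial>torus\<bar> \<le> M * Mp j * (1 + (\<integral>x. N x t \<partial>torus))" for j t
    by (rule dom(2)) (use gb Mp in auto)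
  have tint: "integrable (time T) h" if "h \<in> borel_measurable borel" "\<And>t. \<bar>h t\<bar> \<le> A * (1 + (\<integral>x. N x t \<partial>torus))" for h :: "real \<Rightarrow> real" and A
  proof (rule Bochner_Integration.integrable_bound)
    show "integrable (time T) (\<lambda>t. A * (1 + (\<integral>x. N x t \<partial>torus)))" using NT by auto
    show "AE t in time T. norm (h t) \<le> norm (A * (1 + (\<integral>x. N x t \<partial>torus)))"
      using that(2) by (intro AE_I2) (metis abs_ge_self order_trans real_norm_def)
  qed (use that in auto)
  have ia': "integrable (time T) a'" by (rule tint[OF _ fk(2)]) measurable
  have ib: "integrable (time T) b"
    unfolding b_def by (intro Bochner_Integration.integrable_sum tint[OF _ gk2]) measurable
  have aa: "AE t in time T. a t = a' t" using a(2) by (simp add: a'_def)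
  have ia: "integrable (time T) a"
    using integrable_cong_AE[of a "time T" a'] a(1) aa ia' by simp
  have "AE t in lborel. t \<in> {0<..<T} \<longrightarrow> a t = a0 + (LINT s:{0<..<t}|lborel. b s)"
  proof (rule du_bois_reymond[OF T _ _ _ lim])
    show "set_integrable lborel {0<..<T} a" using ia a(1) by (simp add: integrable_time)
    show "set_integrable lborel {0<..<T} b" using ib by (simp add: integrable_time)
    fix \<phi> \<phi>' :: "real \<Rightarrow> real"
    assume \<phi>: "sm \<phi>" "\<And>s. (\<phi> has_real_derivative \<phi>' s) (at s)"
      "\<exists>c d. 0 < c \<and> c < d \<and> d < T \<and> (\<forall>t. t \<notin> {c..d} \<longrightarrow> \<phi> t = 0)"
    have [measurable]: "\<phi> \<in> borel_measurable borel" using \<phi>(1) by (rule sm_borel)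
    have "sm \<phi>'" by (rule sm_derivative[OF \<phi>(1,2)])
    then have [measurable]: "\<phi>' \<in> borel_measurable borel" by (rule sm_borel)
    have bdd: "integrable (time T) (\<lambda>t. p t * h t)" if p: "sm p" and h: "integrable (time T) h" for p h :: "real \<Rightarrow> real"
    proof -
      have "compact (p ` {0..T})" by (intro compact_continuous_image sm_continuous_on p) auto
      then have "bounded (p ` {0..T})" by (rule compact_imp_bounded)
      then obtain m where "\<forall>y\<in>p ` {0..T}. norm y \<le> m" unfolding bounded_iff by blast
      then have m: "\<bar>p t\<bar> \<le> m" if "t \<in> {0<..<T}" for t using that by auto
      have pm: "p \<in> borel_measurable borel" using p by (rule sm_borel)
      show ?thesis
      proof (rule Bochner_Integration.integrable_bound)
        show "integrable (time T) (\<lambda>t. m * h t)" using h by simp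
        show "AE t in time T. norm (p t * h t) \<le> norm (m * h t)"
          unfolding AE_time
        proof (intro AE_I2 impI)
          fix t assume t: "t \<in> {0<..<T}"
          have "\<bar>p t\<bar> * \<bar>h t\<bar> \<le> \<bar>m\<bar> * \<bar>h t\<bar>" using m[OF t] by (intro mult_right_mono) auto
          then show "norm (p t * h t) \<le> norm (m * h t)" by (simp add: abs_mult)
        qed
      qed (use pm h in auto)
    qed
    define F where "F x t = f x t * (\<phi>' t * k x) + (\<Sum>j\<in>UNIV. g j x t * (\<phi> t * pd j k x))" for x t
    have Fm: "case_prod F \<in> borel_measurable borel"
      unfolding F_def borel_prod[symmetric] by measurable
    have "0 = (\<integral>t. \<integral>x. F x t \<partial>torus \<partial>time T)"
      using weak[OF \<phi>] integral_spacetime[OF Fm, of T] unfolding F_def by auto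
    also have "\<dots> = (\<integral>t. \<phi>' t * a' t + \<phi> t * b t \<partial>time T)"
    proof (rule Bochner_Integration.integral_cong)
      fix t
      have "(\<integral>x. F x t \<partial>torus) = (\<integral>x. \<phi>' t * (f x t * k x) + (\<Sum>j\<in>UNIV. \<phi> t * (g j x t * pd j k x)) \<partial>torus)"
        unfolding F_def by (intro Bochner_Integration.integral_cong) (auto simp: mult_ac)
      also have "\<dots> = \<phi>' t * a' t + \<phi> t * b t"
        using fk(1) gk1 by (simp add: a'_def b_def sum_distrib_left)
      finally show "(\<integral>x. F x t \<partial>torus) = \<phi>' t * a' t + \<phi> t * b t" .
    qed simp
    also have "\<dots> = (\<integral>t. \<phi>' t * a t + \<phi> t * b t \<partial>time T)"
      using a(1) aa by (intro integral_cong_AE) (auto elim!: eventually_mono)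
    also have "\<dots> = (\<integral>t. \<phi>' t * a t \<partial>time T) + (\<integral>t. \<phi> t * b t \<partial>time T)"
      using bdd[OF \<open>sm \<phi>'\<close> ia] bdd[OF \<phi>(1) ib] by simp
    finally show "(LINT t:{0<..<T}|lborel. \<phi>' t * a t) + (LINT t:{0<..<T}|lborel. \<phi> t * b t) = 0"
      using a(1) by (simp add: integral_time)
  qed
  then have "AE t in time T. a t = a0 + (LINT s:{0<..<t}|lborel. b s)" by (simp add: AE_time)
  then show ?thesis using aa
    by eventually_elim (simp add: a'_def b_def)
qed

section \<open>Cubic increments from the seminorms\<close>

lemma cube_root_cubed: "0 \<le> (y::real) \<Longrightarrow> (y powr (1/3)) ^ 3 = y"
  by (cases "y = 0") (simp_all add: powr_power)

lemma ennpowr_less: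
  assumes "ennpowr Y (1/3) < ennreal e"
  shows "Y \<le> ennreal (e ^ 3)"
proof -
  have "Y \<noteq> top" using assms by (auto simp: ennpowr_def)
  then obtain y where y: "Y = ennreal y" "0 \<le> y" by (metis ennreal_cases)
  then have "ennreal (y powr (1/3)) < ennreal e" using assms by (simp add: ennpowr_def)
  then have "y powr (1/3) < e" by (simp add: ennreal_less_iff)
  then have "(y powr (1/3)) ^ 3 \<le> e ^ 3" by (intro power_mono) auto
  moreover have "(y powr (1/3)) ^ 3 = y" using y(2) by (rule cube_root_cubed)
  ultimately show ?thesis by (simp add: y ennreal_leI)
qed

text \<open>The supremum inside \<^const>\<open>V_norm\<close> need not be measurable in time; for a fixed $h$ monotonicity of
  the upper integral suffices.\<close>

lemma velocity_increment:
  fixes u :: "real^'d::finite \<Rightarrow> real \<Rightarrow> real^'d"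
  assumes um: "case_prod u \<in> borel_measurable (borel \<Otimes>\<^sub>M borel)"
    and V: "Lq_time 3 T (\<lambda>t. V_norm (1/3) 3 \<delta> (\<lambda>x. u x t)) < ennreal e" and h: "norm h < \<delta>"
  shows "(\<integral>\<^sup>+t. \<integral>\<^sup>+x. ennreal (norm (u (x + h) t - u x t) ^ 3) \<partial>torus \<partial>time T) \<le> ennreal (e ^ 3 * norm h)"
proof (cases "h = 0")
  case False
  then have h0: "0 < norm h" by simp
  note um [measurable]
  define V where "V t = V_norm (1/3) 3 \<delta> (\<lambda>x. u x t)" for t
  define X where "X t = (\<integral>\<^sup>+x. ennreal (norm (u (x + h) t - u x t) ^ 3) \<partial>torus)" for t
  have [measurable]: "X \<in> borel_measurable borel" unfolding X_def by measurable
  \<comment> \<open>The third power of norm h powr (- 1/3) * X powr (1/3) \<le> V. In extended reals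
    the case V t = top is set apart, and outside it X t = top is impossible since
    \<open>ennpowr\<close> would be infinite too.\<close>
  have XV: "ennreal (1 / norm h) * X t \<le> ennpowr (V t) 3" for t
  proof -
    have [measurable]: "(\<lambda>x. u x t) \<in> borel_measurable borel" by measurable
    have "X t = (\<integral>\<^sup>+x. ennreal (norm (u (x + h) t - u x t) powr 3) * indicator cube x \<partial>lborel)"
      unfolding X_def by (subst nn_integral_torus) auto
    then have "ennreal (norm h powr - (1/3)) * ennpowr (X t) (1/3) \<le> V t"
      unfolding V_def V_norm_def Lp_norm_x_def using h h0
      by (intro SUP_upper2[of h]) auto
    show ?thesis
    proof (cases "V t = top")
      case False
      then obtain v where v: "V t = ennreal v" "0 \<le> v" by (metis ennreal_cases)
      have "X t \<noteq> top"
      proof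
        assume "X t = top"
        then have "ennreal (norm h powr - (1/3)) * ennpowr (X t) (1/3) = top"
          using h0 by (simp add: ennpowr_def ennreal_mult_top)
        then show False using \<open>_ \<le> V t\<close> False by (simp add: top_unique)
      qed
      then obtain y where y: "X t = ennreal y" "0 \<le> y" by (metis ennreal_cases)
      have "ennreal (norm h powr - (1/3) * y powr (1/3)) \<le> ennreal v"
        using \<open>_ \<le> V t\<close> by (simp add: v y ennpowr_def ennreal_mult)
      then have "norm h powr - (1/3) * y powr (1/3) \<le> v" using v(2) by simp
      then have "(norm h powr - (1/3) * y powr (1/3)) ^ 3 \<le> v ^ 3" by (intro power_mono) auto
      moreover have "(norm h powr - (1/3) * y powr (1/3)) ^ 3 = 1 / norm h * y"
      proof -
        have "norm h powr - (1/3) = inverse (norm h powr (1/3))" by (rule powr_minus)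
        then have "(norm h powr - (1/3)) ^ 3 = inverse ((norm h powr (1/3)) ^ 3)"
          by (simp only: power_inverse)
        then have "(norm h powr - (1/3)) ^ 3 = 1 / norm h"
          by (simp only: cube_root_cubed[OF norm_ge_zero] inverse_eq_divide)
        then show ?thesis by (simp only: power_mult_distrib cube_root_cubed[OF y(2)])
      qed
      moreover have "v powr 3 = v ^ 3" using v(2) by simp
      ultimately have "1 / norm h * y \<le> v powr 3" by (simp only:)
      then have "ennreal (1 / norm h * y) \<le> ennreal (v powr 3)" by (rule ennreal_leI)
      moreover have "ennreal (1 / norm h * y) = ennreal (1 / norm h) * X t"
        unfolding y(1) by (rule ennreal_mult) (use y(2) in auto)
      moreover have "ennpowr (V t) 3 = ennreal (v powr 3)"
        unfolding v(1) ennpowr_def using v(2) by (simp only: enn2real_ennreal ennreal_neq_top if_False)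
      ultimately show ?thesis by (simp only:)
    qed (simp add: ennpowr_def)
  qed
  have "ennreal (1 / norm h) * (\<integral>\<^sup>+t. X t \<partial>time T) = (\<integral>\<^sup>+t. ennreal (1 / norm h) * X t * indicator {0<..<T} t \<partial>lborel)"
    by (subst nn_integral_cmult[symmetric], measurable) (subst nn_integral_time, auto)
  also have "\<dots> \<le> (\<integral>\<^sup>+t. ennpowr (V t) 3 * indicator {0<..<T} t \<partial>lborel)"
    by (intro nn_integral_mono mult_right_mono XV) auto
  also have "\<dots> \<le> ennreal (e ^ 3)"
    using V unfolding Lq_time_def V_def by (rule ennpowr_less)
  finally have "ennreal (norm h) * (ennreal (1 / norm h) * (\<integral>\<^sup>+t. X t \<partial>time T)) \<le> ennreal (norm h) * ennreal (e ^ 3)"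
    by (rule mult_left_mono) simp
  moreover have "ennreal (norm h) * (ennreal (1 / norm h) * (\<integral>\<^sup>+t. X t \<partial>time T)) = (\<integral>\<^sup>+t. X t \<partial>time T)"
    using h0 by (simp add: mult.assoc[symmetric] ennreal_mult[symmetric])
  moreover have "ennreal (norm h) * ennreal (e ^ 3) = ennreal (e ^ 3 * norm h)"
    by (simp add: ennreal_mult'[symmetric] mult.commute)
  ultimately show ?thesis by (simp add: X_def)
qed simp

text \<open>Both essential suprema are infima of admissible bounds, so a strict inequality produces
  an actual bound below the given one, first in time and then in space. With h fixed beforehand, one
  null set per shift is enough.\<close>

lemma density_increment:
  fixes \<rho> :: "real^'d::finite \<Rightarrow> real \<Rightarrow> real"
  assumes V: "Linf_time T (\<lambda>t. V_inf_norm \<alpha> \<delta> (\<lambda>x. \<rho> x t)) < ennreal e" and h: "0 < norm h" "norm h < \<delta>"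
  shows "AE t in time T. AE x in torus. \<bar>\<rho> (x + h) t - \<rho> x t\<bar> \<le> e * norm h powr \<alpha>"
proof -
  obtain C where C: "C < ennreal e" "AE t in lborel. t \<in> {0<..<T} \<longrightarrow> V_inf_norm \<alpha> \<delta> (\<lambda>x. \<rho> x t) \<le> C"
    using V unfolding Linf_time_def Inf_less_iff by auto
  then have "AE t in time T. V_inf_norm \<alpha> \<delta> (\<lambda>x. \<rho> x t) \<le> C" by (simp add: AE_time)
  then show ?thesis
  proof eventually_elim
    case (elim t)
    define Li where "Li = Linf_norm_x (\<lambda>x. \<rho> (x + h) t - \<rho> x t)"
    have "ennreal (norm h powr - \<alpha>) * Li \<le> V_inf_norm \<alpha> \<delta> (\<lambda>x. \<rho> x t)"
      unfolding V_inf_norm_def Li_def using h by (intro SUP_upper2[of h]) auto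
    also note elim
    also note C(1)
    finally have 1: "ennreal (norm h powr - \<alpha>) * Li < ennreal e" .
    have e0: "0 < e" using C(1) by (metis ennreal_neg not_less not_less_zero)
    have "ennreal (norm h powr \<alpha>) * (ennreal (norm h powr - \<alpha>) * Li) < ennreal (norm h powr \<alpha>) * ennreal e"
      using 1 h by (intro ennreal_mult_strict_left_mono) auto
    moreover have "ennreal (norm h powr \<alpha>) * (ennreal (norm h powr - \<alpha>) * Li) = Li"
      using h by (simp add: mult.assoc[symmetric] ennreal_mult[symmetric] powr_add[symmetric])
    ultimately have "Li < ennreal (e * norm h powr \<alpha>)"
      using e0 by (simp add: ennreal_mult[symmetric] mult.commute)
    then obtain D where D: "D < ennreal (e * norm h powr \<alpha>)" "AE x in lborel. x \<in> cube \<longrightarrow> ennreal (norm (\<rho> (x + h) t - \<rho> x t)) \<le> D"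
      unfolding Li_def Linf_norm_x_def Inf_less_iff by auto
    have "AE x in torus. ennreal (norm (\<rho> (x + h) t - \<rho> x t)) \<le> D" using D(2) by (simp add: AE_torus)
    then show ?case
    proof eventually_elim
      case (elim x)
      then have "ennreal \<bar>\<rho> (x + h) t - \<rho> x t\<bar> \<le> ennreal (e * norm h powr \<alpha>)"
        using D(1) by (simp add: order_less_imp_le order_trans)
      then show ?case using e0 by simp
    qed
  qed
qed

lemma density_cube_increment:
  fixes \<rho> :: "real^'d::finite \<Rightarrow> real \<Rightarrow> real"
  assumes gam: "1 < \<gamma>" and alpha: "\<alpha> = 2 / (3 * min \<gamma> 2)"
    and reg: "\<exists>\<delta>>0. Linf_time T (\<lambda>t. V_inf_norm \<alpha> \<delta> (\<lambda>x. \<rho> x t)) < top"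
    and vanish: "\<gamma> \<ge> 2 \<Longrightarrow> Limsup (at_right 0) (\<lambda>\<delta>. Linf_time T (\<lambda>t. V_inf_norm \<alpha> \<delta> (\<lambda>x. \<rho> x t))) = 0"
    and e: "0 < e"
  shows "\<exists>\<delta>>0. \<forall>h. 0 < norm h \<and> norm h < \<delta> \<longrightarrow> (AE t in time T. AE x in torus. \<bar>\<rho> (x + h) t - \<rho> x t\<bar> ^ 3 \<le> e * norm h)"
proof (cases "\<gamma> \<ge> 2")
  case True
  then have al: "\<alpha> = 1/3" using alpha by simp
  define e' where "e' = e powr (1/3)"
  have e': "0 < e'" "e' ^ 3 = e" using e cube_root_cubed[of e] by (auto simp: e'_def)
  have "\<forall>\<^sub>F \<delta> in at_right 0. Linf_time T (\<lambda>t. V_inf_norm \<alpha> \<delta> (\<lambda>x. \<rho> x t)) < ennreal e'"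
    by (rule Limsup_lessD) (use vanish[OF True] e' in simp)
  then obtain b where b: "b > 0" "\<And>\<delta>. 0 < \<delta> \<Longrightarrow> \<delta> < b \<Longrightarrow> Linf_time T (\<lambda>t. V_inf_norm \<alpha> \<delta> (\<lambda>x. \<rho> x t)) < ennreal e'"
    unfolding eventually_at_right_field by blast
  have "AE t in time T. AE x in torus. \<bar>\<rho> (x + h) t - \<rho> x t\<bar> ^ 3 \<le> e * norm h" if h: "0 < norm h \<and> norm h < b / 2" for h
  proof -
    have "AE t in time T. AE x in torus. \<bar>\<rho> (x + h) t - \<rho> x t\<bar> \<le> e' * norm h powr \<alpha>"
      by (rule density_increment[OF b(2)[of "b / 2"]]) (use h b(1) in auto)
    then show ?thesis
    proof eventually_elim
      case (elim t)
      then show ?case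
      proof eventually_elim
        case (elim x)
        then have "\<bar>\<rho> (x + h) t - \<rho> x t\<bar> ^ 3 \<le> (e' * norm h powr (1/3)) ^ 3"
          unfolding al by (intro power_mono) auto
        also have "\<dots> = e * norm h" by (simp only: power_mult_distrib e'(2) cube_root_cubed[OF norm_ge_zero])
        finally show ?case .
      qed
    qed
  qed
  then show ?thesis using b(1) by (intro exI[of _ "b / 2"]) auto
next
  case False
  obtain \<delta>0 where d0: "\<delta>0 > 0" "Linf_time T (\<lambda>t. V_inf_norm \<alpha> \<delta>0 (\<lambda>x. \<rho> x t)) < top" using reg by blast
  then obtain E0 where E0: "Linf_time T (\<lambda>t. V_inf_norm \<alpha> \<delta>0 (\<lambda>x. \<rho> x t)) = ennreal E0" "0 \<le> E0"
    by (metis ennreal_cases less_irrefl)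
  \<comment> \<open>Adding 1 makes the bound strict, as \<open>density_increment\<close> requires,
    and keeps E positive.\<close>
  define E where "E = E0 + 1"
  have E: "Linf_time T (\<lambda>t. V_inf_norm \<alpha> \<delta>0 (\<lambda>x. \<rho> x t)) < ennreal E" "0 < E"
    using E0 by (auto simp: E_def ennreal_less_iff)
  \<comment> \<open>Here 3 * \<alpha> = 2 / \<gamma>, so \<open>b\<close> is the surplus over order
    1 of the cubed increment.\<close>
  define b where "b = 2 / \<gamma> - 1"
  have b: "0 < b" "3 * \<alpha> = 1 + b" using False gam by (auto simp: b_def alpha field_simps)
  \<comment> \<open>Chosen so that the surplus power absorbs the constant: E ^ 3 * norm h powr b
    \<le> e for norm h < \<delta>.\<close>
  define \<delta> where "\<delta> = min \<delta>0 ((e / E ^ 3) powr (1 / b))"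
  have d: "\<delta> > 0" using d0 e E by (simp add: \<delta>_def)
  have "AE t in time T. AE x in torus. \<bar>\<rho> (x + h) t - \<rho> x t\<bar> ^ 3 \<le> e * norm h" if h: "0 < norm h \<and> norm h < \<delta>" for h
  proof -
    have "AE t in time T. AE x in torus. \<bar>\<rho> (x + h) t - \<rho> x t\<bar> \<le> E * norm h powr \<alpha>"
      by (rule density_increment[OF E(1)]) (use h in \<open>auto simp: \<delta>_def\<close>)
    then show ?thesis
    proof eventually_elim
      case (elim t)
      then show ?case
      proof eventually_elim
        case (elim x)
        then have "\<bar>\<rho> (x + h) t - \<rho> x t\<bar> ^ 3 \<le> (E * norm h powr \<alpha>) ^ 3"
          by (intro power_mono) auto
        also have "\<dots> = E ^ 3 * norm h powr (1 + b)"
          using h b(2) by (simp add: power_mult_distrib powr_power)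
        also have "\<dots> = E ^ 3 * norm h powr b * norm h" using h by (simp add: powr_add)
        also have "\<dots> \<le> e * norm h"
        proof (rule mult_right_mono)
          have "norm h powr b \<le> ((e / E ^ 3) powr (1 / b)) powr b"
            using h b(1) by (intro powr_mono2) (auto simp: \<delta>_def)
          also have "\<dots> = e / E ^ 3" using b(1) e E(2) by (simp add: powr_powr)
          finally show "E ^ 3 * norm h powr b \<le> e" using E(2) by (simp add: field_simps)
        qed simp
        finally show ?case .
      qed
    qed
  qed
  then show ?thesis using d by blast
qed

section \<open>Reduction of the weak formulation to the locale \<open>euler\<close>\<close>

theorem theorem1p3:
  fixes \<rho> :: "real^'d \<Rightarrow> real \<Rightarrow> real" and u :: "real^'d \<Rightarrow> real \<Rightarrow> real^'d"
    and \<rho>0 :: "real^'d \<Rightarrow> real" and u0 :: "real^'d \<Rightarrow> real^'d"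
    and T \<gamma> \<alpha> :: real
  assumes dim: "CARD('d) \<ge> 2"
    and T: "T > 0" and gam: "\<gamma> > 1"
    and alpha: "\<alpha> = 2 / (3 * min \<gamma> 2)"
    and per_rho: "\<forall>t. periodic_x (\<lambda>x. \<rho> x t)" and per_u: "\<forall>t. periodic_x (\<lambda>x. u x t)"
    and per_rho0: "periodic_x \<rho>0" and per_u0: "periodic_x u0"
    and meas0: "\<rho>0 \<in> borel_measurable borel" "u0 \<in> borel_measurable borel"
    and rho0_nn: "\<forall>x. 0 \<le> \<rho>0 x"
    and weak: "weak_solution \<gamma> T \<rho> u \<rho>0 u0"
    and pos: "\<forall>x t. t \<in> {0<..<T} \<longrightarrow> 0 < \<rho> x t"
    and bnd: "\<exists>C. AE z in lborel. z \<in> spacetime T \<longrightarrow>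
                 \<rho> (fst z) (snd z) \<le> C \<and> 1 / \<rho> (fst z) (snd z) \<le> C"
    and u_L3: "(\<integral>\<^sup>+ z. ennreal (norm (u (fst z) (snd z)) ^ 3) * indicator (spacetime T) z \<partial>lborel) < top"
    and reg: "\<exists>\<delta>0>0. Linf_time T (\<lambda>t. V_inf_norm \<alpha> \<delta>0 (\<lambda>x. \<rho> x t))
                   + Lq_time 3 T (\<lambda>t. V_norm (1/3) 3 \<delta>0 (\<lambda>x. u x t)) < top"
    and u_vanish: "Limsup (at_right 0) (\<lambda>\<delta>. Lq_time 3 T (\<lambda>t. V_norm (1/3) 3 \<delta> (\<lambda>x. u x t))) = 0"
    and rho_vanish: "\<gamma> \<ge> 2 \<Longrightarrow>
          Limsup (at_right 0) (\<lambda>\<delta>. Linf_time T (\<lambda>t. V_inf_norm \<alpha> \<delta> (\<lambda>x. \<rho> x t))) = 0"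
  shows "AE t in lborel. t \<in> {0<..<T} \<longrightarrow>
     (\<integral>\<^sup>+ x. ennreal (1/2 * \<rho> x t * (norm (u x t))\<^sup>2 + \<rho> x t powr \<gamma> / (\<gamma> - 1))
               * indicator cube x \<partial>lborel)
   = (\<integral>\<^sup>+ x. ennreal (1/2 * \<rho>0 x * (norm (u0 x))\<^sup>2 + \<rho>0 x powr \<gamma> / (\<gamma> - 1))
               * indicator cube x \<partial>lborel)"
proof -
  have ms: "(\<lambda>(x,t). \<rho> x t) \<in> borel_measurable borel" "(\<lambda>(x,t). u x t) \<in> borel_measurable borel"
    and mass_weak: "\<And>\<phi>. test_fun T \<phi> \<Longrightarrow>
        set_integrable lborel (spacetime T) (\<lambda>(x,t). \<rho> x t * dt \<phi> (x,t) + (\<Sum>j\<in>UNIV. \<rho> x t * u x t $ j * dx j \<phi> (x,t))) \<and>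
        (LINT z:spacetime T|lborel. (\<lambda>(x,t). \<rho> x t * dt \<phi> (x,t) + (\<Sum>j\<in>UNIV. \<rho> x t * u x t $ j * dx j \<phi> (x,t))) z) = 0"
    and mom_weak: "\<And>\<psi>. vtest_fun T \<psi> \<Longrightarrow>
        set_integrable lborel (spacetime T) (\<lambda>(x,t). (\<Sum>i\<in>UNIV. \<rho> x t * u x t $ i * dt (\<lambda>z. \<psi> z $ i) (x,t))
                  + (\<Sum>i\<in>UNIV. \<Sum>j\<in>UNIV. \<rho> x t * u x t $ i * u x t $ j * dx j (\<lambda>z. \<psi> z $ i) (x,t))
                  + \<rho> x t powr \<gamma> * (\<Sum>i\<in>UNIV. dx i (\<lambda>z. \<psi> z $ i) (x,t))) \<and>
        (LINT z:spacetime T|lborel. (\<lambda>(x,t). (\<Sum>i\<in>UNIV. \<rho> x t * u x t $ i * dt (\<lambda>z. \<psi> z $ i) (x,t))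
                  + (\<Sum>i\<in>UNIV. \<Sum>j\<in>UNIV. \<rho> x t * u x t $ i * u x t $ j * dx j (\<lambda>z. \<psi> z $ i) (x,t))
                  + \<rho> x t powr \<gamma> * (\<Sum>i\<in>UNIV. dx i (\<lambda>z. \<psi> z $ i) (x,t))) z) = 0"
    and mass_lim: "\<And>\<phi>. test_fun_x \<phi> \<Longrightarrow> set_integrable lborel cube (\<lambda>x. \<rho>0 x * \<phi> x) \<and>
        ((\<lambda>t. LINT x:cube|lborel. \<rho> x t * \<phi> x) \<longlongrightarrow> (LINT x:cube|lborel. \<rho>0 x * \<phi> x)) (at_right 0)"
    and mom_lim: "\<And>\<psi>::(real^'d) \<Rightarrow> (real^'d). (\<forall>i. test_fun_x (\<lambda>x. \<psi> x $ i)) \<Longrightarrow>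
        set_integrable lborel cube (\<lambda>x. \<rho>0 x * (u0 x \<bullet> \<psi> x)) \<and>
        ((\<lambda>t. LINT x:cube|lborel. \<rho> x t * (u x t \<bullet> \<psi> x)) \<longlongrightarrow>
           (LINT x:cube|lborel. \<rho>0 x * (u0 x \<bullet> \<psi> x))) (at_right 0)"
    using weak unfolding weak_solution_def Let_def by blast+
  note meas0 [measurable]
  have rm [measurable]: "case_prod \<rho> \<in> borel_measurable (borel \<Otimes>\<^sub>M borel)"
    and um [measurable]: "case_prod u \<in> borel_measurable (borel \<Otimes>\<^sub>M borel)"
    using ms by (simp_all add: borel_prod)
  have vec_meas: "(\<lambda>z. f z $ i) \<in> borel_measurable M" if "f \<in> borel_measurable M" for f :: "_ \<Rightarrow> real^'d" and i M
    by (rule measurable_compose[OF that]) (intro borel_measurable_continuous_onI continuous_intros)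
  have um_i [measurable]: "(\<lambda>(x, t). u x t $ i) \<in> borel_measurable (borel \<Otimes>\<^sub>M borel)" for i
    using vec_meas[OF um, of i] by (simp add: case_prod_beta)
  have u0m_i [measurable]: "(\<lambda>x. u0 x $ i) \<in> borel_measurable borel" for i
    by (rule vec_meas) (rule meas0)
  have [measurable]: "(\<lambda>x. \<rho> x t) \<in> borel_measurable borel" "(\<lambda>x. u x t) \<in> borel_measurable borel"
     "(\<lambda>x. u x t $ i) \<in> borel_measurable borel" for t i
    by measurable
  obtain C0 where C0: "AE z in lborel. z \<in> spacetime T \<longrightarrow> \<rho> (fst z) (snd z) \<le> C0 \<and> 1 / \<rho> (fst z) (snd z) \<le> C0"
    using bnd by blast
  \<comment> \<open>The maximum with 1 gives 1 / C \<le> 1 \<le> C, so that clamping between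
    \<open>c\<close> and C makes sense.\<close>
  define C where "C = max C0 1"
  define c where "c = 1 / C"
  have C: "C \<ge> 1" by (simp add: C_def)
  then have c: "0 < c" "c \<le> C" by (auto simp: c_def intro: order_trans[of _ 1])
  have "AE t in time T. AE x in torus. \<rho> x t \<le> C0 \<and> 1 / \<rho> x t \<le> C0"
    using C0 by (subst (asm) AE_spacetime) measurable
  moreover have "AE t in time T. t \<in> {0<..<T}" by (simp add: AE_time)
  ultimately have rho_bd: "AE t in time T. AE x in torus. c \<le> \<rho> x t \<and> \<rho> x t \<le> C"
  proof eventually_elim
    case (elim t)
    from elim(1) show ?case
    proof eventually_elim
      case (elim x)
      have p: "0 < \<rho> x t" using pos \<open>t \<in> {0<..<T}\<close> by blast
      have "1 / \<rho> x t \<le> C" "\<rho> x t \<le> C" using elim by (auto simp: C_def)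
      then show ?case using p C by (simp add: c_def field_simps)
    qed
  qed
  define Gt where "Gt t = (\<integral>\<^sup>+x. ennreal (norm (u x t) ^ 3) \<partial>torus)" for t
  have [measurable]: "Gt \<in> borel_measurable borel" unfolding Gt_def by measurable
  have Gt: "(\<integral>\<^sup>+t. Gt t \<partial>time T) < top"
    using u_L3 nn_integral_spacetime[of "\<lambda>z. ennreal (norm (u (fst z) (snd z)) ^ 3)" T]
    by (simp add: Gt_def borel_prod[symmetric])
  have AEG: "AE t in time T. Gt t < top"
  proof -
    have "AE t in time T. Gt t \<noteq> \<infinity>" by (rule nn_integral_PInf_AE) (use Gt in auto)
    then show ?thesis by eventually_elim (simp add: less_top)
  qed
  \<comment> \<open>The bounds on \<open>\<rho>\<close> and the integrability of \<open>|u|^3\<close> hold only almost everywhere. Clamping \<open>\<rho>\<close> and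
    discarding \<open>u\<close> at exceptional times makes them hold everywhere without enlarging the increments.\<close>
  define \<rho>' where "\<rho>' x t = max c (min C (\<rho> x t))" for x t
  define u' where "u' x t = (if Gt t < top then u x t else 0)" for x t
  have rm' [measurable]: "case_prod \<rho>' \<in> borel_measurable (borel \<Otimes>\<^sub>M borel)" unfolding \<rho>'_def by measurable
  have um' [measurable]: "case_prod u' \<in> borel_measurable (borel \<Otimes>\<^sub>M borel)" unfolding u'_def by measurable
  have um_i' [measurable]: "(\<lambda>(x, t). u' x t $ i) \<in> borel_measurable (borel \<Otimes>\<^sub>M borel)" for i
    using vec_meas[OF um', of i] by (simp add: case_prod_beta)
  have [measurable]: "(\<lambda>x. \<rho>' x t) \<in> borel_measurable borel" "(\<lambda>x. u' x t) \<in> borel_measurable borel"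
     "(\<lambda>x. u' x t $ i) \<in> borel_measurable borel" for t i
    by measurable
  have same: "AE t in time T. AE x in torus. \<rho>' x t = \<rho> x t \<and> u' x t = u x t"
    using rho_bd AEG
  proof eventually_elim
    case (elim t)
    note G = elim(2)
    from elim(1) show ?case
      by eventually_elim (use G in \<open>auto simp: \<rho>'_def u'_def\<close>)
  qed
  have rho'_bd: "c \<le> \<rho>' x t" "\<rho>' x t \<le> C" for x t using c by (auto simp: \<rho>'_def)
  have per': "periodic_x (\<lambda>x. \<rho>' x t)" "periodic_x (\<lambda>x. u' x t)" for t
    using per_rho per_u by (simp_all add: periodic_x_def \<rho>'_def u'_def)
  define N where "N x t = norm (u' x t) ^ 3" for x t
  have N0: "0 \<le> N x t" for x t by (simp add: N_def)
  have N_nn: "(\<integral>\<^sup>+x. ennreal (N x t) \<partial>torus) \<le> Gt t" "(\<integral>\<^sup>+x. ennreal (N x t) \<partial>torus) < top" for t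
    by (cases "Gt t < top"; simp add: N_def u'_def Gt_def)+
  have iN: "integrable torus (\<lambda>x. N x t)" for t
  proof (rule integrableI_bounded)
    show "(\<lambda>x. N x t) \<in> borel_measurable torus" unfolding N_def by measurable
    show "(\<integral>\<^sup>+x. ennreal (norm (N x t)) \<partial>torus) < \<infinity>" using N_nn(2)[of t] N0 by simp
  qed
  have NT: "integrable (time T) (\<lambda>t. \<integral>x. N x t \<partial>torus)"
  proof (rule integrableI_bounded)
    show "(\<lambda>t. \<integral>x. N x t \<partial>torus) \<in> borel_measurable (time T)" unfolding N_def by measurable
    have "ennreal (norm (\<integral>x. N x t \<partial>torus)) \<le> Gt t" for t
      using norm_integral_le_nn_integral[of torus "\<lambda>x. N x t"] N_nn(1)[of t] N0 by simp
    then have "(\<integral>\<^sup>+t. ennreal (norm (\<integral>x. N x t \<partial>torus)) \<partial>time T) \<le> (\<integral>\<^sup>+t. Gt t \<partial>time T)"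
      by (intro nn_integral_mono)
    then show "(\<integral>\<^sup>+t. ennreal (norm (\<integral>x. N x t \<partial>torus)) \<partial>time T) < \<infinity>" using Gt by simp
  qed
  have N1: "norm (u' x t) \<le> 1 + N x t" "(norm (u' x t))\<^sup>2 \<le> 1 + N x t" for x t
    unfolding N_def by (auto intro: cube_dominates)
  have b_rho: "\<bar>\<rho>' x t\<bar> \<le> C" for x t using rho'_bd[of x t] c by simp
  have b_mom: "\<bar>\<rho>' x t * u' x t $ i\<bar> \<le> C * (1 + N x t)" for x t i
    unfolding abs_mult using b_rho[of x t] N1(1)[of x t] component_le_norm_cart[of "u' x t" i] C
    by (intro mult_mono) auto
  have b_uu: "\<bar>\<rho>' x t * u' x t $ i * u' x t $ j\<bar> \<le> C * (1 + N x t)" for x t i j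
  proof -
    have "\<bar>u' x t $ i\<bar> * \<bar>u' x t $ j\<bar> \<le> norm (u' x t) * norm (u' x t)"
      by (intro mult_mono component_le_norm_cart) auto
    also have "\<dots> \<le> 1 + N x t" using N1(2)[of x t] by (simp add: power2_eq_square)
    finally have "\<bar>\<rho>' x t\<bar> * (\<bar>u' x t $ i\<bar> * \<bar>u' x t $ j\<bar>) \<le> C * (1 + N x t)"
      using b_rho[of x t] C by (intro mult_mono) auto
    then show ?thesis by (simp add: abs_mult mult.assoc)
  qed
  have b_p: "\<bar>\<rho>' x t powr \<gamma>\<bar> \<le> C powr \<gamma>" for x t
    using rho'_bd[of x t] c gam by (auto intro!: powr_mono2)
  have N_ge: "A \<le> A * (1 + N x t)" if "0 \<le> A" for A x t
    using mult_left_mono[of 1 "1 + N x t" A] N0[of x t] that by simp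
  have dom: "integrable torus (\<lambda>x. h x * q x)"
    if "h \<in> borel_measurable borel" "\<And>x. \<bar>h x\<bar> \<le> A * (1 + N x t)" "sm q" "periodic_x q" for h q :: "real^'d \<Rightarrow> real" and A t
  proof -
    have "integrable torus h"
    proof (rule Bochner_Integration.integrable_bound)
      show "integrable torus (\<lambda>x. A * (1 + N x t))" using iN by auto
      show "AE x in torus. norm (h x) \<le> norm (A * (1 + N x t))"
        using that(2) by (intro AE_I2) (metis abs_ge_self order_trans real_norm_def)
    qed (use that in auto)
    \<comment> \<open>The convolution lemma at the point 0 with the reflected kernel is the plain
      product with a bounded periodic factor.\<close>
    then have "integrable torus (\<lambda>y. q (0 - (0 - y)) * h y)"
      using periodic_kernel.cv_integrable[OF periodic_kernel_sm, of "\<lambda>y. q (0 - y)" h 0] pd_reflect(1)[OF that(3), of 0] periodic_reflect[OF that(4), of 0]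
      by simp
    then show ?thesis by (simp add: mult.commute)
  qed
  have const_test: "test_fun_x (\<lambda>x::real^'d. a)" for a
    by (simp add: test_fun_x_def sm_smooth_fun sm_const periodic_x_def)
  \<comment> \<open>Testing the initial condition with a constant yields integrability of the
    initial density; constant vectors do the same for the momentum.\<close>
  have int_rho0: "integrable torus \<rho>0"
    using mass_lim[OF const_test[of 1]] by (simp add: integrable_torus)
  have int_mom0: "integrable torus (\<lambda>x. \<rho>0 x * u0 x $ i)" for i
    using mom_lim[of "\<lambda>x. axis i 1"] const_test by (simp add: integrable_torus inner_axis)
  have rho_dom: "\<bar>\<rho>' x t\<bar> \<le> C * (1 + N x t)" for x t
    using b_rho[of x t] N_ge[of C x t] C by linarith
  have mass: "AE t in time T. (\<integral>y. \<rho>' y t * k y \<partial>torus)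
      = (\<integral>y. \<rho>0 y * k y \<partial>torus) + (LINT s:{0<..<t}|lborel. (\<Sum>j\<in>UNIV. \<integral>y. \<rho>' y s * u' y s $ j * pd j k y \<partial>torus))"
    if k: "sm k" "periodic_x k" for k
  proof (rule integrated_form[where N=N and M=C and a="\<lambda>t. \<integral>x. \<rho> x t * k x \<partial>torus"])
    note sm_borel[OF k(1), measurable] sm_borel[OF sm_pd[OF k(1)], measurable]
    have tk: "test_fun_x k" using k by (simp add: test_fun_x_def sm_smooth_fun)
    \<comment> \<open>The limit belongs to the original field; the clamped one has the same pairing
      only for almost every t.\<close>
    show "((\<lambda>t. \<integral>x. \<rho> x t * k x \<partial>torus) \<longlongrightarrow> (\<integral>y. \<rho>0 y * k y \<partial>torus)) (at_right 0)"
      using mass_lim[OF tk] by (simp add: integral_torus)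
    show "(\<lambda>t. \<integral>x. \<rho> x t * k x \<partial>torus) \<in> borel_measurable borel" by measurable
    show "AE t in time T. (\<integral>x. \<rho> x t * k x \<partial>torus) = (\<integral>x. \<rho>' x t * k x \<partial>torus)"
      using same by eventually_elim (rule integral_cong_AE, simp, simp, elim eventually_mono, simp)
    fix \<phi> \<phi>' :: "real \<Rightarrow> real"
    assume \<phi>: "sm \<phi>" "\<And>s. (\<phi> has_real_derivative \<phi>' s) (at s)"
      "\<exists>a b. 0 < a \<and> a < b \<and> b < T \<and> (\<forall>t. t \<notin> {a..b} \<longrightarrow> \<phi> t = 0)"
    note tf = test_fun_product[OF \<phi> k]
    have [measurable]: "\<phi> \<in> borel_measurable borel" using \<phi>(1) by (rule sm_borel)
    have [measurable]: "\<phi>' \<in> borel_measurable borel" by (rule sm_borel[OF sm_derivative[OF \<phi>(1,2)]])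
    define F where "F = (\<lambda>(x, t). \<rho> x t * (\<phi>' t * k x) + (\<Sum>j\<in>UNIV. \<rho> x t * u x t $ j * (\<phi> t * pd j k x)))"
    define F' where "F' = (\<lambda>(x, t). \<rho>' x t * (\<phi>' t * k x) + (\<Sum>j\<in>UNIV. \<rho>' x t * u' x t $ j * (\<phi> t * pd j k x)))"
    have FF: "F \<in> borel_measurable (borel \<Otimes>\<^sub>M borel)" "F' \<in> borel_measurable (borel \<Otimes>\<^sub>M borel)"
      unfolding F_def F'_def by measurable
    have FF3: "AE t in time T. AE x in torus. F (x, t) = F' (x, t)"
      using same by eventually_elim (elim eventually_mono, simp add: F_def F'_def)
    have "set_integrable lborel (spacetime T) F \<and> (LINT z:spacetime T|lborel. F z) = 0"
      using mass_weak[OF tf(1)] unfolding tf(2,3) F_def .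
    then show "set_integrable lborel (spacetime T) F' \<and> (LINT z:spacetime T|lborel. F' z) = 0"
      using spacetime_cong[OF FF FF3] by (simp add: F'_def)
  qed (use T k iN NT N0 b_mom rho_dom C in auto)
  have mom_dom: "\<bar>\<rho>' x t * u' x t $ i * u' x t $ j + (if j = i then \<rho>' x t powr \<gamma> else 0)\<bar>
      \<le> (C + C powr \<gamma>) * (1 + N x t)" for x t i j
  proof -
    have "\<bar>if j = i then \<rho>' x t powr \<gamma> else 0\<bar> \<le> C powr \<gamma>" using b_p[of x t] by simp
    also have "\<dots> \<le> C powr \<gamma> * (1 + N x t)" by (rule N_ge) simp
    finally have "\<bar>if j = i then \<rho>' x t powr \<gamma> else 0\<bar> \<le> C powr \<gamma> * (1 + N x t)" .
    then show ?thesis using b_uu[of x t i j] by (simp only: distrib_right)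
  qed
  have mom_lim': "((\<lambda>t. \<integral>x. \<rho> x t * u x t $ i * k x \<partial>torus) \<longlongrightarrow> (\<integral>y. \<rho>0 y * u0 y $ i * k y \<partial>torus)) (at_right 0)"
    if k: "sm k" "periodic_x k" for k i
  proof -
    note sm_borel[OF k(1), measurable]
    have tx: "test_fun_x (\<lambda>x. (k x *\<^sub>R axis i (1::real)) $ i')" for i'
    proof (cases "i' = i")
      case True
      then show ?thesis using k by (simp add: test_fun_x_def sm_smooth_fun)
    next
      case False
      then show ?thesis using const_test[of 0] by (simp add: axis_def)
    qed
    show ?thesis
      using mom_lim[of "\<lambda>x. k x *\<^sub>R axis i 1"] tx by (simp add: integral_torus inner_axis mult_ac)
  qed
  have mom_test: "set_integrable lborel (spacetime T) F \<and> (LINT z:spacetime T|lborel. F z) = 0"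
    if k: "sm k" "periodic_x k"
      and \<phi>: "sm \<phi>" "\<And>s. (\<phi> has_real_derivative \<phi>' s) (at s)"
        "\<exists>a b. 0 < a \<and> a < b \<and> b < T \<and> (\<forall>t. t \<notin> {a..b} \<longrightarrow> \<phi> t = 0)"
      and F: "F = (\<lambda>(x, t). \<rho> x t * u x t $ i * (\<phi>' t * k x)
        + (\<Sum>j\<in>UNIV. (\<rho> x t * u x t $ i * u x t $ j + (if j = i then \<rho> x t powr \<gamma> else 0)) * (\<phi> t * pd j k x)))"
    for k \<phi> \<phi>' i F
  proof -
    \<comment> \<open>A test field pointing in direction i isolates the i-th momentum equation; its
      divergence leaves the pressure paired with the i-th derivative alone.\<close>
    define \<psi> :: "(real^'d) \<times> real \<Rightarrow> real^'d" where "\<psi> z = (\<phi> (snd z) * k (fst z)) *\<^sub>R axis i 1" for z :: "(real^'d) \<times> real"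
    note tf = test_fun_product[OF \<phi> k]
    have t0: "test_fun T (\<lambda>z::(real^'d) \<times> real. 0)"
      using test_fun_product(1)[OF \<phi> sm_const[of 0]] by (simp add: periodic_x_def)
    have comp: "(\<lambda>z. \<psi> z $ i') = (if i' = i then (\<lambda>z. \<phi> (snd z) * k (fst z)) else (\<lambda>z. 0))" for i'
      by (auto simp: \<psi>_def axis_def)
    have vt: "vtest_fun T \<psi>"
      unfolding vtest_fun_def comp using tf(1) t0 by simp
    have d: "dt (\<lambda>z. \<psi> z $ i') (x, t) = (if i' = i then \<phi>' t * k x else 0)"
        "dx j (\<lambda>z. \<psi> z $ i') (x, t) = (if i' = i then \<phi> t * pd j k x else 0)" for i' j x t
      unfolding comp using tf(2,3) by (simp_all add: dt_def dx_def)
    have s1: "(\<Sum>i'\<in>UNIV. A i' * (if i' = i then B else 0)) = A i * B" for A :: "'d \<Rightarrow> real" and B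
      by (simp add: if_distrib[of "\<lambda>b. _ * b"] cong: if_cong)
    have s2: "(\<Sum>i'\<in>UNIV. \<Sum>j\<in>UNIV. A i' * D j * (if i' = i then B j else 0)) = (\<Sum>j\<in>UNIV. A i * D j * B j)" for A B D :: "'d \<Rightarrow> real"
      by (subst sum.swap) (intro sum.cong refl s1)
    have s3: "(\<Sum>i'\<in>UNIV. if i' = i then B i' else 0) = B i" for B :: "'d \<Rightarrow> real" by simp
    have s4: "(\<Sum>j\<in>UNIV. (A j + (if j = i then P else 0)) * B j) = (\<Sum>j\<in>UNIV. A j * B j) + P * B i" for A B :: "'d \<Rightarrow> real" and P
      by (simp add: distrib_right sum.distrib if_distrib[of "\<lambda>b. b * _"] cong: if_cong)
    show ?thesis
      using mom_weak[OF vt] unfolding d s1 s2 s3 F s4 by (simp add: add.assoc)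
  qed
  have momentum: "AE t in time T. (\<integral>y. \<rho>' y t * u' y t $ i * k y \<partial>torus)
      = (\<integral>y. \<rho>0 y * u0 y $ i * k y \<partial>torus) + (LINT s:{0<..<t}|lborel.
          (\<Sum>j\<in>UNIV. \<integral>y. \<rho>' y s * u' y s $ i * u' y s $ j * pd j k y \<partial>torus) + (\<integral>y. \<rho>' y s powr \<gamma> * pd i k y \<partial>torus))"
    if k: "sm k" "periodic_x k" for k i
  proof -
    note sm_borel[OF k(1), measurable] sm_borel[OF sm_pd[OF k(1)], measurable]
    \<comment> \<open>Placing the pressure on the diagonal of the flux makes the momentum equation
      an instance of \<open>integrated_form\<close>.\<close>
    define g where "g j x t = \<rho>' x t * u' x t $ i * u' x t $ j + (if j = i then \<rho>' x t powr \<gamma> else 0)" for j x t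
    have gm [measurable]: "case_prod (g j) \<in> borel_measurable (borel \<Otimes>\<^sub>M borel)" for j
      unfolding g_def by measurable
    have gs: "(\<Sum>j\<in>UNIV. \<integral>y. g j y s * pd j k y \<partial>torus)
      = (\<Sum>j\<in>UNIV. \<integral>y. \<rho>' y s * u' y s $ i * u' y s $ j * pd j k y \<partial>torus) + (\<integral>y. \<rho>' y s powr \<gamma> * pd i k y \<partial>torus)" for s
    proof -
      have i1: "integrable torus (\<lambda>y. \<rho>' y s * u' y s $ i * u' y s $ j * pd j k y)" for j
        by (rule dom[OF _ b_uu sm_pd[OF k(1)] periodic_pd[OF k]]) measurable
      have i2: "integrable torus (\<lambda>y. \<rho>' y s powr \<gamma> * pd i k y)"
        by (rule dom[OF _ order_trans[OF b_p N_ge] sm_pd[OF k(1)] periodic_pd[OF k]]) simp_all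
      have "(\<integral>y. g j y s * pd j k y \<partial>torus) = (\<integral>y. \<rho>' y s * u' y s $ i * u' y s $ j * pd j k y \<partial>torus)
          + (if j = i then (\<integral>y. \<rho>' y s powr \<gamma> * pd i k y \<partial>torus) else 0)" for j
        using i1[of j] i2 by (cases "j = i") (simp_all add: g_def distrib_right)
      then show ?thesis by (simp add: sum.distrib)
    qed
    have "AE t in time T. (\<integral>y. \<rho>' y t * u' y t $ i * k y \<partial>torus)
      = (\<integral>y. \<rho>0 y * u0 y $ i * k y \<partial>torus) + (LINT s:{0<..<t}|lborel. (\<Sum>j\<in>UNIV. \<integral>y. g j y s * pd j k y \<partial>torus))"
    proof (rule integrated_form[OF T _ gm N0 iN NT _ _ _ k _ mom_lim'[OF k, of i], where M="C + C powr \<gamma>"])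
      show "(\<lambda>t. \<integral>x. \<rho> x t * u x t $ i * k x \<partial>torus) \<in> borel_measurable borel" by measurable
      show "AE t in time T. (\<integral>x. \<rho> x t * u x t $ i * k x \<partial>torus) = (\<integral>x. \<rho>' x t * u' x t $ i * k x \<partial>torus)"
        using same by eventually_elim (rule integral_cong_AE, simp, simp, elim eventually_mono, simp)
      show "case_prod (\<lambda>x t. \<rho>' x t * u' x t $ i) \<in> borel_measurable (borel \<Otimes>\<^sub>M borel)" by measurable
      show "0 \<le> C + C powr \<gamma>" using C by simp
      show "\<bar>g j x t\<bar> \<le> (C + C powr \<gamma>) * (1 + N x t)" for j x t unfolding g_def by (rule mom_dom)
      show "\<bar>\<rho>' x t * u' x t $ i\<bar> \<le> (C + C powr \<gamma>) * (1 + N x t)" for x t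
        by (rule order_trans[OF b_mom]) (use N0[of x t] in \<open>simp add: mult_right_mono\<close>)
      fix \<phi> \<phi>' :: "real \<Rightarrow> real"
      assume \<phi>: "sm \<phi>" "\<And>s. (\<phi> has_real_derivative \<phi>' s) (at s)"
        "\<exists>a b. 0 < a \<and> a < b \<and> b < T \<and> (\<forall>t. t \<notin> {a..b} \<longrightarrow> \<phi> t = 0)"
      have [measurable]: "\<phi> \<in> borel_measurable borel" using \<phi>(1) by (rule sm_borel)
      have [measurable]: "\<phi>' \<in> borel_measurable borel" by (rule sm_borel[OF sm_derivative[OF \<phi>(1,2)]])
      define F where "F = (\<lambda>(x, t). \<rho> x t * u x t $ i * (\<phi>' t * k x)
        + (\<Sum>j\<in>UNIV. (\<rho> x t * u x t $ i * u x t $ j + (if j = i then \<rho> x t powr \<gamma> else 0)) * (\<phi> t * pd j k x)))"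
      define F' where "F' = (\<lambda>(x, t). \<rho>' x t * u' x t $ i * (\<phi>' t * k x) + (\<Sum>j\<in>UNIV. g j x t * (\<phi> t * pd j k x)))"
      have FF: "F \<in> borel_measurable (borel \<Otimes>\<^sub>M borel)" "F' \<in> borel_measurable (borel \<Otimes>\<^sub>M borel)"
        unfolding F_def F'_def by measurable
      have FF3: "AE t in time T. AE x in torus. F (x, t) = F' (x, t)"
        using same by eventually_elim (elim eventually_mono, simp add: F_def F'_def g_def cong: if_cong)
      show "set_integrable lborel (spacetime T) (\<lambda>(x, t). \<rho>' x t * u' x t $ i * (\<phi>' t * k x) + (\<Sum>j\<in>UNIV. g j x t * (\<phi> t * pd j k x))) \<and>
        (LINT z:spacetime T|lborel. (case z of (x, t) \<Rightarrow> \<rho>' x t * u' x t $ i * (\<phi>' t * k x) + (\<Sum>j\<in>UNIV. g j x t * (\<phi> t * pd j k x)))) = 0"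
        using mom_test[OF k \<phi> F_def] spacetime_cong[OF FF FF3] unfolding F'_def by simp
    qed
    then show ?thesis unfolding gs .
  qed
  interpret TT: pair_sigma_finite "torus :: (real^'d) measure" "time T" ..
  have increments: "\<exists>\<delta>>0. \<forall>h. norm h < \<delta> \<longrightarrow>
      (\<integral>\<^sup>+x. \<integral>\<^sup>+t. ennreal (norm (u' (x + h) t - u' x t) ^ 3 + \<bar>\<rho>' (x + h) t - \<rho>' x t\<bar> ^ 3) \<partial>time T \<partial>torus) \<le> ennreal (\<eta> * norm h)"
    if \<eta>: "0 < \<eta>" for \<eta>
  proof -
    \<comment> \<open>Half of \<eta> goes to the velocity; \<open>velocity_increment\<close> cubes
      its constant, hence the cube root.\<close>
    define e where "e = (\<eta> / 2) powr (1/3)"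
    have e: "0 < e" "e ^ 3 = \<eta> / 2" using \<eta> cube_root_cubed[of "\<eta> / 2"] by (auto simp: e_def)
    have "\<forall>\<^sub>F \<delta> in at_right 0. Lq_time 3 T (\<lambda>t. V_norm (1/3) 3 \<delta> (\<lambda>x. u x t)) < ennreal e"
      by (rule Limsup_lessD) (use u_vanish e in simp)
    then obtain b where b: "b > 0" "\<And>\<delta>. 0 < \<delta> \<Longrightarrow> \<delta> < b \<Longrightarrow> Lq_time 3 T (\<lambda>t. V_norm (1/3) 3 \<delta> (\<lambda>x. u x t)) < ennreal e"
      unfolding eventually_at_right_field by blast
    have reg': "\<exists>\<delta>>0. Linf_time T (\<lambda>t. V_inf_norm \<alpha> \<delta> (\<lambda>x. \<rho> x t)) < top"
      using reg by (auto simp: ennreal_add_less_top)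
    \<comment> \<open>The other half goes to the density. Its pointwise bound will be integrated
      over a torus of mass 1 and a time interval of length T, hence the division by T.\<close>
    obtain \<delta>2 where \<delta>2: "\<delta>2 > 0" "\<And>h. 0 < norm h \<Longrightarrow> norm h < \<delta>2 \<Longrightarrow>
        AE t in time T. AE x in torus. \<bar>\<rho> (x + h) t - \<rho> x t\<bar> ^ 3 \<le> \<eta> / (2 * T) * norm h"
      using density_cube_increment[OF gam alpha reg' rho_vanish, of "\<eta> / (2 * T)"] \<eta> T by auto
    have "(\<integral>\<^sup>+x. \<integral>\<^sup>+t. ennreal (norm (u' (x + h) t - u' x t) ^ 3 + \<bar>\<rho>' (x + h) t - \<rho>' x t\<bar> ^ 3) \<partial>time T \<partial>torus) \<le> ennreal (\<eta> * norm h)"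
      if h: "norm h < min (b / 2) \<delta>2" for h
    proof (cases "h = 0")
      case False
      define U where "U t = (\<integral>\<^sup>+x. ennreal (norm (u (x + h) t - u x t) ^ 3) \<partial>torus)" for t
      have [measurable]: "U \<in> borel_measurable borel" unfolding U_def by measurable
      \<comment> \<open>Truncation to an interval is 1-Lipschitz.\<close>
      have clamp: "\<bar>\<rho>' (x + h) t - \<rho>' x t\<bar> \<le> \<bar>\<rho> (x + h) t - \<rho> x t\<bar>" for x t
        unfolding \<rho>'_def by (simp add: max_def min_def)
      have "(\<integral>\<^sup>+x. \<integral>\<^sup>+t. ennreal (norm (u' (x + h) t - u' x t) ^ 3 + \<bar>\<rho>' (x + h) t - \<rho>' x t\<bar> ^ 3) \<partial>time T \<partial>torus)
        = (\<integral>\<^sup>+t. \<integral>\<^sup>+x. ennreal (norm (u' (x + h) t - u' x t) ^ 3 + \<bar>\<rho>' (x + h) t - \<rho>' x t\<bar> ^ 3) \<partial>torus \<partial>time T)"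
        by (rule TT.Fubini'[symmetric]) measurable
      also have "\<dots> \<le> (\<integral>\<^sup>+t. U t + ennreal (\<eta> / (2 * T) * norm h) \<partial>time T)"
      proof (rule nn_integral_mono_AE)
        have "AE t in time T. AE x in torus. \<bar>\<rho> (x + h) t - \<rho> x t\<bar> ^ 3 \<le> \<eta> / (2 * T) * norm h"
          using False h by (intro \<delta>2(2)) auto
        then show "AE t in time T. (\<integral>\<^sup>+x. ennreal (norm (u' (x + h) t - u' x t) ^ 3 + \<bar>\<rho>' (x + h) t - \<rho>' x t\<bar> ^ 3) \<partial>torus)
            \<le> U t + ennreal (\<eta> / (2 * T) * norm h)"
        proof eventually_elim
          case (elim t)
          have "(\<integral>\<^sup>+x. ennreal (norm (u' (x + h) t - u' x t) ^ 3 + \<bar>\<rho>' (x + h) t - \<rho>' x t\<bar> ^ 3) \<partial>torus)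
            \<le> (\<integral>\<^sup>+x. ennreal (norm (u (x + h) t - u x t) ^ 3) + ennreal (\<eta> / (2 * T) * norm h) \<partial>torus)"
          proof (rule nn_integral_mono_AE)
            show "AE x in torus. ennreal (norm (u' (x + h) t - u' x t) ^ 3 + \<bar>\<rho>' (x + h) t - \<rho>' x t\<bar> ^ 3)
               \<le> ennreal (norm (u (x + h) t - u x t) ^ 3) + ennreal (\<eta> / (2 * T) * norm h)"
              using elim
            proof eventually_elim
              case (elim x)
              \<comment> \<open>Whether a time is discarded depends on t alone, so x and x + h are
                always treated alike.\<close>
              have "norm (u' (x + h) t - u' x t) ^ 3 \<le> norm (u (x + h) t - u x t) ^ 3"
                by (simp add: u'_def)
              moreover have "\<bar>\<rho>' (x + h) t - \<rho>' x t\<bar> ^ 3 \<le> \<eta> / (2 * T) * norm h"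
                by (rule order_trans[OF power_mono[OF clamp abs_ge_zero] elim])
              ultimately show ?case
                by (simp add: ennreal_plus del: power_mono_iff) (intro add_mono ennreal_leI, simp_all)
            qed
          qed
          also have "\<dots> = U t + ennreal (\<eta> / (2 * T) * norm h)"
            unfolding U_def by (subst nn_integral_add) (auto simp: emeasure_torus)
          finally show ?case .
        qed
      qed
      also have "\<dots> = (\<integral>\<^sup>+t. U t \<partial>time T) + ennreal (\<eta> / 2 * norm h)"
      proof -
        have "(\<integral>\<^sup>+t. ennreal (\<eta> / (2 * T) * norm h) \<partial>time T) = ennreal (\<eta> / 2 * norm h)"
          using T \<eta> by (subst nn_integral_time) (simp_all add: nn_integral_cmult_indicator ennreal_mult''[symmetric])
        then show ?thesis by (subst nn_integral_add) auto
      qed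
      also have "\<dots> \<le> ennreal (e ^ 3 * norm h) + ennreal (\<eta> / 2 * norm h)"
        unfolding U_def by (intro add_right_mono velocity_increment[OF um b(2)[of "b / 2"]]) (use b(1) h in auto)
      also have "\<dots> = ennreal (\<eta> * norm h)"
        using \<eta> by (simp add: e(2) ennreal_plus[symmetric] del: ennreal_plus)
      finally show ?thesis .
    qed simp
    then show ?thesis using b(1) \<delta>2(1) by (intro exI[of _ "min (b / 2) \<delta>2"]) auto
  qed
  interpret E: euler \<rho>' u' \<rho>0 u0 T \<gamma> c C
  proof
    show "integrable torus (\<lambda>x. norm (u' x t) ^ 3)" for t using iN[of t] by (simp add: N_def)
    show "integrable (time T) (\<lambda>t. \<integral>x. norm (u' x t) ^ 3 \<partial>torus)" using NT by (simp add: N_def)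
  qed (fact T gam c(1) rm' um' per' rho'_bd meas0 per_rho0 per_u0 rho0_nn[rule_format] int_rho0 int_mom0 mass momentum increments)+
  have [measurable]: "(\<lambda>x. ennreal (1/2 * \<rho> x t * (norm (u x t))\<^sup>2 + \<rho> x t powr \<gamma> / (\<gamma> - 1))) \<in> borel_measurable borel" for t
    by measurable
  have "AE t in time T. (\<integral>\<^sup>+x. ennreal (1/2 * \<rho> x t * (norm (u x t))\<^sup>2 + \<rho> x t powr \<gamma> / (\<gamma> - 1)) \<partial>torus)
      = (\<integral>\<^sup>+x. ennreal (1/2 * \<rho>0 x * (norm (u0 x))\<^sup>2 + \<rho>0 x powr \<gamma> / (\<gamma> - 1)) \<partial>torus)"
    using E.energy_conservation same
  proof eventually_elim
    case (elim t)
    have "(\<integral>\<^sup>+x. ennreal (1/2 * \<rho> x t * (norm (u x t))\<^sup>2 + \<rho> x t powr \<gamma> / (\<gamma> - 1)) \<partial>torus)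
      = (\<integral>\<^sup>+x. ennreal (1/2 * \<rho>' x t * (norm (u' x t))\<^sup>2 + \<rho>' x t powr \<gamma> / (\<gamma> - 1)) \<partial>torus)"
      using elim(2) by (intro nn_integral_cong_AE) (elim eventually_mono, simp)
    with elim(1) show ?case by simp
  qed
  then show ?thesis
    by (simp add: AE_time nn_integral_torus)
qed

end
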